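(* The groups $QF$, $QT$, and $QV$ have type $F_{\infty}$.
   Context: Let $\mathcal{T}$ be the infinite rooted binary tree, with vertex set $\mathcal{T}^0$ identified with the set $\{0,1\}^{\ast}$ of all finite binary words (including the empty word $\epsilon$, the root); for a vertex $v$, $v0$ is its left child and $v1$ is its right child. $QV$ is the group (under composition) of all bijections $h:\mathcal{T}^0\to\mathcal{T}^0$ such that, for all but finitely many $v\in\mathcal{T}^0$, $h$ sends the left (respectively, right) child of $v$ to the left (respectively, right) child of $h(v)$, i.e. $h(v0)=h(v)0$ and $h(v1)=h(v)1$. Every $h\in QV$ induces a homeomorphism of the space of ends $\{0,1\}^{\mathbb{N}}$ of $\mathcal{T}$, and this homeomorphism lies in Thompson's group $V$ (acting on the Cantor set $\{0,1\}^{\mathbb{N}}$ by finite prefix replacements). This gives a surjective homomorphism $\pi:QV\to V$. With $F\le T\le V$ Thompson's groups ($F$ consists of the elements of $V$ that preserve the linear, i.e. lexicographic, order on $\{0,1\}^{\mathbb{N}}$, and $T$ of those that preserve the induced cyclic order), define $QF=\pi^{-1}(F)$ and $QT=\pi^{-1}(T)$. A group $G$ has type $F_\infty$ if there is a $K(G,1)$ CW-complex with finitely many cells in each dimension. *)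

theory Defs
  imports
    "HOL-Analysis.Analysis"
    "HOL-Algebra.Group"
    "HOL-Library.Omega_Words_Fun"
    "HOL-Library.Fun_Lexorder"
begin

section \<open>The groups QV, QF and QT\<close>

text \<open>
  A vertex of the infinite rooted binary tree is a \<open>bool list\<close>, where \<open>False\<close> and \<open>True\<close> stand
  for the letters 0 and 1; the children of \<open>v\<close> are \<open>v @ [False]\<close> and \<open>v @ [True]\<close>.
  An end of the tree is an infinite word \<open>nat \<Rightarrow> bool\<close>.
\<close>

definition respects_children :: "(bool list \<Rightarrow> bool list) \<Rightarrow> bool list \<Rightarrow> bool" where
  "respects_children h v \<longleftrightarrow>
     h (v @ [False]) = h v @ [False] \<and> h (v @ [True]) = h v @ [True]"

definition QV_set :: "(bool list \<Rightarrow> bool list) set" where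
  "QV_set = {h. bij h \<and> finite {v. \<not> respects_children h v}}"

text \<open>
  The action on ends: the vertices of the ray towards the end \<open>w\<close> are the finite prefixes of \<open>w\<close>,
  and \<open>h\<close> carries all but finitely many of them to vertices of the ray towards \<open>end_map h w\<close>.
\<close>

definition maps_end :: "(bool list \<Rightarrow> bool list) \<Rightarrow> bool word \<Rightarrow> bool word \<Rightarrow> bool" where
  "maps_end h w u \<longleftrightarrow> (\<exists>N. \<forall>n\<ge>N. \<exists>m. h (map w [0..<n]) = map u [0..<m])"

definition end_map :: "(bool list \<Rightarrow> bool list) \<Rightarrow> bool word \<Rightarrow> bool word" where
  "end_map h w = (THE u. maps_end h w u)"

text \<open>The description in \<^const>\<open>end_map\<close> is a proper one on \<^const>\<open>QV_set\<close>:\<close>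

lemma maps_end_ex1:
  assumes "h \<in> QV_set"
  shows "\<exists>!u. maps_end h w u"
proof -
  have "finite (length ` {v. \<not> respects_children h v})"
    using assms by (simp add: QV_set_def)
  then obtain N where N: "\<And>v. \<not> respects_children h v \<Longrightarrow> length v < N"
    by (metis (mono_tags, lifting) finite_nat_set_iff_bounded image_eqI mem_Collect_eq)
  define u where "u = h (map w [0..<N]) \<frown> (\<lambda>i. w (N + i))"
  have step: "h (map w [0..<N + k]) = map u [0..<length (h (map w [0..<N])) + k]" for k
  proof (induction k)
    case 0
    then show ?case
      by (auto simp: u_def conc_def intro!: nth_equalityI)
  next
    case (Suc k)
    have "respects_children h (map w [0..<N + k])"
      using N[of "map w [0..<N + k]"] by auto
    then have "h (map w [0..<N + k] @ [w (N + k)]) = h (map w [0..<N + k]) @ [w (N + k)]"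
      by (cases "w (N + k)") (auto simp: respects_children_def)
    moreover have "u (length (h (map w [0..<N])) + k) = w (N + k)"
      by (simp add: u_def conc_def)
    ultimately show ?case
      using Suc by simp
  qed
  show ?thesis
  proof (rule ex1I)
    show "maps_end h w u"
      unfolding maps_end_def using step by (metis le_Suc_ex)
  next
    fix u' assume "maps_end h w u'"
    then obtain M where M: "\<And>n. n \<ge> M \<Longrightarrow> \<exists>m. h (map w [0..<n]) = map u' [0..<m]"
      by (auto simp: maps_end_def)
    show "u' = u"
    proof
      fix i
      define k where "k = Suc i + M"
      obtain m where m: "h (map w [0..<N + k]) = map u' [0..<m]"
        using M[of "N + k"] by (auto simp: k_def)
      with step[of k] have eq: "map u' [0..<m] = map u [0..<length (h (map w [0..<N])) + k]"
        by simp
      then have "m = length (h (map w [0..<N])) + k"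
        by (metis length_map length_upt diff_zero)
      then have "i < m"
        by (simp add: k_def)
      then show "u' i = u i"
        using arg_cong[OF eq, of "\<lambda>xs. xs ! i"] \<open>m = _\<close> by simp
    qed
  qed
qed

text \<open>Thompson's group V acts by finite prefix replacement: each pair \<open>(a, b)\<close> of \<open>P\<close> replaces
  the prefix \<open>a\<close> by \<open>b\<close>, and the cones over the \<open>a\<close>'s, as well as those over the \<open>b\<close>'s,
  partition the Cantor set.\<close>

definition V_set :: "(bool word \<Rightarrow> bool word) set" where
  "V_set = {g. \<exists>P :: (bool list \<times> bool list) set. finite P \<and>
      (\<forall>x. \<exists>!p. p \<in> P \<and> x \<in> range (\<lambda>y. fst p \<frown> y)) \<and>
      (\<forall>x. \<exists>!p. p \<in> P \<and> x \<in> range (\<lambda>y. snd p \<frown> y)) \<and>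
      (\<forall>(a, b) \<in> P. \<forall>y. g (a \<frown> y) = b \<frown> y)}"

definition F_set :: "(bool word \<Rightarrow> bool word) set" where
  "F_set = {g \<in> V_set. \<forall>x y. less_fun x y \<longrightarrow> less_fun (g x) (g y)}"

definition cyclic_less :: "bool word \<Rightarrow> bool word \<Rightarrow> bool word \<Rightarrow> bool" where
  "cyclic_less x y z \<longleftrightarrow>
     less_fun x y \<and> less_fun y z \<or> less_fun y z \<and> less_fun z x \<or> less_fun z x \<and> less_fun x y"

definition T_set :: "(bool word \<Rightarrow> bool word) set" where
  "T_set = {g \<in> V_set. \<forall>x y z. cyclic_less x y z \<longrightarrow> cyclic_less (g x) (g y) (g z)}"

definition QV :: "(bool list \<Rightarrow> bool list) monoid" where
  "QV = \<lparr>carrier = QV_set, mult = (\<circ>), one = id\<rparr>"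

definition QF :: "(bool list \<Rightarrow> bool list) monoid" where
  "QF = QV\<lparr>carrier := {h \<in> QV_set. end_map h \<in> F_set}\<rparr>"

definition QT :: "(bool list \<Rightarrow> bool list) monoid" where
  "QT = QV\<lparr>carrier := {h \<in> QV_set. end_map h \<in> T_set}\<rparr>"


section \<open>CW complexes\<close>

definition disc :: "nat \<Rightarrow> (nat \<Rightarrow> real) topology" where
  "disc n = subtopology (Euclidean_space n) {x. (\<Sum>i<n. (x i)\<^sup>2) \<le> 1}"

definition disc_interior :: "nat \<Rightarrow> (nat \<Rightarrow> real) set" where
  "disc_interior n = {x \<in> topspace (disc n). (\<Sum>i<n. (x i)\<^sup>2) < 1}"

definition disc_boundary :: "nat \<Rightarrow> (nat \<Rightarrow> real) set" where
  "disc_boundary n = {x \<in> topspace (disc n). (\<Sum>i<n. (x i)\<^sup>2) = 1}"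

text \<open>
  \<open>CW_complex X E d \<Phi>\<close>: the space \<open>X\<close> is a CW complex whose cells are indexed by \<open>E\<close>, the cell \<open>e\<close>
  having dimension \<open>d e\<close> and characteristic map \<open>\<Phi> e\<close>.  This is Whitehead's definition; the fifth
  conjunct is closure finiteness, the last one says that \<open>X\<close> has the weak topology.
\<close>

definition CW_complex ::
  "'a topology \<Rightarrow> 'i set \<Rightarrow> ('i \<Rightarrow> nat) \<Rightarrow> ('i \<Rightarrow> (nat \<Rightarrow> real) \<Rightarrow> 'a) \<Rightarrow> bool" where
  "CW_complex X E d \<Phi> \<longleftrightarrow>
     Hausdorff_space X \<and>
     (\<forall>e\<in>E. continuous_map (disc (d e)) X (\<Phi> e) \<and>
            embedding_map (subtopology (disc (d e)) (disc_interior (d e))) X (\<Phi> e)) \<and>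
     disjoint_family_on (\<lambda>e. \<Phi> e ` disc_interior (d e)) E \<and>
     (\<Union>e\<in>E. \<Phi> e ` disc_interior (d e)) = topspace X \<and>
     (\<forall>e\<in>E. \<exists>E'\<subseteq>E. finite E' \<and> (\<forall>e'\<in>E'. d e' < d e) \<and>
            \<Phi> e ` disc_boundary (d e) \<subseteq> (\<Union>e'\<in>E'. \<Phi> e' ` disc_interior (d e'))) \<and>
     (\<forall>A\<subseteq>topspace X.
        (\<forall>e\<in>E. closedin X (A \<inter> X closure_of (\<Phi> e ` disc_interior (d e)))) \<longrightarrow> closedin X A)"


section \<open>Homotopy groups and Eilenberg-MacLane spaces\<close>

definition cube :: "nat \<Rightarrow> (nat \<Rightarrow> real) topology" where
  "cube n = subtopology (Euclidean_space n) {s. \<forall>i<n. 0 \<le> s i \<and> s i \<le> 1}"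

definition cube_boundary :: "nat \<Rightarrow> (nat \<Rightarrow> real) set" where
  "cube_boundary n = {s \<in> topspace (cube n). \<exists>i<n. s i = 0 \<or> s i = 1}"

definition based_cubes :: "nat \<Rightarrow> 'a topology \<Rightarrow> 'a \<Rightarrow> ((nat \<Rightarrow> real) \<Rightarrow> 'a) set" where
  "based_cubes n X x = {f. continuous_map (cube n) X f \<and> f ` cube_boundary n \<subseteq> {x}}"

definition cube_homotopic ::
  "nat \<Rightarrow> 'a topology \<Rightarrow> 'a \<Rightarrow> ((nat \<Rightarrow> real) \<Rightarrow> 'a) \<Rightarrow> ((nat \<Rightarrow> real) \<Rightarrow> 'a) \<Rightarrow> bool" where
  "cube_homotopic n X x =
     homotopic_with (\<lambda>f. f ` cube_boundary n \<subseteq> {x}) (cube n) X"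

definition cube_join ::
  "((nat \<Rightarrow> real) \<Rightarrow> 'a) \<Rightarrow> ((nat \<Rightarrow> real) \<Rightarrow> 'a) \<Rightarrow> (nat \<Rightarrow> real) \<Rightarrow> 'a" where
  "cube_join f g =
     (\<lambda>s. if s 0 \<le> 1 / 2 then f (s(0 := 2 * s 0)) else g (s(0 := 2 * s 0 - 1)))"

text \<open>The \<open>n\<close>-th homotopy group, for \<open>n \<ge> 1\<close>; for \<open>n = 1\<close> this is the fundamental group.\<close>

definition homotopy_group ::
  "nat \<Rightarrow> 'a topology \<Rightarrow> 'a \<Rightarrow> ((nat \<Rightarrow> real) \<Rightarrow> 'a) set monoid" where
  "homotopy_group n X x =
     \<lparr>carrier = based_cubes n X x // {(f, g). cube_homotopic n X x f g},
      mult = (\<lambda>A B. {h. \<exists>f\<in>A. \<exists>g\<in>B. cube_homotopic n X x (cube_join f g) h}),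
      one = {h. cube_homotopic n X x (\<lambda>_. x) h}\<rparr>"

definition Eilenberg_MacLane_1 :: "('g, 'b) monoid_scheme \<Rightarrow> 'a topology \<Rightarrow> bool" where
  "Eilenberg_MacLane_1 G X \<longleftrightarrow>
     topspace X \<noteq> {} \<and> path_connected_space X \<and>
     (\<forall>x\<in>topspace X.
        homotopy_group 1 X x \<cong> G \<and>
        (\<forall>n\<ge>2. carrier (homotopy_group n X x) = {\<one>\<^bsub>homotopy_group n X x\<^esub>}))"

text \<open>
  A complex with finitely many cells in each dimension has countably many cells, so these may be
  indexed by natural numbers, and it is, as a set, the disjoint union of its open cells, so its
  points may be taken to be pairs of a cell and a point of a disc.  Hence the fixed types of \<open>E\<close>
  and \<open>X\<close> below entail no loss of generality.
\<close>

definition type_F_infinity :: "('g, 'b) monoid_scheme \<Rightarrow> bool" where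
  "type_F_infinity G \<longleftrightarrow> group G \<and>
     (\<exists>(X :: (nat \<times> (nat \<Rightarrow> real)) topology) (E :: nat set) d \<Phi>.
        CW_complex X E d \<Phi> \<and> (\<forall>n. finite {e \<in> E. d e = n}) \<and> Eilenberg_MacLane_1 G X)"

end

(*
  Each of the three groups acts on the finite families of embedded copies of the tree that have
  disjoint ranges and leave finitely many points uncovered.  Splitting a member into its two halves
  uncovers its root; splitting several members independently spans cubes.  Joining in the
  enumerations of the finitely many roots and uncovered points makes the action free.
  Discrete Morse theory is used twice.  An equivariant acyclic matching with finitely many orbits of
  critical cells in each dimension yields a free CW complex, and a second matching, not equivariant,
  with a single critical cell shows that this complex is contractible.  Its quotient is a classifying
  space with finitely many cells in each dimension.
*)
theory Submission
  imports Defs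
begin

text \<open>The stabiliser of a family permutes its trees and its uncovered points, so it is finite
  but seldom trivial. Labels make the action free at a price: the join over infinitely many stages
  has infinitely many orbits of cells in each dimension, so the equivariant matching must thin out
  labels as well as families. What bounds the families in critical cells is a count. Uncovered
  points are one fewer than trees, so a large family admits about half as many independent merges as
  it has trees, while each tree that is being split in a cell obstructs at most three of them. The
  merges must be selected equivariantly, and the labels make that possible too. The complex of all
  cells is never topologised. Only the critical cells of the first matching form a space, and
  \<open>q\<close> maps every cell into it by pushing points along that matching. The contraction
  supplied by the second matching lives on the cells and ignores the first matching, so it does not
  descend to this space; a second interpolation replaces it by one compatible with the pushes behind
  \<open>q\<close>.\<close>

notation iff (infixr "<->" 25)
notation conc (infixr "@@" 65)
abbreviation "car \<equiv> carrier"
abbreviation "tset \<equiv> top_of_set"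
abbreviation "cmap \<equiv> continuous_map"
abbreviation "con \<equiv> continuous_on"
abbreviation "ptop \<equiv> prod_topology"
abbreviation "em \<equiv> end_map"
lemmas con_prod = continuous_on_coordinatewise_then_product

type_synonym rseq = "nat \<Rightarrow> real"

section \<open>Cell complexes with prescribed attaching maps\<close>

definition nrm :: "nat => rseq => real" where
 "nrm n x = sqrt (SUM i<n. (x i)\<^sup>2)"

definition dsk :: "nat => rseq set" where
 "dsk n = {x. (ALL i>=n. x i = 0) & nrm n x <= 1}"

definition sph :: "nat => rseq set" where
 "sph n = {x. (ALL i>=n. x i = 0) & nrm n x = 1}"

definition idk :: "nat => rseq set" where
 "idk n = {x. (ALL i>=n. x i = 0) & nrm n x < 1}"

lemma Euclidean_space_top_of_set: "Euclidean_space n = tset {x. ALL i>=n. x i = 0}"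
 by(simp add: Euclidean_space_def euclidean_product_topology)

lemma disc_eq: "disc n = tset (dsk n)"
 by(auto simp: disc_def Euclidean_space_top_of_set subtopology_subtopology dsk_def nrm_def
   intro!: arg_cong[where f="subtopology euclidean"])

lemma nrm_nonneg: "0 <= nrm n x" by(simp add: nrm_def sum_nonneg)

lemma disc_interior_eq: "disc_interior n = idk n"
 by(auto simp: disc_interior_def disc_eq dsk_def idk_def nrm_def)

lemma disc_boundary_eq: "disc_boundary n = sph n"
 by(auto simp: disc_boundary_def disc_eq dsk_def sph_def nrm_def)

lemma dsk_split: "dsk n = idk n Un sph n" "idk n Int sph n = {}"
 by(auto simp: dsk_def idk_def sph_def)

lemma continuous_on_nrm [continuous_intros]: "con A (nrm n)"
 unfolding nrm_def by(intro continuous_intros continuous_on_subset[OF continuous_on_product_coordinates]) auto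

lemma nrm_scale: "nrm n (%i. c * x i) = \<bar>c\<bar> * nrm n x"
proof -
 have "(SUM i<n. (c * x i)\<^sup>2) = c\<^sup>2 * (SUM i<n. (x i)\<^sup>2)"
  by(simp add: power_mult_distrib sum_distrib_left)
 thus ?thesis by(simp add: nrm_def real_sqrt_mult)
qed

lemma nrm_coord: "i < n ==> \<bar>x i\<bar> <= nrm n x"
proof -
 assume "i < n"
 have "(x i)\<^sup>2 <= (SUM i<n. (x i)\<^sup>2)"
  using \<open>i < n\<close> by(intro member_le_sum) auto
 thus ?thesis by(metis nrm_def real_sqrt_abs real_sqrt_le_mono)
qed

definition scal :: "real => rseq => nat => real" where
 "scal c x = (%i. c * x i)"

lemma continuous_on_scal [continuous_intros]:
 assumes "con A c" "con A f"
 shows "con A (%x. scal (c x) (f x))"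
 unfolding scal_def
proof(intro con_prod continuous_intros assms)
 fix i
 have "con (f ` A) (%g. g i)"
  by(rule continuous_on_subset[OF continuous_on_product_coordinates]) auto
 thus "con A (%x. f x i)"
  using continuous_on_compose[OF assms(2)] by(auto simp: o_def)
qed

lemma nrm_scal [simp]: "nrm n (scal c x) = \<bar>c\<bar> * nrm n x"
 by(simp add: scal_def nrm_scale)

lemma scal_scal [simp]: "scal a (scal b x) = scal (a * b) x"
 by(simp add: scal_def mult.assoc)

lemma scal_one [simp]: "scal 1 x = x"
 by(simp add: scal_def)

definition rproj :: "nat => rseq => nat => real" where
 "rproj n x = scal (inverse (nrm n x)) x"

lemma rproj_sph: "(ALL i>=n. x i = 0) ==> nrm n x > 0 ==> rproj n x : sph n"
 by(auto simp: rproj_def sph_def) (simp add: scal_def)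

lemma rproj_id: "x : sph n ==> rproj n x = x"
 by(auto simp: rproj_def sph_def)

lemma continuous_on_rproj: "(!!x. x : A ==> nrm n x ~= 0) ==> con A (rproj n)"
 unfolding rproj_def by(intro continuous_intros) auto

lemma sph_subset_dsk: "sph n <= dsk n" and idk_subset_dsk: "idk n <= dsk n"
 by(auto simp: dsk_split)

lemma openin_idk: "openin (tset (dsk n)) (idk n)"
proof -
 have "open {x. nrm n x < 1}"
  by(intro open_Collect_less continuous_intros)
 moreover have "idk n = dsk n Int {x. nrm n x < 1}"
  by(auto simp: idk_def dsk_def)
 ultimately show ?thesis by(auto simp: openin_open)
qed

text \<open>Points of the space to be built are pairs of a cell and a point of its open disc. No
  topology exists on the lower skeleton yet, so continuity of an attaching map is expressed through
  test sets: whatever pulls back to open sets in all discs of lower dimension must have an open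
  preimage in the sphere.\<close>

locale cell_data =
 fixes I :: "'i set" and d :: "'i => nat"
  and att :: "'i => rseq => 'i * rseq"
 assumes att_cell: "[|i : I; x : sph (d i)|] ==>
   fst (att i x) : I & snd (att i x) : idk (d (fst (att i x))) & d (fst (att i x)) < d i"
  and att_finite: "i : I ==> finite (fst ` att i ` sph (d i))"
  and att_cont: "[|i : I; !!j. [|j : I; d j < d i|] ==>
    openin (tset (dsk (d j))) {x : dsk (d j). (if x : idk (d j) then (j, x) else att j x) : U}|] ==>
   openin (tset (sph (d i))) {x : sph (d i). att i x : U}"
begin

definition pts :: "('i * rseq) set" where
 "pts = {(i, x). i : I & x : idk (d i)}"

definition chr :: "'i => rseq => 'i * rseq" where
 "chr i x = (if x : idk (d i) then (i, x) else att i x)"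

definition pull :: "'i => ('i * rseq) set => rseq set" where
 "pull i U = {x : dsk (d i). chr i x : U}"

definition sp :: "('i * rseq) topology" where
 "sp = topology (%U. U <= pts & (ALL i:I. openin (tset (dsk (d i))) (pull i U)))"

lemma att_cont': "[|i : I; !!j. [|j : I; d j < d i|] ==> openin (tset (dsk (d j))) (pull j U)|] ==>
   openin (tset (sph (d i))) {x : sph (d i). att i x : U}"
 using att_cont[of i U] by(simp add: pull_def chr_def)

lemma openin_sp: "openin sp U <-> U <= pts & (ALL i:I. openin (tset (dsk (d i))) (pull i U))"
proof -
 have "istopology (%U. U <= pts & (ALL i:I. openin (tset (dsk (d i))) (pull i U)))"
  unfolding istopology_def
 proof(intro conjI allI impI)
  fix S T assume "S <= pts & (ALL i:I. openin (tset (dsk (d i))) (pull i S))"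
   "T <= pts & (ALL i:I. openin (tset (dsk (d i))) (pull i T))"
  moreover have "pull i (S Int T) = pull i S Int pull i T" for i by(auto simp: pull_def)
  ultimately show "S Int T <= pts" "ALL i:I. openin (tset (dsk (d i))) (pull i (S Int T))"
   by auto
 next
  fix K assume K: "ALL S:K. S <= pts & (ALL i:I. openin (tset (dsk (d i))) (pull i S))"
  moreover have "pull i (\<Union>K) = \<Union> (pull i ` K)" for i by(auto simp: pull_def)
  ultimately show "\<Union>K <= pts" "ALL i:I. openin (tset (dsk (d i))) (pull i (\<Union>K))"
   by(auto intro!: openin_Union)
 qed
 thus ?thesis by(simp add: sp_def)
qed

lemma chr_in_pts: "i : I ==> x : dsk (d i) ==> chr i x : pts"
 using att_cell[of i x] by(cases "att i x") (auto simp: chr_def pts_def dsk_split)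

lemma topspace_sp [simp]: "topspace sp = pts"
proof -
 have "pull i pts = dsk (d i)" if "i : I" for i
  using chr_in_pts[OF that] by(auto simp: pull_def)
 hence "openin sp pts" by(auto simp: openin_sp)
 thus ?thesis
  by(metis openin_sp openin_subset openin_topspace subset_antisym)
qed

lemma chr_idk: "x : idk (d i) ==> chr i x = (i, x)"
 by(simp add: chr_def)

lemma chr_sph: "x : sph (d i) ==> chr i x = att i x"
 using dsk_split(2)[of "d i"] by(auto simp: chr_def)

lemma continuous_chr: "i : I ==> cmap (tset (dsk (d i))) sp (chr i)"
 unfolding continuous_map
 using chr_in_pts by(auto simp: openin_sp pull_def)

lemma continuous_map_from_sp:
 assumes "f : pts \<rightarrow> topspace Z"
  and "!!i. i : I ==> cmap (tset (dsk (d i))) Z (f o chr i)"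
 shows "cmap sp Z f"
 unfolding continuous_map
proof(intro conjI allI impI)
 show "f ` topspace sp <= topspace Z" using assms(1) by auto
 fix U assume "openin Z U"
 hence "openin (tset (dsk (d i))) {x : dsk (d i). (f o chr i) x : U}" if "i : I" for i
  using assms(2)[OF that] by(auto simp: continuous_map)
 moreover have "pull i {x : topspace sp. f x : U} = {x : dsk (d i). (f o chr i) x : U}" if "i : I" for i
  using chr_in_pts[OF that] by(auto simp: pull_def)
 ultimately show "openin sp {x : topspace sp. f x : U}"
  by(auto simp: openin_sp)
qed

text \<open>The open set spanned by \<open>U\<close> in the skeleton of dimension \<open>n\<close>: the points from which \<open>U\<close> is
 reached by radial projection and attaching, staying outside the radius \<open>th\<close> in every higher cell.\<close>

inductive_set spread :: "('i * rseq) set => nat => real => ('i * rseq) set"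
 for U n th where
 base: "p : U ==> p : spread U n th"
| step: "[|i : I; n < d i; x : idk (d i); th < nrm (d i) x; att i (rproj (d i) x) : spread U n th|] ==>
   (i, x) : spread U n th"

lemma spread_cell_iff:
 assumes "U <= {p : pts. d (fst p) <= n}" "i : I" "x : idk (d i)"
 shows "(i, x) : spread U n th <->
  (if d i <= n then (i, x) : U else th < nrm (d i) x & att i (rproj (d i) x) : spread U n th)"
 using assms by(subst spread.simps) auto

lemma spread_subset:
 assumes "U <= pts" shows "spread U n th <= pts"
proof
 fix p assume "p : spread U n th" thus "p : pts"
  by induction (use assms in "auto simp: pts_def")
qed

text \<open>Induction on the dimension. In a cell above dimension \<open>n\<close> the pulled back
  set is the part of the collar outside radius \<open>th\<close> that projects radially into an open
  subset of the sphere. The bound \<open>th < 1\<close> puts the sphere itself into the collar;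
  \<open>0 <= th\<close> keeps out the centre, where the projection is undefined.\<close>

lemma openin_spread:
 assumes U: "U <= {p : pts. d (fst p) <= n}" and th: "0 <= th" "th < 1"
  and op: "!!i. [|i : I; d i <= n|] ==> openin (tset (dsk (d i))) (pull i U)"
 shows "openin sp (spread U n th)"
proof -
 have main: "openin (tset (dsk (d i))) (pull i (spread U n th))" if "i : I" for i
  using that
 proof(induction "d i" arbitrary: i rule: less_induct)
  case less
  note i = \<open>i \<in> I\<close>
  have low: "chr i x : spread U n th <-> chr i x : U" if "d i <= n" "x : dsk (d i)" for x
  proof -
   have "chr i x : pts" using chr_in_pts i that by auto
   moreover have "d (fst (chr i x)) <= n"
    using att_cell[OF i, of x] that by(auto simp: chr_def dsk_split)
   ultimately show ?thesis
    using spread_cell_iff[OF U, of "fst (chr i x)" "snd (chr i x)"] by(auto simp: pts_def)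
  qed
  show ?case
  proof(cases "d i <= n")
   case True
   hence "pull i (spread U n th) = pull i U" using low by(auto simp: pull_def)
   thus ?thesis using op i True by simp
  next
   case False
   let ?A = "{x : dsk (d i). th < nrm (d i) x}"
   let ?B = "{x : sph (d i). att i x : spread U n th}"
   have B: "openin (tset (sph (d i))) ?B"
    by(rule att_cont'[OF i]) (use less.hyps in auto)
   have eq: "pull i (spread U n th) = {x : ?A. rproj (d i) x : ?B}"
   proof -
    have "chr i x : spread U n th <-> th < nrm (d i) x & rproj (d i) x : ?B" if x: "x : dsk (d i)" for x
    proof(cases "x : idk (d i)")
     case True
     thus ?thesis
      using spread_cell_iff[OF U i True] False th rproj_sph[of "d i" x]
      by(auto simp: chr_def idk_def)
    next
     case F: False
     hence s: "x : sph (d i)" using x by(auto simp: dsk_split)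
     thus ?thesis using th rproj_id[OF s] F by(auto simp: chr_def sph_def)
    qed
    thus ?thesis by(auto simp: pull_def)
   qed
   have cont: "con ?A (rproj (d i))"
    by(rule continuous_on_rproj) (use th in auto)
   have im: "rproj (d i) : ?A \<rightarrow> sph (d i)"
    using rproj_sph th by(fastforce simp: dsk_def)
   have "openin (tset ?A) (?A Int rproj (d i) -` ?B)"
    using cont im B continuous_openin_preimage by blast
   moreover have "openin (tset (dsk (d i))) ?A"
   proof -
    have "open {x. th < nrm (d i) x}" by(intro open_Collect_less continuous_intros)
    thus ?thesis by(auto simp: openin_open)
   qed
   ultimately have "openin (tset (dsk (d i))) (?A Int rproj (d i) -` ?B)"
    using openin_trans by blast
   moreover have "?A Int rproj (d i) -` ?B = {x : ?A. rproj (d i) x : ?B}" by auto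
   ultimately show ?thesis by(simp add: eq)
  qed
 qed
 have "U <= pts" using U by auto
 thus ?thesis using main spread_subset by(auto simp: openin_sp)
qed

end
context cell_data begin
lemma openin_spread_cell:
 assumes i: "i : I" and V: "openin (tset (dsk (d i))) V" "V <= idk (d i)" and th: "0 <= th" "th < 1"
 shows "openin sp (spread ({i} \<times> V) (d i) th)"
proof(rule openin_spread[OF _ th])
 show "{i} \<times> V <= {p : pts. d (fst p) <= d i}" using i V(2) by(auto simp: pts_def)
 fix j assume j: "j : I" "d j <= d i"
 have "pull j ({i} \<times> V) = (if j = i then V else {})"
 proof(rule Set.set_eqI)
  fix x show "x : pull j ({i} \<times> V) <-> x : (if j = i then V else {})"
  proof(cases "x : idk (d j)")
   case True thus ?thesis using V(2) idk_subset_dsk by(auto simp: pull_def chr_def)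
  next
   case False
   thus ?thesis using att_cell[OF j(1), of x] j(2) V(2)
    by(cases "att j x") (auto simp: pull_def chr_def dsk_split)
  qed
 qed
 thus "openin (tset (dsk (d j))) (pull j ({i} \<times> V))" using V by auto
qed

lemma spread_cell_same:
 assumes i: "i : I" and V: "V <= idk (d i)"
 shows "p : spread ({i} \<times> V) (d i) th ==> d (fst p) <= d i ==> p : {i} \<times> V"
proof -
 assume p: "p : spread ({i} \<times> V) (d i) th" "d (fst p) <= d i"
 have U: "{i} \<times> V <= {p : pts. d (fst p) <= d i}" using i V by(auto simp: pts_def)
 hence "p : pts" using p(1) spread_subset[of "{i} \<times> V"] by blast
 thus ?thesis using spread_cell_iff[OF U, of "fst p" "snd p" th] p by(auto simp: pts_def)
qed

text \<open>The radial trajectory of a point meets at most one cell of each dimension.\<close>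

lemma spread_same_dim_disjoint:
 assumes U: "U <= {p : pts. d (fst p) = n}" and U': "U' <= {p : pts. d (fst p) = n}"
  and disj: "U Int U' = {}"
 shows "spread U n th Int spread U' n th' = {}"
proof -
 have Ule: "U <= {p : pts. d (fst p) <= n}" "U' <= {p : pts. d (fst p) <= n}"
  using U U' by auto
 have "p ~: spread U' n th'" if "p : spread U n th" for p
  using that
 proof(induction rule: spread.induct)
  case (base p)
  obtain i x where p: "p = (i, x)" by(cases p)
  have "i : I" "x : idk (d i)" "d i = n" using base U by(auto simp: p pts_def)
  thus ?case
   using spread_cell_iff[OF Ule(2), of i x th'] base disj by(auto simp: p)
 next
  case (step i x)
  thus ?case using spread_cell_iff[OF Ule(2), of i x th'] by auto
 qed
 thus ?thesis by auto
qed

end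
context cell_data begin

text \<open>Points of cells of equal dimension are separated by spreading disjoint open sets. For
  different dimensions the radius decides: the point of the larger cell lies within some
  \<open>th < 1\<close>, and the spread of the smaller cell is kept outside that radius.
  Disjointness then propagates upwards along radial projections.\<close>

lemma Hausdorff_sp: "Hausdorff_space sp"
 unfolding Hausdorff_space_def topspace_sp
proof(intro allI impI)
 have less: "EX A B. openin sp A & openin sp B & (i, x) : A & (j, y) : B & disjnt A B"
  if i: "i : I" "x : idk (d i)" and j: "j : I" "y : idk (d j)" and ij: "d j < d i" for i x j y
 proof -
  obtain th where th: "nrm (d i) x < th" "th < 1" using i(2) dense[of "nrm (d i) x" 1] by(auto simp: idk_def)
  have th0: "0 <= th" using th nrm_nonneg[of "d i" x] by linarith
  define V where "V = idk (d i) Int {z. nrm (d i) z < th}"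
  have "open {z. nrm (d i) z < th}" by(intro open_Collect_less continuous_intros)
  hence V: "openin (tset (dsk (d i))) V" "V <= idk (d i)"
   unfolding V_def using openin_idk by(auto intro: openin_Int_open)
  define A where "A = spread ({i} \<times> V) (d i) 0"
  define B where "B = spread ({j} \<times> idk (d j)) (d j) th"
  have "openin sp A" unfolding A_def by(rule openin_spread_cell[OF i(1) V]) auto
  moreover have "openin sp B" unfolding B_def
   by(rule openin_spread_cell[OF j(1) openin_idk]) (use th th0 in auto)
  moreover have "(i, x) : A" unfolding A_def V_def using i th by(intro spread.base) auto
  moreover have "(j, y) : B" unfolding B_def using j by(intro spread.base) auto
  moreover have "p ~: B" if "p : A" for p
   using that unfolding A_def
  proof(induction rule: spread.induct)
   case (base p)
   then obtain z where p: "p = (i, z)" and z: "z : idk (d i)" "nrm (d i) z < th" by(auto simp: V_def)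
   have "{j} \<times> idk (d j) <= {p : pts. d (fst p) <= d j}" using j by(auto simp: pts_def)
   from spread_cell_iff[OF this i(1) z(1), of th] show ?case
    using z ij by(auto simp: p B_def)
  next
   case (step k z)
   have "{j} \<times> idk (d j) <= {p : pts. d (fst p) <= d j}" using j by(auto simp: pts_def)
   from spread_cell_iff[OF this step(1,3), of th] show ?case
    using step ij by(auto simp: B_def)
  qed
  ultimately show ?thesis unfolding disjnt_def by blast
 qed
 have same: "EX A B. openin sp A & openin sp B & (i, x) : A & (j, y) : B & disjnt A B"
  if i: "i : I" "x : idk (d i)" and j: "j : I" "y : idk (d j)" and ij: "d i = d j"
   and neq: "(i, x) ~= (j, y)" for i x j y
 proof -
  obtain P Q where PQ: "open P" "open Q" "x : P" "y : Q" "i = j --> P Int Q = {}"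
  proof(cases "i = j")
   case True
   hence "x ~= y" using neq by auto
   thus ?thesis using hausdorff[of x y] that by blast
  next
   case False
   thus ?thesis using that[of UNIV UNIV] by auto
  qed
  define V where "V = idk (d i) Int P"
  define V' where "V' = idk (d j) Int Q"
  have V: "openin (tset (dsk (d i))) V" "V <= idk (d i)"
   unfolding V_def using openin_idk PQ by(auto intro: openin_Int_open)
  have V': "openin (tset (dsk (d j))) V'" "V' <= idk (d j)"
   unfolding V'_def using openin_idk PQ by(auto intro: openin_Int_open)
  have "spread ({i} \<times> V) (d i) 0 Int spread ({j} \<times> V') (d i) 0 = {}"
   by(rule spread_same_dim_disjoint) (use i j ij PQ V(2) V'(2) in "auto simp: pts_def V_def V'_def")
  moreover have "openin sp (spread ({i} \<times> V) (d i) 0)"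
   by(rule openin_spread_cell[OF i(1) V]) auto
  moreover have "openin sp (spread ({j} \<times> V') (d i) 0)"
   unfolding ij by(rule openin_spread_cell[OF j(1) V']) auto
  moreover have "(i, x) : spread ({i} \<times> V) (d i) 0" "(j, y) : spread ({j} \<times> V') (d i) 0"
   using i j PQ by(auto simp: V_def V'_def intro: spread.base)
  ultimately show ?thesis by(auto simp: disjnt_def)
 qed
 fix p q assume pq: "p : pts & q : pts & p ~= q"
 obtain i x where p: "p = (i, x)" "i : I" "x : idk (d i)" using pq by(cases p) (auto simp: pts_def)
 obtain j y where q: "q = (j, y)" "j : I" "y : idk (d j)" using pq by(cases q) (auto simp: pts_def)
 consider "d j < d i" | "d i < d j" | "d i = d j" by linarith
 thus "EX U V. openin sp U & openin sp V & p : U & q : V & disjnt U V"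
 proof cases
  case 1
  thus ?thesis using less[OF p(2,3) q(2,3)] p q by auto
 next
  case 2
  then obtain A B where "openin sp A & openin sp B & (j, y) : A & (i, x) : B & disjnt A B"
   using less[OF q(2,3) p(2,3)] by auto
  thus ?thesis using p q unfolding disjnt_def by blast
 next
  case 3
  thus ?thesis using same[OF p(2,3) q(2,3)] pq p q by auto
 qed
qed

text \<open>An open subset \<open>V\<close> of the open cell is the trace on that cell of the open
  set spread from \<open>V\<close>, because spreading adds points of higher dimension only.\<close>

lemma embedding_chr: "i : I ==> embedding_map (tset (idk (d i))) sp (chr i)"
proof -
 assume i: "i : I"
 have c: "cmap (tset (idk (d i))) sp (chr i)"
  using continuous_map_from_subtopology_mono[OF continuous_chr[OF i] idk_subset_dsk] .
 have "open_map (tset (idk (d i))) (subtopology sp (chr i ` idk (d i))) (chr i)"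
  unfolding open_map_def
 proof(intro allI impI)
  fix V assume V: "openin (tset (idk (d i))) V"
  hence V': "openin (tset (dsk (d i))) V" "V <= idk (d i)"
   using openin_trans[OF V openin_idk] openin_subset[OF V] by auto
  have "openin sp (spread ({i} \<times> V) (d i) 0)" by(rule openin_spread_cell[OF i V']) auto
  moreover have "chr i ` V = spread ({i} \<times> V) (d i) 0 Int chr i ` idk (d i)"
  proof
   show "chr i ` V <= spread ({i} \<times> V) (d i) 0 Int chr i ` idk (d i)"
    using V'(2) by(auto simp: chr_idk subset_iff intro!: spread.base)
   show "spread ({i} \<times> V) (d i) 0 Int chr i ` idk (d i) <= chr i ` V"
   proof
    fix p assume p: "p : spread ({i} \<times> V) (d i) 0 Int chr i ` idk (d i)"
    then obtain x where x: "x : idk (d i)" "p = (i, x)" by(auto simp: chr_idk)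
    hence "p : {i} \<times> V" using spread_cell_same[OF i V'(2), of p 0] p by auto
    thus "p : chr i ` V" using V'(2) x by(auto simp: chr_idk image_iff intro!: bexI[of _ x])
   qed
  qed
  ultimately show "openin (subtopology sp (chr i ` idk (d i))) (chr i ` V)"
   by(auto simp: openin_subtopology)
 qed
 moreover have "inj_on (chr i) (idk (d i))" by(auto simp: inj_on_def chr_idk)
 moreover have "chr i ` idk (d i) <= pts" using chr_in_pts[OF i] idk_subset_dsk by blast
 ultimately show ?thesis
  unfolding embedding_map_def using c
  by(intro bijective_open_imp_homeomorphic_map)
    (auto simp: continuous_map_in_subtopology)
qed

lemma dsk_subset_closure: "dsk n <= closure (idk n)"
proof
 fix x assume x: "x : dsk n"
 define f where "f = (%k::nat. scal (1 - inverse (real (Suc k))) x)"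
 have "f k : idk n" for k
 proof -
  have "\<bar>1 - inverse (real (Suc k))\<bar> * nrm n x < 1"
  proof -
   have "\<bar>1 - inverse (real (Suc k))\<bar> * nrm n x <= \<bar>1 - inverse (real (Suc k))\<bar> * 1"
    using x by(intro mult_left_mono) (auto simp: dsk_def)
   also have "... < 1" by(auto simp: field_simps)
   finally show ?thesis .
  qed
  thus ?thesis using x by(auto simp: f_def idk_def dsk_def) (auto simp: scal_def)
 qed
 moreover have "f \<longlonglongrightarrow> x"
 proof -
  have "con UNIV (%c. scal c x)" by(intro continuous_intros)
  hence "isCont (%c. scal c x) 1" by(simp add: continuous_on_eq_continuous_at)
  moreover have "(%k::nat. 1 - inverse (real (Suc k))) \<longlonglongrightarrow> 1"
   using tendsto_diff[OF tendsto_const LIMSEQ_inverse_real_of_nat, of 1] by simp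
  ultimately have "(%k::nat. scal (1 - inverse (real (Suc k))) x) \<longlonglongrightarrow> scal 1 x"
   by(rule isCont_tendsto_compose)
  thus ?thesis by(simp add: f_def)
 qed
 ultimately show "x : closure (idk n)" by(meson closure_sequential)
qed

lemma chr_dsk_subset_closure: "i : I ==> chr i ` dsk (d i) <= sp closure_of (chr i ` idk (d i))"
proof -
 assume i: "i : I"
 have "chr i ` ((tset (dsk (d i))) closure_of (idk (d i))) <= sp closure_of (chr i ` idk (d i))"
  using continuous_chr[OF i] continuous_map_image_closure_subset by blast
 moreover have "dsk (d i) <= (tset (dsk (d i))) closure_of (idk (d i))"
  using dsk_subset_closure[of "d i"] idk_subset_dsk
  by(auto simp: closure_of_subtopology inf.absorb2)
 ultimately show ?thesis by blast
qed

lemma CW_complex_sp: "CW_complex sp I d chr"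
 unfolding CW_complex_def disc_boundary_eq disc_interior_eq topspace_sp
proof(intro conjI ballI allI impI)
 fix i assume i: "i : I"
 show "cmap (disc (d i)) sp (chr i)" using continuous_chr[OF i] by(simp add: disc_eq)
 show "embedding_map (subtopology (disc (d i)) (idk (d i))) sp (chr i)"
  using embedding_chr[OF i] idk_subset_dsk[of "d i"]
  by(simp add: disc_eq subtopology_subtopology inf.absorb2)
 show "EX E'<=I. finite E' & (ALL e':E'. d e' < d i) &
   chr i ` sph (d i) <= (UN e':E'. chr e' ` idk (d e'))"
 proof(intro exI[of _ "fst ` att i ` sph (d i)"] conjI)
  show "chr i ` sph (d i) <= (UN e':fst ` att i ` sph (d i). chr e' ` idk (d e'))"
  proof(rule image_subsetI)
   fix x assume x: "x : sph (d i)"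
   have "chr i x = chr (fst (att i x)) (snd (att i x))"
    using att_cell[OF i x] by(simp add: chr_sph[OF x] chr_idk)
   thus "chr i x : (UN e':fst ` att i ` sph (d i). chr e' ` idk (d e'))"
    using att_cell[OF i x] x by auto
  qed
 qed (use att_cell[OF i] att_finite[OF i] in auto)
next
 show "disjoint_family_on (%e. chr e ` idk (d e)) I"
  by(auto simp: disjoint_family_on_def chr_idk)
 show "(UN e:I. chr e ` idk (d e)) = pts"
  by(force simp: chr_idk pts_def)
 fix A assume A: "A <= pts" "ALL e:I. closedin sp (A Int sp closure_of chr e ` idk (d e))"
 have "openin (tset (dsk (d i))) (pull i (pts - A))" if i: "i : I" for i
 proof -
  have "closedin (tset (dsk (d i))) {x : dsk (d i). chr i x : A Int sp closure_of chr i ` idk (d i)}"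
   using closedin_continuous_map_preimage[OF continuous_chr[OF i]] A(2) i by fastforce
  moreover have "{x : dsk (d i). chr i x : A Int sp closure_of chr i ` idk (d i)} = dsk (d i) - pull i (pts - A)"
   using chr_dsk_subset_closure[OF i] chr_in_pts[OF i] by(auto simp: pull_def)
  moreover have "pull i (pts - A) <= dsk (d i)" by(auto simp: pull_def)
  ultimately show ?thesis by(simp add: openin_closedin)
 qed
 thus "closedin sp A"
  using A(1) by(auto simp: closedin_def openin_sp)
qed (rule Hausdorff_sp)

end

section \<open>Principal covers\<close>

lemma continuous_map_two_pieces:
 assumes "closedin X S" "closedin X T" "topspace X = S Un T"
  and "cmap (subtopology X S) Y f" "cmap (subtopology X T) Y g"
  and "!!x. x : S Int T ==> f x = g x"
 shows "cmap X Y (%x. if x : S then f x else g x)"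
proof(rule continuous_map_cases)
 have cl: "X closure_of {x. x : S} <= S" using assms(1) by(simp add: closure_of_closedin)
 have cl': "X closure_of {x. x ~: S} <= T"
 proof -
  have "X closure_of {x. x ~: S} = X closure_of (topspace X Int {x. x ~: S})" by(rule closure_of_restrict)
  also have "... <= X closure_of T" using assms(3) by(intro closure_of_mono) auto
  also have "... = T" using assms(2) by(simp add: closure_of_closedin)
  finally show ?thesis .
 qed
 show "cmap (subtopology X (X closure_of {x. x : S})) Y f"
  by(rule continuous_map_from_subtopology_mono[OF assms(4) cl])
 show "cmap (subtopology X (X closure_of {x. x ~: S})) Y g"
  by(rule continuous_map_from_subtopology_mono[OF assms(5) cl'])
 fix x assume "x : X frontier_of {x. x : S}"
 hence "x : X closure_of S" "x : X closure_of (topspace X - S)"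
  by(auto simp: frontier_of_closures)
 moreover have "X closure_of (topspace X - S) <= T"
  using assms(2,3) by(metis Diff_subset_conv closure_of_minimal subset_refl)
 ultimately show "f x = g x" using assms(6) cl by auto
qed

text \<open>\<open>wander\<close> is the defining property of a covering space action; together with
  \<open>fibre\<close> and the openness of \<open>p\<close> it makes \<open>p\<close> a principal
  covering with the discrete group \<open>G\<close>.\<close>

locale principal_cover = group G
 for G :: "('g, 'm) monoid_scheme" (structure) +
 fixes E :: "'a topology" and B :: "'b topology" and p :: "'a => 'b" and ga :: "'g => 'a => 'a"
 assumes p_cont: "cmap E B p" and p_open: "open_map E B p"
  and p_surj: "p ` topspace E = topspace B"
  and ga_cont: "g : car G ==> cmap E E (ga g)"
  and ga_one: "e : topspace E ==> ga \<one> e = e"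
  and ga_mult: "[|g : car G; h : car G; e : topspace E|] ==> ga (g \<otimes> h) e = ga g (ga h e)"
  and p_ga: "[|g : car G; e : topspace E|] ==> p (ga g e) = p e"
  and fibre: "[|e : topspace E; e' : topspace E; p e = p e'|] ==> EX g:car G. e' = ga g e"
  and wander: "e : topspace E ==> EX V. openin E V & e : V & (ALL g:car G. ALL v:V. ga g v : V --> g = \<one>)"
begin

lemma ga_in: "g : car G ==> e : topspace E ==> ga g e : topspace E"
 using ga_cont[of g] by(simp add: continuous_map_def Pi_iff)

lemma ga_free: "[|g : car G; h : car G; e : topspace E; ga g e = ga h e|] ==> g = h"
proof -
 assume a: "g : car G" "h : car G" "e : topspace E" "ga g e = ga h e"
 obtain V where V: "e : V" "ALL g:car G. ALL v:V. ga g v : V --> g = \<one>" using wander[OF a(3)] by blast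
 have "ga (inv g \<otimes> h) e = ga (inv g) (ga g e)" using a by(simp add: ga_mult)
 also have "... = e" using a by(metis ga_mult ga_one inv_closed l_inv)
 finally have "inv g \<otimes> h = \<one>" using V a by(metis inv_closed m_closed)
 thus "g = h" using a by(metis inv_closed inv_equality inv_inv)
qed

lemma openin_ga: "g : car G ==> openin E V ==> openin E (ga g ` V)"
proof -
 assume g: "g : car G" and V: "openin E V"
 have "ga g ` V = {e : topspace E. ga (inv g) e : V}"
 proof(rule Set.set_eqI)
  fix e show "e : ga g ` V <-> e : {e : topspace E. ga (inv g) e : V}"
  proof
   assume "e : ga g ` V"
   then obtain v where v: "v : V" "e = ga g v" by auto
   have "v : topspace E" using V v openin_subset by blast
   thus "e : {e : topspace E. ga (inv g) e : V}"
    using v g ga_mult[of "inv g" g v] ga_one[of v] ga_in by simp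
  next
   assume e: "e : {e : topspace E. ga (inv g) e : V}"
   hence "ga g (ga (inv g) e) = e" using g ga_mult[of g "inv g" e] ga_one[of e] by simp
   thus "e : ga g ` V" using e by(metis (mono_tags, lifting) imageI mem_Collect_eq)
  qed
 qed
 thus ?thesis using ga_cont[of "inv g"] g V by(auto simp: continuous_map)
qed

text \<open>The set of agreement is open, since a wandering neighbourhood meets each fibre at most
  once. It is closed because where the lifts differ by a nontrivial \<open>g\<close>, one maps a
  neighbourhood into \<open>V\<close> and the other into the translate of \<open>V\<close> by
  \<open>g\<close>.\<close>

lemma lift_unique:
 assumes C: "connected_space C" and u: "cmap C E u" and v: "cmap C E v"
  and eq: "!!c. c : topspace C ==> p (u c) = p (v c)"
  and c0: "c0 : topspace C" "u c0 = v c0" and c: "c : topspace C"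
 shows "u c = v c"
proof -
 let ?S = "{c : topspace C. u c = v c}"
 have in_E: "u c : topspace E" "v c : topspace E" if "c : topspace C" for c
  using u v that by(simp_all add: continuous_map_def Pi_iff)
 have S: "openin C ?S"
 proof(subst openin_subopen, intro ballI)
  fix c assume c: "c : ?S"
  hence cC: "c : topspace C" by simp
  obtain V where V: "openin E V" "u c : V" "ALL g:car G. ALL v:V. ga g v : V --> g = \<one>"
   using wander[OF in_E(1)[OF cC]] by metis
  define T where "T = {c : topspace C. u c : V} Int {c : topspace C. v c : V}"
  have "openin C T" unfolding T_def using u v V(1) by(intro openin_Int) (auto simp: continuous_map)
  moreover have "T <= ?S"
  proof
   fix c' assume "c' : T"
   hence c': "c' : topspace C" "u c' : V" "v c' : V" by(auto simp: T_def)
   obtain g where g: "g : car G" "v c' = ga g (u c')"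
    using fibre[OF in_E(1)[OF c'(1)] in_E(2)[OF c'(1)] eq[OF c'(1)]] by metis
   hence "g = \<one>" using V(3) c' by metis
   thus "c' : ?S" using g ga_one[OF in_E(1)[OF c'(1)]] c'(1) by simp
  qed
  moreover have "c : T" using c V(2) by(simp add: T_def)
  ultimately show "EX T. openin C T & c : T & T <= ?S" by blast
 qed
 have "openin C (topspace C - ?S)"
 proof(subst openin_subopen, intro ballI)
  fix c assume c: "c : topspace C - ?S"
  hence cC: "c : topspace C" by simp
  obtain V where V: "openin E V" "u c : V" "ALL g:car G. ALL v:V. ga g v : V --> g = \<one>"
   using wander[OF in_E(1)[OF cC]] by metis
  obtain g where g: "g : car G" "v c = ga g (u c)"
   using fibre[OF in_E(1)[OF cC] in_E(2)[OF cC] eq[OF cC]] by metis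
  hence "g ~= \<one>" using c ga_one[OF in_E(1)[OF cC]] by auto
  define T where "T = {c : topspace C. u c : V} Int {c : topspace C. v c : ga g ` V}"
  have "openin C T" unfolding T_def using u v V(1) openin_ga[OF g(1) V(1)]
   by(intro openin_Int) (auto simp: continuous_map)
  moreover have "T <= topspace C - ?S"
  proof
   fix c' assume "c' : T"
   then obtain w where w: "c' : topspace C" "u c' : V" "w : V" "v c' = ga g w" by(auto simp: T_def)
   hence "u c' ~= v c'" using V(3) \<open>g ~= \<one>\<close> g(1) by metis
   thus "c' : topspace C - ?S" using w(1) by simp
  qed
  moreover have "c : T" using cC V(2) g(2) by(simp add: T_def)
  ultimately show "EX T. openin C T & c : T & T <= topspace C - ?S" by blast
 qed
 hence "closedin C ?S" using S by(auto simp: closedin_def)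
 hence "?S = topspace C" using C S c0 by(auto simp: connected_space_clopen_in)
 thus ?thesis using c by auto
qed

text \<open>On a wandering open set the open map \<open>p\<close> is injective, hence a
  homeomorphism onto its image.\<close>

lemma local_section:
 assumes "b : topspace B"
 obtains W V s where "openin B W" "b : W" "openin E V" "p ` V = W"
  "cmap (subtopology B W) E s" "!!w. w : W ==> s w : V & p (s w) = w" "!!v. v : V ==> s (p v) = v"
proof -
 obtain e where e: "e : topspace E" "p e = b" using p_surj assms by(metis imageE)
 then obtain V where V: "openin E V" "e : V" "ALL g:car G. ALL v:V. ga g v : V --> g = \<one>"
  using wander[OF e(1)] by auto
 have VE: "V <= topspace E" using V openin_subset by blast
 have inj: "inj_on p V"
 proof(rule inj_onI)
  fix x y assume xy: "x : V" "y : V" "p x = p y"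
  then obtain g where "g : car G" "y = ga g x" using fibre[of x y] VE by auto
  thus "x = y" using V xy VE ga_one by(metis subsetD)
 qed
 define s where "s = inv_into V p"
 have W: "openin B (p ` V)" using p_open V(1) by(auto simp: open_map_def)
 have cs: "cmap (subtopology B (p ` V)) E s"
  unfolding continuous_map
 proof(intro conjI allI impI)
  show "s ` topspace (subtopology B (p ` V)) <= topspace E"
   using VE by(auto simp: s_def inv_into_f_f[OF inj])
  fix U assume U: "openin E U"
  have "{w : topspace (subtopology B (p ` V)). s w : U} = p ` (V Int U)"
   using W openin_subset[OF W] by(auto simp: s_def inv_into_f_f[OF inj] image_iff)
  moreover have "openin B (p ` (V Int U))" using p_open V(1) U by(auto simp: open_map_def openin_Int)
  ultimately show "openin (subtopology B (p ` V)) {w : topspace (subtopology B (p ` V)). s w : U}"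
   by(simp add: openin_open_subtopology W image_mono)
 qed
 show ?thesis
  by(rule that[OF W _ V(1) refl cs]) (use e V(2) in "auto simp: s_def inv_into_f_f[OF inj]")
qed

lemma lift_segment:
 fixes S :: "'c::topological_space set" and T :: "'d::topological_space set"
 assumes vp: "cmap (tset S) E vp" and vq: "cmap (tset T) E vq"
  and "con {0..1} gm" "con {0..1} dl"
  and "!!t. t : {0..1::real} ==> gm t : S & dl t : T & p (vp (gm t)) = p (vq (dl t))" "vp (gm 0) = vq (dl 0)"
 shows "vp (gm 1) = vq (dl 1)"
proof -
 have "(vp o gm) 1 = (vq o dl) 1"
 proof(rule lift_unique[of "tset {0..1::real}" "vp o gm" "vq o dl" 0])
  have "cmap (tset {0..1}) (tset S) gm" "cmap (tset {0..1}) (tset T) dl"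
   using assms(3-5) by auto
  thus "cmap (tset {0..1}) E (vp o gm)" "cmap (tset {0..1}) E (vq o dl)"
   using continuous_map_compose vp vq by blast+
  show "connected_space (tset {0..1::real})" by(metis connected_Icc connectedin_iff_connected connectedin_def)
 qed (use assms(5,6) in auto)
 thus ?thesis by simp
qed

definition lifts :: "('c::topological_space => 'b) => 'c set => bool" where
 "lifts f S <-> (EX vp. cmap (tset S) E vp & (ALL s:S. p (vp s) = f s))"

lemma lifts_subset: "lifts f T ==> S <= T ==> lifts f S"
 unfolding lifts_def by(meson continuous_map_from_subtopology_mono subsetD)

text \<open>At one common point the two lifts differ by a deck transformation, hence by the same one
  on the whole connected intersection; translating one lift makes them fit together.\<close>

lemma lifts_Un:
 assumes "closed S" "closed T" "connected (S Int T)" "lifts f S" "lifts f T"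
 shows "lifts f (S Un T)"
proof -
 obtain u where u: "cmap (tset S) E u" "!!s. s : S ==> p (u s) = f s" using assms(4) by(auto simp: lifts_def)
 obtain v where v: "cmap (tset T) E v" "!!s. s : T ==> p (v s) = f s" using assms(5) by(auto simp: lifts_def)
 have uE: "u s : topspace E" if "s : S" for s using u(1) that by(auto simp: continuous_map_def)
 have vE: "v s : topspace E" if "s : T" for s using v(1) that by(auto simp: continuous_map_def)
 have "EX g:car G. ALL s:S Int T. u s = ga g (v s)"
 proof(cases "S Int T = {}")
  case False
  then obtain c where c: "c : S" "c : T" by blast
  obtain g where g: "g : car G" "u c = ga g (v c)" using fibre[OF vE[OF c(2)] uE[OF c(1)]] u(2) v(2) c by auto
  have "u s = (ga g o v) s" if s: "s : S Int T" for s
  proof(rule lift_unique[of "tset (S Int T)" u "ga g o v" c])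
   show "connected_space (tset (S Int T))" using assms(3) by(metis connectedin_iff_connected connectedin_def)
   show "cmap (tset (S Int T)) E u" "cmap (tset (S Int T)) E (ga g o v)"
    using continuous_map_from_subtopology_mono[OF u(1)] continuous_map_from_subtopology_mono[OF v(1)]
     continuous_map_compose[OF _ ga_cont[OF g(1)]] by(meson inf_le1 inf_le2)+
  qed (use g c s u v p_ga vE in auto)
  thus ?thesis using g(1) by auto
 qed auto
 then obtain g where g: "g : car G" "!!s. s : S Int T ==> u s = ga g (v s)" by blast
 have "cmap (tset (S Un T)) E (%s. if s : S then u s else (ga g o v) s)"
 proof(rule continuous_map_two_pieces[where T = T])
  show "closedin (tset (S Un T)) S" "closedin (tset (S Un T)) T" using assms(1,2) by(auto intro: closed_subset)
  have "subtopology (tset (S Un T)) S = tset S" "subtopology (tset (S Un T)) T = tset T"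
   by(simp_all add: subtopology_subtopology Int_absorb1)
  thus "cmap (subtopology (tset (S Un T)) S) E u"
   "cmap (subtopology (tset (S Un T)) T) E (ga g o v)"
   using u(1) continuous_map_compose[OF v(1) ga_cont[OF g(1)]] by simp_all
 qed (use g in auto)
 thus ?thesis
  unfolding lifts_def using u(2) v(2) p_ga[OF g(1)] vE by(intro exI conjI) auto
qed

end

section \<open>Lifting and filling maps of cubes\<close>

definition cb :: "nat => rseq set" where
 "cb n = {s. (ALL i>=n. s i = 0) & (ALL i<n. 0 <= s i & s i <= 1)}"

lemma cube_eq: "cube n = tset (cb n)"
proof -
 have "{x. ALL i>=n. x i = 0} Int {s. ALL i<n. 0 <= s i & s i <= 1} = cb n"
  unfolding cb_def by blast
 thus ?thesis
  by(simp only: cube_def Euclidean_space_top_of_set subtopology_subtopology)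
qed

definition cbd :: "nat => rseq set" where
 "cbd n = {s : cb n. EX i<n. s i = 0 | s i = 1}"

lemma cube_boundary_eq: "cube_boundary n = cbd n"
 by(simp only: cube_boundary_def cbd_def cube_eq topspace_euclidean_subtopology)

lemma zero_in_cb: "(%_. 0) : cb n"
 by(simp add: cb_def)

lemma scal_in_cb: "s : cb n ==> t : {0..1} ==> scal t s : cb n"
 by(auto simp: cb_def scal_def mult_le_one)

lemma continuous_on_coord:
 fixes f :: "'a::topological_space => 'i => real"
 assumes "con A f"
 shows "con A (%x. f x i)"
 by(rule continuous_on_product_then_coordinatewise[OF assms])

lemma continuous_on_Max_image:
 fixes h :: "'j => 'a::topological_space => real"
 assumes "finite K" "K ~= {}" "!!j. j : K ==> con A (h j)"
 shows "con A (%x. Max ((%j. h j x) ` K))"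
 using assms by(induction K rule: finite_ne_induct) (auto intro!: continuous_intros)

lemma connected_box: "(!!i. connected (J i)) ==> connected {s::nat => real. ALL i. s i : J i}"
 using connectedin_PiE[of "%_. euclidean" UNIV J]
 by(simp add: euclidean_product_topology connectedin_iff_connected PiE_UNIV_domain Pi_def)

lemma closed_box:
 assumes "!!i. closed (J i)"
 shows "closed {s::nat => real. ALL i. s i : J i}"
proof -
 have "closed {s::nat => real. s i : J i}" for i
  using closed_vimage[OF assms continuous_on_coord[OF continuous_on_id, of UNIV i]] by(simp add: vimage_def)
 thus ?thesis unfolding Collect_all_eq by blast
qed

context principal_cover begin

lemma lifts_cube_local:
 assumes f: "cmap (tset (cb n)) B f" and y: "y : cb n"
 shows "EX d>0. lifts f {s : cb n. ALL i<n. \<bar>s i - y i\<bar> <= d}"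
proof -
 have "f y : topspace B" using f y by(auto simp: continuous_map_def)
 then obtain W V s where W: "openin B W" "f y : W" "openin E V" "p ` V = W"
   "cmap (subtopology B W) E s" "!!w. w : W ==> s w : V & p (s w) = w"
  using local_section by metis
 have "openin (tset (cb n)) {s : cb n. f s : W}" using f W(1) by(auto simp: continuous_map)
 then obtain U where U: "open U" "{s : cb n. f s : W} = cb n Int U" by(auto simp: openin_open)
 have yU: "y : U" "openin (product_topology (%_. euclidean) UNIV) U" using U W(2) y by(auto simp: open_fun_def)
 obtain X where X: "y : (\<Pi>\<^sub>E i\<in>UNIV. X i)" "!!i. open (X i)" "(\<Pi>\<^sub>E i\<in>UNIV. X i) <= U"
  using product_topology_open_contains_basis[OF yU(2,1)] by auto
 have "EX d>0. ALL i<m. cball (y i) d <= X i" for m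
 proof(induction m)
  case (Suc m)
  then obtain d where d: "d > 0" "ALL i<m. cball (y i) d <= X i" by blast
  obtain e where e: "e > 0" "cball (y m) e <= X m" using X(1,2) open_contains_cball by(metis PiE_mem UNIV_I)
  have "cball (y i) (min d e) <= X i" if "i < Suc m" for i using that d(2) e(2) by(auto simp: less_Suc_eq subset_iff)
  thus ?case using d(1) e(1) by(intro exI[of _ "min d e"]) auto
 qed (auto intro: exI[of _ 1])
 then obtain d where d: "d > 0" "ALL i<n. cball (y i) d <= X i" by blast
 let ?S = "{s : cb n. ALL i<n. \<bar>s i - y i\<bar> <= d}"
 have "t i : X i" if "t : ?S" for t i
 proof(cases "i < n")
  case True
  hence "t i : cball (y i) d" using that by(auto simp: dist_real_def)
  thus ?thesis using d True by blast
 next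
  case False
  hence "t i = y i" using that y by(simp add: cb_def)
  thus ?thesis using X(1) by auto
 qed
 hence "?S <= cb n Int U" using X(3) by(auto simp: PiE_UNIV_domain Pi_def)
 hence "f ` ?S <= W" "cmap (tset ?S) B f"
  using U(2) continuous_map_from_subtopology_mono[OF f] by auto
 hence "cmap (tset ?S) E (s o f)"
  by(intro continuous_map_compose[OF _ W(5)]) (auto simp: continuous_map_in_subtopology)
 hence "lifts f ?S" unfolding lifts_def using W(6) \<open>f ` ?S \<subseteq> W\<close> by(intro exI[of _ "s o f"]) auto
 thus ?thesis using d(1) by blast
qed

text \<open>The first \<open>k\<close> coordinates are unrestricted; Bolzano's bisection frees one more at each step.\<close>

lemma lifts_cube_slab:
 assumes f: "cmap (tset (cb n)) B f"
 shows "k <= n ==> y : cb n ==> EX d>0. lifts f {s : cb n. ALL i<n. k <= i --> \<bar>s i - y i\<bar> <= d}"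
proof(induction k arbitrary: y)
 case 0
 thus ?case using lifts_cube_local[OF f] by simp
next
 case (Suc k)
 define S where "S a b d = {s : cb n. a <= s k & s k <= b & (ALL i<n. Suc k <= i --> \<bar>s i - y i\<bar> <= d)}" for a b d
 define J where "J a b d i = (if i = k then {0..1} Int {a..b} else if i < k then {0..1}
  else if i < n then {0..1} Int {y i - d..y i + d} else {0})" for a b d i
 have SJ: "S a b d = {s. ALL i. s i : J a b d i}" for a b d
  using Suc.prems(1) by(auto simp: S_def J_def cb_def abs_le_iff not_less Suc_le_eq split: if_splits)
 have cn: "connected (S a b d)" and cl: "closed (S a b d)" for a b d
  unfolding SJ by(rule connected_box closed_box; simp add: J_def)+
 have "EX d>0. lifts f (S 0 1 d)"
 proof(rule Bolzano[of 0 1 "%a b. EX d>0. lifts f (S a b d)"])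
  fix a b c assume "EX d>0. lifts f (S a b d)" "EX d>0. lifts f (S b c d)" and abc: "a <= b" "b <= c"
  then obtain d d' where d: "d > 0" "d' > 0" "lifts f (S a b d)" "lifts f (S b c d')" by blast
  let ?d = "min d d'"
  have "S a b ?d <= S a b d" "S b c ?d <= S b c d'" by(auto simp: S_def)
  moreover have "S a b ?d Int S b c ?d = S b b ?d" "S a b ?d Un S b c ?d = S a c ?d" using abc by(auto simp: S_def)
  ultimately have "lifts f (S a c ?d)" using lifts_Un[OF cl cl _ lifts_subset[OF d(3)] lifts_subset[OF d(4)]] cn by metis
  thus "EX d>0. lifts f (S a c d)" using d(1,2) by(intro exI[of _ ?d]) simp
 next
  fix x :: real assume x: "0 <= x" "x <= 1"
  have "y(k := x) : cb n" using Suc.prems x by(auto simp: cb_def)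
  then obtain d where d: "d > 0" "lifts f {s : cb n. ALL i<n. k <= i --> \<bar>s i - (y(k := x)) i\<bar> <= d}"
   using Suc.IH Suc.prems(1) Suc_leD by blast
  have "lifts f (S a b d)" if "a <= x" "x <= b" "b - a < d" for a b
   by(rule lifts_subset[OF d(2)]) (use that in "auto simp: S_def abs_le_iff Suc_le_eq")
  thus "EX d>0. ALL a b. a <= x & x <= b & b - a < d --> (EX d>0. lifts f (S a b d))" using d(1) by blast
 qed simp
 thus ?case
 proof(elim exE conjE)
  fix d assume d: "d > 0" "lifts f (S 0 1 d)"
  have "S 0 1 d = {s : cb n. ALL i<n. Suc k <= i --> \<bar>s i - y i\<bar> <= d}" using Suc.prems(1) by(auto simp: S_def cb_def)
  thus ?thesis using d by(intro exI[of _ d]) simp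
 qed
qed

lemma cube_lift:
 assumes f: "cmap (tset (cb n)) B f" and e: "e : topspace E" "p e = f (%_. 0)"
 obtains vp where "cmap (tset (cb n)) E vp" "vp (%_. 0) = e" "!!s. s : cb n ==> p (vp s) = f s"
proof -
 obtain vp where vp: "cmap (tset (cb n)) E vp" "!!s. s : cb n ==> p (vp s) = f s"
  using lifts_cube_slab[OF f order_refl zero_in_cb] by(auto simp: lifts_def)
 have vpE: "vp s : topspace E" if "s : cb n" for s using vp(1) that by(auto simp: continuous_map_def)
 then obtain g where g: "g : car G" "e = ga g (vp (%_. 0))"
  using fibre[of "vp (%_. 0)" e] e vp(2)[OF zero_in_cb] zero_in_cb by auto
 show ?thesis
  by(rule that[of "ga g o vp"]) (use continuous_map_compose[OF vp(1) ga_cont[OF g(1)]] g vp vpE p_ga in auto)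
qed

end

text \<open>The contraction is run to a depth that vanishes on the boundary, on a collar of which the map has
 first been made independent of the distance to the boundary.\<close>

lemma contractible_fill:
 assumes E: "contractible_space E"
  and f: "cmap (tset (cb n)) E f" and g: "cmap (tset (cb n)) E g"
  and fg: "!!s. s : cbd n ==> f s = g s"
 obtains K where "cmap (ptop (tset {0..1}) (tset (cb n))) E K"
  "!!s. s : cb n ==> K (0::real, s) = f s" "!!s. s : cb n ==> K (1, s) = g s"
  "!!t s. [|t : {0..1}; s : cbd n|] ==> K (t, s) : f ` cbd n"
proof -
 obtain a where "homotopic_with (%x. True) E E id (%x. a)"
  using E by(auto simp: contractible_space_def)
 then obtain C where C: "cmap (ptop (tset {0..1}) E) E C"
  "!!x. C (0, x) = x" "!!x. C (1::real, x) = a"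
  by(auto simp: homotopic_with_def)
 define X where "X = ({0..1::real} \<times> cb n)"
 define clip where "clip x = max 0 (min 1 x)" for x :: real
 \<comment> \<open>\<open>u\<close> is a tent over time, 0 at both ends and 1 in the middle.
   \<open>tu\<close> is the depth of the contraction; its product is 0 on the boundary and 1 on the
   concentric cube of half the side. \<open>sm\<close> stretches the cube about its centre by
   \<open>1 + u\<close>, at most 2, and clips, so that at time 1/2 everything outside that inner
   cube lands in the boundary.\<close>
 define u where "u q = 1 - \<bar>2 * fst q - 1\<bar>" for q :: "real * rseq"
 define tu where "tu q = min (u q) (PROD i<n. clip (2 - 2 * \<bar>2 * snd q i - 1\<bar>))" for q
 define sm where "sm q = (%i. if i < n then clip (1/2 + (1 + u q) * (snd q i - 1/2)) else 0)" for q
 have clip: "0 <= clip x" "clip x <= 1" for x by(auto simp: clip_def)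
 have clip_cont: "con A (%q. clip (h q))" if "con A h" for A and h :: "real * rseq => real"
  unfolding clip_def using that by(intro continuous_intros)
 note c = continuous_on_fst[OF continuous_on_id] continuous_on_coord[OF continuous_on_snd[OF continuous_on_id]]
 have uc: "con A u" for A unfolding u_def by(intro continuous_intros c)
 have tu: "cmap (tset X) (tset {0..1}) tu"
 proof -
  have "con X tu" unfolding tu_def by(intro continuous_intros clip_cont uc c)
  moreover have "tu q : {0..1}" if "q : X" for q
   using that clip by(auto simp: tu_def u_def X_def intro!: prod_nonneg)
  ultimately show ?thesis by auto
 qed
 have sm: "cmap (tset X) (tset (cb n)) sm"
 proof -
  have "con X (%q. sm q i)" for i
   unfolding sm_def by(cases "i < n") (auto intro!: continuous_intros clip_cont uc c)
  hence "con X sm" by(rule con_prod)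
  thus ?thesis using clip by(auto simp: sm_def cb_def)
 qed
 define K where "K h q = C (tu q, h (sm q))" for h q
 have K: "cmap (tset X) E (K h)" if h: "cmap (tset (cb n)) E h" for h
  using continuous_map_compose[OF continuous_map_pairedI[OF tu continuous_map_compose[OF sm h]] C(1)]
  unfolding K_def o_def .
 have smbd: "sm q : cbd n" if q: "q : X" and i: "i < n" "clip (1/2 + (1 + u q) * (snd q i - 1/2)) : {0, 1}" for q i
  using sm q i by(auto simp: cbd_def sm_def cb_def clip intro!: exI[of _ i])
 \<comment> \<open>At time 1/2 the two halves of the homotopy meet: over the inner cube the
   contraction is complete and the map is forgotten, elsewhere the argument lies in the boundary,
   where \<open>f\<close> and \<open>g\<close> coincide.\<close>
 have agree: "K f q = K g q" if q: "q : X" "fst q = 1/2" for q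
 proof -
  have u1: "u q = 1" using q by(simp add: u_def)
  show ?thesis
 proof(cases "ALL i<n. \<bar>2 * snd q i - 1\<bar> <= 1/2")
  case True
  hence "(PROD i<n. clip (2 - 2 * \<bar>2 * snd q i - 1\<bar>)) = 1" by(intro prod.neutral) (auto simp: clip_def)
  hence "tu q = 1" using q by(simp add: tu_def u_def)
  thus ?thesis by(simp add: K_def C)
 next
  case False
  then obtain i where i: "i < n" "\<bar>2 * snd q i - 1\<bar> > 1/2" by force
  hence "clip (1/2 + (1 + u q) * (snd q i - 1/2)) : {0, 1}" using u1 by(auto simp: clip_def max_def min_def abs_if split: if_splits)
  thus ?thesis using fg[OF smbd[OF q(1) i(1)]] by(simp add: K_def)
 qed
 qed
 define L where "L q = (if q : {q : X. fst q <= 1/2} then K f q else K g q)" for q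
 have ends: "K h (t, s) = h s" if "t = 0 | t = 1" "s : cb n" for h t s
 proof -
  have 1: "u (t, s) = 0" using that by(auto simp: u_def)
  hence "sm (t, s) = s" using that by(auto simp: sm_def clip_def cb_def fun_eq_iff)
  moreover have "tu (t, s) = 0" using 1 clip by(auto simp: tu_def min_def intro!: antisym prod_nonneg)
  ultimately show ?thesis by(simp add: K_def C)
 qed
 have bd: "K h (t, s) = h (sm (t, s)) & sm (t, s) : cbd n" if ts: "t : {0..1}" "s : cbd n" for h t s
 proof -
  obtain i where i: "i < n" "s i = 0 | s i = 1" using ts by(auto simp: cbd_def)
  have q: "(t, s) : X" "0 <= u (t, s)" using ts by(auto simp: X_def cbd_def u_def)
  have "clip (2 - 2 * \<bar>2 * s i - 1\<bar>) = 0" using i by(auto simp: clip_def)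
  hence "(PROD i<n. clip (2 - 2 * \<bar>2 * s i - 1\<bar>)) = 0" using i(1) by(simp add: prod_zero_iff) blast
  hence "tu (t, s) = 0" using q(2) by(simp only: tu_def snd_conv min_absorb2)
  moreover have "clip (1/2 + (1 + u (t, s)) * (s i - 1/2)) : {0, 1}" using i(2) q(2)
   by(auto simp: clip_def max_def min_def add_divide_distrib)
  ultimately show ?thesis using smbd[OF q(1) i(1)] by(simp add: K_def C)
 qed
 have "cmap (tset X) E L"
  unfolding L_def
 proof(rule continuous_map_two_pieces[where T = "{q : X. 1/2 <= fst q}"])
  have "closed {q::real * rseq. fst q <= 1/2}" "closed {q::real * rseq. 1/2 <= fst q}"
   by(intro closed_Collect_le continuous_intros)+
  thus "closedin (tset X) {q : X. fst q <= 1/2}" "closedin (tset X) {q : X. 1/2 <= fst q}"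
   by(auto simp: closedin_closed)
 qed (use agree K[OF f] K[OF g] in "auto intro: continuous_map_from_subtopology")
 thus ?thesis
  by(intro that[of L]) (use ends bd fg in "auto simp: L_def X_def cbd_def")
qed

section \<open>Homotopy groups of the base\<close>

lemma cube_homotopic_iff:
 "cube_homotopic n X x f g <->
   (EX K. cmap (ptop (tset {0..1}) (tset (cb n))) X K &
    (ALL s:cb n. K (0::real, s) = f s & K (1, s) = g s) & (ALL t:{0..1}. ALL s:cbd n. K (t, s) = x))"
 (is "?L <-> ?R")
proof
 assume ?L
 thus ?R
  unfolding cube_homotopic_def homotopic_with_def cube_eq cube_boundary_eq by(fastforce simp: image_subset_iff)
next
 assume ?R
 then obtain K where K: "cmap (ptop (tset {0..1}) (tset (cb n))) X K"
   "!!s. s : cb n ==> K (0::real, s) = f s" "!!s. s : cb n ==> K (1, s) = g s"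
   "!!t s. t : {0..1} ==> s : cbd n ==> K (t, s) = x" by blast
 \<comment> \<open>\<open>homotopic_with\<close> prescribes both ends for all arguments, also for
   those outside the cube, so \<open>K\<close> is replaced there.\<close>
 define h where "h = (%(t, s). if s : cb n then K (t, s) else if t = 0 then f s else g s)"
 have "cmap (ptop (tset {0..1}) (tset (cb n))) X h"
  by(rule continuous_map_eq[OF K(1)]) (auto simp: h_def)
 moreover have "h (0, s) = f s" "h (1, s) = g s" for s using K by(auto simp: h_def)
 moreover have "(%s. h (t, s)) ` cbd n <= {x}" if "t : {0..1}" for t
  using K(4)[OF that] by(auto simp: h_def cbd_def)
 ultimately show ?L unfolding cube_homotopic_def homotopic_with_def cube_eq cube_boundary_eq by blast
qed

lemma based_cubes_iff:
 "f : based_cubes n X x <-> cmap (tset (cb n)) X f & (ALL s:cbd n. f s = x)"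
 by(auto simp: based_cubes_def cube_eq cube_boundary_eq)

lemma cube_homotopic_refl: "f : based_cubes n X x ==> cube_homotopic n X x f f"
 by(auto simp: cube_homotopic_def based_cubes_def)

lemma cube_homotopic_sym: "cube_homotopic n X x f g ==> cube_homotopic n X x g f"
 unfolding cube_homotopic_def by(rule homotopic_with_symD)

lemma cube_homotopic_trans:
 "cube_homotopic n X x f g ==> cube_homotopic n X x g h ==> cube_homotopic n X x f h"
 unfolding cube_homotopic_def by(rule homotopic_with_trans)

lemma cube_homotopic_based:
 assumes "cube_homotopic n X x f g" shows "f : based_cubes n X x" "g : based_cubes n X x"
proof -
 have "cmap (cube n) X f & cmap (cube n) X g"
  using assms unfolding cube_homotopic_def by(rule homotopic_with_imp_continuous_maps)
 moreover have "f ` cube_boundary n <= {x} & g ` cube_boundary n <= {x}"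
  using assms unfolding cube_homotopic_def by(rule homotopic_with_imp_property)
 ultimately show "f : based_cubes n X x" "g : based_cubes n X x" by(simp_all add: based_cubes_def)
qed

definition one1 :: "nat => real" where
 "one1 = (%i. if i = 0 then 1 else 0)"

lemma cbd_1: "cbd 1 = {(%_. 0), one1}"
proof -
 have ge: "s i = 0" if "s : cb 1" "i ~= 0" for s i using that by(simp add: cb_def)
 have z: "s = (%_. 0)" if "s : cb 1" "s 0 = 0" for s
 proof
  fix i show "s i = 0" using ge[OF that(1), of i] that(2) by(cases "i = 0") auto
 qed
 have o: "s = one1" if "s : cb 1" "s 0 = 1" for s
 proof
  fix i show "s i = one1 i" using ge[OF that(1), of i] that(2) by(cases "i = 0") (auto simp: one1_def)
 qed
 have in1: "(%_. 0) : cb 1" "one1 : cb 1" by(auto simp: cb_def one1_def)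
 show ?thesis
 proof
  show "cbd 1 <= {(%_. 0), one1}"
  proof
   fix s assume "s : cbd 1"
   hence "s : cb 1" "s 0 = 0 | s 0 = 1" by(simp_all add: cbd_def)
   thus "s : {(%_. 0), one1}" using z[of s] o[of s] by blast
  qed
  have "(%_. 0) : cbd 1" "one1 : cbd 1" using in1 by(simp_all add: cbd_def one1_def)
  thus "{(%_. 0), one1} <= cbd 1" by blast
 qed
qed

lemma one1_in: "one1 : cb 1" "one1 : cbd 1" "(%_. 0) : cbd 1"
 unfolding cbd_1 by(simp_all add: cb_def one1_def)

locale contractible_cover = principal_cover +
 assumes contr: "contractible_space E" and nonempty: "topspace E ~= {}"
begin

text \<open>The filling in the contractible \<open>E\<close> may move boundary points, but only
  within the image of the boundary under the lift, and \<open>p\<close> collapses that image to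
  \<open>x\<close>.\<close>

lemma homotopic_of_lifts:
 assumes vp: "cmap (tset (cb n)) E vp" and vq: "cmap (tset (cb n)) E vq"
  and eq: "!!s. s : cbd n ==> vp s = vq s" "!!s. s : cbd n ==> p (vp s) = x"
  and f: "!!s. s : cb n ==> p (vp s) = f s" "!!s. s : cb n ==> p (vq s) = g s"
 shows "cube_homotopic n B x f g"
proof -
 obtain K where K: "cmap (ptop (tset {0..1}) (tset (cb n))) E K"
  "!!s. s : cb n ==> K (0::real, s) = vp s" "!!s. s : cb n ==> K (1, s) = vq s"
  "!!t s. [|t : {0..1}; s : cbd n|] ==> K (t, s) : vp ` cbd n"
  using contractible_fill[OF contr vp vq eq(1)] by metis
 have "cmap (ptop (tset {0..1}) (tset (cb n))) B (p o K)"
  by(rule continuous_map_compose[OF K(1) p_cont])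
 thus ?thesis unfolding cube_homotopic_iff
  using K(2-4) eq(2) f by(intro exI[of _ "p o K"]) fastforce
qed

lemma segment_const:
 assumes vp: "cmap (tset (cb n)) E vp"
  and seg: "con {0..1} gm" "!!t. t : {0..1::real} ==> gm t : cb n & p (vp (gm t)) = x"
 shows "vp (gm 1) = vp (gm 0)"
proof -
 have "vp (gm 0) : topspace E" using vp seg(2)[of 0] by(auto simp: continuous_map_def)
 thus ?thesis using lift_segment[OF vp _ seg(1) seg(1), of "cb n" "%_. vp (gm 0)"] seg(2) seg(2)[of 0] by simp
qed

text \<open>For \<open>n >= 2\<close> the boundary of the cube is connected, so a lift is constant
  on it and can be compared with a constant lift. Connectedness enters through explicit segments: a
  face with a zero coordinate shrinks to the origin, and on a face with a coordinate 1 another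
  coordinate is first slid to 0.\<close>

lemma higher_trivial:
 assumes n: "2 <= n" and x: "x : topspace B"
 shows "car (homotopy_group n B x) = {\<one>\<^bsub>homotopy_group n B x\<^esub>}"
proof -
 have null: "cube_homotopic n B x (%_. x) f" if f: "f : based_cubes n B x" for f
 proof -
  have z: "(%_. 0) : cbd n" using n by(auto simp: cbd_def cb_def intro!: exI[of _ 0])
  have f': "cmap (tset (cb n)) B f" "!!s. s : cbd n ==> f s = x"
   using f by(auto simp: based_cubes_iff)
  obtain e where e: "e : topspace E" "p e = x" using p_surj x by(metis imageE)
  obtain vp where vp: "cmap (tset (cb n)) E vp" "vp (%_. 0) = e" "!!s. s : cb n ==> p (vp s) = f s"
   using cube_lift[OF f'(1) e(1)] e(2) f'(2)[OF z] by metis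
  have cbd_cb: "s : cbd n ==> s : cb n" for s by(simp add: cbd_def)
  have zero_face: "vp s = e" if s: "s : cb n" "i < n" "s i = 0" for s i
  proof -
   have "scal t s : cbd n" if "t : {0..1}" for t
    using scal_in_cb[OF s(1) that] s by(auto simp: cbd_def scal_def intro!: exI[of _ i])
   hence "vp (scal 1 s) = vp (scal 0 s)"
    using vp(3) f'(2) cbd_cb
    by(intro segment_const[OF vp(1), of "%t. scal t s" x] continuous_on_scal) auto
   thus ?thesis using vp(2) by(simp add: scal_def)
  qed
  have "vp s = e" if s: "s : cbd n" for s
  proof -
   obtain i where i: "i < n" "s i = 0 | s i = 1" using s by(auto simp: cbd_def)
   show ?thesis
   proof(cases "s i = 0")
    case True thus ?thesis using zero_face s i by(auto simp: cbd_def)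
   next
    case False
    hence si: "s i = 1" using i by auto
    obtain j where j: "j < n" "j ~= i" using n by(metis One_nat_def Suc_1 Suc_le_lessD less_2_cases_iff lessI not_less_eq_eq order_less_le_trans zero_less_Suc)
    define gm where "gm = (%t::real. s(j := t * s j))"
    have g: "gm t : cbd n" if "t : {0..1}" for t
     using s si i j that by(auto simp: gm_def cbd_def cb_def mult_le_one intro!: exI[of _ i])
    have "con {0..1} gm" unfolding gm_def
    proof(rule con_prod)
     fix i show "con {0..1} (%t. (s(j := t * s j)) i)"
      by(cases "i = j") (simp_all add: continuous_on_mult_right)
    qed
    hence "vp (gm 1) = vp (gm 0)"
     using g vp(3) f'(2) cbd_cb by(intro segment_const[OF vp(1), of gm x]) auto
    moreover have "vp (gm 0) = e"
     using zero_face[of "gm 0" j] g[of 0] j cbd_cb by(auto simp: gm_def)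
    moreover have "gm 1 = s" by(auto simp: gm_def)
    ultimately show ?thesis by simp
   qed
  qed
  thus ?thesis
   using homotopic_of_lifts[of n "%_. e" vp x "%_. x" f] vp e by auto
 qed
 have const: "(%_. x) : based_cubes n B x" using x by(auto simp: based_cubes_iff)
 have cls: "{(f, g). cube_homotopic n B x f g} `` {f} = {h. cube_homotopic n B x (%_. x) h}"
  if "f : based_cubes n B x" for f
 proof -
  have "cube_homotopic n B x f h <-> cube_homotopic n B x (%_. x) h" for h
   using cube_homotopic_trans[OF null[OF that], of h]
    cube_homotopic_trans[OF cube_homotopic_sym[OF null[OF that]], of h] by metis
  thus ?thesis by simp
 qed
 have "based_cubes n B x // {(f, g). cube_homotopic n B x f g} = {{h. cube_homotopic n B x (%_. x) h}}"
 proof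
  show "based_cubes n B x // {(f, g). cube_homotopic n B x f g} <= {{h. cube_homotopic n B x (%_. x) h}}"
   using cls by(simp add: quotient_def UN_subset_iff)
  show "{{h. cube_homotopic n B x (%_. x) h}} <= based_cubes n B x // {(f, g). cube_homotopic n B x f g}"
   using quotientI[OF const, of "{(f, g). cube_homotopic n B x f g}"] unfolding cls[OF const] by simp
 qed
 thus ?thesis by(simp add: homotopy_group_def)
qed

end

section \<open>The fundamental group of the base\<close>

context contractible_cover begin

text \<open>The monodromy of the loop \<open>f\<close>, measured at the point \<open>e\<close> over
  its base point.\<close>

definition deg where
 "deg x e f g <-> g : car G & f : based_cubes 1 B x & (EX vp. cmap (tset (cb 1)) E vp & vp (%_. 0) = e &
   vp one1 = ga g e & (ALL s:cb 1. p (vp s) = f s))"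

lemma deg_exists:
 assumes e: "e : topspace E" "p e = x" and f: "f : based_cubes 1 B x"
 shows "EX g. deg x e f g"
proof -
 have f': "cmap (tset (cb 1)) B f" "!!s. s : cbd 1 ==> f s = x"
  using f by(auto simp: based_cubes_iff)
 obtain vp where vp: "cmap (tset (cb 1)) E vp" "vp (%_. 0) = e" "!!s. s : cb 1 ==> p (vp s) = f s"
  using cube_lift[OF f'(1) e(1)] e(2) f'(2)[OF one1_in(3)] by metis
 have "vp one1 : topspace E" using vp(1) one1_in by(auto simp: continuous_map_def)
 moreover have "p (vp one1) = x" using vp(3)[OF one1_in(1)] f'(2)[OF one1_in(2)] by simp
 ultimately obtain g where "g : car G" "vp one1 = ga g e"
  using fibre[OF e(1), of "vp one1"] e(2) by metis
 thus ?thesis using vp f unfolding deg_def by blast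
qed

lemma deg_homotopic:
 assumes e: "e : topspace E" "p e = x" and df: "deg x e f g" and df': "deg x e f' g'"
  and hom: "cube_homotopic 1 B x f f'"
 shows "g = g'"
proof -
 obtain vp where vp: "g : car G" "cmap (tset (cb 1)) E vp" "vp (%_. 0) = e"
   "vp one1 = ga g e" "!!s. s:cb 1 ==> p (vp s) = f s"
  using df by(auto simp: deg_def)
 obtain vp' where vp': "g' : car G" "cmap (tset (cb 1)) E vp'" "vp' (%_. 0) = e"
   "vp' one1 = ga g' e" "!!s. s:cb 1 ==> p (vp' s) = f' s"
  using df' by(auto simp: deg_def)
 obtain K where K: "cmap (ptop (tset {0..1}) (tset (cb 1))) B K"
   "!!s. s : cb 1 ==> K (0::real, s) = f s" "!!s. s : cb 1 ==> K (1, s) = f' s"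
   "!!t s. t : {0..1} ==> s : cbd 1 ==> K (t, s) = x"
  using hom unfolding cube_homotopic_iff by blast
 \<comment> \<open>The homotopy is read as a map \<open>h\<close> of the square, with the loop
   parameter as coordinate 0 and time as coordinate 1. By unique lifting its lift restricts to the
   given lifts on the two rows, and it is constant on the two columns, so both lifts end at the same
   point.\<close>
 define q where "q a b = (%i::nat. if i = 0 then a else if i = 1 then b else 0 :: real)" for a b
 define h where "h s = K (s 1, scal (s 0) one1)" for s :: "nat => real"
 have q: "q a b : cb 2" if "a : {0..1}" "b : {0..1}" for a b using that by(auto simp: q_def cb_def)
 have hq: "h (q a b) = K (b, scal a one1)" for a b by(simp add: h_def q_def)
 have cq: "con A (%a. q a b)" "con A (q a)" for A a b
 proof -
  have "con A (%a. q a b i)" "con A (%b. q a b i)" for i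
   unfolding q_def by(cases "i = 0"; cases "i = 1"; simp)+
  thus "con A (%a. q a b)" "con A (q a)" by(auto intro: con_prod)
 qed
 have one: "scal a one1 : cb 1" if "a : {0..1}" for a by(rule scal_in_cb[OF one1_in(1) that])
 have q00: "q 0 0 = (%_. 0)" by(auto simp: q_def)
 have "cmap (tset (cb 2)) (tset {0..1}) (%s. s 1)"
  by(auto simp: cb_def intro!: continuous_on_coord[OF continuous_on_id])
 moreover have "cmap (tset (cb 2)) (tset (cb 1)) (%s. scal (s 0) one1)"
  using one by(auto simp: cb_def intro!: continuous_on_scal continuous_on_coord[OF continuous_on_id])
 ultimately have "cmap (tset (cb 2)) B h"
  unfolding h_def using continuous_map_compose[OF continuous_map_pairedI K(1), unfolded o_def] by blast
 moreover have "p e = h (%_. 0)" using hq[of 0 0] K(4)[of 0 "%_. 0"] one1_in(3) e(2) unfolding q00 by(simp add: scal_def)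
 ultimately obtain F where F: "cmap (tset (cb 2)) E F" "F (%_. 0) = e" "!!s. s : cb 2 ==> p (F s) = h s"
  using cube_lift[OF _ e(1)] by metis
 have row: "F (q 1 b) = th one1"
  if th: "cmap (tset (cb 1)) E th" "!!s. s : cb 1 ==> p (th s) = K (b, s)" "F (q 0 b) = th (%_. 0)"
   and b: "b : {0..1}" for th b
  using lift_segment[OF F(1) th(1) cq(1), of "%a. scal a one1" b] one q[OF _ b] F(3) th(2,3) hq
   continuous_on_scal[OF continuous_on_id continuous_on_const]
  by(simp add: scal_def)
 have col: "F (q a 1) = F (q a 0)" if a: "a : {0, 1}" for a
 proof(rule segment_const[OF F(1) cq(2)])
  have "scal a one1 : cbd 1" using a one1_in by(auto simp: scal_def)
  thus "q a t : cb 2 & p (F (q a t)) = x" if "t : {0..1}" for t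
   using q[of a t] that a F(3) hq K(4)[OF that] by auto
 qed
 have "F (q 1 0) = vp one1" using row[OF vp(2)] vp(3,5) K(2) F(2) q00 by simp
 moreover have "F (q 1 1) = vp' one1" using row[OF vp'(2), of 1] vp'(3,5) K(3) F(2) q00 col[of 0] by simp
 ultimately have "ga g e = ga g' e" using col[of 1] vp(4) vp'(4) by simp
 thus ?thesis using ga_free vp(1) vp'(1) e(1) by blast
qed

lemma deg_same_homotopic:
 assumes e: "e : topspace E" "p e = x" and df: "deg x e f g" and df': "deg x e f' g"
 shows "cube_homotopic 1 B x f f'"
proof -
 obtain vp where vp: "cmap (tset (cb 1)) E vp" "vp (%_. 0) = e"
   "vp one1 = ga g e" "!!s. s:cb 1 ==> p (vp s) = f s"
  using df by(auto simp: deg_def)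
 obtain vp' where vp': "cmap (tset (cb 1)) E vp'" "vp' (%_. 0) = e"
   "vp' one1 = ga g e" "!!s. s:cb 1 ==> p (vp' s) = f' s"
  using df' by(auto simp: deg_def)
 have g: "g : car G" using df by(simp add: deg_def)
 show ?thesis
 proof(rule homotopic_of_lifts[OF vp(1) vp'(1)])
  show "vp s = vp' s" "p (vp s) = x" if "s : cbd 1" for s
   using that vp(2,3) vp'(2,3) e p_ga[OF g e(1)] unfolding cbd_1 by auto
 qed (use vp(4) vp'(4) in auto)
qed

lemma path_connected_E: "path_connected_space E"
 using contr contractible_imp_path_connected_space by blast

lemma path_E:
 assumes "a : topspace E" "b : topspace E"
 obtains vp where "cmap (tset (cb 1)) E vp" "vp (%_. 0) = a" "vp one1 = b"
proof -
 obtain gm where gm: "pathin E gm" "gm 0 = a" "gm 1 = b"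
  using path_connected_E assms by(auto simp: path_connected_space_def)
 have "cmap (tset (cb 1)) (tset {0..1}) (%s. s 0)"
  by(auto simp: cb_def intro!: continuous_on_coord[OF continuous_on_id])
 hence "cmap (tset (cb 1)) E (%s. gm (s 0))"
  using continuous_map_compose[of _ _ "%s. s 0" _ gm, unfolded o_def] gm(1) unfolding pathin_def by blast
 thus ?thesis using that gm(2,3) by(simp add: one1_def)
qed

lemma deg_surj:
 assumes e: "e : topspace E" "p e = x" and g: "g : car G"
 shows "EX f. deg x e f g"
proof -
 obtain vp where vp: "cmap (tset (cb 1)) E vp" "vp (%_. 0) = e" "vp one1 = ga g e"
  using path_E[OF e(1) ga_in[OF g e(1)]] .
 have "p o vp : based_cubes 1 B x"
  unfolding based_cubes_iff cbd_1 using continuous_map_compose[OF vp(1) p_cont] vp(2,3) e p_ga[OF g e(1)] by simp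
 thus ?thesis using vp g unfolding deg_def by(intro exI[of _ "p o vp"]) auto
qed

lemma continuous_map_cube_join:
 fixes vp vq :: "rseq => 'z"
 assumes "cmap (tset (cb 1)) Z vp" "cmap (tset (cb 1)) Z vq"
  and "vp one1 = vq (%_. 0)"
 shows "cmap (tset (cb 1)) Z (cube_join vp vq)"
proof -
 let ?S = "{s : cb 1. s 0 <= 1/2}" and ?T = "{s : cb 1. 1/2 <= s 0}"
 have eq: "cube_join vp vq s = (if s : ?S then vp (s(0 := 2 * s 0)) else vq (s(0 := 2 * s 0 - 1)))" if "s : cb 1" for s
  using that by(simp add: cube_join_def)
 have upd: "con A (%s::nat => real. s(0 := h s))" if "con A h" for A h
 proof(rule con_prod)
  fix i show "con A (%s. (s(0 := h s)) i)"
   using that continuous_on_coord[OF continuous_on_id, of A i] by(cases "i = 0") auto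
 qed
 have c0: "con A (%s::nat => real. 2 * s 0)" "con A (%s::nat => real. 2 * s 0 - 1)" for A
  by(intro continuous_on_mult continuous_on_diff continuous_on_const continuous_on_coord[OF continuous_on_id])+
 have "cmap (tset (cb 1)) Z (%s. if s : ?S then vp (s(0 := 2 * s 0)) else vq (s(0 := 2 * s 0 - 1)))"
 proof(rule continuous_map_two_pieces[where T = ?T])
  have "closed {s::nat => real. s 0 <= 1/2}" "closed {s::nat => real. 1/2 <= s 0}"
   by(intro closed_Collect_le continuous_on_const continuous_on_coord[OF continuous_on_id])+
  moreover have "?S = cb 1 Int {s. s 0 <= 1/2}" "?T = cb 1 Int {s. 1/2 <= s 0}" by auto
  ultimately show "closedin (tset (cb 1)) ?S" "closedin (tset (cb 1)) ?T"
   by(simp_all only: closedin_closed_Int)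
  show "topspace (tset (cb 1)) = ?S Un ?T" by auto
  have "cmap (tset ?S) (tset (cb 1)) (%s. s(0 := 2 * s 0))"
   using upd[OF c0(1)] by(auto simp: cb_def)
  moreover have "cmap (tset ?T) (tset (cb 1)) (%s. s(0 := 2 * s 0 - 1))"
   using upd[OF c0(2)] by(auto simp: cb_def)
  moreover have "subtopology (tset (cb 1)) ?S = tset ?S" "subtopology (tset (cb 1)) ?T = tset ?T"
   by(simp_all add: subtopology_subtopology Int_def conj_ac)
  ultimately show "cmap (subtopology (tset (cb 1)) ?S) Z (%s. vp (s(0 := 2 * s 0)))"
   "cmap (subtopology (tset (cb 1)) ?T) Z (%s. vq (s(0 := 2 * s 0 - 1)))"
   using continuous_map_compose[OF _ assms(1), unfolded o_def] continuous_map_compose[OF _ assms(2), unfolded o_def]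
   by(simp_all only:)
  fix s assume "s : ?S Int ?T"
  hence s: "s : cb 1" "s 0 = 1/2" by auto
  have "s(0 := 2 * s 0) = one1" "s(0 := 2 * s 0 - 1) = (%_. 0)"
   using s by(auto simp: cb_def one1_def fun_eq_iff)
  thus "vp (s(0 := 2 * s 0)) = vq (s(0 := 2 * s 0 - 1))" using assms(3) by simp
 qed
 thus ?thesis by(rule continuous_map_eq) (use eq in auto)
qed

lemma cube_join_in_cb:
 "s : cb 1 ==> s 0 <= 1/2 ==> s(0 := 2 * s 0) : cb 1"
 "s : cb 1 ==> ~ s 0 <= 1/2 ==> s(0 := 2 * s 0 - 1) : cb 1"
 by(auto simp: cb_def)

text \<open>The lift of a concatenation is the first lift followed by the translate of the second
  one by \<open>g\<close>, which ends at the translate of \<open>e\<close> by the product in this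
  order.\<close>

lemma deg_join:
 assumes e: "e : topspace E" "p e = x" and df: "deg x e f g" and df': "deg x e f' g'"
 shows "deg x e (cube_join f f') (g \<otimes> g')"
proof -
 obtain vp where vp: "g : car G" "cmap (tset (cb 1)) E vp" "vp (%_. 0) = e"
   "vp one1 = ga g e" "!!s. s:cb 1 ==> p (vp s) = f s"
  using df by(auto simp: deg_def)
 obtain vp' where vp': "g' : car G" "cmap (tset (cb 1)) E vp'" "vp' (%_. 0) = e"
   "vp' one1 = ga g' e" "!!s. s:cb 1 ==> p (vp' s) = f' s"
  using df' by(auto simp: deg_def)
 have f: "cmap (tset (cb 1)) B f" "f (%_. 0) = x" "f one1 = x"
  and f': "cmap (tset (cb 1)) B f'" "f' (%_. 0) = x" "f' one1 = x"
  using df df' unfolding deg_def based_cubes_iff cbd_1 by auto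
 define vq where "vq = cube_join vp (ga g o vp')"
 have ends: "cube_join u v (%_. 0) = u (%_. 0)" "cube_join u v one1 = v one1" for u v :: "rseq => 'z"
 proof -
  have "(%_::nat. 0::real)(0 := 2 * 0) = (%_. 0)" "one1(0 := 2 * 1 - 1) = one1" by(auto simp: one1_def fun_eq_iff)
  thus "cube_join u v (%_. 0) = u (%_. 0)" "cube_join u v one1 = v one1"
   by(simp_all add: cube_join_def one1_def)
 qed
 have "cmap (tset (cb 1)) E vq"
  unfolding vq_def using vp vp' continuous_map_compose[OF vp'(2) ga_cont[OF vp(1)]]
  by(intro continuous_map_cube_join) auto
 moreover have "vq (%_. 0) = e" "vq one1 = ga (g \<otimes> g') e"
  using ends[of vp "ga g o vp'"] vp vp' ga_mult[OF vp(1) vp'(1) e(1)] by(simp_all add: vq_def)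
 moreover have "p (vq s) = cube_join f f' s" if "s : cb 1" for s
 proof -
  have "vp' u : topspace E" if "u : cb 1" for u using vp'(2) that by(auto simp: continuous_map_def)
  thus ?thesis
   using cube_join_in_cb[OF that] vp(5) vp'(5) p_ga[OF vp(1)] by(simp add: vq_def cube_join_def)
 qed
 moreover have "cube_join f f' : based_cubes 1 B x"
  unfolding based_cubes_iff cbd_1 using continuous_map_cube_join[OF f(1) f'(1)] f f' ends[of f f'] by auto
 ultimately show ?thesis using vp(1) vp'(1) unfolding deg_def by blast
qed

lemma fundamental_group_iso:
 assumes x: "x : topspace B"
 shows "homotopy_group 1 B x \<cong> G"
proof -
 obtain e where e: "e : topspace E" "p e = x" using p_surj x by(metis imageE)
 define R where "R = {(f, g). cube_homotopic 1 B x f g}"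
 have uniq: "g = g'" if "deg x e f g" "deg x e f g'" for f g g'
  by(rule deg_homotopic[OF e that]) (use that cube_homotopic_refl in "auto simp: deg_def")
 define Ps where "Ps = (%A. THE g. EX f:A. deg x e f g)"
 have val: "Ps (R `` {f}) = g" if d: "deg x e f g" for f g
  unfolding Ps_def
 proof(rule the_equality)
  have "f : based_cubes 1 B x" using d by(simp add: deg_def)
  thus "EX f:R `` {f}. deg x e f g" using d cube_homotopic_refl[of f 1 B x] by(auto simp: R_def)
  fix g' assume "EX f':R `` {f}. deg x e f' g'"
  then obtain f' where f': "cube_homotopic 1 B x f f'" "deg x e f' g'" by(auto simp: R_def)
  thus "g' = g" using deg_homotopic[OF e d f'(2) f'(1)] by simp
 qed
 have cls: "R `` {f} = R `` {f'}" if "cube_homotopic 1 B x f f'" for f f'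
 proof -
  have "cube_homotopic 1 B x f h <-> cube_homotopic 1 B x f' h" for h
   using cube_homotopic_trans[OF that, of h] cube_homotopic_trans[OF cube_homotopic_sym[OF that], of h] by metis
  thus ?thesis by(simp add: R_def)
 qed
 \<comment> \<open>The product in \<open>homotopy_group\<close> ranges over all representatives; it
   is a single class because the degree determines the class.\<close>
 have mult: "{h. EX f:R `` {f1}. EX g:R `` {f2}. cube_homotopic 1 B x (cube_join f g) h} = R `` {cube_join f1 f2}"
  if d: "deg x e f1 g1" "deg x e f2 g2" for f1 f2 g1 g2
 proof -
  have j: "cube_homotopic 1 B x (cube_join f1 f2) (cube_join f g)" if "f : R `` {f1}" "g : R `` {f2}" for f g
  proof -
   have f: "cube_homotopic 1 B x f1 f" "cube_homotopic 1 B x f2 g" using that by(auto simp: R_def)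
   obtain h1 h2 where h: "deg x e f h1" "deg x e g h2"
    using deg_exists[OF e] cube_homotopic_based(2) f by metis
   have "g1 = h1" "g2 = h2" using deg_homotopic[OF e] d h f by blast+
   hence h': "deg x e f g1" "deg x e g g2" using h by simp_all
   show ?thesis by(rule deg_same_homotopic[OF e deg_join[OF e d] deg_join[OF e h']])
  qed
  have self: "f1 : R `` {f1}" "f2 : R `` {f2}"
   using d cube_homotopic_refl[of f1 1 B x] cube_homotopic_refl[of f2 1 B x] by(simp_all add: R_def deg_def)
  show ?thesis
  proof(rule Set.set_eqI)
   fix h
   show "h : {h. EX f:R `` {f1}. EX g:R `` {f2}. cube_homotopic 1 B x (cube_join f g) h} <-> h : R `` {cube_join f1 f2}"
   proof
    assume "h : {h. EX f:R `` {f1}. EX g:R `` {f2}. cube_homotopic 1 B x (cube_join f g) h}"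
    then obtain f g where fg: "f : R `` {f1}" "g : R `` {f2}" "cube_homotopic 1 B x (cube_join f g) h"
     by blast
    show "h : R `` {cube_join f1 f2}"
     using cube_homotopic_trans[OF j[OF fg(1,2)] fg(3)] by(simp add: R_def)
   next
    assume "h : R `` {cube_join f1 f2}"
    hence "cube_homotopic 1 B x (cube_join f1 f2) h" by(simp add: R_def)
    thus "h : {h. EX f:R `` {f1}. EX g:R `` {f2}. cube_homotopic 1 B x (cube_join f g) h}"
     using self by blast
   qed
  qed
 qed
 have car: "car (homotopy_group 1 B x) = based_cubes 1 B x // R"
  by(simp add: homotopy_group_def R_def)
 have rep: "EX f g. A = R `` {f} & deg x e f g" if "A : based_cubes 1 B x // R" for A
  using that deg_exists[OF e] by(auto simp: quotient_def)
 have "Ps : iso (homotopy_group 1 B x) G"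
  unfolding iso_def hom_def
 proof(intro CollectI conjI ballI Pi_I)
  fix A assume A: "A : car (homotopy_group 1 B x)"
  then obtain f g where fg: "A = R `` {f}" "deg x e f g" using rep unfolding car by blast
  show "Ps A : car G" using val[OF fg(2)] fg by(simp add: deg_def)
  fix A' assume "A' : car (homotopy_group 1 B x)"
  then obtain f' g' where fg': "A' = R `` {f'}" "deg x e f' g'" using rep unfolding car by blast
  have "A \<otimes>\<^bsub>homotopy_group 1 B x\<^esub> A' = R `` {cube_join f f'}"
   unfolding fg fg' mult[OF fg(2) fg'(2), symmetric] by(simp add: homotopy_group_def)
  thus "Ps (A \<otimes>\<^bsub>homotopy_group 1 B x\<^esub> A') = Ps A \<otimes> Ps A'"
   using val[OF deg_join[OF e fg(2) fg'(2)]] val[OF fg(2)] val[OF fg'(2)] fg fg' by simp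
 next
  show "bij_betw Ps (car (homotopy_group 1 B x)) (car G)"
   unfolding bij_betw_def
  proof
   show "inj_on Ps (car (homotopy_group 1 B x))"
   proof(rule inj_onI)
    fix A A' assume A: "A : car (homotopy_group 1 B x)" "A' : car (homotopy_group 1 B x)" "Ps A = Ps A'"
    obtain f g where fg: "A = R `` {f}" "deg x e f g" using rep A unfolding car by blast
    obtain f' g' where fg': "A' = R `` {f'}" "deg x e f' g'" using rep A unfolding car by blast
    have "g = g'" using A(3) val[OF fg(2)] val[OF fg'(2)] fg fg' by simp
    thus "A = A'" using cls deg_same_homotopic[OF e fg(2)] fg fg' by blast
   qed
   show "Ps ` car (homotopy_group 1 B x) = car G"
   proof
    show "Ps ` car (homotopy_group 1 B x) <= car G"
     using rep val unfolding car deg_def by blast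
    show "car G <= Ps ` car (homotopy_group 1 B x)"
    proof
     fix g assume "g : car G"
     then obtain f where f: "deg x e f g" using deg_surj[OF e] by blast
     hence "R `` {f} : car (homotopy_group 1 B x)"
      unfolding car by(auto simp: deg_def intro: quotientI)
     thus "g : Ps ` car (homotopy_group 1 B x)" using val[OF f] by blast
    qed
   qed
  qed
 qed
 thus ?thesis unfolding is_iso_def by blast
qed

theorem Eilenberg_MacLane_base: "Eilenberg_MacLane_1 G B"
 unfolding Eilenberg_MacLane_1_def
proof(intro conjI ballI allI impI)
 show "topspace B ~= {}" using nonempty p_surj by auto
 have "path_connectedin B (p ` topspace E)"
  by(rule path_connectedin_continuous_map_image[OF p_cont]) (simp add: path_connectedin_topspace path_connected_E)
 thus "path_connected_space B" by(simp add: p_surj path_connectedin_topspace)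
qed (use fundamental_group_iso higher_trivial in auto)

end

section \<open>Free cellular actions\<close>

locale free_action = group G
 for G :: "('g, 'm) monoid_scheme" (structure) +
 fixes C :: "'c set" and act :: "'g => 'c => 'c"
 assumes act_in: "[|g : car G; c : C|] ==> act g c : C"
  and act_one: "c : C ==> act \<one> c = c"
  and act_mult: "[|g : car G; h : car G; c : C|] ==> act (g \<otimes> h) c = act g (act h c)"
  and act_free: "[|g : car G; c : C; act g c = c|] ==> g = \<one>"
begin

lemma act_inv: "[|g : car G; c : C|] ==> act (inv g) (act g c) = c"
 "[|g : car G; c : C|] ==> act g (act (inv g) c) = c"
 by(simp_all add: act_mult[symmetric] act_one)

text \<open>The predicate under \<open>SOME\<close> is the same for all members of an orbit, so one
  representative is picked for each orbit.\<close>

definition orb :: "'c => 'c" where "orb c = (SOME r. r : C & (EX g:car G. r = act g c))"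
definition mv :: "'c => 'g" where "mv c = (SOME g. g : car G & c = act g (orb c))"

lemma orb_ex: "c : C ==> orb c : C & (EX g:car G. orb c = act g c)"
 unfolding orb_def by(rule someI[where x = c]) (metis act_one one_closed)

lemma orb_in: "c : C ==> orb c : C"
 using orb_ex by blast

lemma mv: "c : C ==> mv c : car G & act (mv c) (orb c) = c"
proof -
 assume c: "c : C"
 obtain g where g: "g : car G" "orb c = act g c" using orb_ex[OF c] by blast
 have "inv g : car G & c = act (inv g) (orb c)" using g act_inv[OF g(1) c] by simp
 hence "mv c : car G & c = act (mv c) (orb c)" unfolding mv_def by(rule someI)
 thus ?thesis by simp
qed

lemma orb_act: "[|g : car G; c : C|] ==> orb (act g c) = orb c"
proof -
 assume g: "g : car G" "c : C"
 have "(EX h:car G. r = act h (act g c)) <-> (EX h:car G. r = act h c)" for r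
 proof
  assume "EX h:car G. r = act h (act g c)"
  then obtain h where "h : car G" "r = act h (act g c)" by blast
  thus "EX h:car G. r = act h c" using g by(intro bexI[of _ "h \<otimes> g"]) (simp_all add: act_mult)
 next
  assume "EX h:car G. r = act h c"
  then obtain h where "h : car G" "r = act h c" by blast
  thus "EX h:car G. r = act h (act g c)"
   using g by(intro bexI[of _ "h \<otimes> inv g"]) (simp_all add: act_mult act_in act_inv)
 qed
 thus ?thesis by(simp add: orb_def)
qed

lemma act_eq_act: "[|g : car G; h : car G; c : C; act g c = act h c|] ==> g = h"
proof -
 assume a: "g : car G" "h : car G" "c : C" "act g c = act h c"
 have "act (inv h \<otimes> g) c = c" using a act_inv by(simp add: act_mult)
 hence "inv h \<otimes> g = \<one>" using a act_free by simp
 thus ?thesis using a by(metis inv_closed inv_equality inv_inv)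
qed

lemma mv_act: "[|g : car G; c : C|] ==> mv (act g c) = g \<otimes> mv c"
 using mv[of c] mv[of "act g c"] act_in[of g c] orb_act[of g c] orb_in[of c] act_mult[of g "mv c" "orb c"]
 by(intro act_eq_act[of _ _ "orb c"]) simp_all

end

locale equiv_cells = free_action G I act + cell_data I d att
 for G :: "('g, 'm) monoid_scheme" (structure) and I :: "'i set" and d att and act :: "'g => 'i => 'i" +
 assumes d_act: "[|g : car G; i : I|] ==> d (act g i) = d i"
  and att_act: "[|g : car G; i : I; x : sph (d i)|] ==>
     att (act g i) x = (act g (fst (att i x)), snd (att i x))"
  and orbits_finite: "EX F. finite F & {i : I. d i = n} <= (UN g:car G. act g ` (F Int I))"
  and contr_sp: "contractible_space sp" and I_nonempty: "I ~= {}"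
begin

lemma d_orb: "i : I ==> d (orb i) = d i"
 using orb_ex d_act by metis

lemma orb_orb: "i : I ==> orb (orb i) = orb i"
 using orb_ex orb_act by metis

text \<open>The cells in \<open>type_F_infinity\<close> are natural numbers, so orbit
  representatives are numbered; they are countable, being finitely many in each dimension.\<close>

definition ix :: "'i => nat" where "ix = to_nat_on (orb ` I)"
definition Ix :: "nat set" where "Ix = ix ` orb ` I"
definition rep :: "nat => 'i" where "rep = inv_into (orb ` I) ix"
definition oi :: "'i => nat" where "oi i = ix (orb i)"

lemma finite_reps: "finite {r : orb ` I. d r = n}"
proof -
 obtain F where F: "finite F" "{i : I. d i = n} <= (UN g:car G. act g ` (F Int I))"
  using orbits_finite[of n] by(elim exE conjE)
 have "{r : orb ` I. d r = n} <= orb ` F"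
 proof
  fix r assume r: "r : {r : orb ` I. d r = n}"
  then obtain i where i: "i : I" "r = orb i" "d i = n" using d_orb by(auto simp del: ex_simps)
  then obtain g j where "g : car G" "j : F" "j : I" "i = act g j" using subsetD[OF F(2), of i] by auto
  thus "r : orb ` F" using orb_act[of g j] i by(intro image_eqI[of _ _ j]) simp_all
 qed
 thus ?thesis using F(1) finite_surj by blast
qed

lemma inj_ix: "inj_on ix (orb ` I)"
proof -
 have "orb ` I = (UN n. {r : orb ` I. d r = n})" by auto
 hence "countable (orb ` I)"
  using finite_reps by(metis (mono_tags, lifting) countable_UN countable_finite countableI_type)
 thus ?thesis unfolding ix_def by(rule inj_on_to_nat_on)
qed

lemma rep_ix: "i : I ==> rep (oi i) = orb i"
 by(simp add: rep_def oi_def inv_into_f_f[OF inj_ix])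

lemma oi_in: "i : I ==> oi i : Ix"
 by(simp add: oi_def Ix_def)

lemma Ix_rep: "k : Ix ==> rep k : I" "k : Ix ==> oi (rep k) = k" "k : Ix ==> orb (rep k) = rep k"
 using rep_ix orb_in orb_orb by(auto simp: Ix_def oi_def[symmetric]) (simp_all add: oi_def orb_orb)

lemma oi_act: "[|g : car G; i : I|] ==> oi (act g i) = oi i"
 by(simp add: oi_def orb_act)

lemma oi_eq: "[|i : I; j : I; oi i = oi j|] ==> EX g:car G. j = act g i"
proof -
 assume ij: "i : I" "j : I" "oi i = oi j"
 hence e: "orb i = orb j" using rep_ix by metis
 obtain g h where g: "g : car G" "orb i = act g i" "h : car G" "orb j = act h j"
  using orb_ex ij by metis
 have "j = act (inv h) (act g i)" using g e ij act_inv(1) by metis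
 thus ?thesis using g ij by(intro bexI[of _ "inv h \<otimes> g"]) (simp_all add: act_mult)
qed

lemma rep_oi: "i : I ==> EX g:car G. i = act g (rep (oi i))"
 using oi_eq[OF Ix_rep(1)[OF oi_in]] Ix_rep(2)[OF oi_in] by metis

definition dY :: "nat => nat" where "dY k = d (rep k)"
definition pr :: "'i * rseq => nat * rseq" where "pr q = (oi (fst q), snd q)"
definition attY :: "nat => rseq => nat * rseq" where "attY k x = pr (att (rep k) x)"
definition gact :: "'g => 'i * rseq => 'i * rseq" where "gact g q = (act g (fst q), snd q)"

lemma dY_oi: "i : I ==> dY (oi i) = d i"
 by(simp add: dY_def rep_ix d_orb)

lemma chr_act: "[|g : car G; i : I; x : dsk (d i)|] ==> chr (act g i) x = gact g (chr i x)"
 using att_act[of g i x] dsk_split[of "d i"] by(auto simp: chr_def d_act gact_def)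

lemma pr_gact: "[|g : car G; q : pts|] ==> pr (gact g q) = pr q"
 by(auto simp: pr_def gact_def pts_def oi_act)

text \<open>A cell of the quotient is attached by the map of the chosen representative. Equivariance
  of \<open>att\<close> shows that any other cell of the orbit gives the same map after
  projection.\<close>

lemma pr_chr:
 assumes "i : I" "x : dsk (d i)"
 shows "(if x : idk (dY (oi i)) then (oi i, x) else attY (oi i) x) = pr (chr i x)"
proof -
 obtain g where g: "g : car G" "i = act g (rep (oi i))" using rep_oi assms by blast
 have "pr (att (rep (oi i)) x) = pr (att i x)" if "x : sph (d i)"
 proof -
  have r: "rep (oi i) : I" "d (rep (oi i)) = d i" using Ix_rep oi_in assms dY_oi dY_def by simp_all
  have "att i x = gact g (att (rep (oi i)) x)"
   using att_act[OF g(1) r(1), of x] that r(2) g(2) by(simp add: gact_def)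
  moreover have "att (rep (oi i)) x : pts" using att_cell[OF r(1), of x] that r(2) by(auto simp: pts_def split_beta)
  ultimately show ?thesis using pr_gact[OF g(1)] by simp
 qed
 thus ?thesis using assms dsk_split[of "d i"] by(auto simp: chr_def dY_oi attY_def) (simp add: pr_def)
qed

sublocale Y: cell_data Ix dY attY
proof
 fix k x assume k: "k : Ix" and x: "x : sph (dY k)"
 hence "rep k : I" "x : sph (d (rep k))" using Ix_rep by(auto simp: dY_def)
 from att_cell[OF this] show "fst (attY k x) : Ix & snd (attY k x) : idk (dY (fst (attY k x))) & dY (fst (attY k x)) < dY k"
  by(simp add: attY_def pr_def oi_in dY_oi) (simp add: dY_def)
next
 fix k assume k: "k : Ix"
 have "fst ` attY k ` sph (dY k) = oi ` fst ` att (rep k) ` sph (d (rep k))"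
  by(auto simp: attY_def pr_def dY_def image_iff)
 thus "finite (fst ` attY k ` sph (dY k))" using att_finite[OF Ix_rep(1)[OF k]] by simp
next
 fix k U assume k: "k : Ix"
  and U: "!!j. [|j : Ix; dY j < dY k|] ==> openin (tset (dsk (dY j)))
       {x : dsk (dY j). (if x : idk (dY j) then (j, x) else attY j x) : U}"
 have "openin (tset (sph (d (rep k)))) {x : sph (d (rep k)). att (rep k) x : {q. pr q : U}}"
 proof(rule att_cont'[OF Ix_rep(1)[OF k]])
  fix i assume i: "i : I" "d i < d (rep k)"
  have lt: "dY (oi i) < dY k" using i(2) unfolding dY_oi[OF i(1)] by(simp add: dY_def)
  have eq: "pull i {q. pr q : U} = {x : dsk (dY (oi i)). (if x : idk (dY (oi i)) then (oi i, x) else attY (oi i) x) : U}"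
  proof(rule Set.set_eqI)
   fix x show "x : pull i {q. pr q : U} <->
     x : {x : dsk (dY (oi i)). (if x : idk (dY (oi i)) then (oi i, x) else attY (oi i) x) : U}"
    using pr_chr[OF i(1), of x] unfolding pull_def mem_Collect_eq dY_oi[OF i(1)]
    by(cases "x : dsk (d i)") (simp_all only: simp_thms)
  qed
  show "openin (tset (dsk (d i))) (pull i {q. pr q : U})"
   unfolding eq using U[OF oi_in[OF i(1)] lt] by(simp only: dY_oi[OF i(1)])
 qed
 thus "openin (tset (sph (dY k))) {x : sph (dY k). attY k x : U}"
  by(simp add: dY_def attY_def)
qed

lemma Ychr: "[|i : I; x : dsk (d i)|] ==> Y.chr (oi i) x = pr (chr i x)"
 using pr_chr by(simp add: Y.chr_def)

lemma gact_pts: "[|g : car G; q : pts|] ==> gact g q : pts"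
 by(auto simp: gact_def pts_def act_in d_act)

lemma continuous_gact: "g : car G ==> cmap sp sp (gact g)"
proof(rule continuous_map_from_sp)
 assume g: "g : car G"
 show "gact g : pts \<rightarrow> topspace sp" using gact_pts[OF g] by simp
 fix i assume i: "i : I"
 show "cmap (tset (dsk (d i))) sp (gact g o chr i)"
  by(rule continuous_map_eq[OF continuous_chr[OF act_in[OF g i], unfolded d_act[OF g i]]])
    (use chr_act[OF g i] in simp)
qed

lemma pr_pts: "pr ` pts = Y.pts"
proof
 show "pr ` pts <= Y.pts" by(auto simp: pts_def Y.pts_def pr_def oi_in dY_oi)
 show "Y.pts <= pr ` pts"
 proof
  fix q assume "q : Y.pts"
  then obtain k x where q: "q = (k, x)" "k : Ix" "x : idk (d (rep k))" by(auto simp: Y.pts_def dY_def)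
  hence "(rep k, x) : pts" "pr (rep k, x) = q" by(simp_all add: pts_def pr_def Ix_rep)
  thus "q : pr ` pts" by blast
 qed
qed

lemma continuous_pr: "cmap sp Y.sp pr"
proof(rule continuous_map_from_sp)
 show "pr : pts \<rightarrow> topspace Y.sp" using pr_pts by auto
 fix i assume i: "i : I"
 show "cmap (tset (dsk (d i))) Y.sp (pr o chr i)"
  by(rule continuous_map_eq[OF Y.continuous_chr[OF oi_in[OF i], unfolded dY_oi[OF i]]])
    (use Ychr[OF i] in simp)
qed

lemma pr_eq: "[|q : pts; q' : pts; pr q = pr q'|] ==> EX g:car G. q' = gact g q"
proof -
 assume q: "q : pts" "q' : pts" "pr q = pr q'"
 hence "fst q : I" "fst q' : I" "oi (fst q) = oi (fst q')" "snd q = snd q'" by(auto simp: pr_def pts_def)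
 then obtain g where "g : car G" "fst q' = act g (fst q)" using oi_eq by blast
 thus ?thesis using \<open>snd q = snd q'\<close> by(intro bexI[of _ g]) (simp_all add: gact_def prod_eq_iff)
qed

lemma gact_inv: "[|g : car G; q : pts|] ==> gact (inv g) (gact g q) = q"
 "[|g : car G; q : pts|] ==> gact g (gact (inv g) q) = q"
 by(auto simp: gact_def pts_def act_inv)

text \<open>The union \<open>S\<close> of all translates of an open set is open, and on a
  representing cell it has the same pull-back as the projected set has on the quotient cell.\<close>

lemma open_pr: "open_map sp Y.sp pr"
 unfolding open_map_def
proof(intro allI impI)
 fix U assume U: "openin sp U"
 have Up: "U <= pts" using U by(auto simp: openin_sp)
 define S where "S = (UN g:car G. {q : topspace sp. gact (inv g) q : U})"
 have S: "openin sp S"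
  unfolding S_def using openin_continuous_map_preimage[OF continuous_gact U] by auto
 have memS: "pr q : pr ` U <-> q : S" if q: "q : pts" for q
 proof
  assume "pr q : pr ` U"
  then obtain u where u: "u : U" "pr u = pr q" by auto
  then obtain g where "g : car G" "q = gact g u" using pr_eq[of u q] q Up by blast
  moreover have "gact (inv g) (gact g u) = u" using gact_inv(1)[of g u] u Up calculation by blast
  ultimately show "q : S" using u q unfolding S_def by(intro UN_I[of g]) simp_all
 next
  assume "q : S"
  then obtain g where g: "g : car G" "gact (inv g) q : U" by(auto simp: S_def)
  thus "pr q : pr ` U" using pr_gact[of "inv g" q] q by(metis image_eqI inv_closed)
 qed
 have "openin (tset (dsk (dY k))) (Y.pull k (pr ` U))" if k: "k : Ix" for k
 proof -
  have "Y.pull k (pr ` U) = pull (rep k) S"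
  proof(rule Set.set_eqI)
   fix x
   have "Y.chr k x : pr ` U <-> chr (rep k) x : S" if x: "x : dsk (d (rep k))"
    using Ychr[OF Ix_rep(1)[OF k] x] memS[OF chr_in_pts[OF Ix_rep(1)[OF k] x]]
    by(simp only: Ix_rep(2)[OF k])
   thus "x : Y.pull k (pr ` U) <-> x : pull (rep k) S"
    unfolding Y.pull_def pull_def dY_def mem_Collect_eq by blast
  qed
  thus ?thesis using S Ix_rep(1)[OF k] by(auto simp: openin_sp dY_def)
 qed
 thus "openin Y.sp (pr ` U)" using Up pr_pts by(auto simp: Y.openin_sp)
qed

lemma star_gact:
 assumes "g : car G" "i : I"
 shows "q : spread ({i} \<times> idk (d i)) (d i) 0 ==> gact g q : spread ({act g i} \<times> idk (d i)) (d i) 0"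
proof(induction rule: spread.induct)
 case (base q)
 thus ?case by(auto simp: gact_def intro: spread.base)
next
 case (step j x)
 have "rproj (d j) x : sph (d j)" using step(3,4) by(intro rproj_sph) (auto simp: idk_def)
 hence "att (act g j) (rproj (d (act g j)) x) = gact g (att j (rproj (d j) x))"
  using att_act[OF assms(1) step(1)] by(simp add: gact_def d_act[OF assms(1) step(1)])
 thus ?case using step assms
  unfolding gact_def fst_conv snd_conv by(intro spread.step) (simp_all add: act_in d_act gact_def)
qed

sublocale cover: contractible_cover G sp Y.sp pr gact
proof
 show "cmap sp Y.sp pr" by(rule continuous_pr)
 show "open_map sp Y.sp pr" by(rule open_pr)
 show "pr ` topspace sp = topspace Y.sp" by(simp add: pr_pts)
 show "contractible_space sp" by(rule contr_sp)
 have "(i, %_. 0) : pts" if "i : I" for i using that by(simp add: pts_def idk_def nrm_def)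
 thus "topspace sp ~= {}" using I_nonempty by auto
next
 fix g assume "g : car G" thus "cmap sp sp (gact g)" by(rule continuous_gact)
next
 fix q assume "q : topspace sp" thus "gact \<one> q = q" by(auto simp: gact_def pts_def act_one)
next
 fix g h q assume "g : car G" "h : car G" "q : topspace sp"
 thus "gact (g \<otimes> h) q = gact g (gact h q)" by(auto simp: gact_def pts_def act_mult)
next
 fix g q assume "g : car G" "q : topspace sp"
 thus "pr (gact g q) = pr q" by(simp add: pr_gact)
next
 fix q q' assume "q : topspace sp" "q' : topspace sp" "pr q = pr q'"
 thus "EX g:car G. q' = gact g q" using pr_eq by simp
next
 fix q assume "q : topspace sp"
 then obtain i x where q: "q = (i, x)" "i : I" "x : idk (d i)" by(auto simp: pts_def)
 \<comment> \<open>The spread of the open cell is a wandering neighbourhood: a nontrivial element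
   moves the cell to another one of the same dimension, and the spreads of these two are
   disjoint.\<close>
 let ?V = "spread ({i} \<times> idk (d i)) (d i) 0"
 have "openin sp ?V" by(rule openin_spread_cell[OF q(2) openin_idk]) auto
 moreover have "q : ?V" using q by(auto intro: spread.base)
 moreover have "g = \<one>" if g: "g : car G" "v : ?V" "gact g v : ?V" for g v
 proof(rule ccontr)
  assume "g ~= \<one>"
  hence neq: "act g i ~= i" using act_free g(1) q(2) by blast
  have "spread ({act g i} \<times> idk (d i)) (d i) 0 Int ?V = {}"
   by(rule spread_same_dim_disjoint) (use neq q(2) g(1) in "auto simp: pts_def act_in d_act")
  thus False using star_gact[OF g(1) q(2) g(2)] g(3) by blast
 qed
 ultimately show "EX V. openin sp V & q : V & (ALL g:car G. ALL v:V. gact g v : V --> g = \<one>)" by blast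
qed

theorem type_F_infinity_G: "type_F_infinity G"
 unfolding type_F_infinity_def
proof(intro conjI exI)
 show "group G" by(rule is_group)
 show "CW_complex Y.sp Ix dY Y.chr" by(rule Y.CW_complex_sp)
 show "ALL n. finite {e : Ix. dY e = n}"
 proof
  fix n
  have "{e : Ix. dY e = n} <= ix ` {r : orb ` I. d r = n}"
   by(auto simp: Ix_def dY_def rep_def inv_into_f_f[OF inj_ix])
  thus "finite {e : Ix. dY e = n}" using finite_reps finite_surj by blast
 qed
 show "Eilenberg_MacLane_1 G Y.sp" by(rule cover.Eilenberg_MacLane_base)
qed

end

section \<open>Products of simplices\<close>

definition blok :: "('n => 'b) => 'n set => 'n => 'n set" where
 "blok blk N n = {k : N. blk k = blk n}"

text \<open>A product of simplices in barycentric coordinates, one factor for each class of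
  \<open>blk\<close>. Coordinates outside \<open>N\<close> are unconstrained, so a point is a
  function only up to its values on \<open>N\<close>; hence the many congruence lemmas
  below.\<close>

definition shape :: "('n => 'b) => 'n set => ('n => real) set" where
 "shape blk N = {z. (ALL n:N. 0 <= z n) & (ALL n:N. sum z (blok blk N n) = 1)}"

definition prune :: "('n => 'b) => 'n set => 'n set" where
 "prune blk N = {n : N. EX k:N. k ~= n & blk k = blk n}"

lemma prune_subset: "prune blk N <= N"
 by(auto simp: prune_def)

lemma blok_prune: "n : prune blk N ==> blok blk (prune blk N) n = blok blk N n"
 by(auto simp: prune_def blok_def) metis

lemma shape_cong: "(!!n. n : N ==> z n = z' n) ==> z : shape blk N <-> z' : shape blk N"
by(auto simp: blok_def shape_def)

lemma shape_face:
 assumes "finite N" "z : shape blk N" "vp : N" "z vp = 0"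
 shows "z : shape blk (prune blk (N - {vp}))"
proof -
 have "sum z (blok blk (prune blk (N - {vp})) n) = 1" if n: "n : prune blk (N - {vp})" for n
 proof -
  have "sum z (blok blk (N - {vp}) n) = sum z (blok blk N n)"
   by(rule sum.mono_neutral_left) (use assms in "auto simp: blok_def")
  thus ?thesis using n assms(2) prune_subset[of blk "N - {vp}"]
   unfolding blok_prune[OF n] by(auto simp: shape_def)
 qed
 thus ?thesis using assms(2) prune_subset[of blk "N - {vp}"] by(auto simp: shape_def)
qed

lemma shape_face_rest:
 assumes "finite N" "z : shape blk N" "vp : N" "z vp = 0" "n : N" "n ~: prune blk (N - {vp})" "n ~= vp"
 shows "z n = 1"
proof -
 have "sum z (blok blk N n) = sum z {n}"
  by(rule sum.mono_neutral_right) (use assms in "auto simp: blok_def prune_def")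
 thus ?thesis using assms by(simp add: shape_def)
qed

lemma shape_two_zeros:
 assumes "finite N" "z : shape blk N" "vp : N" "z vp = 0" "vq : N" "z vq = 0" "vp ~= vq"
 shows "vq : prune blk (N - {vp})"
 using shape_face_rest[OF assms(1-5)] assms(6,7) by force

text \<open>The inclusion of a facet: the vanishing coordinate is restored as 0, and a coordinate
  dropped by \<open>prune\<close> as 1, being alone in its factor.\<close>

definition extend :: "'n set => 'n => ('n => 'b) => ('n => real) => 'n => real" where
 "extend N vp blk z n = (if n : N then if n = vp then 0 else if n : prune blk (N - {vp}) then z n else 1 else z n)"

lemma extend_shape:
 assumes N: "finite N" "prune blk N = N" "vp : N" and z: "z : shape blk (prune blk (N - {vp}))"
 shows "extend N vp blk z : shape blk N"
proof -
 let ?P = "prune blk (N - {vp})" and ?e = "extend N vp blk z"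
 have z': "!!n. n : ?P ==> 0 <= z n" "!!n. n : ?P ==> sum z (blok blk ?P n) = 1"
  using z by(auto simp: shape_def)
 have P: "?P <= N - {vp}" by(rule prune_subset)
 have "sum ?e (blok blk N n) = 1" if n: "n : N" for n
 proof(cases "blok blk N n Int ?P = {}")
  case True
  have two: "EX k:N. k ~= n & blk k = blk n" using N n by(auto simp: prune_def)
  have vpb: "vp : blok blk N n"
  proof(rule ccontr)
   assume "vp ~: blok blk N n"
   hence "n : ?P" using two n N(3) by(auto simp: prune_def blok_def)
   thus False using True n by(auto simp: blok_def)
  qed
  have "EX m. blok blk N n = {vp, m} & m ~= vp"
  proof -
   obtain m where m: "m : N" "m ~= vp" "blk m = blk n" using two n vpb by(metis (mono_tags, lifting) blok_def mem_Collect_eq)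
   have "k = vp | k = m" if "k : blok blk N n" for k
   proof(rule ccontr)
    assume "~ (k = vp | k = m)"
    hence "m : ?P" "m : blok blk N n" using m that by(auto simp: prune_def blok_def)
    thus False using True by blast
   qed
   hence "blok blk N n = {vp, m}" using m vpb by(auto simp: blok_def)
   thus ?thesis using m by blast
  qed
  then obtain m where m: "blok blk N n = {vp, m}" "m ~= vp" by blast
  hence "m : N" "m ~: ?P" using True by(auto simp: blok_def)
  thus ?thesis using m N by(simp add: extend_def)
 next
  case False
  then obtain k where k: "k : N" "blk k = blk n" "k : ?P" by(auto simp: blok_def)
  hence b: "blok blk N n = blok blk N k" by(simp add: blok_def)
  have sub: "blok blk (N - {vp}) k = blok blk ?P k" using blok_prune[OF k(3)] by simp
  have "sum ?e (blok blk N k) = sum ?e (blok blk (N - {vp}) k)"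
   by(rule sum.mono_neutral_right) (use N in "auto simp: blok_def extend_def")
  also have "... = sum z (blok blk ?P k)"
   unfolding sub by(rule sum.cong) (use P in "auto simp: blok_def extend_def")
  finally show ?thesis using z'(2)[OF k(3)] b by simp
 qed
 moreover have "0 <= ?e n" if "n : N" for n using that z'(1) by(simp add: extend_def)
 ultimately show ?thesis by(simp add: shape_def)
qed

lemma extend_id:
 assumes "finite N" "z : shape blk N" "vp : N" "z vp = 0"
 shows "extend N vp blk z = z"
 using shape_face_rest[OF assms] assms(4) by(auto simp: extend_def fun_eq_iff)

text \<open>The retraction of a product of simplices onto the union of the facets other than the facet
 \<open>vp\<close> is the projection from a point \<open>cen\<close> beyond that facet.\<close>

definition cen :: "('n => 'b) => 'n set => 'n => 'n => real" where
 "cen blk N vp n = (if n = vp then - 1 else if blk n = blk vp then 2 / (real (card (blok blk N n)) - 1)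
   else 1 / real (card (blok blk N n)))"

text \<open>The Minkowski functional, about \<open>cen\<close>, of the region cut out by the facets
  other than \<open>vp\<close>. On the shape it lies between 0 and 1 and equals 1 exactly where one
  of these facets is met, so division by it moves a point radially onto their union.\<close>

definition gauge :: "('n => 'b) => 'n set => 'n => ('n => real) => real" where
 "gauge blk N vp z = Max ((%n. 1 - z n / cen blk N vp n) ` (N - {vp}))"

definition retr :: "('n => 'b) => 'n set => 'n => ('n => real) => 'n => real" where
 "retr blk N vp z n = (if n : N then cen blk N vp n + (z n - cen blk N vp n) / gauge blk N vp z else z n)"

locale shape_facet =
 fixes blk :: "'n => 'b" and N :: "'n set" and vp :: 'n
 assumes finN: "finite N" and full: "prune blk N = N" and vpN: "vp : N"
begin

lemma card_blok: "n : N ==> 2 <= card (blok blk N n)"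
proof -
 assume n: "n : N"
 then obtain k where "k : N" "k ~= n" "blk k = blk n" using full by(auto simp: prune_def)
 hence "{n, k} <= blok blk N n" "card {n, k} = 2" using n by(auto simp: blok_def)
 moreover have "finite (blok blk N n)" using finN by(simp add: blok_def)
 ultimately show ?thesis using card_mono by metis
qed

lemma cen_pos: "n : N ==> n ~= vp ==> 0 < cen blk N vp n"
 using card_blok[of n] by(auto simp: cen_def intro!: divide_pos_pos)

lemma horn_ne: "N - {vp} ~= {}"
 using vpN full by(auto simp: prune_def)

text \<open>In the block of \<open>vp\<close> the entry -1 is balanced by the others, which add up
  to 2; so \<open>cen\<close> lies in the affine span of the shape although outside the shape
  itself.\<close>

lemma sum_cen: "n : N ==> sum (cen blk N vp) (blok blk N n) = 1"
proof -
 assume n: "n : N"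
 have card: "2 <= card (blok blk N n)" by(rule card_blok[OF n])
 have same: "blok blk N k = blok blk N n" if "k : blok blk N n" for k using that by(auto simp: blok_def)
 have fin: "finite (blok blk N n)" using finN by(simp add: blok_def)
 show ?thesis
 proof(cases "blk n = blk vp")
  case True
  hence vpb: "vp : blok blk N n" using vpN by(simp add: blok_def)
  have "sum (cen blk N vp) (blok blk N n) = cen blk N vp vp + sum (cen blk N vp) (blok blk N n - {vp})"
   by(rule sum.remove[OF fin vpb])
  also have "sum (cen blk N vp) (blok blk N n - {vp}) = (SUM k:blok blk N n - {vp}. 2 / (real (card (blok blk N n)) - 1))"
   by(rule sum.cong) (use same True in "auto simp: cen_def blok_def")
  also have "... = 2"
  proof -
   have "real (card (blok blk N n - {vp})) = real (card (blok blk N n)) - 1"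
    using card card_Diff_singleton[OF vpb] by(simp add: of_nat_diff)
   thus ?thesis using card by(simp add: divide_eq_eq)
  qed
  finally show ?thesis by(simp add: cen_def)
 next
  case False
  have "sum (cen blk N vp) (blok blk N n) = (SUM k:blok blk N n. 1 / real (card (blok blk N n)))"
   by(rule sum.cong) (use same False in "auto simp: cen_def blok_def")
  thus ?thesis using card by simp
 qed
qed

lemma gauge_ge: "n : N ==> n ~= vp ==> 1 - z n / cen blk N vp n <= gauge blk N vp z"
 unfolding gauge_def using finN by(intro Max_ge) auto

lemma gauge_attained: obtains n where "n : N" "n ~= vp" "gauge blk N vp z = 1 - z n / cen blk N vp n"
proof -
 have "gauge blk N vp z : (%n. 1 - z n / cen blk N vp n) ` (N - {vp})"
  unfolding gauge_def using finN horn_ne by(intro Max_in) auto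
 thus ?thesis using that by auto
qed

text \<open>In the block of \<open>vp\<close> the remaining entries of \<open>cen\<close> add up to
  2, those of a point of the shape to at most 1, so at least one of them is smaller than in
  \<open>cen\<close>.\<close>

lemma gauge_pos:
 assumes z: "z : shape blk N" shows "0 < gauge blk N vp z"
proof -
 have "EX n:blok blk N vp - {vp}. z n < cen blk N vp n"
 proof(rule ccontr)
  assume "~ ?thesis"
  hence le: "!!n. n : blok blk N vp - {vp} ==> cen blk N vp n <= z n" by(meson not_le)
  have fin: "finite (blok blk N vp)" and vpb: "vp : blok blk N vp" using finN vpN by(simp_all add: blok_def)
  have "sum (cen blk N vp) (blok blk N vp - {vp}) = 2"
   using sum_cen[OF vpN] sum.remove[OF fin vpb, of "cen blk N vp"] by(simp add: cen_def)
  moreover have "sum z (blok blk N vp - {vp}) <= 1"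
  proof -
   have "0 <= z vp" "sum z (blok blk N vp) = 1" using z vpN by(simp_all add: shape_def)
   thus ?thesis using sum.remove[OF fin vpb, of z] by linarith
  qed
  moreover have "sum (cen blk N vp) (blok blk N vp - {vp}) <= sum z (blok blk N vp - {vp})"
   by(rule sum_mono) (rule le)
  ultimately show False by linarith
 qed
 then obtain n where n: "n : N" "n ~= vp" "z n < cen blk N vp n" by(auto simp: blok_def)
 hence "z n / cen blk N vp n < 1" using cen_pos by simp
 thus ?thesis using gauge_ge[OF n(1,2), of z] by linarith
qed

lemma gauge_le_1:
 assumes z: "z : shape blk N" shows "gauge blk N vp z <= 1"
proof -
 obtain n where n: "n : N" "n ~= vp" "gauge blk N vp z = 1 - z n / cen blk N vp n" by(rule gauge_attained)
 have "0 <= z n / cen blk N vp n" using z n cen_pos[OF n(1,2)] by(simp add: shape_def)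
 thus ?thesis using n by linarith
qed

lemma retr_shape:
 assumes z: "z : shape blk N" shows "retr blk N vp z : shape blk N"
proof -
 let ?mm = "gauge blk N vp z" and ?a = "cen blk N vp"
 have mm: "0 < ?mm" "?mm <= 1" using gauge_pos[OF z] gauge_le_1[OF z] by auto
 have "0 <= retr blk N vp z n" if n: "n : N" for n
 proof(cases "n = vp")
  case True
  have "1 <= (z vp + 1) / ?mm" using mm z vpN by(simp add: shape_def add_increasing)
  thus ?thesis using True vpN by(simp add: retr_def cen_def)
 next
  case False
  have "(?a n - z n) / ?a n <= ?mm"
   using gauge_ge[OF n False, of z] cen_pos[OF n False] by(simp add: diff_divide_distrib)
  hence "?a n - z n <= ?a n * ?mm"
   using cen_pos[OF n False] by(simp add: pos_divide_le_eq mult.commute)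
  hence "(?a n - z n) / ?mm <= ?a n" using mm by(simp add: pos_divide_le_eq)
  thus ?thesis using n by(simp add: retr_def diff_divide_distrib)
 qed
 moreover have "sum (retr blk N vp z) (blok blk N n) = 1" if n: "n : N" for n
 proof -
  have "sum (retr blk N vp z) (blok blk N n) = (SUM k:blok blk N n. ?a k + (z k - ?a k) / ?mm)"
   by(rule sum.cong) (auto simp: blok_def retr_def)
  also have "... = sum ?a (blok blk N n) + (sum z (blok blk N n) - sum ?a (blok blk N n)) / ?mm"
   by(simp add: sum.distrib sum_subtractf flip: sum_divide_distrib)
  finally show ?thesis using sum_cen[OF n] z n by(simp add: shape_def)
 qed
 ultimately show ?thesis by(simp add: shape_def)
qed

lemma retr_horn:
 assumes z: "z : shape blk N" shows "EX vq:N - {vp}. retr blk N vp z vq = 0"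
proof -
 let ?mm = "gauge blk N vp z" and ?a = "cen blk N vp"
 obtain n where n: "n : N" "n ~= vp" "?mm = 1 - z n / ?a n" by(rule gauge_attained)
 have "?a n * ?mm = ?a n - z n" using cen_pos[OF n(1,2)] n(3) by(simp add: right_diff_distrib)
 hence "?a n + (z n - ?a n) / ?mm = 0"
  using gauge_pos[OF z] by(simp add: divide_simps)
 thus ?thesis using n by(intro bexI[of _ n]) (simp_all add: retr_def)
qed

lemma retr_fix:
 assumes z: "z : shape blk N" "vq : N" "vq ~= vp" "z vq = 0" shows "retr blk N vp z = z"
proof -
 have "gauge blk N vp z = 1" using gauge_ge[OF z(2,3), of z] gauge_le_1[OF z(1)] z(4) by simp
 thus ?thesis by(auto simp: retr_def fun_eq_iff)
qed

lemma retr_cong: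
 assumes "!!n. n : N ==> z n = z' n" "n : N" shows "retr blk N vp z n = retr blk N vp z' n"
proof -
 have "gauge blk N vp z = gauge blk N vp z'"
  unfolding gauge_def by(intro arg_cong[where f=Max] image_cong) (use assms in auto)
 thus ?thesis using assms by(simp add: retr_def)
qed

lemma continuous_on_proj: "con A (%z::'n => real. z n)"
 by(rule continuous_on_coord[OF continuous_on_id])

lemma continuous_on_retr: "con (shape blk N) (retr blk N vp)"
proof(rule con_prod)
 fix n
 have g: "con (shape blk N) (gauge blk N vp)"
  unfolding gauge_def[abs_def]
  by(rule continuous_on_Max_image)
    (use finN horn_ne cen_pos in "auto intro!: continuous_on_diff continuous_on_divide continuous_on_const continuous_on_proj simp: less_imp_neq[symmetric]")
 have "con (shape blk N) (%z. cen blk N vp n + (z n - cen blk N vp n) / gauge blk N vp z)"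
  using gauge_pos by(intro continuous_on_add continuous_on_divide continuous_on_diff continuous_on_const continuous_on_proj g)
    (auto simp: less_imp_neq[symmetric])
 thus "con (shape blk N) (%z. retr blk N vp z n)"
  using continuous_on_proj[of "shape blk N" n] by(cases "n : N") (simp_all add: retr_def)
qed

lemma continuous_on_extend: "con A (extend N vp blk)"
proof(rule con_prod)
 fix n
 show "con A (%z. extend N vp blk z n)"
  unfolding extend_def
  by(cases "n : N"; cases "n = vp"; cases "n : prune blk (N - {vp})")
    (simp_all add: continuous_on_const continuous_on_proj)
qed

end

lemma continuous_map_finite_closed_cover:
 assumes "finite J" "!!j. j : J ==> closedin X (A j)" "topspace X <= (UN j:J. A j)"
  and "!!j. j : J ==> cmap (subtopology X (A j)) Y (g j)"
  and "!!j x. j : J ==> x : A j ==> f x = g j x"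
 shows "cmap X Y f"
proof -
 have A: "A j <= topspace X" if "j : J" for j using assms(2)[OF that] closedin_subset by blast
 have "f x : topspace Y" if x: "x : topspace X" for x
 proof -
  obtain j where j: "j : J" "x : A j" using assms(3) x by blast
  have "g j x : topspace Y" using assms(4)[OF j(1)] x j(2) by(simp add: continuous_map_def Pi_iff)
  thus ?thesis using assms(5)[OF j] by simp
 qed
 moreover have "closedin X {x : topspace X. f x : C}" if C: "closedin Y C" for C
 proof -
  have "{x : topspace X. f x : C} = (UN j:J. {x : topspace (subtopology X (A j)). g j x : C})"
  proof
   show "{x : topspace X. f x : C} <= (UN j:J. {x : topspace (subtopology X (A j)). g j x : C})"
   proof
    fix x assume x: "x : {x : topspace X. f x : C}"
    then obtain j where j: "j : J" "x : A j" using assms(3) by blast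
    thus "x : (UN j:J. {x : topspace (subtopology X (A j)). g j x : C})"
     using x assms(5)[OF j] by(intro UN_I[of j]) auto
   qed
   show "(UN j:J. {x : topspace (subtopology X (A j)). g j x : C}) <= {x : topspace X. f x : C}"
   proof
    fix x assume "x : (UN j:J. {x : topspace (subtopology X (A j)). g j x : C})"
    then obtain j where j: "j : J" "x : A j" "x : topspace X" "g j x : C" by auto
    thus "x : {x : topspace X. f x : C}" using assms(5)[OF j(1,2)] by simp
   qed
  qed
  moreover have "closedin X {x : topspace (subtopology X (A j)). g j x : C}" if j: "j : J" for j
   using closedin_continuous_map_preimage[OF assms(4)[OF j] C] assms(2)[OF j] closedin_trans_full by blast
  ultimately show ?thesis using assms(1) by(simp only:) (rule closedin_Union, auto)
 qed
 ultimately show ?thesis unfolding continuous_map_closedin by blast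
qed

section \<open>Acyclic matchings\<close>

text \<open>A cell \<open>c\<close> is a product of simplices with one barycentric coordinate for each name in \<open>N c\<close>, the
 factors being the classes of \<open>blk\<close>. The facet where the coordinate \<open>n\<close> vanishes is glued to \<open>bd n c\<close>;
 a factor of which a single coordinate is left is a point and its name is dropped.\<close>

locale named_complex =
 fixes C :: "'c set" and N :: "'c => 'n set" and blk :: "'n => 'b" and bd :: "'n => 'c => 'c"
 assumes N_fin: "c : C ==> finite (N c)"
  and N_full: "c : C ==> prune blk (N c) = N c"
  and bd_in: "[|c : C; vp : N c|] ==> bd vp c : C"
  and N_bd: "[|c : C; vp : N c|] ==> N (bd vp c) = prune blk (N c - {vp})"
  and bd_comm: "[|c : C; vp : N c; vq : N (bd vp c)|] ==> bd vq (bd vp c) = bd vp (bd vq c)"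
begin

abbreviation Sh :: "'c => ('n => real) set" where "Sh c == shape blk (N c)"

lemma N_bd_subset: "[|c : C; vp : N c|] ==> N (bd vp c) <= N c - {vp}"
 using N_bd[of c vp] prune_subset[of blk "N c - {vp}"] by simp

lemma Sh_bd: "[|c : C; z : Sh c; vp : N c; z vp = 0|] ==> z : Sh (bd vp c)"
 using shape_face[OF N_fin, of c z blk vp] N_bd[of c vp] by simp

lemma N_two_zeros:
 "[|c : C; z : Sh c; vp : N c; z vp = 0; vq : N c; z vq = 0; vp ~= vq|] ==> vq : N (bd vp c)"
 using shape_two_zeros[OF N_fin, of c z blk vp vq] N_bd[of c vp] by simp

lemma N_bd_sym: "[|c : C; vp : N c; vq : N (bd vp c)|] ==> vp : N (bd vq c)"
proof -
 assume a: "c : C" "vp : N c" "vq : N (bd vp c)"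
 hence vq: "vq : N c" "vq ~= vp" using N_bd_subset by blast+
 obtain k where k: "k : N c - {vp}" "k ~= vq" "blk k = blk vq" using a N_bd by(auto simp: prune_def)
 obtain m where m: "m : N c" "m ~= vp" "blk m = blk vp" using N_full[OF a(1)] a(2) by(auto simp: prune_def)
 have "EX m':N c - {vq}. m' ~= vp & blk m' = blk vp"
  using k m by(cases "m = vq") auto
 thus ?thesis using N_bd[OF a(1) vq(1)] a(2) vq by(auto simp: prune_def)
qed

end

text \<open>In the pair containing \<open>c\<close>, \<open>tau c\<close> is the larger cell and \<open>bd (phi c) (tau c)\<close> the smaller one.\<close>

locale matching = named_complex C N blk bd
 for C :: "'c set" and N :: "'c => 'n set" and blk :: "'n => 'b" and bd :: "'n => 'c => 'c" +
 fixes R :: "('c * 'c) set" and crit :: "'c => bool" and tau :: "'c => 'c" and phi :: "'c => 'n"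
 assumes wfR: "wf R" and transR: "trans R"
  and tau_in: "[|c : C; ~ crit c|] ==> tau c : C"
  and phi_in: "[|c : C; ~ crit c|] ==> phi c : N (tau c)"
  and tau_tau: "[|c : C; ~ crit c|] ==> ~ crit (tau c) & tau (tau c) = tau c & phi (tau c) = phi c"
  and tau_sig: "[|c : C; ~ crit c|] ==> ~ crit (bd (phi c) (tau c)) &
    tau (bd (phi c) (tau c)) = tau c & phi (bd (phi c) (tau c)) = phi c"
  and tau_cases: "[|c : C; ~ crit c|] ==> c = tau c | c = bd (phi c) (tau c)"
  and horn_R: "[|c : C; ~ crit c; vq : N (tau c); vq ~= phi c|] ==> (bd vq (tau c), c) : R"
  and sig_R: "[|c : C; ~ crit c|] ==> (bd (phi c) (tau c), tau c) : R"
  and crit_R: "[|c : C; crit c; vq : N c|] ==> (bd vq c, c) : R"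
begin

text \<open>The axioms order the facets of critical cells and of the larger cells of pairs. A facet
  of a smaller cell is, by \<open>bd_comm\<close>, also a facet of the horn facet
  \<open>bd vq (tau c)\<close>, which precedes \<open>c\<close>, so the induction hypothesis applies
  to the latter.\<close>

lemma facet_R: "[|c : C; vq : N c|] ==> (bd vq c, c) : R"
proof(induction c arbitrary: vq rule: wf_induct_rule[OF wfR])
 case (1 c)
 show ?case
 proof(cases "crit c")
  case True
  thus ?thesis using crit_R 1 by blast
 next
  case nc: False
  consider "c = tau c" | "c ~= tau c" "c = bd (phi c) (tau c)" using tau_cases 1 nc by blast
  thus ?thesis
  proof cases
   case 1
   thus ?thesis
    using horn_R[OF \<open>c \<in> C\<close> nc, of vq] sig_R[OF \<open>c \<in> C\<close> nc] \<open>vq \<in> N c\<close> by(cases "vq = phi c") auto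
  next
   case 2
   let ?t = "tau c" and ?f = "phi c"
   have t: "?t : C" "?f : N ?t" using tau_in phi_in \<open>c \<in> C\<close> nc by auto
   have p: "vq : N (bd ?f ?t)" using \<open>vq \<in> N c\<close> 2 by simp
   hence vq: "vq : N ?t" "vq ~= ?f" using N_bd_subset[OF t] by auto
   have h: "(bd vq ?t, c) : R" by(rule horn_R[OF \<open>c \<in> C\<close> nc vq])
   have "(bd ?f (bd vq ?t), bd vq ?t) : R"
    by(rule "1.IH"[OF h bd_in[OF t(1) vq(1)] N_bd_sym[OF t p]])
   moreover have "bd ?f (bd vq ?t) = bd vq c" using bd_comm[OF t p] 2 by simp
   ultimately show ?thesis using h transR by(metis transD)
  qed
 qed
qed

definition lift :: "'c => ('n => real) => 'n => real" where
 "lift c z = (if c = tau c then z else extend (N (tau c)) (phi c) blk z)"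

lemma facet_tau: "[|c : C; ~ crit c|] ==> shape_facet blk (N (tau c)) (phi c)"
 by(intro shape_facet.intro N_fin N_full tau_in phi_in)

lemma sigma_N:
 assumes "c : C" "~ crit c" "c ~= tau c"
 shows "N c = prune blk (N (tau c) - {phi c})"
using tau_cases assms(1,2) assms(3) arg_cong N_bd tau_in phi_in by metis

lemma lift_tau: "c = tau c ==> lift c z = z"
 unfolding lift_def by(rule if_P)

lemma lift_sigma: "c ~= tau c ==> lift c z = extend (N (tau c)) (phi c) blk z"
 unfolding lift_def by(rule if_not_P)

lemma lift_Sh:
 assumes "c : C" "~ crit c" "z : Sh c"
 shows "lift c z : Sh (tau c)"
using arg_cong assms(3) lift_tau tau_in assms(1,2) lift_sigma extend_shape N_fin N_full phi_in sigma_N by metis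

lemma lift_coord:
 assumes "c : C" "~ crit c" "n : N c"
 shows "lift c z n = z n"
proof(cases "c = tau c")
 case False
 hence "n : prune blk (N (tau c) - {phi c})" using sigma_N assms by blast
 thus ?thesis unfolding lift_sigma[OF False] by(simp add: extend_def prune_def)
qed (simp add: lift_tau)

lemma lift_cong:
 assumes "c : C" "~ crit c" "!!n. n : N c ==> z n = z' n" "n : N (tau c)"
 shows "lift c z n = lift c z' n"
proof(cases "c = tau c")
 case True
 hence "N c = N (tau c)" by(rule arg_cong)
 thus ?thesis using assms(3,4) unfolding lift_tau[OF True] by simp
next
 case False
 have "z n = z' n" if "n : prune blk (N (tau c) - {phi c})"
  using assms(3) sigma_N[OF assms(1,2) False] that by blast
 thus ?thesis using assms(4) unfolding lift_sigma[OF False] by(simp add: extend_def)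
qed

lemma lift_zero:
 assumes "c : C" "~ crit c" "c ~= tau c"
 shows "lift c z (phi c) = 0"
 using phi_in[OF assms(1,2)] unfolding lift_sigma[OF assms(3)] by(simp add: extend_def)

end

text \<open>The map onto the horn is a parameter: \<open>retr\<close> serves for the Morse complex,
  while the later homotopy calls for one that leaves the time coordinate alone and so moves some
  points of the horn. The condition \<open>consistent\<close> deals with those points.\<close>

locale matching_rho = matching C N blk bd R crit tau phi
 for C :: "'c set" and N :: "'c => 'n set" and blk :: "'n => 'b" and bd :: "'n => 'c => 'c"
  and R crit tau phi +
 fixes rho :: "'c => ('n => real) => 'n => real"
 assumes rho_Sh: "[|c : C; ~ crit c; z : Sh (tau c)|] ==> rho (tau c) z : Sh (tau c)"
  and rho_horn: "[|c : C; ~ crit c; z : Sh (tau c)|] ==> EX vq:N (tau c). vq ~= phi c & rho (tau c) z vq = 0"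
  and rho_cong: "[|c : C; ~ crit c; !!n. n : N (tau c) ==> z n = z' n; n : N (tau c)|] ==>
    rho (tau c) z n = rho (tau c) z' n"
  and rho_cont: "[|c : C; ~ crit c|] ==> con (Sh (tau c)) (rho (tau c))"
begin

definition push :: "'c => ('n => real) => 'n => real" where
 "push c z = rho (tau c) (lift c z)"

definition horn_face :: "'c => ('n => real) => 'n" where
 "horn_face c w = (SOME vq. vq : N (tau c) & vq ~= phi c & w vq = 0)"

definition zero_face :: "'c => ('n => real) => 'n" where
 "zero_face c z = (SOME vp. vp : N c & z vp = 0)"

text \<open>Transports values given inside critical cells to all cells. A point of a matched cell is
  pushed onto the horn and evaluated in a horn facet containing it; a boundary point of a critical
  cell is evaluated in a facet. Both facets precede the cell in \<open>R\<close>. That the choice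
  among several facets does not matter has to be proved afterwards.\<close>

definition ext :: "('c => ('n => real) => 'p) => 'c => ('n => real) => 'p" where
 "ext T0 = wfrec R (%f c z. if crit c then (if EX vp:N c. z vp = 0 then f (bd (zero_face c z) c) z else T0 c z)
   else f (bd (horn_face c (push c z)) (tau c)) (push c z))"

lemma push_Sh: "[|c : C; ~ crit c; z : Sh c|] ==> push c z : Sh (tau c)"
 unfolding push_def by(intro rho_Sh lift_Sh)

lemma horn_face:
 assumes "c : C" "~ crit c" "z : Sh c"
 shows "horn_face c (push c z) : N (tau c) & horn_face c (push c z) ~= phi c & push c z (horn_face c (push c z)) = 0"
proof -
 have "EX vq. vq : N (tau c) & vq ~= phi c & push c z vq = 0"
  using rho_horn[OF assms(1,2) lift_Sh[OF assms]] unfolding push_def by blast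
 thus ?thesis unfolding horn_face_def by(rule someI_ex)
qed

lemma zero_face: "EX vp:N c. z vp = 0 ==> zero_face c z : N c & z (zero_face c z) = 0"
 unfolding zero_face_def by(rule someI_ex) blast

lemma push_cong:
 assumes "c : C" "~ crit c" "!!n. n : N c ==> z n = z' n" "n : N (tau c)"
 shows "push c z n = push c z' n"
 unfolding push_def by(rule rho_cong[OF assms(1,2) lift_cong[OF assms(1-3)] assms(4)])

lemma ext_eq:
 assumes "c : C" "z : Sh c"
 shows "ext T0 c z = (if crit c then (if EX vp:N c. z vp = 0 then ext T0 (bd (zero_face c z) c) z else T0 c z)
   else ext T0 (bd (horn_face c (push c z)) (tau c)) (push c z))"
proof -
 have "(bd (zero_face c z) c, c) : R" if "EX vp:N c. z vp = 0"
  using facet_R zero_face[OF that] assms by blast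
 moreover have "(bd (horn_face c (push c z)) (tau c), c) : R" if "~ crit c"
  using horn_R horn_face assms that by blast
 ultimately show ?thesis
  by(subst def_wfrec[OF ext_def[THEN eq_reflection] wfR]) (auto simp: cut_def)
qed

end

locale gen = matching_rho C N blk bd R crit tau phi rho
 for C :: "'c set" and N :: "'c => 'n set" and blk :: "'n => 'b" and bd :: "'n => 'c => 'c"
  and R crit tau phi rho +
 fixes T0 :: "'c => ('n => real) => 'p"
 assumes T0_cong: "[|c : C; crit c; z : Sh c; !!n. n : N c ==> z n = z' n|] ==> T0 c z = T0 c z'"
begin

abbreviation F where "F == ext T0"

lemmas F_eq = ext_eq[where ?T0.0 = T0]

definition compat :: "'c => bool" where
 "compat c <-> (ALL z:Sh c. ALL vp:N c. z vp = 0 --> F c z = F (bd vp c) z)"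

lemma compatD: "[|compat c; z : Sh c; vp : N c; z vp = 0|] ==> F c z = F (bd vp c) z"
 by(simp add: compat_def)

lemma F_cong: "[|c : C; z : Sh c; !!n. n : N c ==> z n = z' n|] ==> F c z = F c z'"
proof(induction c arbitrary: z z' rule: wf_induct_rule[OF wfR])
 case (1 c)
 have z': "z' : Sh c" using shape_cong[of "N c" z z'] 1 by blast
 show ?case
 proof(cases "crit c")
  case True
  show ?thesis
  proof(cases "EX vp:N c. z vp = 0")
   case ex: True
   hence ex': "EX vp:N c. z' vp = 0" using 1(4) by auto
   have zf: "zero_face c z = zero_face c z'"
    unfolding zero_face_def by(rule arg_cong[where f=Eps]) (use 1(4) in auto)
   let ?b = "bd (zero_face c z) c"
   have f: "zero_face c z : N c" "z (zero_face c z) = 0" using zero_face[OF ex] by auto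
   have "F ?b z = F ?b z'"
    by(rule "1.IH"[OF facet_R[OF 1(2) f(1)] bd_in[OF 1(2) f(1)] Sh_bd[OF 1(2,3) f]])
      (use 1(4) N_bd_subset[OF 1(2) f(1)] in auto)
   thus ?thesis using F_eq[OF 1(2,3)] F_eq[OF 1(2) z'] True ex ex' zf by simp
  next
   case nex: False
   hence "~ (EX vp:N c. z' vp = 0)" using 1(4) by auto
   thus ?thesis using F_eq[OF 1(2,3)] F_eq[OF 1(2) z'] True nex T0_cong[OF 1(2) True 1(3,4)] by simp
  qed
 next
  case False
  note pc = push_cong[OF 1(2) False 1(4)]
  have hf: "horn_face c (push c z) = horn_face c (push c z')"
   unfolding horn_face_def by(rule arg_cong[where f=Eps]) (use pc in "auto simp: fun_eq_iff")
  let ?h = "horn_face c (push c z)"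
  have h: "?h : N (tau c)" "?h ~= phi c" "push c z ?h = 0" using horn_face[OF 1(2) False 1(3)] by auto
  note t = tau_in[OF 1(2) False]
  have "F (bd ?h (tau c)) (push c z) = F (bd ?h (tau c)) (push c z')"
   by(rule "1.IH"[OF horn_R[OF 1(2) False h(1,2)] bd_in[OF t h(1)] Sh_bd[OF t push_Sh[OF 1(2) False 1(3)] h(1,3)]])
     (use pc N_bd_subset[OF t h(1)] in auto)
  thus ?thesis using F_eq[OF 1(2,3)] F_eq[OF 1(2) z'] False hf by simp
 qed
qed

text \<open>Both values equal the value on the common face of the two facets, where
  \<open>bd_comm\<close> identifies the two iterated facets.\<close>

lemma face_indep:
 assumes c: "c : C" "z : Sh c" and vp: "vp : N c" "z vp = 0" and vq: "vq : N c" "z vq = 0"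
  and "compat (bd vp c)" "compat (bd vq c)"
 shows "F (bd vp c) z = F (bd vq c) z"
proof(cases "vp = vq")
 case False
 have vq': "vq : N (bd vp c)" by(rule N_two_zeros[OF c vp vq False])
 have vp': "vp : N (bd vq c)" by(rule N_two_zeros[OF c vq vp]) (use False in auto)
 have "F (bd vp c) z = F (bd vq (bd vp c)) z"
  by(rule compatD[OF assms(7) Sh_bd[OF c vp] vq' vq(2)])
 also have "... = F (bd vp (bd vq c)) z" using bd_comm[OF c(1) vp(1) vq'] by simp
 also have "... = F (bd vq c) z"
  by(rule compatD[OF assms(8) Sh_bd[OF c vq] vp' vp(2), symmetric])
 finally show ?thesis .
qed simp

text \<open>If the push does not fix the horn, its values there have to be consistent for another reason.\<close>

definition consistent :: bool where
 "consistent <-> (ALL c z vq vq'. c : C & ~ crit c & c = tau c & z : Sh c & vq : N c & vq ~= phi c & z vq = 0 &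
   vq' : N c & vq' ~= phi c & rho c z vq' = 0 & rho c z ~= z &
   (ALL c':C. (c', bd (phi c) c) : R --> compat c') --> F (bd vq c) z = F (bd vq' c) (rho c z))"

text \<open>Well-founded induction along \<open>R\<close>. In a critical cell only the choice of a
  facet is at stake. In a pair, everything is compared with the value at the pushed point in the
  horn, whose facets precede both members of the pair and are therefore already compatible.\<close>

lemma compat_all:
 assumes cons: consistent
 shows "c : C ==> compat c"
proof(induction c rule: wf_induct_rule[OF wfR])
 case (1 c)
 have bdc: "compat (bd vp c)" if "vp : N c" for vp using 1 that facet_R bd_in by blast
 show ?case
 proof(cases "crit c")
  case True
  show ?thesis
   unfolding compat_def
  proof(intro ballI impI)
   fix z vp assume z: "z : Sh c" "vp : N c" "z vp = 0"
   hence ex: "EX vp:N c. z vp = 0" by blast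
   have f: "zero_face c z : N c" "z (zero_face c z) = 0" using zero_face[OF ex] by auto
   have "F c z = F (bd (zero_face c z) c) z" using F_eq[OF 1(2) z(1)] ex True by simp
   thus "F c z = F (bd vp c) z" using face_indep[OF 1(2) z(1) f z(2,3) bdc bdc] f z by simp
  qed
 next
  case nc: False
  let ?t = "tau c" and ?f = "phi c"
  have t: "?t : C" "?f : N ?t" using tau_in phi_in 1(2) nc by auto
  have tt: "~ crit ?t" "tau ?t = ?t" "phi ?t = ?f" using tau_tau[OF 1(2) nc] by auto
  let ?s = "bd ?f ?t"
  have ss: "~ crit ?s" "tau ?s = ?t" "phi ?s = ?f" using tau_sig[OF 1(2) nc] by auto
  have sC: "?s : C" by(rule bd_in[OF t])
  have below: "compat c'" if "c' : C" "(c', ?s) : R" for c'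
  proof -
   have "(c', c) : R" using that tau_cases[OF 1(2) nc] sig_R[OF 1(2) nc] transR by(metis transD)
   thus ?thesis using 1 that by blast
  qed
  have hornc: "compat (bd vq ?t)" if "vq : N ?t" "vq ~= ?f" for vq
   using below[OF bd_in[OF t(1) that(1)]] horn_R[OF sC ss(1)] that unfolding ss by blast
  \<comment> \<open>At a point of the horn, evaluation before and after \<open>rho\<close> agrees:
    by independence of the facet if \<open>rho\<close> fixes the point, and by
    \<open>consistent\<close> otherwise.\<close>
  have key: "F (bd vq ?t) w = F (bd vq' ?t) (rho ?t w)"
   if w: "w : Sh ?t" "vq : N ?t" "vq ~= ?f" "w vq = 0" "vq' : N ?t" "vq' ~= ?f" "rho ?t w vq' = 0" for w vq vq'
  proof(cases "rho ?t w = w")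
   case True
   thus ?thesis
    using face_indep[OF t(1) w(1,2,4,5) _ hornc hornc] w by simp
  next
   case False
   thus ?thesis using cons[unfolded consistent_def, rule_format, of ?t w vq vq'] w t tt below by auto
  qed
  have val: "F c z = F (bd vq' ?t) (push c z)"
   if z: "z : Sh c" "vq' : N ?t" "vq' ~= ?f" "push c z vq' = 0" for z vq'
  proof -
   have h: "horn_face c (push c z) : N ?t" "horn_face c (push c z) ~= ?f" "push c z (horn_face c (push c z)) = 0"
    using horn_face[OF 1(2) nc z(1)] by auto
   have "F c z = F (bd (horn_face c (push c z)) ?t) (push c z)" using F_eq[OF 1(2) z(1)] nc by simp
   thus ?thesis
    using face_indep[OF t(1) push_Sh[OF 1(2) nc z(1)] h(1,3) z(2,4) hornc hornc] h z by simp
  qed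
  show ?thesis
   unfolding compat_def
  proof(intro ballI impI)
   fix z vp assume z: "z : Sh c" "vp : N c" "z vp = 0"
   obtain vq' where vq': "vq' : N ?t" "vq' ~= ?f" "push c z vq' = 0" using horn_face[OF 1(2) nc z(1)] by blast
   note v = val[OF z(1) vq']
   show "F c z = F (bd vp c) z"
   proof(cases "c = ?t")
    case c: True
    show ?thesis
    proof(cases "vp = ?f")
     case False
     have "push c z = rho ?t z" using c by(simp add: push_def lift_def)
     thus ?thesis using v key[of z vp vq'] z c False vq' by simp
    next
     \<comment> \<open>This facet of \<open>c\<close> is its partner, and both are evaluated at the
       same pushed point.\<close>
     case True
     have sh: "z : Sh ?s" using Sh_bd[OF t(1), of z ?f] z c True by simp
     have "?s ~= ?t" using N_bd_subset[OF t] t by auto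
     hence l1: "lift ?s z = z" unfolding lift_def ss
      using extend_id[OF N_fin[OF t(1)], of z blk ?f] z c True t by auto
     have l2: "lift c z = z" using c by(simp add: lift_def)
     have p: "push ?s z = push c z" unfolding push_def ss l1 l2 ..
     have h: "horn_face ?s (push ?s z) : N ?t" "horn_face ?s (push ?s z) ~= ?f"
      "push ?s z (horn_face ?s (push ?s z)) = 0"
      using horn_face[OF sC ss(1) sh] unfolding ss by auto
     have "F ?s z = F (bd (horn_face ?s (push ?s z)) ?t) (push ?s z)"
      using F_eq[OF sC sh] ss by simp
     also have "... = F c z" using val[OF z(1) h(1,2)] h(3) p by simp
     finally show ?thesis using True c by simp
    qed
   next
    \<comment> \<open>Now \<open>c\<close> is the smaller cell. The lifted point lies in the facets
      \<open>vp\<close> and \<open>phi c\<close> of the larger one, and interchanging these two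
      facets leads to \<open>bd vp c\<close>.\<close>
    case False
    hence c: "c = ?s" using tau_cases[OF 1(2) nc] by blast
    have w: "lift c z : Sh ?t" by(rule lift_Sh[OF 1(2) nc z(1)])
    have vps: "vp : N ?s" using z(2) c by simp
    hence vp: "vp : N ?t" "vp ~= ?f" using N_bd_subset[OF t] by auto
    have wvp: "lift c z vp = 0" using lift_coord[OF 1(2) nc z(2)] z(3) by simp
    have wf: "lift c z ?f = 0" by(rule lift_zero[OF 1(2) nc False])
    have "F c z = F (bd vp ?t) (lift c z)"
     using v key[OF w vp wvp vq'(1,2)] vq'(3) by(simp add: push_def)
    also have "... = F (bd ?f (bd vp ?t)) (lift c z)"
     by(rule compatD[OF hornc[OF vp] Sh_bd[OF t(1) w vp(1) wvp] N_bd_sym[OF t vps] wf])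
    also have "... = F (bd vp c) (lift c z)" using bd_comm[OF t vps] c by simp
    also have "... = F (bd vp c) z"
    proof(rule F_cong[OF bd_in[OF 1(2) z(2)], symmetric])
     show "z : Sh (bd vp c)" by(rule Sh_bd[OF 1(2) z])
     show "z n = lift c z n" if "n : N (bd vp c)" for n
      using lift_coord[OF 1(2) nc, of n z] N_bd_subset[OF 1(2) z(2)] that by auto
    qed
    finally show ?thesis .
   qed
  qed
 qed
qed

lemma F_pair:
 assumes cons: consistent and c: "c : C" "~ crit c" "z : Sh c"
  and vq: "vq : N (tau c)" "vq ~= phi c" "push c z vq = 0"
 shows "F c z = F (bd vq (tau c)) (push c z)"
proof -
 have t: "tau c : C" by(rule tau_in[OF c(1,2)])
 have h: "horn_face c (push c z) : N (tau c)" "push c z (horn_face c (push c z)) = 0"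
  using horn_face[OF c] by auto
 have 1: "F c z = F (bd (horn_face c (push c z)) (tau c)) (push c z)"
  using F_eq[OF c(1,3)] c(2) by(simp only: if_False)
 have 2: "F (bd (horn_face c (push c z)) (tau c)) (push c z) = F (bd vq (tau c)) (push c z)"
  by(rule face_indep[OF t push_Sh[OF c] h vq(1,3) compat_all[OF cons bd_in[OF t h(1)]]
     compat_all[OF cons bd_in[OF t vq(1)]]])
 show ?thesis by(rule trans[OF 1 2])
qed

lemma F_crit: "[|c : C; crit c; z : Sh c; !!vp. vp : N c ==> z vp ~= 0|] ==> F c z = T0 c z"
 using F_eq[of c z] by auto

text \<open>A matched cell is covered by the closed sets where the pushed point meets a given horn
  facet, and on each of them the map is the push followed by the map of that facet. \<open>Q\<close>
  is a set of cells closed under the recursive calls; it permits restriction to bounded dimension,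
  where continuity has to be known before the space exists.\<close>

lemma F_continuous:
 assumes cons: consistent
  and Qcrit: "!!c vp. [|c : Q; c : C; crit c; vp : N c|] ==> bd vp c : Q"
  and Qhorn: "!!c vq. [|c : Q; c : C; ~ crit c; vq : N (tau c); vq ~= phi c|] ==> bd vq (tau c) : Q"
  and base: "!!c. [|c : Q; c : C; crit c;
    !!vp. vp : N c ==> cmap (tset (Sh (bd vp c))) Z (F (bd vp c))|] ==>
    cmap (tset (Sh c)) Z (F c)"
 shows "[|c : C; c : Q|] ==> cmap (tset (Sh c)) Z (F c)"
proof(induction c rule: wf_induct_rule[OF wfR])
 case (1 c)
 show ?case
 proof(cases "crit c")
  case True
  show ?thesis
   by(rule base[OF 1(3,2) True]) (use 1 facet_R bd_in Qcrit True in blast)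
 next
  case nc: False
  let ?t = "tau c" and ?J = "N (tau c) - {phi c}"
  let ?A = "%vq. {z : Sh c. push c z vq = 0}"
  have t: "?t : C" by(rule tau_in[OF 1(2) nc])
  interpret sf: shape_facet blk "N ?t" "phi c" by(rule facet_tau[OF 1(2) nc])
  have cl: "con (Sh c) (lift c)"
   using sf.continuous_on_extend[of "Sh c"] by(cases "c = ?t") (simp_all add: lift_def[abs_def])
  have cp: "con (Sh c) (push c)"
   unfolding push_def[abs_def]
   by(rule continuous_on_compose2[OF rho_cont[OF 1(2) nc] cl]) (use lift_Sh[OF 1(2) nc] in auto)
  show ?thesis
  proof(rule continuous_map_finite_closed_cover[where J = ?J and A = ?A and g = "%vq z. F (bd vq ?t) (push c z)"])
   show "finite ?J" using N_fin[OF t] by simp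
   show "topspace (tset (Sh c)) <= (UN vq:?J. ?A vq)" using horn_face[OF 1(2) nc] by fastforce
   fix vq assume vq: "vq : ?J"
   have "con (Sh c) (%z. push c z vq)" by(rule continuous_on_coord[OF cp])
   hence "closedin (tset (Sh c)) (Sh c Int (%z. push c z vq) -` {0})"
    by(rule continuous_closedin_preimage) simp
   moreover have "Sh c Int (%z. push c z vq) -` {0} = ?A vq" by auto
   ultimately show "closedin (tset (Sh c)) (?A vq)" by simp
   have "cmap (tset (Sh (bd vq ?t))) Z (F (bd vq ?t))"
    using 1 horn_R[OF 1(2) nc] bd_in[OF t] Qhorn[OF 1(3,2) nc] vq by blast
   moreover have "cmap (tset (?A vq)) (tset (Sh (bd vq ?t))) (push c)"
    using continuous_on_subset[OF cp, of "?A vq"] Sh_bd[OF t push_Sh[OF 1(2) nc]] vq by auto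
   ultimately have "cmap (tset (?A vq)) Z (%z. F (bd vq ?t) (push c z))"
    using continuous_map_compose[of _ _ "push c" Z "F (bd vq ?t)", unfolded o_def] by blast
   moreover have "subtopology (tset (Sh c)) (?A vq) = tset (?A vq)"
    by(simp add: subtopology_subtopology Int_def conj_ac)
   ultimately show "cmap (subtopology (tset (Sh c)) (?A vq)) Z (%z. F (bd vq ?t) (push c z))"
    by simp
   show "F c z = F (bd vq ?t) (push c z)" if "z : ?A vq" for z
    using F_pair[OF cons 1(2) nc] that vq by auto
  qed
 qed
qed

end

section \<open>Products of simplices as discs\<close>

text \<open>Away from the origin this is a quotient of continuous functions with nonzero
  denominator; at the origin each coordinate is dominated by \<open>p\<close>, which tends to
  0.\<close>

lemma radial_continuous:
 fixes p q :: "rseq => real"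
 assumes p: "con UNIV p" and q: "con UNIV q" and p0: "p (%_. 0) = 0" and pn: "!!x. 0 <= p x"
  and bound: "!!x i. x : A ==> \<bar>x i\<bar> <= q x"
 shows "con A (%x. scal (p x / q x) x)"
proof(rule con_prod)
 fix i
 have qn: "0 <= q x" if "x : A" for x using bound[OF that, of 0] by linarith
 have q0: "x = (%_. 0)" if "x : A" "q x = 0" for x
  using bound[OF that(1)] that(2) by(auto simp: fun_eq_iff)
 have coord: "con B (%x::nat => real. x i)" for B by(rule continuous_on_coord[OF continuous_on_id])
 have "continuous (at x within A) (%x. p x / q x * x i)" if x: "x : A" for x
 proof(cases "q x = 0")
  case False
  have "continuous (at x within A) p" "continuous (at x within A) q" "continuous (at x within A) (%x. x i)"
   using continuous_on_subset[OF p, of A] continuous_on_subset[OF q, of A] coord[of A] x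
   by(auto simp: continuous_on_eq_continuous_within)
  thus ?thesis using False by(intro continuous_mult continuous_at_within_divide) auto
 next
  case True
  have x0: "x = (%_. 0)" by(rule q0[OF x True])
  have le: "\<bar>p y / q y * y i\<bar> <= p y" if y: "y : A" for y
  proof(cases "q y = 0")
   case True thus ?thesis using pn by simp
  next
   case False
   hence qy: "0 < q y" using qn[OF y] by simp
   have "\<bar>p y / q y * y i\<bar> = p y * (\<bar>y i\<bar> / q y)" using pn[of y] qy by(simp add: abs_mult)
   also have "... <= p y * 1"
    by(rule mult_left_mono[OF _ pn]) (use bound[OF y, of i] qy in "simp add: pos_divide_le_eq")
   finally show ?thesis by simp
  qed
  have "(p \<longlongrightarrow> 0) (at x within A)"
   using continuous_on_subset[OF p, of A] x p0 x0 by(auto simp: continuous_on_def)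
  hence "((%y. p y / q y * y i) \<longlongrightarrow> 0) (at x within A)"
   by(rule Lim_null_comparison[rotated]) (use le in "auto simp: eventually_at_filter")
  thus ?thesis using True by(simp add: continuous_within x0)
 qed
 thus "con A (%x. scal (p x / q x) x i)"
  by(simp add: scal_def continuous_on_eq_continuous_within)
qed

definition sdim :: "('n => 'b) => 'n set => nat" where
 "sdim blk N = card N - card (blk ` N)"

text \<open>In each block one name, its \<open>base\<close>, is eliminated by the condition on the
  sum; the \<open>free\<close> names give linear coordinates about the barycentre
  \<open>ctr\<close>, and \<open>lin\<close> recovers all coordinates from them. \<open>gg\<close>
  is the gauge of the polytope in these coordinates, and \<open>chi\<close> rescales each ray so
  that the Euclidean norm turns into the gauge, which carries the ball onto the polytope.\<close>

locale shape_disc =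
 fixes blk :: "'n => 'b" and N :: "'n set"
 assumes finN: "finite N"
begin

definition base :: "'n => 'n" where "base m = (SOME k. k : N & blk k = blk m)"
definition free :: "'n set" where "free = N - base ` N"
definition enum :: "nat => 'n" where "enum = (SOME f. bij_betw f {..<card free} free)"
definition index :: "'n => nat" where "index = inv_into {..<card free} enum"
definition ctr :: "'n => real" where "ctr m = 1 / real (card (blok blk N m))"
definition lin :: "rseq => 'n => real" where
 "lin v m = (if m : free then v (index m) else - (SUM k:free Int blok blk N m. v (index k)))"
definition gg :: "rseq => real" where
 "gg v = (if N = {} then 0 else Max ((%m. - (lin v m / ctr m)) ` N))"
definition chi :: "rseq => 'n => real" where
 "chi x m = (if m : N then ctr m + lin (scal (nrm (card free) x / gg x) x) m else 0)"
definition vec :: "('n => real) => nat => real" where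
 "vec z i = (if i < card free then z (enum i) - ctr (enum i) else 0)"
definition chi_inv :: "('n => real) => nat => real" where
 "chi_inv z = scal (gg (vec z) / nrm (card free) (vec z)) (vec z)"

lemma base: "m : N ==> base m : N & blk (base m) = blk m"
 unfolding base_def by(rule someI[of _ m]) simp

lemma base_eq: "blk m = blk k ==> base m = base k"
 by(simp add: base_def)

lemma base_base: "m : N ==> base (base m) = base m"
 using base base_eq by blast

lemma finite_free: "finite free"
 using finN by(simp add: free_def)

lemma card_free: "card free = sdim blk N"
proof -
 have "inj_on blk (base ` N)"
  by(rule inj_onI) (metis base_base base_eq imageE)
 moreover have "blk ` base ` N = blk ` N"
  unfolding image_image by(rule image_cong) (simp_all add: base)
 ultimately have "card (base ` N) = card (blk ` N)" by(metis card_image)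
 moreover have "base ` N <= N" using base by blast
 ultimately show ?thesis using finN by(simp add: free_def sdim_def card_Diff_subset finite_subset)
qed

lemma bij_enum: "bij_betw enum {..<card free} free"
 using ex_bij_betw_nat_finite[OF finite_free] unfolding enum_def lessThan_atLeast0 by(rule someI_ex)

lemma enum_in: "i < card free ==> enum i : free"
 using bij_enum by(auto simp: bij_betw_def)

lemma index_enum: "i < card free ==> index (enum i) = i"
 unfolding index_def using bij_enum by(simp add: bij_betw_def)

lemma enum_index: "m : free ==> enum (index m) = m" and index_less: "m : free ==> index m < card free"
proof -
 assume "m : free"
 hence "m : enum ` {..<card free}" using bij_enum by(simp add: bij_betw_def)
 from f_inv_into_f[OF this] inv_into_into[OF this] show "enum (index m) = m" "index m < card free"
  by(simp_all add: index_def)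
qed

lemma ctr_pos: "m : N ==> 0 < ctr m" and ctr_le_1: "m : N ==> ctr m <= 1"
proof -
 assume "m : N"
 hence "m : blok blk N m" "finite (blok blk N m)" using finN by(simp_all add: blok_def)
 hence "0 < card (blok blk N m)" unfolding card_gt_0_iff by blast
 thus "0 < ctr m" "ctr m <= 1" by(simp_all add: ctr_def)
qed

lemma blok_same: "k : blok blk N m ==> blok blk N k = blok blk N m"
 by(auto simp: blok_def)

lemma finite_blok: "finite (blok blk N m)"
 using finN by(simp add: blok_def)

lemma sum_ctr: "m : N ==> sum ctr (blok blk N m) = 1"
proof -
 assume m: "m : N"
 have "sum ctr (blok blk N m) = (SUM k:blok blk N m. 1 / real (card (blok blk N m)))"
  by(rule sum.cong[OF refl]) (simp only: ctr_def blok_same[of _ m])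
 moreover have "card (blok blk N m) ~= 0" using m finite_blok by(auto simp: blok_def)
 ultimately show ?thesis by simp
qed

lemma base_blok: "m : N ==> blok blk N m = insert (base m) (free Int blok blk N m) & base m ~: free"
proof -
 assume m: "m : N"
 have "k = base m" if "k : base ` N" "blk k = blk m" for k
  using that base base_eq base_base by(metis imageE)
 thus ?thesis using base[OF m] m by(auto simp: blok_def free_def)
qed

lemma sum_block_split: "m : N ==> sum f (blok blk N m) = f (base m) + sum f (free Int blok blk N m)"
 using base_blok[of m] finite_free by(metis Int_iff finite_Int sum.insert)

lemma sum_lin: "m : N ==> sum (lin v) (blok blk N m) = 0"
proof -
 assume m: "m : N"
 have "base m : blok blk N m" using base[OF m] by(simp add: blok_def)
 hence "lin v (base m) = - (SUM k:free Int blok blk N m. v (index k))"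
  using base_blok[OF m] blok_same[of "base m" m] by(simp add: lin_def)
 moreover have "sum (lin v) (free Int blok blk N m) = (SUM k:free Int blok blk N m. v (index k))"
  by(rule sum.cong) (auto simp: lin_def)
 ultimately show ?thesis unfolding sum_block_split[OF m] by simp
qed

lemma gg_empty: "N = {} ==> gg v = 0"
 unfolding gg_def by(rule if_P)

lemma lin_scal: "lin (scal c v) m = c * lin v m"
 by(simp add: lin_def scal_def sum_distrib_left)

lemma lin_ge: "m : N ==> - (ctr m * gg v) <= lin v m"
proof -
 assume m: "m : N"
 have "- (lin v m / ctr m) <= gg v" using m finN by(auto simp: gg_def intro!: Max_ge)
 hence "- gg v <= lin v m / ctr m" by linarith
 thus ?thesis using ctr_pos[OF m] by(simp add: pos_le_divide_eq mult.commute)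
qed

lemma gg_attained: "N ~= {} ==> EX m:N. gg v = - (lin v m / ctr m)"
proof -
 assume "N ~= {}"
 hence "gg v : (%m. - (lin v m / ctr m)) ` N" unfolding gg_def using finN by(simp add: Max_in)
 thus ?thesis by auto
qed

lemma gg_nonneg: "0 <= gg v"
proof(cases "N = {}")
 case False
 then obtain m where m: "m : N" by blast
 have "EX k:blok blk N m. lin v k <= 0"
 proof(rule ccontr)
  assume "~ ?thesis"
  hence "!!k. k : blok blk N m ==> 0 < lin v k" by(meson not_le)
  moreover have "blok blk N m ~= {}" using m by(auto simp: blok_def)
  ultimately have "0 < sum (lin v) (blok blk N m)" using finite_blok by(simp add: sum_pos)
  thus False using sum_lin[OF m] by simp
 qed
 then obtain k where k: "k : N" "lin v k <= 0" by(auto simp: blok_def)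
 have "0 <= - (lin v k / ctr k)" using k ctr_pos[OF k(1)] by(simp add: divide_nonpos_pos)
 also have "... <= gg v" using k finN by(auto simp: gg_def intro!: Max_ge)
 finally show ?thesis .
qed (metis gg_empty order_refl)

text \<open>The entries of \<open>lin v\<close> in a block add up to 0, so a large positive entry
  forces negative ones elsewhere in the block, and these are bounded by the gauge.\<close>

lemma lin_le: "m : N ==> \<bar>lin v m\<bar> <= gg v"
proof -
 assume m: "m : N"
 have mb: "m : blok blk N m" using m by(simp add: blok_def)
 have "lin v m = - sum (lin v) (blok blk N m - {m})"
  using sum_lin[OF m, of v] sum.remove[OF finite_blok mb, of "lin v"] by linarith
 also have "... <= sum (%k. ctr k * gg v) (blok blk N m - {m})"
  unfolding sum_negf[symmetric] by(rule sum_mono) (use lin_ge[of _ v] in "fastforce simp: blok_def")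
 also have "... = (1 - ctr m) * gg v"
  using sum_ctr[OF m] sum.remove[OF finite_blok mb, of ctr] by(simp flip: sum_distrib_right)
 also have "... <= gg v" using ctr_pos[OF m] gg_nonneg[of v] by(simp add: mult_le_cancel_right2)
 finally have "lin v m <= gg v" .
 moreover have "- gg v <= lin v m"
  using lin_ge[OF m, of v] mult_right_mono[OF ctr_le_1[OF m] gg_nonneg[of v]] by simp
 ultimately show ?thesis by simp
qed

definition dom :: "rseq set" where "dom = {v. ALL i>=card free. v i = 0}"

lemma coord_le: "v : dom ==> \<bar>v i\<bar> <= gg v"
proof(cases "i < card free")
 case True
 have "lin v (enum i) = v i" using enum_in[OF True] index_enum[OF True] by(simp add: lin_def)
 thus ?thesis using lin_le[of "enum i" v] enum_in[OF True] by(simp add: free_def)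
next
 case False
 assume "v : dom"
 thus ?thesis using False gg_nonneg by(simp add: dom_def)
qed

lemma coord_le_nrm: "v : dom ==> \<bar>v i\<bar> <= nrm (card free) v"
 using nrm_coord[of i "card free" v] nrm_nonneg[of "card free" v] by(cases "i < card free") (auto simp: dom_def)

lemma gg_zero: "gg (%_. 0) = 0"
proof -
 have "lin (%_. 0) m = 0" for m by(simp add: lin_def)
 thus ?thesis using gg_attained[of "%_. 0"] by(cases "N = {}") (metis gg_empty, auto)
qed

lemma gg_scal: "0 <= c ==> gg (scal c v) = c * gg v"
proof(cases "N = {}")
 case False
 assume c: "0 <= c"
 have "mono ((*) c)" using c by(intro monoI mult_left_mono)
 from mono_Max_commute[OF this, of "(%m. - (lin v m / ctr m)) ` N"]
 show ?thesis using False finN by(simp add: gg_def lin_scal image_image)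
qed (metis gg_empty mult_zero_right)

lemma continuous_on_lin: "con B (%v. lin v m)"
proof -
 have "con B (%v::nat => real. v i)" for i by(rule continuous_on_coord[OF continuous_on_id])
 thus ?thesis
  by(cases "m : free") (simp_all add: lin_def continuous_on_minus continuous_on_sum)
qed

lemma continuous_on_gg: "con B gg"
proof(cases "N = {}")
 case False
 have "con B (%v. Max ((%m. - (lin v m / ctr m)) ` N))"
 proof(rule continuous_on_Max_image[OF finN False])
  fix m assume m: "m : N"
  hence "ctr m ~= 0" using ctr_pos by force
  thus "con B (%v. - (lin v m / ctr m))"
   by(intro continuous_on_minus continuous_on_divide continuous_on_lin continuous_on_const) simp
 qed
 thus ?thesis using False by(simp add: gg_def[abs_def])
next
 case True
 have "gg = (%_. 0)" by(rule ext) (rule gg_empty[OF True])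
 thus ?thesis by simp
qed

lemma gg_nrm_zero: "v : dom ==> gg v = 0 <-> v = (%_. 0)" "v : dom ==> nrm (card free) v = 0 <-> v = (%_. 0)"
proof -
 assume v: "v : dom"
 show "gg v = 0 <-> v = (%_. 0)" using coord_le[OF v] gg_zero by(fastforce simp: fun_eq_iff)
 have "nrm (card free) (%_. 0) = 0" by(simp add: nrm_def)
 thus "nrm (card free) v = 0 <-> v = (%_. 0)" using coord_le_nrm[OF v] by(fastforce simp: fun_eq_iff)
qed

lemma scal_dom: "v : dom ==> scal c v : dom"
 by(simp add: dom_def scal_def)

lemma dsk_dom: "dsk (card free) <= dom"
 by(auto simp: dsk_def dom_def)

lemma vec_dom: "vec z : dom"
 by(simp add: vec_def dom_def)

lemma gg_radial: "x : dom ==> gg (scal (nrm (card free) x / gg x) x) = nrm (card free) x"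
 using gg_nrm_zero[of x] gg_nonneg[of x] nrm_nonneg[of "card free" x]
 by(subst gg_scal) auto

lemma nrm_radial: "v : dom ==> nrm (card free) (scal (gg v / nrm (card free) v) v) = gg v"
 using gg_nrm_zero[of v] gg_nonneg[of v] nrm_nonneg[of "card free" v] by auto

lemma continuous_on_chi: "con (dsk (card free)) chi"
proof(rule con_prod)
 fix m
 have "con (dsk (card free)) (%x. scal (nrm (card free) x / gg x) x)"
 proof(rule continuous_on_subset[OF radial_continuous dsk_dom])
  show "nrm (card free) (%_. 0) = 0" by(simp add: nrm_def)
 qed (use coord_le nrm_nonneg continuous_on_gg continuous_on_nrm in auto)
 hence "con (dsk (card free)) (%x. lin (scal (nrm (card free) x / gg x) x) m)"
  by(rule continuous_on_compose2[OF continuous_on_lin[of UNIV]]) simp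
 thus "con (dsk (card free)) (%x. chi x m)"
  by(cases "m : N") (simp_all add: chi_def continuous_on_add)
qed

lemma continuous_on_chi_inv: "con B chi_inv"
proof -
 have v: "con B vec"
 proof(rule con_prod)
  fix i
  have "con B (%z::'n => real. z (enum i))" by(rule continuous_on_coord[OF continuous_on_id])
  thus "con B (%z. vec z i)"
   by(cases "i < card free") (simp_all add: vec_def continuous_on_diff)
 qed
 have "con dom (%x. scal (gg x / nrm (card free) x) x)"
  by(rule radial_continuous) (use coord_le_nrm gg_nonneg continuous_on_gg continuous_on_nrm gg_zero in auto)
 thus ?thesis unfolding chi_inv_def[abs_def]
  by(rule continuous_on_compose2[OF _ v]) (use vec_dom in auto)
qed

lemma lin_vec: "z : shape blk N ==> m : N ==> lin (vec z) m = z m - ctr m"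
proof(cases "m : free")
 case True
 thus ?thesis using index_less[OF True] enum_index[OF True] by(simp add: lin_def vec_def)
next
 case False
 assume z: "z : shape blk N" and m: "m : N"
 have "m = base m" using False m base_blok[OF m] by(auto simp: blok_def)
 hence s: "sum f (blok blk N m) = f m + sum f (free Int blok blk N m)" for f :: "'n => real"
  using sum_block_split[OF m, of f] by simp
 have "(SUM k:free Int blok blk N m. vec z (index k)) = (SUM k:free Int blok blk N m. z k - ctr k)"
  by(rule sum.cong) (use index_less enum_index in "auto simp: vec_def")
 also have "... = (1 - z m) - (1 - ctr m)"
  using s[of z] s[of ctr] sum_ctr[OF m] z m by(simp add: sum_subtractf shape_def)
 finally show ?thesis using False by(simp add: lin_def)
qed

lemma chi_shape: "x : dsk (card free) ==> chi x : shape blk N"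
proof -
 assume x: "x : dsk (card free)"
 let ?v = "scal (nrm (card free) x / gg x) x"
 have g: "gg ?v <= 1" using gg_radial[of x] x dsk_dom by(auto simp: dsk_def)
 have "0 <= chi x m" if m: "m : N" for m
 proof -
  have "ctr m * gg ?v <= ctr m"
   using mult_left_mono[OF g less_imp_le[OF ctr_pos[OF m]]] by(simp only: mult_1_right)
  hence "0 <= ctr m + lin ?v m" using lin_ge[OF m, of ?v] by linarith
  thus ?thesis using m by(simp add: chi_def)
 qed
 moreover have "sum (chi x) (blok blk N m) = 1" if m: "m : N" for m
 proof -
  have "sum (chi x) (blok blk N m) = (SUM k:blok blk N m. ctr k + lin ?v k)"
   by(rule sum.cong) (auto simp: chi_def blok_def)
  thus ?thesis using sum_ctr[OF m] sum_lin[OF m] by(simp add: sum.distrib)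
 qed
 ultimately show ?thesis by(simp add: shape_def)
qed

lemma chi_boundary:
 assumes N: "N ~= {}" and x: "x : dsk (card free)"
 shows "(EX m:N. chi x m = 0) <-> x : sph (card free)"
proof -
 let ?v = "scal (nrm (card free) x / gg x) x"
 have g: "gg ?v = nrm (card free) x" using gg_radial[of x] x dsk_dom by auto
 have "(EX m:N. chi x m = 0) <-> gg ?v = 1"
 proof
  assume "EX m:N. chi x m = 0"
  then obtain m where m: "m : N" "ctr m + lin ?v m = 0" by(auto simp: chi_def)
  hence "ctr m * 1 <= ctr m * gg ?v" using lin_ge[OF m(1), of ?v] by linarith
  hence "1 <= gg ?v" using ctr_pos[OF m(1)] by(metis mult_le_cancel_left_pos)
  thus "gg ?v = 1" using g x by(simp add: dsk_def)
 next
  assume g1: "gg ?v = 1"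
  obtain m where m: "m : N" "gg ?v = - (lin ?v m / ctr m)" using gg_attained[OF N] by blast
  hence "lin ?v m = - ctr m" using g1 ctr_pos[OF m(1)] by(simp add: field_simps)
  thus "EX m:N. chi x m = 0" using m by(intro bexI[of _ m]) (simp_all add: chi_def)
 qed
 thus ?thesis using g x by(auto simp: dsk_def sph_def)
qed

lemma vec_chi: "x : dsk (card free) ==> vec (chi x) = scal (nrm (card free) x / gg x) x"
proof
 fix i assume x: "x : dsk (card free)"
 show "vec (chi x) i = scal (nrm (card free) x / gg x) x i"
 proof(cases "i < card free")
  case True
  thus ?thesis using enum_in[OF True] index_enum[OF True]
   by(simp add: vec_def chi_def lin_def free_def)
 next
  case False
  thus ?thesis using x by(simp add: vec_def scal_def dsk_def)
 qed
qed

lemma chi_inv_chi: "x : dsk (card free) ==> chi_inv (chi x) = x"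
proof -
 assume x: "x : dsk (card free)"
 hence d: "x : dom" using dsk_dom by blast
 let ?c = "nrm (card free) x / gg x"
 have c0: "0 <= ?c" using nrm_nonneg gg_nonneg by(simp add: divide_nonneg_nonneg)
 have "chi_inv (chi x) = scal (gg (scal ?c x) / nrm (card free) (scal ?c x) * ?c) x"
  unfolding chi_inv_def vec_chi[OF x] by simp
 also have "gg (scal ?c x) / nrm (card free) (scal ?c x) = nrm (card free) x / (?c * nrm (card free) x)"
  using gg_radial[OF d] c0 gg_nonneg[of x] nrm_nonneg[of "card free" x] by simp
 finally show ?thesis
  using gg_nrm_zero[OF d] by(cases "x = (%_. 0)") (simp_all add: scal_def)
qed

lemma chi_inv_dsk: "z : shape blk N ==> chi_inv z : dsk (card free)"
proof -
 assume z: "z : shape blk N"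
 have "gg (vec z) <= 1"
 proof(cases "N = {}")
  case False
  obtain m where m: "m : N" "gg (vec z) = - (lin (vec z) m / ctr m)" using gg_attained[OF False] by blast
  hence "gg (vec z) = - ((z m - ctr m) / ctr m)" using lin_vec[OF z m(1)] by simp
  also have "... = 1 - z m / ctr m" using ctr_pos[OF m(1)] by(simp add: diff_divide_distrib)
  also have "... <= 1" using z m ctr_pos[OF m(1)] by(simp add: shape_def)
  finally show ?thesis .
 next
  case True
  thus ?thesis by(metis gg_empty zero_le_one)
 qed
 thus ?thesis
  using nrm_radial[OF vec_dom, of z] scal_dom[OF vec_dom, of _ z]
  by(simp add: dsk_def chi_inv_def dom_def)
qed

lemma chi_chi_inv: "z : shape blk N ==> m : N ==> chi (chi_inv z) m = z m"
proof -
 assume z: "z : shape blk N" and m: "m : N"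
 let ?v = "vec z" and ?c = "gg (vec z) / nrm (card free) (vec z)"
 have c0: "0 <= ?c" using nrm_nonneg gg_nonneg by(simp add: divide_nonneg_nonneg)
 have "scal (nrm (card free) (chi_inv z) / gg (chi_inv z)) (chi_inv z) = ?v"
 proof(cases "?v = (%_. 0)")
  case False
  hence nz: "gg ?v ~= 0" "nrm (card free) ?v ~= 0" using gg_nrm_zero[OF vec_dom] by auto
  have "nrm (card free) (chi_inv z) = gg ?v" unfolding chi_inv_def by(rule nrm_radial[OF vec_dom])
  moreover have "gg (chi_inv z) = ?c * gg ?v" unfolding chi_inv_def by(rule gg_scal[OF c0])
  ultimately show ?thesis using nz by(simp add: chi_inv_def)
 qed (simp add: chi_inv_def scal_def)
 thus ?thesis using lin_vec[OF z m] m by(simp add: chi_def)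
qed

lemma chi_inv_cong: "(!!m. m : N ==> z m = z' m) ==> chi_inv z = chi_inv z'"
proof -
 assume eq: "!!m. m : N ==> z m = z' m"
 have "vec z i = vec z' i" for i using eq[of "enum i"] enum_in[of i] by(simp add: vec_def free_def)
 hence "vec z = vec z'" by(simp add: fun_eq_iff)
 thus ?thesis by(simp add: chi_inv_def)
qed

end

section \<open>Cylinders\<close>

text \<open>The cells over \<open>c\<close> of the cylinder are its two ends and the product \<open>Mid\<close> of \<open>c\<close> and an interval,
 with \<open>Inr True\<close> and \<open>Inr False\<close> vanishing at the ends \<open>Lo\<close> and \<open>Hi\<close>.\<close>

datatype cpos = Lo | Hi | Mid

fun cylN :: "('c => 'n set) => 'c * cpos => ('n + bool) set" where
 "cylN N (c, e) = Inl ` N c Un (if e = Mid then range Inr else {})"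

definition cylblk :: "('n => 'b) => 'n + bool => 'b + unit" where
 "cylblk blk = case_sum (%n. Inl (blk n)) (%_. Inr ())"

fun cylbd :: "('n => 'c => 'c) => 'n + bool => 'c * cpos => 'c * cpos" where
 "cylbd bd (Inl vp) (c, e) = (bd vp c, e)"
| "cylbd bd (Inr b) (c, e) = (c, if b then Lo else Hi)"

lemma cylblk_simps [simp]: "cylblk blk (Inl n) = Inl (blk n)" "cylblk blk (Inr b) = Inr ()"
 by(simp_all add: cylblk_def)

lemma prune_cyl:
 "prune (cylblk blk) (Inl ` A) = Inl ` prune blk A"
 "prune (cylblk blk) (Inl ` A Un range Inr) = Inl ` prune blk A Un range Inr"
 "prune (cylblk blk) (insert (Inr b) (Inl ` A)) = Inl ` prune blk A"
proof -
 have inl: "Inl n : prune (cylblk blk) (Inl ` A Un B) <-> n : prune blk A"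
  if "B <= range Inr" for n and B :: "('a + bool) set"
  using that by(auto simp: prune_def inj_image_mem_iff Bex_def)
 have inr: "Inr b : prune (cylblk blk) (Inl ` A Un B) <-> Inr False : B & Inr True : B"
  for B :: "('a + bool) set" and b
 proof -
  have "(EX m:Inl ` A Un B. m ~= Inr b & cylblk blk m = Inr ()) <-> Inr (~ b) : B"
  proof
   assume "EX m:Inl ` A Un B. m ~= Inr b & cylblk blk m = Inr ()"
   then obtain m where m: "m : Inl ` A Un B" "m ~= Inr b" "cylblk blk m = Inr ()" by blast
   then obtain b' where b': "m = Inr b'" by(cases m) simp_all
   hence "b' = (~ b)" using m(2) by simp
   thus "Inr (~ b) : B" using m(1) b' by auto
  qed (rule bexI[of _ "Inr (~ b)"], simp_all)
  thus ?thesis by(cases b) (auto simp: prune_def)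
 qed
 have eqI: "X = Y" if "!!n. Inl n : X <-> Inl n : Y" "!!b. Inr b : X <-> Inr b : Y" for X Y :: "('d + bool) set"
 proof(rule Set.set_eqI)
  fix x show "x : X <-> x : Y" using that(1)[of "projl x"] that(2)[of "projr x"] by(cases x) simp_all
 qed
 show "prune (cylblk blk) (Inl ` A) = Inl ` prune blk A"
  by(rule eqI) (use inl[of "{}"] inr[of _ "{}"] in "auto simp: inj_image_mem_iff")
 show "prune (cylblk blk) (Inl ` A Un range Inr) = Inl ` prune blk A Un range Inr"
  by(rule eqI) (use inl[of "range Inr"] inr[of _ "range Inr"] in "auto simp: inj_image_mem_iff")
 show "prune (cylblk blk) (insert (Inr b) (Inl ` A)) = Inl ` prune blk A"
  by(rule eqI) (use inl[of "{Inr b}"] inr[of _ "{Inr b}"] in "auto simp: inj_image_mem_iff")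
qed

lemma blok_cyl:
 "blok (cylblk blk) (Inl ` A Un B) (Inl n) = Inl ` blok blk A n" if "B <= range Inr"
 using that by(auto simp: blok_def)

lemma blok_cyl_Inr: "blok (cylblk blk) (Inl ` A Un range Inr) (Inr b) = {Inr False, Inr True}"
 by(auto simp: blok_def image_iff)

lemma shape_cyl:
 "Z : shape (cylblk blk) (Inl ` A) <-> (%n. Z (Inl n)) : shape blk A"
 "Z : shape (cylblk blk) (Inl ` A Un range Inr) <->
   (%n. Z (Inl n)) : shape blk A & 0 <= Z (Inr False) & 0 <= Z (Inr True) & Z (Inr False) + Z (Inr True) = 1"
proof -
 have s: "sum Z (Inl ` blok blk A n) = sum (%n. Z (Inl n)) (blok blk A n)" for n
  by(simp add: sum.reindex)
 show "Z : shape (cylblk blk) (Inl ` A) <-> (%n. Z (Inl n)) : shape blk A"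
  using blok_cyl[of "{}" blk A] by(auto simp: shape_def s)
 have all: "(ALL b. P b) <-> P False & P True" for P :: "bool => bool" by(metis (full_types))
 show "Z : shape (cylblk blk) (Inl ` A Un range Inr) <->
   (%n. Z (Inl n)) : shape blk A & 0 <= Z (Inr False) & 0 <= Z (Inr True) & Z (Inr False) + Z (Inr True) = 1"
  using blok_cyl[of "range Inr" blk A] blok_cyl_Inr[of blk A]
  by(auto simp: shape_def s ball_Un all)
qed

context named_complex
begin

lemma cyl_named_complex: "named_complex (C \<times> UNIV) (cylN N) (cylblk blk) (cylbd bd)"
proof
 fix c :: "'c * cpos" assume "c : C \<times> UNIV"
 then obtain a e where c: "c = (a, e)" "a : C" by(cases c) auto
 show "finite (cylN N c)" using N_fin[OF c(2)] c(1) by simp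
 show "prune (cylblk blk) (cylN N c) = cylN N c"
  using N_full[OF c(2)] c(1) by(simp add: prune_cyl)
next
 fix c :: "'c * cpos" and vp assume a: "c : C \<times> UNIV" "vp : cylN N c"
 then obtain a e where c: "c = (a, e)" "a : C" by(cases c) auto
 show "cylbd bd vp c : C \<times> UNIV"
  using a c bd_in by(cases vp) (auto split: if_splits)
 show "cylN N (cylbd bd vp c) = prune (cylblk blk) (cylN N c - {vp})"
 proof(cases vp)
  case (Inl n)
  hence n: "n : N a" using a c by(auto split: if_splits)
  have "cylN N c - {vp} = Inl ` (N a - {n}) Un (if e = Mid then range Inr else {})"
   using c Inl by auto
  thus ?thesis using N_bd[OF c(2) n] c Inl by(simp add: prune_cyl)
 next
  case (Inr b)
  hence e: "e = Mid" using a c by(auto split: if_splits)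
  have "range (Inr :: bool => 'n + bool) - {Inr b} = {Inr (~ b)}" by auto
  hence "cylN N c - {vp} = insert (Inr (~ b)) (Inl ` N a)"
   using c Inr e by auto
  thus ?thesis using N_full[OF c(2)] c Inr by(simp add: prune_cyl)
 qed
 fix vq assume "vq : cylN N (cylbd bd vp c)"
 thus "cylbd bd vq (cylbd bd vp c) = cylbd bd vp (cylbd bd vq c)"
  using a c bd_comm[OF c(2)] by(cases vp; cases vq) (auto split: if_splits)
qed

end

lemma trans_inv_image_lex:
 "trans R ==> trans S ==> trans (inv_image (R <*lex*> S) f)"
 by(intro trans_inv_image trans_lex_prod)

context matching
begin

definition cyl_crit :: "'c * cpos => bool" where "cyl_crit x <-> snd x ~= Mid | crit (fst x)"
definition cyl_tau :: "'c * cpos => 'c * cpos" where "cyl_tau x = (tau (fst x), snd x)"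
definition cyl_phi :: "'c * cpos => 'n + bool" where "cyl_phi x = Inl (phi (fst x))"
definition cyl_R :: "(('c * cpos) \<times> ('c * cpos)) set" where
 "cyl_R = inv_image (less_than <*lex*> R) (%x. (if snd x = Mid then 1 else 0::nat, fst x))"

text \<open>Both ends of the cylinder count as critical, so that values can be prescribed there; the
  middle cells inherit the matching and come after the ends in \<open>cyl_R\<close>.\<close>

lemma cyl_matching: "matching (C \<times> UNIV) (cylN N) (cylblk blk) (cylbd bd) cyl_R cyl_crit cyl_tau cyl_phi"
proof(intro matching.intro cyl_named_complex matching_axioms.intro)
 show "wf cyl_R" unfolding cyl_R_def by(intro wf_inv_image wf_lex_prod wf_less_than wfR)
 show "trans cyl_R" unfolding cyl_R_def by(intro trans_inv_image_lex trans_less_than transR)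
next
 fix x :: "'c * cpos" assume x: "x : C \<times> UNIV" "~ cyl_crit x"
 then obtain c where c: "x = (c, Mid)" "c : C" "~ crit c" by(cases x) (auto simp: cyl_crit_def)
 show "cyl_tau x : C \<times> UNIV" "cyl_phi x : cylN N (cyl_tau x)"
  using tau_in[OF c(2,3)] phi_in[OF c(2,3)] by(simp_all add: c(1) cyl_tau_def cyl_phi_def)
 show "~ cyl_crit (cyl_tau x) & cyl_tau (cyl_tau x) = cyl_tau x & cyl_phi (cyl_tau x) = cyl_phi x"
  using tau_tau[OF c(2,3)] by(simp add: c(1) cyl_tau_def cyl_phi_def cyl_crit_def)
 show "~ cyl_crit (cylbd bd (cyl_phi x) (cyl_tau x)) & cyl_tau (cylbd bd (cyl_phi x) (cyl_tau x)) = cyl_tau x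
   & cyl_phi (cylbd bd (cyl_phi x) (cyl_tau x)) = cyl_phi x"
  using tau_sig[OF c(2,3)] by(simp add: c(1) cyl_tau_def cyl_phi_def cyl_crit_def)
 show "x = cyl_tau x | x = cylbd bd (cyl_phi x) (cyl_tau x)"
  using tau_cases[OF c(2,3)] by(simp add: c(1) cyl_tau_def cyl_phi_def)
 show "(cylbd bd (cyl_phi x) (cyl_tau x), cyl_tau x) : cyl_R"
  using sig_R[OF c(2,3)] by(simp add: c(1) cyl_tau_def cyl_phi_def cyl_R_def)
 fix vq assume "vq : cylN N (cyl_tau x)" "vq ~= cyl_phi x"
 thus "(cylbd bd vq (cyl_tau x), x) : cyl_R"
  using horn_R[OF c(2,3)] by(cases vq) (auto simp: c(1) cyl_tau_def cyl_phi_def cyl_R_def)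
next
 fix x :: "'c * cpos" and vq assume x: "x : C \<times> UNIV" "cyl_crit x" "vq : cylN N x"
 then obtain c e where c: "x = (c, e)" "c : C" "e ~= Mid | crit c" by(cases x) (auto simp: cyl_crit_def)
 show "(cylbd bd vq x, x) : cyl_R"
 proof(cases vq)
  case (Inl n)
  hence "n : N c" using x(3) c(1) by(auto split: if_splits)
  thus ?thesis using facet_R[OF c(2)] Inl by(simp add: c(1) cyl_R_def)
 next
  case (Inr b)
  hence "e = Mid" using x(3) c(1) by(auto split: if_splits)
  thus ?thesis using Inr by(simp add: c(1) cyl_R_def)
 qed
qed

text \<open>A representative of the pair containing \<open>c\<close>. It serves to rank base cells
  in \<open>pri_R\<close> in a way that does not distinguish the two members of a pair.\<close>

definition sig :: "'c => 'c" where "sig c = (if crit c then c else bd (phi c) (tau c))"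

definition urk :: "cpos => nat" where "urk u = (case u of Lo => 0 | Hi => 1 | Mid => 2)"

text \<open>The matching on the double cylinder. Prescribed are the ends of the outer cylinder and
  everything over the inner \<open>Lo\<close>. Over a critical base cell the inner prism is paired
  with its end \<open>Hi\<close>, the facet where \<open>Inr False\<close> vanishes; over a matched
  base cell the first matching is used, both at \<open>Hi\<close> and at \<open>Mid\<close>.\<close>

definition pri_crit :: "('c * cpos) * cpos => bool" where
 "pri_crit x <-> snd x ~= Mid | snd (fst x) = Lo"
definition pri_tau :: "('c * cpos) * cpos => ('c * cpos) * cpos" where
 "pri_tau x = (if crit (fst (fst x)) then (fst (fst x), Mid) else (tau (fst (fst x)), snd (fst x)), snd x)"
definition pri_phi :: "('c * cpos) * cpos => ('n + bool) + bool" where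
 "pri_phi x = Inl (if crit (fst (fst x)) then Inr False else Inl (phi (fst (fst x))))"
text \<open>\<open>sig\<close> comes before \<open>urk\<close> because a horn facet of the prism
  over a critical cell may be a whole prism over a facet of that cell. \<open>urk\<close> comes
  before the base cell itself because the ends over the larger cell of a pair have to precede the
  prism over the smaller one.\<close>

definition pri_R where
 "pri_R = inv_image (less_than <*lex*> (R <*lex*> (less_than <*lex*> R)))
   (%x. (if snd x = Mid then 1 else 0::nat, (sig (fst (fst x)), (urk (snd (fst x)), fst (fst x)))))"

lemma sig_below: "c : C ==> (c, c') : R ==> (sig c, c') : R"
proof(cases "crit c")
 case False
 assume c: "c : C" "(c, c') : R"
 have s: "sig c = bd (phi c) (tau c)" using False by(simp add: sig_def)
 consider "c = tau c" | "c = bd (phi c) (tau c)" using tau_cases[OF c(1) False] by blast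
 thus ?thesis
 proof cases
  case 1
  have "(bd (phi c) (tau c), c) : R" using sig_R[OF c(1) False] 1 by simp
  thus ?thesis unfolding s using c(2) by(rule transD[OF transR])
 next
  case 2
  show ?thesis unfolding s using c(2) 2 by simp
 qed
qed (simp add: sig_def)

text \<open>\<open>horn_R\<close> applies to both members of a pair, so the horn facet precedes the
  smaller one as well, and passing from the facet to its own \<open>sig\<close> only goes further
  down.\<close>

lemma sig_horn:
 "[|c : C; ~ crit c; vq : N (tau c); vq ~= phi c|] ==> (sig (bd vq (tau c)), sig c) : R"
proof -
 assume c: "c : C" "~ crit c" "vq : N (tau c)" "vq ~= phi c"
 let ?s = "bd (phi c) (tau c)"
 have s: "?s : C" "~ crit ?s" "tau ?s = tau c" "phi ?s = phi c"
  using bd_in[OF tau_in[OF c(1,2)] phi_in[OF c(1,2)]] tau_sig[OF c(1,2)] by auto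
 have "(bd vq (tau c), ?s) : R" using horn_R[OF s(1,2)] s(3,4) c by simp
 thus ?thesis using sig_below bd_in[OF tau_in[OF c(1,2)] c(3)] c(2) by(simp add: sig_def)
qed

lemma sig_pair: "[|c : C; ~ crit c|] ==> sig (tau c) = sig c & sig (bd (phi c) (tau c)) = sig c"
 using tau_tau[of c] tau_sig[of c] by(simp add: sig_def)

lemma sig_facet:
 assumes c: "c : C" "vq : N c"
 shows "(sig (bd vq c), sig c) : R | sig (bd vq c) = sig c"
proof(cases "crit c")
 case True
 thus ?thesis using sig_below[OF bd_in[OF c] facet_R[OF c]] by(simp add: sig_def)
next
 case nc: False
 consider "c = tau c" "vq = phi c" | "c = tau c" "vq ~= phi c" | "c = bd (phi c) (tau c)"
  using tau_cases[OF c(1) nc] by blast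
 thus ?thesis
 proof cases
  case 1
  thus ?thesis using sig_pair[OF c(1) nc] by metis
 next
  case 2
  thus ?thesis using sig_horn[OF c(1) nc, of vq] c(2) by metis
 next
  case 3
  hence "sig c = c" using nc by(simp add: sig_def)
  thus ?thesis using sig_below[OF bd_in[OF c] facet_R[OF c]] by simp
 qed
qed

lemma pri_matching:
 "matching ((C \<times> UNIV) \<times> UNIV) (cylN (cylN N)) (cylblk (cylblk blk)) (cylbd (cylbd bd)) pri_R pri_crit pri_tau pri_phi"
proof(intro matching.intro matching_axioms.intro)
 interpret cy: named_complex "C \<times> UNIV" "cylN N" "cylblk blk" "cylbd bd" by(rule cyl_named_complex)
 show "named_complex ((C \<times> UNIV) \<times> UNIV) (cylN (cylN N)) (cylblk (cylblk blk)) (cylbd (cylbd bd))"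
  by(rule cy.cyl_named_complex)
 show "wf pri_R" unfolding pri_R_def by(intro wf_inv_image wf_lex_prod wf_less_than wfR)
 show "trans pri_R" unfolding pri_R_def by(intro trans_inv_image trans_lex_prod trans_less_than transR)
next
 fix x :: "('c * cpos) * cpos" assume x: "x : (C \<times> UNIV) \<times> UNIV" "~ pri_crit x"
 then obtain c u where c: "x = ((c, u), Mid)" "c : C" "u ~= Lo" by(cases x) (auto simp: pri_crit_def)
 show "pri_tau x : (C \<times> UNIV) \<times> UNIV" using tau_in[OF c(2)] c by(simp add: pri_tau_def)
 show "pri_phi x : cylN (cylN N) (pri_tau x)"
  using phi_in[OF c(2)] by(auto simp: c(1) pri_tau_def pri_phi_def)
 show "~ pri_crit (pri_tau x) & pri_tau (pri_tau x) = pri_tau x & pri_phi (pri_tau x) = pri_phi x"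
  using tau_tau[OF c(2)] c(3) by(simp add: c(1) pri_tau_def pri_phi_def pri_crit_def)
 show "~ pri_crit (cylbd (cylbd bd) (pri_phi x) (pri_tau x)) &
   pri_tau (cylbd (cylbd bd) (pri_phi x) (pri_tau x)) = pri_tau x &
   pri_phi (cylbd (cylbd bd) (pri_phi x) (pri_tau x)) = pri_phi x"
  using tau_sig[OF c(2)] c(3) by(simp add: c(1) pri_tau_def pri_phi_def pri_crit_def)
 show "x = pri_tau x | x = cylbd (cylbd bd) (pri_phi x) (pri_tau x)"
  using tau_cases[OF c(2)] c(3) by(cases u) (auto simp: c(1) pri_tau_def pri_phi_def)
 show "(cylbd (cylbd bd) (pri_phi x) (pri_tau x), pri_tau x) : pri_R"
  using sig_R[OF c(2)] sig_pair[OF c(2)]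
  by(simp add: c(1) pri_tau_def pri_phi_def pri_R_def urk_def)
 fix vq assume vq: "vq : cylN (cylN N) (pri_tau x)" "vq ~= pri_phi x"
 show "(cylbd (cylbd bd) vq (pri_tau x), x) : pri_R"
 proof(cases vq)
  case (Inr b)
  thus ?thesis by(simp add: c(1) pri_tau_def pri_R_def)
 next
  case (Inl vq1)
  show ?thesis
  proof(cases "crit c")
   case cr: True
   hence vq1: "vq1 : cylN N (c, Mid)" "vq1 ~= Inr False"
    using vq Inl by(auto simp: c(1) pri_tau_def pri_phi_def)
   show ?thesis
   proof(cases vq1)
    case (Inl n)
    hence n: "n : N c" using vq1 by auto
    have "(sig (bd n c), sig c) : R"
     using sig_below[OF bd_in[OF c(2) n] facet_R[OF c(2) n]] cr by(simp add: sig_def)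
    thus ?thesis using \<open>vq = Inl vq1\<close> Inl cr by(simp add: c(1) pri_tau_def pri_R_def)
   next
    case (Inr b)
    hence "b" using vq1 by simp
    thus ?thesis using \<open>vq = Inl vq1\<close> Inr cr c(3) by(cases u) (simp_all add: c(1) pri_tau_def pri_R_def urk_def)
   qed
  next
   case nc: False
   hence vq1: "vq1 : cylN N (tau c, u)" "vq1 ~= Inl (phi c)"
    using vq Inl by(auto simp: c(1) pri_tau_def pri_phi_def)
   show ?thesis
   proof(cases vq1)
    case (Inl n)
    hence n: "n : N (tau c)" "n ~= phi c" using vq1 by(auto split: if_splits)
    thus ?thesis using sig_horn[OF c(2) nc n] \<open>vq = Inl vq1\<close> Inl nc
     by(simp add: c(1) pri_tau_def pri_R_def)
   next
    case (Inr b)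
    hence "u = Mid" using vq1 by(auto split: if_splits)
    thus ?thesis using sig_pair[OF c(2) nc] \<open>vq = Inl vq1\<close> Inr nc
     by(simp add: c(1) pri_tau_def pri_R_def urk_def)
   qed
  qed
 qed
next
 fix x :: "('c * cpos) * cpos" and vq
 assume x: "x : (C \<times> UNIV) \<times> UNIV" "pri_crit x" "vq : cylN (cylN N) x"
 then obtain c u s where c: "x = ((c, u), s)" "c : C" "s ~= Mid | u = Lo" by(cases x) (auto simp: pri_crit_def)
 show "(cylbd (cylbd bd) vq x, x) : pri_R"
 proof(cases vq)
  case (Inr b)
  hence "s = Mid" using x(3) c(1) by(auto split: if_splits)
  thus ?thesis using Inr by(simp add: c(1) pri_R_def)
 next
  case (Inl vq1)
  hence vq1: "vq1 : cylN N (c, u)" using x(3) c(1) by(auto split: if_splits)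
  show ?thesis
  proof(cases vq1)
   case i: (Inl n)
   hence n: "n : N c" using vq1 by(auto split: if_splits)
   show ?thesis using sig_facet[OF c(2) n] facet_R[OF c(2) n] Inl i by(auto simp: c(1) pri_R_def)
  next
   case i: (Inr b)
   hence "u = Mid" using vq1 by(auto split: if_splits)
   thus ?thesis using Inl i by(simp add: c(1) pri_R_def urk_def)
  qed
 qed
qed

end

section \<open>The Morse complex\<close>

text \<open>If the block of \<open>vp\<close> has a third element, one coordinate is lost and no
  block; if it has just two, both coordinates and the block disappear. Either way the difference
  drops by 1.\<close>

lemma sdim_facet:
 assumes N: "finite N" "prune blk N = N" and vp: "vp : N"
 shows "Suc (sdim blk (prune blk (N - {vp}))) = sdim blk N"
proof -
 obtain k where k: "k : N" "k ~= vp" "blk k = blk vp" using assms by(auto simp: prune_def)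
 have two: "EX m:N. m ~= n & blk m = blk n" if "n : N" for n using N(2) that by(auto simp: prune_def)
 have le: "card (blk ` B) < card B" if B: "finite B" "m : B" "n : B" "m ~= n" "blk m = blk n" for B m n
  using B card_image_le[of B blk] eq_card_imp_inj_on[of B blk] unfolding inj_on_def by(metis le_neq_implies_less)
 show ?thesis
 proof(cases "EX m:N. m ~= vp & m ~= k & blk m = blk vp")
  case True
  then obtain m where m: "m : N" "m ~= vp" "m ~= k" "blk m = blk vp" by blast
  have "EX l:N - {vp}. l ~= n & blk l = blk n" if n: "n : N - {vp}" for n
  proof(cases "blk n = blk vp")
   case True
   thus ?thesis using k m by(cases "n = k") auto
  next
   case False
   thus ?thesis using two[of n] n by(metis DiffE DiffI insertCI insertE emptyE)
  qed
  hence p: "prune blk (N - {vp}) = N - {vp}" by(auto simp: prune_def)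
  have "blk vp : blk ` (N - {vp})" using k by(metis DiffI image_eqI singletonD)
  moreover have "N = insert vp (N - {vp})" using vp by blast
  ultimately have "blk ` (N - {vp}) = blk ` N" by(metis image_insert insert_absorb)
  moreover have "card N = Suc (card (N - {vp}))" by(rule card.remove[OF N(1) vp])
  moreover have "card (blk ` (N - {vp})) <= card (N - {vp})" using N by(intro card_image_le) simp
  ultimately show ?thesis unfolding p by(simp add: sdim_def)
 next
  case False
  have ne: "blk n ~= blk vp" if "n : N - {vp, k}" for n using False that by auto
  have "prune blk (N - {vp}) = N - {vp, k}"
  proof(rule Set.set_eqI)
   fix n
   show "n : prune blk (N - {vp}) <-> n : N - {vp, k}"
   proof(cases "n : N - {vp, k}")
    case True
    then obtain m where "m : N" "m ~= n" "blk m = blk n" using two by blast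
    thus ?thesis using True ne[OF True] by(auto simp: prune_def)
   next
    case F: False
    thus ?thesis using False k by(auto simp: prune_def)
   qed
  qed
  moreover have "blk ` N = insert (blk vp) (blk ` (N - {vp, k}))" using vp k by(auto simp: image_iff)
  moreover have "blk vp ~: blk ` (N - {vp, k})" using ne by(metis imageE)
  moreover have "card (N - {vp}) = Suc (card (N - {vp} - {k}))" by(rule card.remove) (use N k in auto)
  hence "card N = Suc (Suc (card (N - {vp, k})))"
   using card.remove[OF N(1) vp] Diff_insert2[of N vp "{k}"] by simp
  moreover have "card (blk ` (N - {vp, k})) <= card (N - {vp, k})" using N by(intro card_image_le) simp
  ultimately show ?thesis using N by(simp add: sdim_def)
 qed
qed

lemma istopology_final:
 "istopology (%V. V <= P & (ALL j:J. openin (X j) {x : topspace (X j). f j x : V}))"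
proof -
 have "{x : topspace (X j). f j x : S Int T} = {x : topspace (X j). f j x : S} Int {x : topspace (X j). f j x : T}" for j S T
  by auto
 moreover have "{x : topspace (X j). f j x : \<Union>K} = \<Union>((%V. {x : topspace (X j). f j x : V}) ` K)" for j K
  by auto
 ultimately show ?thesis unfolding istopology_def by(auto intro!: openin_Union)
qed

lemma continuous_map_final:
 assumes P: "!!j. j : J ==> f j : topspace (X j) \<rightarrow> P" and f: "!!x. x : topspace Y ==> g x : P"
  and g: "!!V. [|V <= P; !!j. j : J ==> openin (X j) {x : topspace (X j). f j x : V}|] ==>
   openin Y {x : topspace Y. g x : V}"
 shows "cmap Y (topology (%V. V <= P & (ALL j:J. openin (X j) {x : topspace (X j). f j x : V}))) g"
proof -
 let ?O = "%V. V <= P & (ALL j:J. openin (X j) {x : topspace (X j). f j x : V})"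
 have o: "openin (topology ?O) = ?O" by(rule topology_inverse'[OF istopology_final])
 have "{x : topspace (X j). f j x : P} = topspace (X j)" if "j : J" for j using P[OF that] by auto
 hence "?O P" by simp
 moreover have "topspace (topology ?O) = \<Union>(Collect ?O)" unfolding topspace_def[of "topology ?O"] o ..
 ultimately have t: "topspace (topology ?O) = P" by blast
 show ?thesis unfolding continuous_map t o using f g by blast
qed

context matching begin

lemma retr_rho: "matching_rho C N blk bd R crit tau phi (%c. retr blk (N c) (phi c))"
proof(intro matching_rho.intro matching_axioms matching_rho_axioms.intro)
 fix c z assume c: "c : C" "~ crit c"
 interpret sf: shape_facet blk "N (tau c)" "phi c" by(rule facet_tau[OF c])
 have p: "phi (tau c) = phi c" using tau_tau[OF c] by blast
 show "con (Sh (tau c)) (retr blk (N (tau c)) (phi (tau c)))"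
  unfolding p by(rule sf.continuous_on_retr)
 show "retr blk (N (tau c)) (phi (tau c)) z n = retr blk (N (tau c)) (phi (tau c)) z' n"
  if "!!n. n : N (tau c) ==> z n = z' n" "n : N (tau c)" for z z' n
  unfolding p using that by(rule sf.retr_cong)
 assume z: "z : Sh (tau c)"
 show "retr blk (N (tau c)) (phi (tau c)) z : Sh (tau c)" unfolding p by(rule sf.retr_shape[OF z])
 show "EX vq:N (tau c). vq ~= phi c & retr blk (N (tau c)) (phi (tau c)) z vq = 0"
  unfolding p using sf.retr_horn[OF z] by blast
qed

end

text \<open>Charts identifying critical cells with discs are a parameter because in the equivariant
  case they have to be transported from orbit representatives.\<close>

locale charted = matching C N blk bd R crit tau phi
 for C :: "'c set" and N :: "'c => 'n set" and blk :: "'n => 'b" and bd :: "'n => 'c => 'c"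
  and R crit tau phi +
 fixes chart :: "'c => rseq => 'n => real" and chinv :: "'c => ('n => real) => nat => real"
 assumes chart_cont: "[|c : C; crit c|] ==> con (dsk (sdim blk (N c))) (chart c)"
  and chinv_cont: "[|c : C; crit c|] ==> con (Sh c) (chinv c)"
  and chart_Sh: "[|c : C; crit c; x : dsk (sdim blk (N c))|] ==> chart c x : Sh c"
  and chart_boundary: "[|c : C; crit c; x : dsk (sdim blk (N c))|] ==>
   (EX n:N c. chart c x n = 0) <-> x : sph (sdim blk (N c))"
  and chinv_chart: "[|c : C; crit c; x : dsk (sdim blk (N c))|] ==> chinv c (chart c x) = x"
  and chinv_dsk: "[|c : C; crit c; z : Sh c|] ==> chinv c z : dsk (sdim blk (N c))"
  and chart_chinv: "[|c : C; crit c; z : Sh c; n : N c|] ==> chart c (chinv c z) n = z n"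
  and chinv_cong: "[|c : C; crit c; !!n. n : N c ==> z n = z' n|] ==> chinv c z = chinv c z'"
begin

abbreviation dm :: "'c => nat" where "dm c == sdim blk (N c)"

definition I :: "'c set" where "I = {c : C. crit c}"

lemma dm_bd: "[|c : C; vp : N c|] ==> Suc (dm (bd vp c)) = dm c"
 using sdim_facet[OF N_fin N_full] N_bd by metis

end

text \<open>Extending the tautological map of the open critical cells yields \<open>q\<close>: it
  sends a point of any cell to the point of the Morse complex that is reached by flowing along the
  matching.\<close>

sublocale charted \<subseteq> q: gen C N blk bd R crit tau phi "%c. retr blk (N c) (phi c)" "%c z. (c, chinv c z)"
proof(intro gen.intro retr_rho gen_axioms.intro)
 fix c and z z' :: "_ => real" assume c: "c : C" "crit c" "!!n. n : N c ==> z n = z' n"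
 show "(c, chinv c z) = (c, chinv c z')" using chinv_cong[OF c] by simp
qed

context charted begin

lemma q_cons: "q.consistent"
 unfolding q.consistent_def
proof(intro allI impI, elim conjE)
 fix c z vq vq'
 assume a: "c : C" "~ crit c" "c = tau c" "z : Sh c" "vq : N c" "vq ~= phi c" "z vq = 0"
  "retr blk (N c) (phi c) z ~= z"
 have "shape_facet blk (N c) (phi c)" using facet_tau[OF a(1,2)] a(3) by simp
 thus "q.F (bd vq c) z = q.F (bd vq' c) (retr blk (N c) (phi c) z)"
  using shape_facet.retr_fix[of blk "N c" "phi c" z vq] a by simp
qed

abbreviation q where "q == q.F"

lemmas q_pair = q.F_pair[OF q_cons]
lemmas q_compat = q.compatD[OF q.compat_all[OF q_cons]]

lemma q_cases:
 assumes c: "c : C" "z : Sh c"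
 obtains (inner) "crit c" "!!vp. vp : N c ==> z vp ~= 0" "q c z = (c, chinv c z)"
 | (bdry) vp where "crit c" "vp : N c" "z vp = 0" "q c z = q (bd vp c) z" "bd vp c : C" "z : Sh (bd vp c)"
   "(bd vp c, c) : R" "dm (bd vp c) < dm c"
 | (pair) vq where "~ crit c" "vq : N (tau c)" "vq ~= phi c" "q.push c z vq = 0"
   "q c z = q (bd vq (tau c)) (q.push c z)" "bd vq (tau c) : C" "q.push c z : Sh (bd vq (tau c))"
   "(bd vq (tau c), c) : R" "dm (bd vq (tau c)) <= dm c"
proof(cases "crit c")
 case True
 show ?thesis
 proof(cases "EX vp:N c. z vp = 0")
  case True
  then obtain vp where vp: "vp : N c" "z vp = 0" by blast
  show ?thesis
   by(rule bdry[OF \<open>crit c\<close> vp q_compat[OF c(1,2) vp] bd_in[OF c(1) vp(1)] Sh_bd[OF c vp] facet_R[OF c(1) vp(1)]])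
     (use dm_bd[OF c(1) vp(1)] in simp)
 next
  case False
  show ?thesis by(rule inner[OF \<open>crit c\<close> _ q.F_crit[OF c(1) \<open>crit c\<close> c(2)]]) (use False in blast)+
 qed
next
 case nc: False
 note t = tau_in[OF c(1) nc]
 have h: "q.horn_face c (q.push c z) : N (tau c)" "q.horn_face c (q.push c z) ~= phi c"
  "q.push c z (q.horn_face c (q.push c z)) = 0" using q.horn_face[OF c(1) nc c(2)] by auto
 have d: "dm (bd (q.horn_face c (q.push c z)) (tau c)) <= dm c"
 proof(cases "c = tau c")
  case True
  thus ?thesis using dm_bd[OF t h(1)] by simp
 next
  case False
  hence "c = bd (phi c) (tau c)" using tau_cases[OF c(1) nc] by blast
  hence "dm c = dm (bd (phi c) (tau c))" by simp
  thus ?thesis using dm_bd[OF t h(1)] dm_bd[OF t phi_in[OF c(1) nc]] by simp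
 qed
 show ?thesis
  by(rule pair[OF nc h q_pair[OF c(1) nc c(2) h] bd_in[OF t h(1)] Sh_bd[OF t q.push_Sh[OF c(1) nc c(2)] h(1,3)]
     horn_R[OF c(1) nc h(1,2)] d])
qed

text \<open>A push never raises the dimension, as it ends in a facet of the larger cell of the pair,
  of the dimension of the smaller one. An attaching map first passes to a proper facet and therefore
  ends in strictly lower dimension.\<close>

lemma q_crit_cell: "[|c : C; z : Sh c|] ==> fst (q c z) : I & snd (q c z) : idk (dm (fst (q c z))) & dm (fst (q c z)) <= dm c"
proof(induction c arbitrary: z rule: wf_induct_rule[OF wfR])
 case (1 c)
 from 1(2,3) show ?case
 proof(cases rule: q_cases)
  case inner
  let ?x = "chinv c z"
  have x: "?x : dsk (dm c)" by(rule chinv_dsk[OF 1(2) inner(1) 1(3)])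
  have "?x ~: sph (dm c)" unfolding chart_boundary[OF 1(2) inner(1) x, symmetric]
   using inner(2) chart_chinv[OF 1(2) inner(1) 1(3)] by simp
  hence "?x : idk (dm c)" using x dsk_split by blast
  thus ?thesis using inner 1(2) by(simp add: I_def)
 next
  case (bdry vp)
  show ?thesis unfolding bdry(4) using "1.IH"[OF bdry(7,5,6)] bdry(8) by simp
 next
  case (pair vq)
  show ?thesis unfolding pair(5) using "1.IH"[OF pair(8,6,7)] pair(9) by simp
 qed
qed

lemma q_finite: "c : C ==> finite (fst ` q c ` Sh c)"
proof(induction c rule: wf_induct_rule[OF wfR])
 case (1 c)
 let ?K = "if crit c then (%vp. bd vp c) ` N c else (%vq. bd vq (tau c)) ` (N (tau c) - {phi c})"
 have sub: "fst ` q c ` Sh c <= insert c (UN b:?K. fst ` q b ` Sh b)"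
 proof
  fix x assume "x : fst ` q c ` Sh c"
  then obtain z where z: "z : Sh c" "x = fst (q c z)" by blast
  from 1(2) z(1) show "x : insert c (UN b:?K. fst ` q b ` Sh b)"
  proof(cases rule: q_cases)
   case inner
   thus ?thesis using z(2) by simp
  next
   case (bdry vp)
   have "bd vp c : ?K" using bdry(1,2) by simp
   thus ?thesis using bdry(4,6) z(2) by(intro insertI2 UN_I) auto
  next
   case (pair vq)
   have "bd vq (tau c) : ?K" using pair(1-3) by simp
   thus ?thesis using pair(5,7) z(2) by(intro insertI2 UN_I) auto
  qed
 qed
 have "finite (fst ` q b ` Sh b)" if b: "b : ?K" for b
 proof(rule "1.IH")
  show "(b, c) : R" "b : C"
   using b facet_R[OF 1(2)] horn_R[OF 1(2)] bd_in[OF 1(2)] bd_in[OF tau_in[OF 1(2)]] by(auto split: if_splits)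
 qed
 moreover have "finite ?K" using N_fin[OF 1(2)] N_fin[OF tau_in[OF 1(2)]] by simp
 ultimately have "finite (insert c (UN b:?K. fst ` q b ` Sh b))" by blast
 with sub show ?case by(rule finite_subset)
qed

definition att :: "'c => rseq => 'c * rseq" where
 "att e x = q e (chart e x)"

lemma q_chart: "[|c : I; x : dsk (dm c)|] ==> (if x : idk (dm c) then (c, x) else att c x) = q c (chart c x)"
proof -
 assume c: "c : I" "x : dsk (dm c)"
 hence c': "c : C" "crit c" by(auto simp: I_def)
 have "q c (chart c x) = (c, x)" if "x : idk (dm c)"
 proof -
  have "x ~: sph (dm c)" using that dsk_split by blast
  hence nz: "!!vp. vp : N c ==> chart c x vp ~= 0" using chart_boundary[OF c' c(2)] by blast
  show ?thesis using q.F_crit[OF c' chart_Sh[OF c' c(2)] nz] chinv_chart[OF c' c(2)] by simp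
 qed
 thus ?thesis by(simp add: att_def)
qed

lemma q_chinv: "[|c : I; z : Sh c|] ==> q c (chart c (chinv c z)) = q c z"
 using q.F_cong[of c z "chart c (chinv c z)"] chart_chinv[of c z] by(simp add: I_def)

text \<open>A stand-in for the skeleton below dimension \<open>m\<close>: the topology of
  \<open>sp\<close> becomes available only after the attaching maps have been shown to be
  continuous.\<close>

definition pre_sp :: "nat => ('c * rseq) topology" where
 "pre_sp m = topology (%V. V <= {(i, x). i : I & x : idk (dm i)} & (ALL j:{j : I. dm j < m}.
   openin (tset (dsk (dm j))) {x : topspace (tset (dsk (dm j))). q j (chart j x) : V}))"

lemma q_pre_sp:
 assumes "c : C" "dm c < m"
 shows "cmap (tset (Sh c)) (pre_sp m) (q c)"
proof(rule q.F_continuous[OF q_cons, where Q = "{c. dm c < m}"])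
 show "c : C" "c : {c. dm c < m}" using assms by auto
next
 fix c vp assume "c : {c. dm c < m}" "c : C" "crit c" "vp : N c"
 thus "bd vp c : {c. dm c < m}" using dm_bd[of c vp] by simp
next
 fix c vq assume c: "c : {c. dm c < m}" "c : C" "~ crit c" "vq : N (tau c)" "vq ~= phi c"
 note t = tau_in[OF c(2,3)]
 show "bd vq (tau c) : {c. dm c < m}"
  using tau_cases[OF c(2,3)]
 proof
  assume "c = tau c"
  thus ?thesis using dm_bd[OF t c(4)] c(1) by simp
 next
  assume "c = bd (phi c) (tau c)"
  hence "dm c = dm (bd (phi c) (tau c))" by simp
  thus ?thesis using dm_bd[OF t c(4)] dm_bd[OF t phi_in[OF c(2,3)]] c(1) by simp
 qed
next
 fix c assume c: "c : {c. dm c < m}" "c : C" "crit c"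
 hence cI: "c : I" by(simp add: I_def)
 show "cmap (tset (Sh c)) (pre_sp m) (q c)"
  unfolding pre_sp_def
 proof(rule continuous_map_final)
  fix j assume j: "j : {j : I. dm j < m}"
  show "(%x. q j (chart j x)) : topspace (tset (dsk (dm j))) \<rightarrow> {(i, x). i : I & x : idk (dm i)}"
  proof
   fix x assume "x : topspace (tset (dsk (dm j)))"
   thus "q j (chart j x) : {(i, x). i : I & x : idk (dm i)}"
    using j q_crit_cell[of j "chart j x"] chart_Sh[of j x] by(cases "q j (chart j x)") (simp add: I_def)
  qed
 next
  fix z assume "z : topspace (tset (Sh c))"
  thus "q c z : {(i, x). i : I & x : idk (dm i)}"
   using q_crit_cell[OF c(2), of z] by(cases "q c z") simp
 next
  fix V assume "!!j. j : {j : I. dm j < m} ==>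
   openin (tset (dsk (dm j))) {x : topspace (tset (dsk (dm j))). q j (chart j x) : V}"
  from this[of c] have "openin (tset (dsk (dm c))) {x : dsk (dm c). q c (chart c x) : V}"
   using c cI by simp
  moreover have "cmap (tset (Sh c)) (tset (dsk (dm c))) (chinv c)"
   using chinv_cont[OF c(2,3)] chinv_dsk[OF c(2,3)] by auto
  ultimately have "openin (tset (Sh c)) {z : topspace (tset (Sh c)). chinv c z : {x : dsk (dm c). q c (chart c x) : V}}"
   by(rule openin_continuous_map_preimage[rotated])
  moreover have "{z : topspace (tset (Sh c)). chinv c z : {x : dsk (dm c). q c (chart c x) : V}} =
   {z : topspace (tset (Sh c)). q c z : V}"
   using chinv_dsk[OF c(2,3)] q_chinv[OF cI] by auto
  ultimately show "openin (tset (Sh c)) {z : topspace (tset (Sh c)). q c z : V}" by simp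
 qed
qed

lemma att_pre_sp:
 assumes i: "i : I"
 shows "cmap (tset (sph (dm i))) (pre_sp (dm i)) (att i)"
proof -
 have i': "i : C" "crit i" using i by(auto simp: I_def)
 let ?A = "%vp. {x : sph (dm i). chart i x vp = 0}"
 have sd: "x : dsk (dm i)" if "x : sph (dm i)" for x using that sph_subset_dsk by blast
 have cs: "con (sph (dm i)) (chart i)"
  using continuous_on_subset[OF chart_cont[OF i'] sph_subset_dsk] .
 show ?thesis
 proof(rule continuous_map_finite_closed_cover[where J = "N i" and A = ?A and g = "%vp x. q (bd vp i) (chart i x)"])
  show "finite (N i)" by(rule N_fin[OF i'(1)])
  show "topspace (tset (sph (dm i))) <= (UN vp:N i. ?A vp)"
   using chart_boundary[OF i' sd] by auto
  fix vp assume vp: "vp : N i"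
  have "con (sph (dm i)) (%x. chart i x vp)" by(rule continuous_on_coord[OF cs])
  hence "closedin (tset (sph (dm i))) (sph (dm i) Int (%x. chart i x vp) -` {0})"
   by(rule continuous_closedin_preimage) simp
  moreover have "sph (dm i) Int (%x. chart i x vp) -` {0} = ?A vp" by auto
  ultimately show "closedin (tset (sph (dm i))) (?A vp)" by simp
  have "cmap (tset (Sh (bd vp i))) (pre_sp (dm i)) (q (bd vp i))"
   by(rule q_pre_sp[OF bd_in[OF i'(1) vp]]) (use dm_bd[OF i'(1) vp] in simp)
  moreover have "cmap (tset (?A vp)) (tset (Sh (bd vp i))) (chart i)"
   using continuous_on_subset[OF cs, of "?A vp"] Sh_bd[OF i'(1) chart_Sh[OF i' sd] vp] by auto
  ultimately have "cmap (tset (?A vp)) (pre_sp (dm i)) (%x. q (bd vp i) (chart i x))"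
   using continuous_map_compose[of _ _ "chart i" "pre_sp (dm i)" "q (bd vp i)", unfolded o_def] by blast
  moreover have "subtopology (tset (sph (dm i))) (?A vp) = tset (?A vp)"
   by(simp add: subtopology_subtopology Int_def conj_ac)
  ultimately show "cmap (subtopology (tset (sph (dm i))) (?A vp)) (pre_sp (dm i)) (%x. q (bd vp i) (chart i x))"
   by simp
  show "att i x = q (bd vp i) (chart i x)" if x: "x : ?A vp" for x
   unfolding att_def by(rule q_compat[OF i'(1) chart_Sh[OF i' sd] vp]) (use x in auto)
 qed
qed

end

sublocale charted \<subseteq> cell_data I "%c. dm c" att
proof
 fix i x assume i: "i : I" and x: "x : sph (dm i)"
 hence i': "i : C" "crit i" "x : dsk (dm i)" using sph_subset_dsk by(auto simp: I_def)
 obtain vp where vp: "vp : N i" "chart i x vp = 0" using chart_boundary[OF i'] x by blast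
 note z = chart_Sh[OF i']
 have "att i x = q (bd vp i) (chart i x)" unfolding att_def by(rule q_compat[OF i'(1) z vp])
 thus "fst (att i x) : I & snd (att i x) : idk (dm (fst (att i x))) & dm (fst (att i x)) < dm i"
  using q_crit_cell[OF bd_in[OF i'(1) vp(1)] Sh_bd[OF i'(1) z vp]] dm_bd[OF i'(1) vp(1)] by auto
next
 fix i assume i: "i : I"
 hence i': "i : C" "crit i" by(auto simp: I_def)
 have "fst ` att i ` sph (dm i) <= fst ` q i ` Sh i"
  using chart_Sh[OF i'] sph_subset_dsk[of "dm i"] by(auto simp: att_def image_image intro!: imageI)
 thus "finite (fst ` att i ` sph (dm i))" using q_finite[OF i'(1)] finite_subset by blast
next
 fix i U assume i: "i : I" and U: "!!j. [|j : I; dm j < dm i|] ==>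
  openin (tset (dsk (dm j))) {x : dsk (dm j). (if x : idk (dm j) then (j, x) else att j x) : U}"
 let ?P = "{(i, x). i : I & x : idk (dm i)}"
 have inP: "q j (chart j x) : ?P" if "j : I" "x : dsk (dm j)" for j x
  using that q_crit_cell[of j "chart j x"] chart_Sh[of j x] by(cases "q j (chart j x)") (simp add: I_def)
 have "openin (tset (dsk (dm j))) {x : dsk (dm j). q j (chart j x) : U Int ?P}" if j: "j : I" "dm j < dm i" for j
 proof -
  have "{x : dsk (dm j). q j (chart j x) : U Int ?P} = {x : dsk (dm j). (if x : idk (dm j) then (j, x) else att j x) : U}"
   by(rule Collect_cong, rule conj_cong[OF refl]) (simp only: q_chart[OF j(1)] inP[OF j(1)] Int_iff simp_thms)
  thus ?thesis using U[OF j] by simp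
 qed
 hence "openin (pre_sp (dm i)) (U Int ?P)"
  unfolding pre_sp_def topology_inverse'[OF istopology_final] by simp
 hence "openin (tset (sph (dm i))) {x : topspace (tset (sph (dm i))). att i x : U Int ?P}"
  by(rule openin_continuous_map_preimage[OF att_pre_sp[OF i]])
 moreover have "att i x : ?P" if "x : sph (dm i)" for x
  unfolding att_def by(rule inP[OF i]) (use that sph_subset_dsk in blast)
 hence "{x : topspace (tset (sph (dm i))). att i x : U Int ?P} = {x : sph (dm i). att i x : U}"
  by(intro Collect_cong) (simp only: topspace_euclidean_subtopology Int_iff simp_thms cong: conj_cong)
 ultimately show "openin (tset (sph (dm i))) {x : sph (dm i). att i x : U}" by simp
qed

context charted begin

lemma chr_q: "[|c : I; x : dsk (dm c)|] ==> chr c x = q c (chart c x)"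
 using q_chart[of c x] by(simp add: chr_def)

lemma q_sp: "c : C ==> cmap (tset (Sh c)) sp (q c)"
proof(rule q.F_continuous[OF q_cons, where Q = UNIV])
 fix c assume c: "c : C" "crit c"
 hence cI: "c : I" by(simp add: I_def)
 have "cmap (tset (Sh c)) (tset (dsk (dm c))) (chinv c)"
  using chinv_cont[OF c] chinv_dsk[OF c] by auto
 hence "cmap (tset (Sh c)) sp (chr c o chinv c)"
  by(rule continuous_map_compose[OF _ continuous_chr[OF cI]])
 moreover have "(chr c o chinv c) z = q c z" if "z : topspace (tset (Sh c))" for z
  using chr_q[OF cI chinv_dsk[OF c]] q_chinv[OF cI] that by simp
 ultimately show "cmap (tset (Sh c)) sp (q c)" by(rule continuous_map_eq)
qed auto

end

section \<open>Invariance under renaming of coordinates, and equivariance of the Morse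
  complex\<close>

locale name_map =
 fixes f :: "'n => 'n" and blk :: "'n => 'b" and N :: "'n set"
 assumes inj_f: "inj_on f N" and blk_f: "[|n : N; m : N|] ==> blk (f n) = blk (f m) <-> blk n = blk m"
begin

lemma eq_f: "[|n : N; m : N|] ==> f n = f m <-> n = m"
 using inj_f by(auto simp: inj_on_def)

lemma blok_image: "n : N ==> blok blk (f ` N) (f n) = f ` blok blk N n"
 using blk_f by(auto simp: blok_def)

lemma card_blok_image: "n : N ==> card (blok blk (f ` N) (f n)) = card (blok blk N n)"
 unfolding blok_image by(rule card_image, rule inj_on_subset[OF inj_f]) (auto simp: blok_def)

lemma prune_image: "prune blk (f ` N) = f ` prune blk N"
proof -
 have "f n : prune blk (f ` N) <-> n : prune blk N" if n: "n : N" for n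
  using n by(auto simp: prune_def blk_f[OF _ n] eq_f[OF _ n])
 thus ?thesis using prune_subset[of blk N] prune_subset[of blk "f ` N"] by blast
qed

lemma shape_image:
 assumes "!!n. n : N ==> z' (f n) = z n"
 shows "z' : shape blk (f ` N) <-> z : shape blk N"
proof -
 have "sum z' (blok blk (f ` N) (f n)) = sum z (blok blk N n)" if "n : N" for n
 proof -
  have "inj_on f (blok blk N n)" by(rule inj_on_subset[OF inj_f]) (auto simp: blok_def)
  hence "sum z' (f ` blok blk N n) = sum (z' o f) (blok blk N n)" by(rule sum.reindex)
  also have "... = sum z (blok blk N n)" using assms by(intro sum.cong) (auto simp: blok_def)
  finally show ?thesis using blok_image[OF that] by simp
 qed
 thus ?thesis using assms by(simp add: shape_def)
qed

lemma cen_image: "[|vp : N; n : N|] ==> cen blk (f ` N) (f vp) (f n) = cen blk N vp n"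
 using eq_f blk_f card_blok_image by(simp add: cen_def)

lemma retr_image:
 assumes "vp : N" "n : N" "!!n. n : N ==> z' (f n) = z n"
 shows "retr blk (f ` N) (f vp) z' (f n) = retr blk N vp z n"
proof -
 have "f ` N - {f vp} = f ` (N - {vp})" using eq_f assms(1) by auto
 moreover have "1 - z' (f n) / cen blk (f ` N) (f vp) (f n) = 1 - z n / cen blk N vp n" if "n : N" for n
  using cen_image[OF assms(1) that] assms(3)[OF that] by simp
 ultimately have "gauge blk (f ` N) (f vp) z' = gauge blk N vp z"
  unfolding gauge_def by(simp add: image_image cong: image_cong_simp)
 thus ?thesis using assms by(simp add: retr_def cen_image)
qed

lemma facet_map: "name_map f blk (N - {vp})"
 by unfold_locales (use inj_f blk_f in "auto intro: inj_on_subset")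

lemma prune_facet: "vp : N ==> prune blk (f ` N - {f vp}) = f ` prune blk (N - {vp})"
proof -
 assume "vp : N"
 hence "f ` N - {f vp} = f ` (N - {vp})" using eq_f by auto
 thus ?thesis using name_map.prune_image[OF facet_map] by simp
qed

lemma extend_image:
 assumes "vp : N" "n : N" "!!n. n : N ==> z' (f n) = z n"
 shows "extend (f ` N) (f vp) blk z' (f n) = extend N vp blk z n"
proof -
 have "f n : f ` prune blk (N - {vp}) <-> n : prune blk (N - {vp})"
  using eq_f assms(2) prune_subset[of blk "N - {vp}"] by auto
 thus ?thesis unfolding extend_def prune_facet[OF assms(1)] using assms eq_f by simp
qed

lemma sdim_image: "sdim blk (f ` N) = sdim blk N"
proof -
 let ?h = "%b. blk (f (inv_into N blk b))"
 have h: "?h (blk n) = blk (f n)" if "n : N" for n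
  using blk_f[OF inv_into_into[of "blk n" blk N] that] f_inv_into_f[of "blk n" blk N] that by simp
 have "inj_on ?h (blk ` N)" using h blk_f by(auto intro!: inj_onI)
 hence "card (?h ` blk ` N) = card (blk ` N)" by(rule card_image)
 moreover have "?h ` blk ` N = blk ` f ` N" using h by(simp add: image_image cong: image_cong_simp)
 ultimately show ?thesis using card_image[OF inj_f] by(simp add: sdim_def)
qed

end

locale morse_action = free_action G C act + matching C N blk bd R crit tau phi
 for G :: "('g, 'm) monoid_scheme" (structure)
  and C :: "'c set" and N :: "'c => 'n set" and blk :: "'n => 'b" and bd :: "'n => 'c => 'c"
  and R crit tau phi and act :: "'g => 'c => 'c" +
 fixes nact :: "'g => 'n => 'n"
 assumes nact_one: "nact \<one> n = n"
  and nact_mult: "[|g : car G; h : car G|] ==> nact (g \<otimes> h) n = nact g (nact h n)"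
  and N_act: "[|g : car G; c : C|] ==> N (act g c) = nact g ` N c"
  and blk_nact: "g : car G ==> blk (nact g n) = blk (nact g m) <-> blk n = blk m"
  and bd_act: "[|g : car G; c : C; vp : N c|] ==> bd (nact g vp) (act g c) = act g (bd vp c)"
  and crit_act: "[|g : car G; c : C|] ==> crit (act g c) <-> crit c"
  and tau_act: "[|g : car G; c : C; ~ crit c|] ==> tau (act g c) = act g (tau c)"
  and phi_act: "[|g : car G; c : C; ~ crit c|] ==> phi (act g c) = nact g (phi c)"
begin

lemma nact_inv: "g : car G ==> nact (inv g) (nact g n) = n" "g : car G ==> nact g (nact (inv g) n) = n"
 by(simp_all add: nact_mult[symmetric] nact_one)

lemma name_map_nact: "g : car G ==> name_map (nact g) blk M"
 by unfold_locales (auto simp: blk_nact intro!: inj_on_inverseI[of _ "nact (inv g)"] nact_inv)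

lemma N_orb: "c : C ==> N c = nact (mv c) ` N (orb c)"
 using N_act[of "mv c" "orb c"] mv orb_in by simp

text \<open>The coordinates of \<open>shape_disc\<close> rest on arbitrary choices of
  \<open>base\<close> and \<open>enum\<close>, which a group element has no reason to respect. They
  are made on orbit representatives and carried to other cells by \<open>mv\<close>.\<close>

definition chart :: "'c => rseq => 'n => real" where
 "chart c x n = shape_disc.chi blk (N (orb c)) x (nact (inv (mv c)) n)"
definition chinv :: "'c => ('n => real) => nat => real" where
 "chinv c z = shape_disc.chi_inv blk (N (orb c)) (%n. z (nact (mv c) n))"

lemma charted: "charted C N blk bd R crit tau phi chart chinv"
proof(intro charted.intro matching_axioms charted_axioms.intro)
 fix c assume c: "c : C"
 let ?f = "nact (mv c)"
 interpret sd: shape_disc blk "N (orb c)" by(rule shape_disc.intro[OF N_fin[OF orb_in[OF c]]])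
 note g = mv[OF c, THEN conjunct1]
 interpret nm: name_map ?f blk "N (orb c)" by(rule name_map_nact[OF g])
 have dim: "sdim blk (N c) = card sd.free" using nm.sdim_image N_orb[OF c] sd.card_free by simp
 have ch: "chart c x (?f n) = sd.chi x n" for x n by(simp add: chart_def nact_inv[OF g])
 have Shc: "z : Sh c <-> (%n. z (?f n)) : Sh (orb c)" for z
  unfolding N_orb[OF c] by(rule nm.shape_image) simp
 show "con (dsk (sdim blk (N c))) (chart c)"
  unfolding dim by(rule con_prod)
   (use continuous_on_coord[OF sd.continuous_on_chi] in "simp add: chart_def")
 have "con (Sh c) (%z n. z (?f n))"
  by(rule con_prod) (rule continuous_on_coord[OF continuous_on_id])
 thus "con (Sh c) (chinv c)"
  unfolding chinv_def[abs_def] by(rule continuous_on_compose2[OF sd.continuous_on_chi_inv[of UNIV]]) simp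
 show "chinv c z = chinv c z'" if "!!n. n : N c ==> z n = z' n" for z z'
  unfolding chinv_def by(rule sd.chi_inv_cong) (use that N_orb[OF c] in blast)
 show "chinv c z : dsk (sdim blk (N c))" if "z : Sh c" for z
  unfolding chinv_def dim by(rule sd.chi_inv_dsk) (use that Shc in blast)
 show "chart c (chinv c z) n = z n" if zn: "z : Sh c" "n : N c" for z n
 proof -
  obtain m where m: "m : N (orb c)" "n = ?f m" using zn(2) N_orb[OF c] by blast
  show ?thesis unfolding m(2) ch chinv_def by(rule sd.chi_chi_inv) (use zn Shc m in auto)
 qed
 fix x assume "x : dsk (sdim blk (N c))"
 hence x: "x : dsk (card sd.free)" using dim by simp
 show "chart c x : Sh c" unfolding Shc ch by(rule sd.chi_shape[OF x])
 show "chinv c (chart c x) = x" unfolding chinv_def ch by(rule sd.chi_inv_chi[OF x])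
 show "(EX n:N c. chart c x n = 0) <-> x : sph (sdim blk (N c))"
 proof(cases "N (orb c) = {}")
  case True
  hence "sdim blk (N c) = 0" using N_orb[OF c] by(simp add: sdim_def)
  thus ?thesis using True N_orb[OF c] by(simp add: sph_def nrm_def)
 next
  case False
  thus ?thesis using sd.chi_boundary[OF False x] unfolding dim unfolding N_orb[OF c] by(simp add: ch)
 qed
qed

end

sublocale morse_action \<subseteq> charted C N blk bd R crit tau phi chart chinv
 by(rule charted)

context morse_action begin

lemma chart_act: "[|g : car G; c : C|] ==> chart (act g c) x (nact g n) = chart c x n"
 using mv[of c] by(simp add: chart_def orb_act mv_act inv_mult_group nact_mult nact_inv)

lemma dm_act: "[|g : car G; c : C|] ==> dm (act g c) = dm c"
 using name_map.sdim_image[OF name_map_nact] N_act by metis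

text \<open>Renaming commutes with \<open>lift\<close> and \<open>retr\<close>, so the push of a
  translated point is the translate of the push, and the recursion behind \<open>q\<close> runs in
  parallel in \<open>c\<close> and in its translate.\<close>

lemma q_act:
 assumes g: "g : car G"
 shows "[|c : C; z : Sh c; !!n. n : N c ==> z' (nact g n) = z n|] ==>
  q (act g c) z' = (act g (fst (q c z)), snd (q c z))"
proof(induction c arbitrary: z z' rule: wf_induct_rule[OF wfR])
 case (1 c)
 have nz: "name_map (nact g) blk M" for M by(rule name_map_nact[OF g])
 note gc = act_in[OF g 1(2)]
 have shI: "w' : Sh (act g b)" if "b : C" "w : Sh b" "!!n. n : N b ==> w' (nact g n) = w n" for b w w'
  unfolding N_act[OF g that(1)] by(subst name_map.shape_image[OF nz, where z = w]) (use that in auto)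
 have z': "z' : Sh (act g c)" by(rule shI[OF 1(2-4)])
 from 1(2,3) show ?case
 proof(cases rule: q_cases)
  case inner
  have cr: "crit (act g c)" using inner(1) crit_act[OF g 1(2)] by simp
  have "z' n ~= 0" if "n : N (act g c)" for n
   using that inner(2) 1(4) unfolding N_act[OF g 1(2)] by(metis imageE)
  hence 2: "q (act g c) z' = (act g c, chinv (act g c) z')" by(rule q.F_crit[OF gc cr z'])
  let ?x = "chinv c z"
  have x: "?x : dsk (dm c)" by(rule chinv_dsk[OF 1(2) inner(1) 1(3)])
  have "chinv (act g c) z' = chinv (act g c) (chart (act g c) ?x)"
  proof(rule chinv_cong[OF gc cr])
   fix n assume "n : N (act g c)"
   then obtain m where m: "m : N c" "n = nact g m" unfolding N_act[OF g 1(2)] by blast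
   thus "z' n = chart (act g c) ?x n"
    using 1(4)[OF m(1)] chart_chinv[OF 1(2) inner(1) 1(3) m(1)] chart_act[OF g 1(2)] by simp
  qed
  also have "... = ?x" by(rule chinv_chart[OF gc cr]) (use x dm_act[OF g 1(2)] in simp)
  finally show ?thesis unfolding 2 inner(3) by simp
 next
  case (bdry vp)
  have "q (act g c) z' = q (bd (nact g vp) (act g c)) z'"
   by(rule q_compat[OF gc z']) (use bdry(2,3) 1(4) N_act[OF g 1(2)] in auto)
  also have "... = q (act g (bd vp c)) z'" using bd_act[OF g 1(2) bdry(2)] by simp
  also have "... = (act g (fst (q (bd vp c) z)), snd (q (bd vp c) z))"
   by(rule "1.IH"[OF bdry(7,5,6)]) (use 1(4) N_bd_subset[OF 1(2) bdry(2)] in blast)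
  finally show ?thesis unfolding bdry(4) .
 next
  case (pair vq)
  let ?t = "tau c"
  have t: "?t : C" "phi c : N ?t" using tau_in phi_in 1(2) pair(1) by auto
  have tt: "phi ?t = phi c" using tau_tau[OF 1(2) pair(1)] by blast
  have ncg: "~ crit (act g c)" using pair(1) crit_act[OF g 1(2)] by simp
  have tg: "tau (act g c) = act g ?t" "phi (act g c) = nact g (phi c)"
   using tau_act[OF g 1(2) pair(1)] phi_act[OF g 1(2) pair(1)] by auto
  have Nt: "N (tau (act g c)) = nact g ` N ?t" unfolding tg by(rule N_act[OF g t(1)])
  have ceq: "act g c = act g ?t <-> c = ?t"
   using act_inv[OF g 1(2)] act_inv[OF g t(1)] by metis
  have lift: "lift (act g c) z' (nact g n) = lift c z n" if n: "n : N ?t" for n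
  proof(cases "c = ?t")
   case True
   have "n : N c" using n True by simp
   thus ?thesis using 1(4) lift_tau[OF True] lift_tau[of "act g c" z'] ceq tg True by metis
  next
   case False
   have *: "lift c z = extend (N ?t) (phi c) blk z" by(rule lift_sigma[OF False])
   have "lift (act g c) z' = extend (N (tau (act g c))) (phi (act g c)) blk z'"
    by(rule lift_sigma) (use False ceq tg in simp)
   hence **: "lift (act g c) z' = extend (nact g ` N ?t) (nact g (phi c)) blk z'" using Nt tg by simp
   \<comment> \<open>Outside \<open>N c\<close> the points \<open>z\<close> and \<open>z'\<close>
     are unrelated; \<open>w\<close> adjusts \<open>z\<close> there to meet the hypothesis of
     \<open>extend_image\<close>.\<close>
   define w where "w m = (if m : N c then z m else z' (nact g m))" for m
   have "extend (nact g ` N ?t) (nact g (phi c)) blk z' (nact g n) = extend (N ?t) (phi c) blk w n"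
    by(rule name_map.extend_image[OF nz t(2) n]) (use 1(4) in "simp add: w_def")
   also have "... = extend (N ?t) (phi c) blk z n"
    using n sigma_N[OF 1(2) pair(1) False] by(simp add: extend_def w_def)
   finally show ?thesis unfolding * ** .
  qed
  have pe: "q.push (act g c) z' (nact g n) = q.push c z n" if n: "n : N ?t" for n
  proof -
   have tp: "phi (tau (act g c)) = nact g (phi c)" using tau_tau[OF gc ncg] tg by simp
   show ?thesis unfolding q.push_def Nt tt tp
    by(rule name_map.retr_image[OF nz t(2) n]) (rule lift)
  qed
  have vq': "nact g vq : N (tau (act g c))" using pair(2) Nt by blast
  have "q (act g c) z' = q (bd (nact g vq) (tau (act g c))) (q.push (act g c) z')"
   by(rule q_pair[OF gc ncg z' vq'])
    (use pair(2-4) pe tg name_map.eq_f[OF nz[of UNIV]] in auto)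
  also have "... = q (act g (bd vq ?t)) (q.push (act g c) z')"
   using bd_act[OF g t(1) pair(2)] tg by simp
  also have "... = (act g (fst (q (bd vq ?t) (q.push c z))), snd (q (bd vq ?t) (q.push c z)))"
   by(rule "1.IH"[OF pair(8,6,7)]) (use pe N_bd_subset[OF t(1) pair(2)] in blast)
  finally show ?thesis unfolding pair(5) .
 qed
qed

lemma att_act:
 assumes g: "g : car G" and e: "e : I" and x: "x : dsk (dm e)"
 shows "att (act g e) x = (act g (fst (att e x)), snd (att e x))"
 unfolding att_def by(rule q_act[OF g]) (use e x chart_Sh chart_act[OF g] in "auto simp: I_def")

lemma equiv_cellsI:
 assumes "contractible_space sp" "C ~= {}"
  and "!!n. EX K. finite K & {i : I. dm i = n} <= (UN g:car G. act g ` (K Int I))"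
 shows "equiv_cells G I (%c. dm c) att act"
proof(intro equiv_cells.intro free_action.intro free_action_axioms.intro group_axioms cell_data_axioms equiv_cells_axioms.intro)
 obtain c where c: "c : C" using assms(2) by blast
 have "N c = {} | Sh c ~= {}"
 proof -
  have "(%_. 0) : dsk n" for n by(simp add: dsk_def nrm_def)
  thus ?thesis using shape_disc.chi_shape[OF shape_disc.intro[OF N_fin[OF c]]] by blast
 qed
 hence "Sh c ~= {}" by(auto simp: shape_def)
 thus "I ~= {}" using q_crit_cell[OF c] by blast
next
 fix g i x assume g: "g : car G" and i: "i : I" and x: "x : sph (dm i)"
 hence "x : dsk (dm i)" using sph_subset_dsk by blast
 thus "att (act g i) x = (act g (fst (att i x)), snd (att i x))" by(rule att_act[OF g i])
next
 fix g i assume "g : car G" "i : I"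
 thus "act g i : I" "dm (act g i) = dm i" using act_in crit_act dm_act by(simp_all add: I_def)
next
 fix g i assume "g : car G" "i : I" "act g i = i"
 thus "g = \<one>" using act_free[of g i] by(simp add: I_def)
qed (use act_one act_mult assms(1,3) in "simp_all add: I_def")

end

section \<open>Contractibility of the Morse complex\<close>

context cell_data begin

text \<open>Openness in the product with the interval is not tested on cells directly. For a compact
  interval \<open>J\<close> of times around \<open>t0\<close>, the points that stay in
  \<open>W\<close> throughout \<open>J\<close> form an open set, since in each disc its complement
  is the projection of a closed set along a compact factor.\<close>

lemma continuous_map_homotopy_from_sp:
 assumes Z: "!!t p. t : {0..1} ==> p : pts ==> h (t, p) : topspace Z"
  and h: "!!i. i : I ==>
   cmap (ptop (tset {0..1::real}) (tset (dsk (d i)))) Z (%(t, x). h (t, chr i x))"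
 shows "cmap (ptop (tset {0..1}) sp) Z h"
 unfolding continuous_map
proof(intro conjI allI impI)
 show "h ` topspace (ptop (tset {0..1}) sp) <= topspace Z"
  using Z by(auto simp: topspace_prod_topology)
 fix W assume W: "openin Z W"
 let ?P = "{tp : topspace (ptop (tset {0..1}) sp). h tp : W}"
 show "openin (ptop (tset {0..1}) sp) ?P"
 proof(subst openin_subopen, intro ballI)
  fix tp assume tp: "tp : ?P"
  obtain t0 e x0 where e: "tp = (t0, (e, x0))" by(cases tp) auto
  have t0: "t0 : {0..1}" and p0: "e : I" "x0 : idk (d e)" and hW: "h (t0, (e, x0)) : W"
   using tp by(auto simp: e topspace_prod_topology pts_def)
  have x0: "x0 : dsk (d e)" using p0 idk_subset_dsk by blast
  have c0: "chr e x0 = (e, x0)" by(rule chr_idk[OF p0(2)])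
  let ?T = "{t : {0..1}. h (t, (e, x0)) : W}"
  have "cmap (tset {0..1}) (ptop (tset {0..1::real}) (tset (dsk (d e)))) (%t. (t, x0))"
   by(intro continuous_map_pairedI) (use x0 in auto)
  from continuous_map_compose[OF this h[OF p0(1)]]
  have "cmap (tset {0..1}) Z (%t. h (t, (e, x0)))" by(simp add: o_def c0)
  from openin_continuous_map_preimage[OF this W]
  have "openin (tset {0..1}) ?T" by simp
  then obtain eps where eps: "eps > 0" "ball t0 eps Int {0..1} <= ?T" using t0 hW by(auto simp: openin_contains_ball)
  define J where "J = cball t0 (eps / 2) Int {0..1}"
  have J: "compact J" "J <= {0..1}" unfolding J_def by(auto intro!: compact_Int_closed)
  have "cball t0 (eps / 2) <= ball t0 eps" using eps(1) by(intro subsetI) simp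
  hence JT: "J <= ?T" unfolding J_def using eps(2) by(rule order_trans[OF Int_mono[OF _ order_refl]])
  define V where "V = {p : pts. ALL t:J. h (t, p) : W}"
  have "openin sp V"
   unfolding openin_sp
  proof(intro conjI ballI)
   show "V <= pts" by(auto simp: V_def)
   fix i assume i: "i : I"
   let ?X = "tset J" and ?Y = "tset (dsk (d i))"
   have "cmap (ptop ?X ?Y) Z (%(t, x). h (t, chr i x))"
    using continuous_map_from_subtopology[OF h[OF i], of "J \<times> dsk (d i)"] J(2)
    by(simp add: subtopology_Times subtopology_subtopology Int_absorb1 del: prod_topology_subtopology_eu)
   hence "closedin (ptop ?X ?Y) {tx : topspace (ptop ?X ?Y). (case tx of (t, x) => h (t, chr i x)) : topspace Z - W}"
    by(rule closedin_continuous_map_preimage) (use W in blast)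
   moreover have "closed_map (ptop ?X ?Y) ?Y snd"
    by(rule closed_map_snd) (use J in "simp add: compact_space_subtopology")
   ultimately have "closedin ?Y (snd ` {tx : topspace (ptop ?X ?Y). (case tx of (t, x) => h (t, chr i x)) : topspace Z - W})"
    unfolding closed_map_def by blast
   moreover have "snd ` {tx : topspace (ptop ?X ?Y). (case tx of (t, x) => h (t, chr i x)) : topspace Z - W}
     = topspace ?Y - pull i V" (is "?L = ?R")
   proof(intro Set.equalityI subsetI)
    fix x assume "x : ?L"
    then obtain t where "t : J" "x : dsk (d i)" "h (t, chr i x) ~: W" by(auto simp: topspace_prod_topology)
    thus "x : ?R" by(auto simp: pull_def V_def)
   next
    fix x assume "x : ?R"
    hence x: "x : dsk (d i)" "x ~: pull i V" by auto
    hence "chr i x ~: V" by(simp add: pull_def)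
    then obtain t where t: "t : J" "h (t, chr i x) ~: W" using chr_in_pts[OF i x(1)] by(auto simp: V_def)
    have "h (t, chr i x) : topspace Z" using Z chr_in_pts[OF i x(1)] t J(2) by blast
    hence "(t, x) : {tx : topspace (ptop ?X ?Y). (case tx of (t, x) => h (t, chr i x)) : topspace Z - W}"
     using t x by(simp add: topspace_prod_topology)
    thus "x : ?L" by(metis (no_types, lifting) imageI snd_conv)
   qed
   ultimately show "openin ?Y (pull i V)"
    by(simp add: closedin_def double_diff pull_def)
  qed
  moreover have "openin (tset {0..1}) (ball t0 (eps / 2) Int {0..1})" by(metis openin_open_Int open_ball inf_commute)
  ultimately have "openin (ptop (tset {0..1}) sp) ((ball t0 (eps / 2) Int {0..1}) \<times> V)"
   by(simp only: openin_prod_Times_iff simp_thms)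
  moreover have "tp : (ball t0 (eps / 2) Int {0..1}) \<times> V"
   using e t0 eps(1) JT p0 by(auto simp: V_def pts_def)
  moreover have "(ball t0 (eps / 2) Int {0..1}) \<times> V <= ?P"
   by(auto simp: V_def J_def topspace_prod_topology)
  ultimately show "EX T. openin (ptop (tset {0..1}) sp) T & tp : T & T <= ?P" by blast
 qed
qed

end

context gen begin

lemma F_known:
 assumes D: "!!c. c : D ==> c : C & crit c" "!!c vp. [|c : D; vp : N c|] ==> bd vp c : D"
  and f: "!!c z. [|c : D; z : Sh c|] ==> T0 c z = f c z"
   "!!c z vp. [|c : D; z : Sh c; vp : N c; z vp = 0|] ==> f c z = f (bd vp c) z"
 shows "[|c : D; z : Sh c|] ==> F c z = f c z"
proof(induction c rule: wf_induct_rule[OF wfR])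
 case (1 c)
 have c: "c : C" "crit c" using D(1)[OF 1(2)] by auto
 show ?case
 proof(cases "EX vp:N c. z vp = 0")
  case True
  note zf = zero_face[OF True, THEN conjunct1] zero_face[OF True, THEN conjunct2]
  have "F c z = F (bd (zero_face c z) c) z" using F_eq[OF c(1) 1(3)] c(2) True by simp
  also have "... = f (bd (zero_face c z) c) z"
   by(rule "1.IH"[OF facet_R[OF c(1) zf(1)] D(2)[OF 1(2) zf(1)] Sh_bd[OF c(1) 1(3) zf]])
  also have "... = f c z" by(rule f(2)[OF 1(2,3) zf, symmetric])
  finally show ?thesis .
 next
  case False
  hence "F c z = T0 c z" using F_eq[OF c(1) 1(3)] c(2) by simp
  thus ?thesis using f(1)[OF 1(2,3)] by simp
 qed
qed

end

locale morse_contraction = charted C N blk bd R crit tau phi chart chinv + M2: matching C N blk bd R2 crit2 tau2 phi2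
 for C :: "'c set" and N :: "'c => 'n set" and blk :: "'n => 'b" and bd :: "'n => 'c => 'c"
  and R crit tau phi chart chinv R2 crit2 tau2 phi2 +
 fixes c0 :: 'c
 assumes c0: "c0 : C" "N c0 = {}" and crit2: "[|c : C; crit2 c|] ==> c = c0"
begin

definition "pt0 = q c0 (%_. 0)"

text \<open>The homotopy \<open>h\<close> contracts \<open>q\<close> to a point on the complex itself, where the second matching is
 available. It descends to \<open>sp\<close> by the extension \<open>k\<close> over a second cylinder: with \<open>Lo\<close> in the inner
 cylinder one has \<open>h\<close>, with \<open>Hi\<close> a homotopy compatible with the first matching.\<close>

definition kn where "kn x Z = (if snd x = Lo then q (fst x) (%n. Z (Inl n)) else pt0)"

lemma Sh_c0: "z : Sh c0"
 using c0 by(simp add: shape_def)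

lemma q_c0: "q c0 z = pt0"
 unfolding pt0_def by(rule q.F_cong[OF c0(1) Sh_c0]) (simp add: c0)

lemma cyl_Sh: "Z : shape (cylblk blk) (cylN N (c, u)) ==> (%n. Z (Inl n)) : Sh c"
 using shape_cyl(1)[of Z blk "N c"] shape_cyl(2)[of Z blk "N c"] by(cases u) auto

end

sublocale morse_contraction \<subseteq> h: gen "C \<times> UNIV" "cylN N" "cylblk blk" "cylbd bd" M2.cyl_R M2.cyl_crit M2.cyl_tau M2.cyl_phi
  "%c. retr (cylblk blk) (cylN N c) (M2.cyl_phi c)" kn
proof(intro gen.intro matching.retr_rho M2.cyl_matching gen_axioms.intro)
 fix c and z z' :: "_ => real" assume a: "c : C \<times> UNIV" "z : shape (cylblk blk) (cylN N c)"
  and eq: "!!n. n : cylN N c ==> z n = z' n"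
 obtain b u where c: "c = (b, u)" by(cases c) auto
 have "q b (%n. z (Inl n)) = q b (%n. z' (Inl n))"
  by(rule q.F_cong) (use a eq c cyl_Sh in auto)
 thus "kn c z = kn c z'" by(simp add: kn_def c)
qed

context morse_contraction begin

lemma h_cons: "h.consistent"
 unfolding h.consistent_def
proof(intro allI impI, elim conjE)
 fix c z vq vq'
 assume a: "c : C \<times> UNIV" "~ M2.cyl_crit c" "c = M2.cyl_tau c" "z : h.Sh c" "vq : cylN N c" "vq ~= M2.cyl_phi c" "z vq = 0"
  "retr (cylblk blk) (cylN N c) (M2.cyl_phi c) z ~= z"
 have "shape_facet (cylblk blk) (cylN N c) (M2.cyl_phi c)" using h.facet_tau[OF a(1,2)] a(3) by simp
 thus "h.F (cylbd bd vq c) z = h.F (cylbd bd vq' c) (retr (cylblk blk) (cylN N c) (M2.cyl_phi c) z)"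
  using shape_facet.retr_fix[of "cylblk blk" "cylN N c" "M2.cyl_phi c" z vq] a by simp
qed

lemmas h_compat = h.compatD[OF h.compat_all[OF h_cons]]

lemma h_known: "[|x : C \<times> UNIV; M2.cyl_crit x; Z : h.Sh x|] ==> h.F x Z = kn x Z"
proof(rule h.F_known[where D = "{x : C \<times> UNIV. M2.cyl_crit x}"])
 fix x vq assume x: "x : {x : C \<times> UNIV. M2.cyl_crit x}" "vq : cylN N x"
 obtain c u where c: "x = (c, u)" "c : C" "u ~= Mid | c = c0"
  using x(1) crit2 by(cases x) (auto simp: M2.cyl_crit_def)
 show b: "cylbd bd vq x : {x : C \<times> UNIV. M2.cyl_crit x}"
  using x(2) c bd_in[OF c(2)] c0 by(cases vq) (auto simp: M2.cyl_crit_def split: if_splits)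
 fix Z assume Z: "Z : h.Sh x" "Z vq = 0"
 show "kn x Z = kn (cylbd bd vq x) Z"
 proof(cases vq)
  case (Inl n)
  hence n: "n : N c" using x(2) c by(auto split: if_splits)
  have "q c (%n. Z (Inl n)) = q (bd n c) (%n. Z (Inl n))"
   by(rule q_compat[OF c(2) cyl_Sh n]) (use Z c Inl in auto)
  thus ?thesis by(simp add: kn_def c(1) Inl)
 next
  case (Inr b)
  hence "u = Mid" using x(2) c by(auto split: if_splits)
  thus ?thesis using c q_c0 by(simp add: kn_def Inr)
 qed
qed auto

lemma continuous_on_comp_coord: "con A (%Z::'i => real. %n. Z (g n))"
 by(rule con_prod) (rule continuous_on_coord[OF continuous_on_id])

lemma pt0_sp: "pt0 : pts"
 using q_crit_cell[OF c0(1) Sh_c0, of "%_. 0"] by(cases pt0) (simp add: pts_def pt0_def)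

lemma continuous_map_q_comp:
 assumes "c : C" "!!Z. Z : A ==> g Z : Sh c" "con A g"
 shows "cmap (tset A) sp (%Z. q c (g Z))"
proof -
 have "cmap (tset A) (tset (Sh c)) g" using assms by auto
 from continuous_map_compose[OF this q_sp[OF assms(1)]] show ?thesis by(simp add: o_def)
qed

lemma h_cont: "x : C \<times> UNIV ==> cmap (tset (h.Sh x)) sp (h.F x)"
proof(rule h.F_continuous[OF h_cons, where Q = UNIV])
 fix x assume x: "x : C \<times> UNIV" "M2.cyl_crit x"
 obtain c u where c: "x = (c, u)" by(cases x) auto
 have "cmap (tset (h.Sh x)) sp (kn x)"
 proof(cases "u = Lo")
  case True
  have "cmap (tset (h.Sh x)) sp (%Z. q c (%n. Z (Inl n)))"
   by(rule continuous_map_q_comp[OF _ _ continuous_on_comp_coord]) (use x c cyl_Sh in auto)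
  thus ?thesis using True c by(simp add: kn_def[abs_def])
 next
  case False
  thus ?thesis using pt0_sp c by(simp add: kn_def[abs_def])
 qed
 thus "cmap (tset (h.Sh x)) sp (h.F x)"
  by(rule continuous_map_eq) (use h_known[OF x] in simp)
qed auto

abbreviation "N3 == cylN (cylN N)"
abbreviation "blk3 == cylblk (cylblk blk)"
abbreviation "bd3 == cylbd (cylbd bd)"
abbreviation "C3 == ((C \<times> UNIV) \<times> UNIV)"
abbreviation "Sh3 x == shape blk3 (N3 x)"
abbreviation "i3 n == Inl (Inl n)"

text \<open>Over the cells with \<open>Hi\<close> only the coordinates of the base are pushed, so that time is preserved.\<close>

definition krho where
 "krho x Z = (if crit (fst (fst x)) | snd (fst x) ~= Hi then retr blk3 (N3 x) (pri_phi x) Z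
   else case_sum (case_sum (retr blk (N (fst (fst x))) (phi (fst (fst x))) (%n. Z (i3 n))) (%b. Z (Inl (Inr b)))) (%b. Z (Inr b)))"

text \<open>The outer cylinder is time: it starts with \<open>q\<close> and ends at
  \<open>pt0\<close> whatever the inner position. Over the inner \<open>Lo\<close>, at intermediate
  times, the contraction \<open>h\<close> is prescribed.\<close>

definition kk where
 "kk x Z = (if snd x = Lo then q (fst (fst x)) (%n. Z (i3 n)) else if snd x = Hi then pt0
   else h.F (fst (fst x), Mid) (case_sum (%n. Z (i3 n)) (%b. Z (Inr b))))"

lemma cyl2_Sh: "Z : Sh3 ((c, u), s) ==> (%n. Z (i3 n)) : Sh c"
proof -
 assume "Z : Sh3 ((c, u), s)"
 hence "(%n. Z (Inl n)) : shape (cylblk blk) (cylN N (c, u))"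
  using shape_cyl(1)[of Z "cylblk blk"] shape_cyl(2)[of Z "cylblk blk"] by(cases s) auto
 thus ?thesis by(rule cyl_Sh)
qed

lemma Sh3_noMid: "u ~= Mid ==> Z : Sh3 ((c, u), Mid) <->
  (%n. Z (i3 n)) : Sh c & 0 <= Z (Inr False) & 0 <= Z (Inr True) & Z (Inr False) + Z (Inr True) = 1"
 using shape_cyl(2)[of Z "cylblk blk" "cylN N (c, u)"] shape_cyl(1)[of "%n. Z (Inl n)" blk "N c"] by auto

lemma h_Sh: "[|u ~= Mid; Z : Sh3 ((c, u), Mid)|] ==> case_sum (%n. Z (i3 n)) (%b. Z (Inr b)) : h.Sh (c, Mid)"
 using Sh3_noMid[of u Z c] shape_cyl(2)[of "case_sum (%n. Z (i3 n)) (%b. Z (Inr b))" blk "N c"] by simp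

lemma kk_cong:
 assumes "x : C3" "pri_crit x" "Z : Sh3 x" "!!i. i : N3 x ==> Z i = Z' i"
 shows "kk x Z = kk x Z'"
proof -
 obtain c u s where x: "x = ((c, u), s)" "c : C" using assms(1) by(cases x) auto
 have c: "s ~= Mid | u = Lo" using assms(2) x by(auto simp: pri_crit_def)
 have n: "Z (i3 n) = Z' (i3 n)" if "n : N c" for n using assms(4)[of "i3 n"] that x by auto
 have "q c (%n. Z (i3 n)) = q c (%n. Z' (i3 n))"
  by(rule q.F_cong[OF x(2)]) (use assms(3) x n cyl2_Sh in auto)
 moreover have "h.F (c, Mid) (case_sum (%n. Z (i3 n)) (%b. Z (Inr b))) = h.F (c, Mid) (case_sum (%n. Z' (i3 n)) (%b. Z' (Inr b)))"
  if "s = Mid"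
 proof(rule h.F_cong)
  have u: "u ~= Mid" using c that by auto
  show "case_sum (%n. Z (i3 n)) (%b. Z (Inr b)) : h.Sh (c, Mid)"
   by(rule h_Sh[OF u]) (use assms(3) x that in simp)
  fix i assume "i : cylN N (c, Mid)"
  thus "case_sum (%n. Z (i3 n)) (%b. Z (Inr b)) i = case_sum (%n. Z' (i3 n)) (%b. Z' (Inr b)) i"
   using n assms(4) x that by(cases i) auto
 qed (use x in simp)
 ultimately show ?thesis using x by(cases s) (simp_all add: kk_def)
qed

lemma krho_matching: "matching_rho C3 N3 blk3 bd3 pri_R pri_crit pri_tau pri_phi krho"
proof -
 interpret m: matching C3 N3 blk3 bd3 pri_R pri_crit pri_tau pri_phi by(rule pri_matching)
 interpret r: matching_rho C3 N3 blk3 bd3 pri_R pri_crit pri_tau pri_phi "%x. retr blk3 (N3 x) (pri_phi x)"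
  by(rule m.retr_rho)
 have dflt: "krho (pri_tau x) = retr blk3 (N3 (pri_tau x)) (pri_phi (pri_tau x))"
  if a: "~ (EX c. x = ((c, Hi), Mid) & ~ crit c)" "x : C3" "~ pri_crit x" for x
 proof(rule ext)
  fix Z
  obtain c u s where x: "x = ((c, u), s)" "c : C" using a(2) by(cases x) auto
  have "s = Mid" using a(3) x by(auto simp: pri_crit_def)
  hence "crit c | u ~= Hi" using a(1) x by auto
  thus "krho (pri_tau x) Z = retr blk3 (N3 (pri_tau x)) (pri_phi (pri_tau x)) Z"
   by(auto simp: krho_def pri_tau_def x)
 qed
 have sp: "pri_tau ((c, Hi), Mid) = ((tau c, Hi), Mid)" "pri_phi ((c, Hi), Mid) = i3 (phi c)"
  "krho ((tau c, Hi), Mid) Z = case_sum (case_sum (retr blk (N (tau c)) (phi c) (%n. Z (i3 n))) (%b. Z (Inl (Inr b)))) (%b. Z (Inr b))"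
  if "c : C" "~ crit c" for c Z
  using tau_tau[OF that] that by(simp_all add: pri_tau_def pri_phi_def krho_def)
 show ?thesis
 proof(intro matching_rho.intro pri_matching matching_rho_axioms.intro)
  fix x Z assume x: "x : C3" "~ pri_crit x"
  show "con (Sh3 (pri_tau x)) (krho (pri_tau x))"
  proof(cases "EX c. x = ((c, Hi), Mid) & ~ crit c")
   case True
   then obtain c where c: "x = ((c, Hi), Mid)" "~ crit c" "c : C" using x by blast
   interpret sf: shape_facet blk "N (tau c)" "phi c" by(rule facet_tau[OF c(3,2)])
   have "con (Sh3 ((tau c, Hi), Mid)) (%Z. retr blk (N (tau c)) (phi c) (%n. Z (i3 n)))"
    by(rule continuous_on_compose2[OF sf.continuous_on_retr continuous_on_comp_coord]) (use cyl2_Sh in blast)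
   hence *: "con (Sh3 ((tau c, Hi), Mid)) (%Z. retr blk (N (tau c)) (phi c) (%n. Z (i3 n)) n)" for n
    by(rule continuous_on_coord)
   have cc: "con A (%Z::_ => real. Z i)" for A and i :: "('n + bool) + bool"
    by(rule continuous_on_coord[OF continuous_on_id])
   show ?thesis unfolding c(1) sp(1)[OF c(3,2)] sp(3)[OF c(3,2), abs_def]
   proof(rule con_prod)
    fix i :: "('n + bool) + bool"
    show "con (Sh3 ((tau c, Hi), Mid)) (%Z. case_sum (case_sum (retr blk (N (tau c)) (phi c) (%n. Z (i3 n))) (%b. Z (Inl (Inr b)))) (%b. Z (Inr b)) i)"
     using * cc by(cases i; cases "projl i") simp_all
   qed
  next
   case False
   show ?thesis unfolding dflt[OF False x] by(rule r.rho_cont[OF x])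
  qed
  show "krho (pri_tau x) Z i = krho (pri_tau x) Z' i" if "!!i. i : N3 (pri_tau x) ==> Z i = Z' i" "i : N3 (pri_tau x)" for Z' i
  proof(cases "EX c. x = ((c, Hi), Mid) & ~ crit c")
   case True
   then obtain c where c: "x = ((c, Hi), Mid)" "~ crit c" "c : C" using x by blast
   interpret sf: shape_facet blk "N (tau c)" "phi c" by(rule facet_tau[OF c(3,2)])
   have n: "Z (i3 n) = Z' (i3 n)" if "n : N (tau c)" for n
    by(rule \<open>!!i. i \<in> N3 (pri_tau x) ==> Z i = Z' i\<close>) (use that c sp in auto)
   have b: "Z (Inr b) = Z' (Inr b)" for b
    by(rule \<open>!!i. i \<in> N3 (pri_tau x) ==> Z i = Z' i\<close>) (use c sp in auto)
   have "(EX b. i = Inr b) | (EX n:N (tau c). i = i3 n)" using \<open>i \<in> N3 (pri_tau x)\<close> c sp by auto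
   thus ?thesis unfolding c(1) sp(1)[OF c(3,2)] sp(3)[OF c(3,2)]
    using b sf.retr_cong[of "%n. Z (i3 n)" "%n. Z' (i3 n)", OF n] by auto
  next
   case False
   show ?thesis unfolding dflt[OF False x] by(rule r.rho_cong[OF x that])
  qed
  assume Z: "Z : Sh3 (pri_tau x)"
  show "krho (pri_tau x) Z : Sh3 (pri_tau x)"
  proof(cases "EX c. x = ((c, Hi), Mid) & ~ crit c")
   case True
   then obtain c where c: "x = ((c, Hi), Mid)" "~ crit c" "c : C" using x by blast
   interpret sf: shape_facet blk "N (tau c)" "phi c" by(rule facet_tau[OF c(3,2)])
   show ?thesis using Z sf.retr_shape[of "%n. Z (i3 n)"]
    unfolding c(1) sp(1)[OF c(3,2)] sp(3)[OF c(3,2)] Sh3_noMid[OF cpos.distinct(5)] by simp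
  next
   case False
   show ?thesis unfolding dflt[OF False x] by(rule r.rho_Sh[OF x Z])
  qed
  show "EX vq:N3 (pri_tau x). vq ~= pri_phi x & krho (pri_tau x) Z vq = 0"
  proof(cases "EX c. x = ((c, Hi), Mid) & ~ crit c")
   case True
   then obtain c where c: "x = ((c, Hi), Mid)" "~ crit c" "c : C" using x by blast
   interpret sf: shape_facet blk "N (tau c)" "phi c" by(rule facet_tau[OF c(3,2)])
   have "(%n. Z (i3 n)) : Sh (tau c)" by(rule cyl2_Sh[where u = Hi and s = Mid]) (use Z c sp in simp)
   from sf.retr_horn[OF this] obtain vq where vq: "vq : N (tau c)" "vq ~= phi c"
    "retr blk (N (tau c)) (phi c) (%n. Z (i3 n)) vq = 0" by blast
   show ?thesis unfolding c(1) sp(1,2)[OF c(3,2)] sp(3)[OF c(3,2)]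
    by(rule bexI[of _ "i3 vq"]) (use vq in auto)
  next
   case False
   show ?thesis unfolding dflt[OF False x] by(rule r.rho_horn[OF x Z])
  qed
 qed
qed

end

sublocale morse_contraction \<subseteq> k: gen "(C \<times> UNIV) \<times> UNIV" "cylN (cylN N)" "cylblk (cylblk blk)" "cylbd (cylbd bd)"
  pri_R pri_crit pri_tau pri_phi krho kk
 by(intro gen.intro krho_matching gen_axioms.intro kk_cong)

context morse_contraction begin

lemma q_retr:
 assumes "c : C" "~ crit c" "c = tau c" "z : Sh c" "vq : N c" "vq ~= phi c" "retr blk (N c) (phi c) z vq = 0"
 shows "q c z = q (bd vq c) (retr blk (N c) (phi c) z)"
proof -
 have "q.push c z = retr blk (N c) (phi c) z"
  using assms(3) lift_tau[OF assms(3)] unfolding q.push_def by simp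
 thus ?thesis using q_pair[OF assms(1,2,4), of vq] assms(3,5-7) by simp
qed

lemma kk_compat:
 assumes "x : C3" "pri_crit x" "Z : Sh3 x" "vq : N3 x" "Z vq = 0"
 shows "kk x Z = kk (bd3 vq x) Z"
proof -
 obtain c u s where x: "x = ((c, u), s)" "c : C" using assms(1) by(cases x) auto
 have c: "s ~= Mid | u = Lo" using assms(2) x by(auto simp: pri_crit_def)
 have z: "(%n. Z (i3 n)) : Sh c" using assms(3) unfolding x(1) by(rule cyl2_Sh)
 consider (n) n where "vq = i3 n" "n : N c" | (u) b where "vq = Inl (Inr b)" "u = Mid" | (s) b where "vq = Inr b" "s = Mid"
  using assms(4) x by(auto split: if_splits)
 thus ?thesis
 proof cases
  case n
  have 1: "q c (%n. Z (i3 n)) = q (bd n c) (%n. Z (i3 n))"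
   by(rule q_compat[OF x(2) z n(2)]) (use assms(5) n(1) in simp)
  have 2: "h.F (c, Mid) (case_sum (%n. Z (i3 n)) (%b. Z (Inr b))) = h.F (cylbd bd (Inl n) (c, Mid)) (case_sum (%n. Z (i3 n)) (%b. Z (Inr b)))"
   if "s = Mid"
   by(rule h_compat[OF _ h_Sh[of u]]) (use x n assms(3,5) c that in auto)
  show ?thesis using 1 2 n by(cases s) (simp_all add: x(1) kk_def)
 next
  case u
  hence "s ~= Mid" using c by auto
  thus ?thesis by(simp add: x(1) u kk_def)
 next
  case (s b)
  let ?Z = "case_sum (%n. Z (i3 n)) (%b. Z (Inr b))"
  have u: "u = Lo" using c s by simp
  have sh: "?Z : h.Sh (c, Mid)" by(rule h_Sh[of u]) (use assms(3) x s u in auto)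
  have "h.F (c, Mid) ?Z = h.F (cylbd bd (Inr b) (c, Mid)) ?Z"
   by(rule h_compat[OF _ sh]) (use x s assms(5) in auto)
  also have "... = kn (cylbd bd (Inr b) (c, Mid)) ?Z"
  proof(rule h_known)
   show "?Z : h.Sh (cylbd bd (Inr b) (c, Mid))"
    by(rule h.Sh_bd[OF _ sh]) (use x s assms(5) in auto)
  qed (use x in "auto simp: M2.cyl_crit_def")
  finally show ?thesis by(simp add: x(1) s u kk_def kn_def)
 qed
qed

lemma pri_crit_bd:
 "[|x : C3; pri_crit x; vq : N3 x|] ==> bd3 vq x : C3 & pri_crit (bd3 vq x)"
proof -
 assume a: "x : C3" "pri_crit x" "vq : N3 x"
 obtain c u s where x: "x = ((c, u), s)" "c : C" using a(1) by(cases x) auto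
 consider (n) n where "vq = i3 n" "n : N c" | (u) b where "vq = Inl (Inr b)" "u = Mid" | (s) b where "vq = Inr b" "s = Mid"
  using a(3) x by(auto split: if_splits)
 thus ?thesis
  by cases (use a x bd_in in "auto simp: pri_crit_def")
qed

lemma k_known: "[|x : C3; pri_crit x; Z : Sh3 x|] ==> k.F x Z = kk x Z"
 by(rule k.F_known[where D = "{x : C3. pri_crit x}"]) (use pri_crit_bd kk_compat in "auto simp del: cylN.simps")

text \<open>\<open>krho\<close> fixes a point that lies in a base facet of the horn, so only points
  at an end of time are in question. There the value is \<open>q\<close> of the base point or
  \<open>pt0\<close>, and pushing the base point changes neither. If the pushed point is evaluated
  in a base facet, compatibility of that facet leads back to the same end of time.\<close>

lemma k_cons: "k.consistent"
 unfolding k.consistent_def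
proof(intro allI impI, elim conjE)
 fix x Z xj xj'
 assume a: "x : C3" "~ pri_crit x" "x = pri_tau x" "Z : Sh3 x" "xj : N3 x" "xj ~= pri_phi x" "Z xj = 0"
  "xj' : N3 x" "xj' ~= pri_phi x" "krho x Z xj' = 0" "krho x Z ~= Z"
  "ALL x':C3. (x', bd3 (pri_phi x) x) : pri_R --> k.compat x'"
 obtain c u s where x: "x = ((c, u), s)" "c : C" using a(1) by(cases x) auto
 have s: "s = Mid" using a(2) x by(auto simp: pri_crit_def)
 have u: "u = Hi" "~ crit c"
 proof -
  have "shape_facet blk3 (N3 x) (pri_phi x)" using k.facet_tau[OF a(1,2)] a(3) by simp
  hence "retr blk3 (N3 x) (pri_phi x) Z = Z" using shape_facet.retr_fix[of blk3 "N3 x" "pri_phi x" Z xj] a by simp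
  thus "u = Hi" "~ crit c" using a(11) x by(auto simp: krho_def split: if_splits)
 qed
 have ct: "c = tau c" using a(3) u x by(simp add: pri_tau_def)
 interpret sf: shape_facet blk "N c" "phi c" using facet_tau[OF x(2) u(2)] ct by simp
 have ph: "pri_phi x = i3 (phi c)" using x u by(simp add: pri_phi_def)
 let ?z = "%n. Z (i3 n)" and ?r = "retr blk (N c) (phi c) (%n. Z (i3 n))"
 have kr: "krho x Z = case_sum (case_sum ?r (%b. Z (Inl (Inr b)))) (%b. Z (Inr b))"
  using x u by(simp add: krho_def)
 have z: "?z : Sh c" "Z (Inr False) + Z (Inr True) = 1"
  using a(4) unfolding x(1) s u(1) Sh3_noMid[OF cpos.distinct(5)] by blast+
 have r: "?r : Sh c" by(rule sf.retr_shape[OF z(1)])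
 have nm: "(EX b. th = Inr b) | (EX n:N c. th = i3 n)" if "th : N3 x" for th
  using that x u s by auto
 obtain b where b: "xj = Inr b"
 proof -
  have "xj ~= i3 n" if n: "n : N c" for n
  proof
   assume e: "xj = i3 n"
   have "?r = ?z" by(rule sf.retr_fix[OF z(1) n]) (use a(6,7) e ph in auto)
   hence "krho x Z i = Z i" for i unfolding kr by(cases i; cases "projl i") (simp_all add: fun_eq_iff)
   thus False using a(11) by blast
  qed
  thus ?thesis using nm[OF a(5)] that by blast
 qed
 have Zb: "Z (Inr b) = 0" using a(7) b by simp
 obtain vq where vq: "vq : N c" "vq ~= phi c" "?r vq = 0" using sf.retr_horn[OF z(1)] by blast
 let ?y = "if b then Lo else Hi"
 define v where "v w = (if b then q c w else pt0)" for w
 have qr: "q c ?r = q c ?z"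
  using q_retr[OF x(2) u(2) ct z(1) vq] q_compat[OF x(2) r vq(1,3)] by simp
 have yC: "((c, Hi), ?y) : C3" "pri_crit ((c, Hi), ?y)" using x by(auto simp: pri_crit_def)
 have Fv: "k.F ((c, Hi), ?y) W = v (%n. W (i3 n))" if "(%n. W (i3 n)) : Sh c" for W
 proof -
  have "W : Sh3 ((c, Hi), ?y)" using that shape_cyl(1)[of W "cylblk blk"] shape_cyl(1)[of "%n. W (Inl n)" blk "N c"] by simp
  from k_known[OF yC this] show ?thesis by(simp add: kk_def v_def)
 qed
 have 1: "k.F (bd3 xj x) Z = v ?z" using Fv[OF z(1)] by(simp add: b x(1) u s)
 have ri: "(%n. krho x Z (i3 n)) = ?r" unfolding kr by simp
 have vr: "v ?r = v ?z" using qr by(simp add: v_def)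
 from nm[OF a(8)] show "k.F (bd3 xj x) Z = k.F (bd3 xj' x) (krho x Z)"
 proof(elim disjE exE bexE)
  fix b' assume b': "xj' = Inr b'"
  have "Z (Inr b') = 0" using a(10) b' unfolding kr by simp
  hence "b' = b" using Zb z(2) by(cases b; cases b') auto
  hence "k.F (bd3 xj' x) (krho x Z) = v ?r" using Fv[of "krho x Z"] r unfolding ri by(simp add: b' x(1) u s)
  thus ?thesis using 1 vr by simp
 next
  fix n assume n: "n : N c" "xj' = i3 n"
  have nf: "n ~= phi c" "?r n = 0" using a(9,10) n ph unfolding kr by auto
  let ?s = "bd3 (pri_phi x) x"
  have ss: "?s : C3" "~ pri_crit ?s" "pri_tau ?s = x" "pri_phi ?s = pri_phi x"
   using k.bd_in[OF a(1), of "pri_phi x"] k.phi_in[OF a(1,2)] k.tau_sig[OF a(1,2)] a(3) by auto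
  have "(bd3 xj' x, ?s) : pri_R" using k.horn_R[OF ss(1,2), of xj'] ss(3,4) a(8,9) by simp
  hence cb: "k.compat (bd3 xj' x)" by(rule a(12)[rule_format, OF k.bd_in[OF a(1,8)]])
  have kS: "krho x Z : Sh3 x" using k.rho_Sh[OF a(1,2), of Z] a(3,4) by simp
  have bx: "bd3 xj' x = ((bd n c, Hi), Mid)" using n x u s by simp
  have "k.F (bd3 xj' x) (krho x Z) = k.F (bd3 (Inr b) (bd3 xj' x)) (krho x Z)"
   by(rule k.compatD[OF cb k.Sh_bd[OF a(1) kS a(8,10)]]) (use bx Zb kr in auto)
  also have "bd3 (Inr b) (bd3 xj' x) = ((bd n c, Hi), ?y)" unfolding bx by simp
  also have "k.F ((bd n c, Hi), ?y) (krho x Z) = (if b then q (bd n c) ?r else pt0)"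
  proof -
   have rs: "(%n. krho x Z (i3 n)) : Sh (bd n c)" unfolding ri by(rule Sh_bd[OF x(2) r n(1) nf(2)])
   have "krho x Z : Sh3 ((bd n c, Hi), ?y)"
    using rs shape_cyl(1)[of "krho x Z" "cylblk blk"] shape_cyl(1)[of "%n. krho x Z (Inl n)" blk "N (bd n c)"] by simp
   from k_known[OF _ _ this] have "k.F ((bd n c, Hi), ?y) (krho x Z) = kk ((bd n c, Hi), ?y) (krho x Z)"
    using bd_in[OF x(2) n(1)] by(simp add: pri_crit_def)
   thus ?thesis unfolding kk_def ri by simp
  qed
  also have "... = v ?r" using q_compat[OF x(2) r n(1) nf(2)] by(simp add: v_def)
  finally show ?thesis using 1 vr by simp
 qed
qed

lemmas k_compat = k.compatD[OF k.compat_all[OF k_cons]]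
lemmas k_pair = k.F_pair[OF k_cons]

lemma k_cont: "x : C3 ==> cmap (tset (Sh3 x)) sp (k.F x)"
proof(rule k.F_continuous[OF k_cons, where Q = UNIV])
 fix x assume x: "x : C3" "pri_crit x"
 obtain c u s where c: "x = ((c, u), s)" "c : C" using x(1) by(cases x) auto
 have "cmap (tset (Sh3 x)) sp (kk x)"
 proof(cases s)
  case Lo
  have "cmap (tset (Sh3 x)) sp (%Z. q c (%n. Z (i3 n)))"
   by(rule continuous_map_q_comp[OF c(2) _ continuous_on_comp_coord]) (use c cyl2_Sh in blast)
  thus ?thesis using Lo c by(simp add: kk_def[abs_def])
 next
  case Hi
  thus ?thesis using pt0_sp c by(simp add: kk_def[abs_def])
 next
  case Mid
  hence u: "u = Lo" using x(2) c by(simp add: pri_crit_def)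
  let ?g = "%Z::('n + bool) + bool => real. case_sum (%n. Z (i3 n)) (%b. Z (Inr b))"
  have "?g Z = (%i. Z (case i of Inl n => i3 n | Inr b => Inr b))" for Z by(auto split: sum.split)
  hence "con (Sh3 x) ?g" using continuous_on_comp_coord by simp
  moreover have "?g Z : h.Sh (c, Mid)" if "Z : Sh3 x" for Z
   by(rule h_Sh[of u]) (use that c Mid u in auto)
  ultimately have "cmap (tset (Sh3 x)) (tset (h.Sh (c, Mid))) ?g" by auto
  from continuous_map_compose[OF this h_cont[of "(c, Mid)"]] c(2)
  have "cmap (tset (Sh3 x)) sp (%Z. h.F (c, Mid) (?g Z))" by(simp add: o_def)
  thus ?thesis using Mid c by(simp add: kk_def[abs_def])
 qed
 thus "cmap (tset (Sh3 x)) sp (k.F x)"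
  by(rule continuous_map_eq) (use k_known[OF x] in simp)
qed auto

text \<open>Used over the inner \<open>Hi\<close>, where the inner cylinder contributes no names;
  the value 0 is a dummy.\<close>

definition mk :: "('n => real) => (bool => real) => ('n + bool) + bool => real" where
 "mk z y = case_sum (case_sum z (%_. 0)) y"

text \<open>Over \<open>Hi\<close> the push moves the base coordinates exactly as the push behind
  \<open>q\<close> does and preserves time, so the value depends on the base point through
  \<open>q\<close> alone. This is what lets the homotopy descend to \<open>sp\<close>.\<close>

lemma k_q:
 "[|c : C; Z : Sh3 ((c, Hi), Mid); q c (%n. Z (i3 n)) = (e, x)|] ==>
  k.F ((c, Hi), Mid) Z = k.F ((e, Hi), Mid) (mk (chart e x) (%b. Z (Inr b)))"
proof(induction c arbitrary: Z rule: wf_induct_rule[OF wfR])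
 case (1 c)
 let ?z = "%n. Z (i3 n)" and ?x = "((c, Hi), Mid)"
 have z: "?z : Sh c" using 1(3) by(rule cyl2_Sh)
 have xC: "?x : C3" using 1(2) by simp
 from 1(2) z show ?case
 proof(cases rule: q_cases)
  case inner
  hence e: "e = c" "x = chinv c ?z" using 1(4) by simp_all
  show ?thesis unfolding e
   by(rule k.F_cong[OF xC 1(3)]) (use chart_chinv[OF 1(2) inner(1) z] in "auto simp: mk_def")
 next
  case (bdry vp)
  have m: "i3 vp : N3 ?x" using bdry(2) by simp
  have "k.F ?x Z = k.F (bd3 (i3 vp) ?x) Z" by(rule k_compat[OF xC 1(3) m bdry(3)])
  also have "... = k.F ((bd vp c, Hi), Mid) Z" by simp
  also have "... = k.F ((e, Hi), Mid) (mk (chart e x) (%b. Z (Inr b)))"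
  proof(rule "1.IH"[OF bdry(7,5)])
   show "Z : Sh3 ((bd vp c, Hi), Mid)" using k.Sh_bd[OF xC 1(3) m bdry(3)] by simp
  qed (use bdry(4) 1(4) in simp)
  finally show ?thesis .
 next
  case (pair vq)
  let ?t = "tau c" and ?W = "k.push ?x Z"
  have t: "?t : C" "phi c : N ?t" using tau_in phi_in 1(2) pair(1) by auto
  have tt: "~ crit ?t" "phi ?t = phi c" using tau_tau[OF 1(2) pair(1)] by auto
  have nc: "~ pri_crit ?x" by(simp add: pri_crit_def)
  have pt: "pri_tau ?x = ((?t, Hi), Mid)" "pri_phi ?x = i3 (phi c)"
   using pair(1) by(simp_all add: pri_tau_def pri_phi_def)
  have ll: "k.lift ?x Z (i3 n) = lift c ?z n" if n: "n : N ?t" for n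
  proof(cases "c = ?t")
   case True
   hence "?x = pri_tau ?x" using pt by simp
   thus ?thesis using k.lift_tau[of ?x Z] lift_tau[OF True] by simp
  next
   case False
   have "N3 ((?t, Hi), Mid) - {i3 (phi c)} = Inl ` Inl ` (N ?t - {phi c}) Un range Inr" by auto
   hence pr: "prune blk3 (N3 ((?t, Hi), Mid) - {i3 (phi c)}) = Inl ` Inl ` prune blk (N ?t - {phi c}) Un range Inr"
    by(simp only: prune_cyl)
   have "k.lift ?x Z = extend (N3 ((?t, Hi), Mid)) (i3 (phi c)) blk3 Z"
    using k.lift_sigma[of ?x Z] False pt by simp
   moreover have "lift c ?z = extend (N ?t) (phi c) blk ?z" by(rule lift_sigma[OF False])
   ultimately show ?thesis using n unfolding extend_def pr by(simp add: image_iff)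
  qed
  have lb: "k.lift ?x Z (Inr b) = Z (Inr b)" for b
   by(rule k.lift_coord[OF xC nc]) simp
  have W: "?W = case_sum (case_sum (retr blk (N ?t) (phi c) (%n. k.lift ?x Z (i3 n))) (%b. k.lift ?x Z (Inl (Inr b)))) (%b. k.lift ?x Z (Inr b))"
   unfolding k.push_def pt krho_def using tt by simp
  interpret sf: shape_facet blk "N ?t" "phi c" by(rule facet_tau[OF 1(2) pair(1)])
  have Wi: "?W (i3 n) = q.push c ?z n" if n: "n : N ?t" for n
   unfolding W q.push_def tt(2) using sf.retr_cong[of "%n. k.lift ?x Z (i3 n)" "lift c ?z", OF ll n] by simp
  have Wb: "(%b. ?W (Inr b)) = (%b. Z (Inr b))" unfolding W lb by simp
  have m: "i3 vq : N3 (pri_tau ?x)" "i3 vq ~= pri_phi ?x" "?W (i3 vq) = 0"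
   using pair(2-4) pt Wi by auto
  have "k.F ?x Z = k.F (bd3 (i3 vq) (pri_tau ?x)) ?W" by(rule k_pair[OF xC nc 1(3) m])
  also have "... = k.F ((bd vq ?t, Hi), Mid) ?W" unfolding pt by simp
  also have "... = k.F ((e, Hi), Mid) (mk (chart e x) (%b. ?W (Inr b)))"
  proof(rule "1.IH"[OF pair(8,6)])
   show "?W : Sh3 ((bd vq ?t, Hi), Mid)"
    using k.Sh_bd[OF k.tau_in[OF xC nc] k.push_Sh[OF xC nc 1(3)] m(1,3)] pt by simp
   have "q (bd vq ?t) (%n. ?W (i3 n)) = q (bd vq ?t) (q.push c ?z)"
   proof(rule q.F_cong[OF pair(6), symmetric])
    show "q.push c ?z n = ?W (i3 n)" if "n : N (bd vq ?t)" for n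
     using Wi N_bd_subset[OF t(1) pair(2)] that by auto
   qed (rule pair(7))
   thus "q (bd vq ?t) (%n. ?W (i3 n)) = (e, x)" using pair(5) 1(4) by simp
  qed
  finally show ?thesis unfolding Wb .
 qed
qed

lemma contractible_sp: "contractible_space sp"
proof -
 \<comment> \<open>\<open>Inr True\<close> vanishes at time 0, the outer end \<open>Lo\<close> with
   value \<open>q\<close>, and \<open>Inr False\<close> at time 1, the outer end \<open>Hi\<close>
   with value \<open>pt0\<close>.\<close>
 define y where "y t b = (if b then t else 1 - t)" for t :: real and b
 define H where "H tp = k.F ((fst (snd tp), Hi), Mid) (mk (chart (fst (snd tp)) (snd (snd tp))) (y (fst tp)))" for tp
 have mkSh: "mk z (y t) : Sh3 ((c, Hi), Mid)" if "z : Sh c" "t : {0..1}" for c z t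
  using that unfolding Sh3_noMid[OF cpos.distinct(5)] by(simp add: mk_def y_def)
 have Hq: "H (t, chr i x) = k.F ((i, Hi), Mid) (mk (chart i x) (y t))" if a: "i : I" "x : dsk (dm i)" "t : {0..1}" for i x t
 proof -
  have i: "i : C" "crit i" using a by(auto simp: I_def)
  obtain e x' where e: "chr i x = (e, x')" by(cases "chr i x") auto
  have "k.F ((i, Hi), Mid) (mk (chart i x) (y t)) = k.F ((e, Hi), Mid) (mk (chart e x') (%b. mk (chart i x) (y t) (Inr b)))"
   by(rule k_q[OF i(1) mkSh[OF chart_Sh[OF i a(2)] a(3)]]) (use e chr_q[OF a(1,2)] in "simp add: mk_def")
  thus ?thesis by(simp add: H_def e mk_def)
 qed
 have pts_chr: "p = chr (fst p) (snd p) & fst p : I & snd p : dsk (dm (fst p))" if "p : pts" for p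
  using that subsetD[OF idk_subset_dsk] by(auto simp: pts_def chr_idk)
 have cont: "cmap (tset ({0..1} \<times> dsk (dm i))) sp (%(t, x). H (t, chr i x))" if i: "i : I" for i
 proof -
  have i': "i : C" "crit i" using i by(auto simp: I_def)
  have "con ({0..1} \<times> dsk (dm i)) (%p. chart i (snd p))"
   by(rule continuous_on_compose2[OF chart_cont[OF i'] continuous_on_snd[OF continuous_on_id]]) auto
  hence cc: "con ({0..1} \<times> dsk (dm i)) (%p. chart i (snd p) n)" for n by(rule continuous_on_coord)
  have "con ({0..1} \<times> dsk (dm i)) (%p. mk (chart i (snd p)) (y (fst p)))"
  proof(rule con_prod)
   fix j :: "('n + bool) + bool"
   have "con ({0..1} \<times> dsk (dm i)) (%p. y (fst p) b)" for b
    by(cases b) (auto simp: y_def intro!: continuous_intros)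
   thus "con ({0..1} \<times> dsk (dm i)) (%p. mk (chart i (snd p)) (y (fst p)) j)"
    using cc by(cases j; cases "projl j") (simp_all add: mk_def)
  qed
  hence "cmap (tset ({0..1} \<times> dsk (dm i))) (tset (Sh3 ((i, Hi), Mid))) (%p. mk (chart i (snd p)) (y (fst p)))"
   using mkSh[OF chart_Sh[OF i']] by(auto simp del: cylN.simps)
  from continuous_map_compose[OF this k_cont[of "((i, Hi), Mid)"]] i'(1)
  have "cmap (tset ({0..1} \<times> dsk (dm i))) sp (%p. k.F ((i, Hi), Mid) (mk (chart i (snd p)) (y (fst p))))"
   by(simp add: o_def del: cylN.simps)
  thus ?thesis by(rule continuous_map_eq) (use Hq[OF i] in auto)
 qed
 have Hend: "H (t, p) = (if t = 0 then p else pt0)" if p: "p : pts" and t: "t = 0 | t = 1" for t p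
 proof -
  obtain i x where ix: "p = (i, x)" "p = chr i x" "i : I" "x : dsk (dm i)" using pts_chr[OF p] by(metis prod.collapse)
  have i: "i : C" "crit i" using ix by(auto simp: I_def)
  have t01: "t : {0..1}" using t by auto
  let ?b = "t = 0" and ?Z = "mk (chart i x) (y t)" and ?x = "((i, Hi), Mid)"
  have Z: "?Z : Sh3 ?x" by(rule mkSh[OF chart_Sh[OF i ix(4)] t01])
  have xC: "?x : C3" and m: "Inr ?b : N3 ?x" "?Z (Inr ?b) = 0" using i t by(auto simp: mk_def y_def)
  have "H (t, p) = k.F ?x ?Z" using Hq[OF ix(3,4) t01] ix(2) by simp
  also have "... = k.F (bd3 (Inr ?b) ?x) ?Z" by(rule k_compat[OF xC Z m])
  also have "... = kk (bd3 (Inr ?b) ?x) ?Z"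
   by(rule k_known[OF k.bd_in[OF xC m(1)] _ k.Sh_bd[OF xC Z m]]) (simp add: pri_crit_def)
  also have "... = (if t = 0 then q i (chart i x) else pt0)" by(simp add: kk_def mk_def)
  finally show ?thesis using chr_q[OF ix(3,4)] ix(2) by simp
 qed
 have "cmap (ptop (tset {0..1}) sp) sp H"
 proof(rule continuous_map_homotopy_from_sp)
  fix i assume "i : I"
  thus "cmap (ptop (tset {0..1::real}) (tset (dsk (dm i)))) sp (%(t, x). H (t, chr i x))"
   using cont by simp
 next
  fix t p assume t: "t : {0..1::real}" and p: "p : pts"
  have "(t, snd p) : topspace (tset ({0..1} \<times> dsk (dm (fst p))))" using pts_chr[OF p] t by simp
  hence "(%(t, x). H (t, chr (fst p) x)) (t, snd p) : topspace sp"
   using continuous_map_image_subset_topspace[OF cont[of "fst p"]] pts_chr[OF p] by blast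
  hence "H (t, chr (fst p) (snd p)) : topspace sp" by(simp only: prod.case)
  thus "H (t, p) : topspace sp" using pts_chr[OF p] by metis
 qed
 hence "homotopic_with (%x. True) sp sp id (%x. pt0)"
  using Hend by(subst homotopic_with) (auto intro!: exI[of _ H] simp del: split_paired_All)
 thus ?thesis unfolding contractible_space_def by blast
qed

end

context morse_action begin

theorem morse_type_F_infinity:
 assumes "matching C N blk bd R2 crit2 tau2 phi2" "c0 : C" "N c0 = {}"
  and "!!c. [|c : C; crit2 c|] ==> c = c0"
  and "!!n. EX K. finite K & {c : C. crit c & dm c = n} <= (UN g:car G. act g ` {c : K Int C. crit c})"
 shows "type_F_infinity G"
proof -
 interpret mc: morse_contraction C N blk bd R crit tau phi chart chinv R2 crit2 tau2 phi2 c0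
  by(intro morse_contraction.intro charted_axioms morse_contraction_axioms.intro assms(1-4))
 have "K Int I = {c : K Int C. crit c}" for K by(auto simp: I_def)
 hence "equiv_cells G I (%c. dm c) att act"
  using assms(2,5) mc.contractible_sp by(intro equiv_cellsI) (auto simp: I_def)
 thus ?thesis by(rule equiv_cells.type_F_infinity_G)
qed

end

section \<open>The complex of tree families\<close>

type_synonym tree = "bool list => bool list"

definition lft :: "tree => tree" where "lft t w = t (False # w)"
definition rgt :: "tree => tree" where "rgt t w = t (True # w)"
definition wild :: "tree => bool list set" where "wild t = {w. ~ respects_children t w}"
definition rest :: "tree set => bool list set" where "rest y = - (UN t:y. range t)"
text \<open>Splitting a tree makes its root an uncovered point and adds the roots of its halves, so
  these sets only grow. Hence an enumeration for the split family restricts to one for the original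
  family by deleting two entries, as \<open>strip\<close> does.\<close>

definition marks :: "tree set => bool list set" where "marks x = rest x Un (%t. t []) ` x"
definition spl :: "tree => tree set => tree set" where "spl m y = insert (lft m) (insert (rgt m) (y - {m}))"
definition mrg :: "tree => tree set => tree set" where "mrg s x = insert s (x - {lft s, rgt s})"
definition topv :: "tree set => tree set => tree set" where "topv y A = (y - A) Un lft ` A Un rgt ` A"

lemma wild_lft: "wild (lft t) = Cons False -` wild t" and wild_rgt: "wild (rgt t) = Cons True -` wild t"
 by(auto simp: wild_def respects_children_def lft_def rgt_def)

lemma finite_wild_lft: "finite (wild t) ==> finite (wild (lft t))" and finite_wild_rgt: "finite (wild t) ==> finite (wild (rgt t))"
 unfolding wild_lft wild_rgt by(erule finite_vimageI; simp)+

lemma wild_cases: "wild t <= {[]} Un Cons False ` wild (lft t) Un Cons True ` wild (rgt t)"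
proof
 fix w assume w: "w : wild t"
 show "w : {[]} Un Cons False ` wild (lft t) Un Cons True ` wild (rgt t)"
 proof(cases w)
  case (Cons a v)
  thus ?thesis using w by(cases a) (auto simp: wild_lft wild_rgt)
 qed simp
qed

lemma range_tree: "range t = insert (t []) (range (lft t) Un range (rgt t))"
proof -
 have "t w : insert (t []) (range (lft t) Un range (rgt t))" for w
 proof(cases w)
  case (Cons a v)
  thus ?thesis by(cases a) (auto simp: lft_def rgt_def)
 qed simp
 thus ?thesis by(auto simp: lft_def rgt_def)
qed

text \<open>\<open>good\<close> distinguishes the three groups: it is no restriction for QV, and
  compatibility with the linear or cyclic order of the ends for QF and QT.\<close>

locale good_trees =
 fixes good :: "tree => bool"
 assumes good_lft: "good t ==> good (lft t)" and good_rgt: "good t ==> good (rgt t)" and good_id: "good id"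
begin

text \<open>The last conjunct fixes an index: splitting adds one tree and one uncovered point, group
  elements preserve both numbers, and the identity alone leaves nothing uncovered. It provides the
  roots for merges and makes families of equal size have equally many uncovered points.\<close>

definition vtx :: "tree set => bool" where
 "vtx y <-> finite y & (ALL t:y. good t & finite (wild t)) &
   (ALL t:y. ALL t':y. ALL w w'. t w = t' w' --> t = t' & w = w') & finite (rest y) & Suc (card (rest y)) = card y"

lemma vtxD:
 assumes "vtx y"
 shows "finite y" "t : y ==> good t" "t : y ==> finite (wild t)" "finite (rest y)" "Suc (card (rest y)) = card y"
 using assms unfolding vtx_def by blast+

lemma vtx_inj: "[|vtx y; t : y; t' : y; t w = t' w'|] ==> t = t' & w = w'"
proof -
 assume a: "vtx y" "t : y" "t' : y" "t w = t' w'"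
 from a(1) have "ALL t:y. ALL t':y. ALL w w'. t w = t' w' --> t = t' & w = w'"
  unfolding vtx_def by(elim conjE)
 thus ?thesis using a(2-4) by meson
qed

lemma vtx_inj_same: "[|vtx y; t : y|] ==> t w = t w' <-> w = w'"
 using vtx_inj by blast

lemma vtx_ne: "vtx y ==> y ~= {}"
 using vtxD(5) by fastforce

lemma rest_disj: "[|t : y|] ==> t w ~: rest y"
 by(auto simp: rest_def)

lemma fresh:
 assumes "vtx y" "m : y"
 shows "lft m ~: y" "rgt m ~: y" "lft m ~= rgt m"
proof -
 show "lft m ~: y"
 using vtx_inj assms(1) assms(2) by(fastforce simp: lft_def)
 show "rgt m ~: y"
 using vtx_inj assms(1) assms(2) by(fastforce simp: rgt_def)
 show "lft m ~= rgt m"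
 proof
  assume "lft m = rgt m"
  hence "m [False] = m [True]" by(metis lft_def rgt_def)
  thus False using vtx_inj_same[OF assms] by simp
 qed
qed

lemma rest_spl: "vtx y ==> m : y ==> rest (spl m y) = insert (m []) (rest y)"
proof -
 assume y: "vtx y" "m : y"
 have 1: "m [] ~: range t" if "t : y - {m}" for t
  using vtx_inj[OF y(1) y(2), of t "[]"] that by blast
 have 2: "m [] ~: range (lft m) Un range (rgt m)"
  using vtx_inj_same[OF y] by(auto simp: lft_def rgt_def)
 have 3: "(UN t:y. range t) = range m Un (UN t:y - {m}. range t)" using y by auto
 have 4: "(UN t:spl m y. range t) = range (lft m) Un range (rgt m) Un (UN t:y - {m}. range t)"
  by(auto simp: spl_def)
 have "m [] ~: range (lft m) Un range (rgt m) Un (UN t:y - {m}. range t)" using 1 2 by blast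
 moreover have "- S = insert a (- (insert a S))" if "a ~: S" for a :: "bool list" and S using that by blast
 ultimately show ?thesis unfolding rest_def 3 4 range_tree[of m] Un_insert_left by blast
qed

lemma vtx_spl:
 assumes y: "vtx y" "m : y"
 shows "vtx (spl m y)" "card (spl m y) = Suc (card y)"
proof -
 note fr = fresh[OF y]
 have "card (spl m y) = Suc (Suc (card (y - {m})))"
  using fr vtxD(1)[OF y(1)] by(simp add: spl_def)
 thus c: "card (spl m y) = Suc (card y)"
  using y vtxD(1)[OF y(1)] by(metis card_Suc_Diff1)
 have pre: "EX t0:y. EX v. (ALL w. t w = t0 (v @ w)) & (t0 ~= m & t = t0 & v = [] | t0 = m & t = lft m & v = [False] | t0 = m & t = rgt m & v = [True])"
  if "t : spl m y" for t
 proof -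
  consider "t : y" "t ~= m" | "t = lft m" | "t = rgt m" using \<open>t \<in> spl m y\<close> unfolding spl_def by blast
  thus ?thesis
  proof cases
   case 1
   thus ?thesis by(intro bexI[of _ t] exI[of _ "[]"]) simp_all
  next
   case 2
   thus ?thesis using y(2) by(intro bexI[of _ m] exI[of _ "[False]"]) (simp_all add: lft_def)
  next
   case 3
   thus ?thesis using y(2) by(intro bexI[of _ m] exI[of _ "[True]"]) (simp_all add: rgt_def)
  qed
 qed
 have inj: "t = t' & w = w'" if t: "t : spl m y" "t' : spl m y" "t w = t' w'" for t t' w w'
 proof -
  obtain t0 v where 1: "t0 : y" "!!w. t w = t0 (v @ w)"
   "t0 ~= m & t = t0 & v = [] | t0 = m & t = lft m & v = [False] | t0 = m & t = rgt m & v = [True]" using pre[OF t(1)] by blast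
  obtain t0' v' where 2: "t0' : y" "!!w. t' w = t0' (v' @ w)"
   "t0' ~= m & t' = t0' & v' = [] | t0' = m & t' = lft m & v' = [False] | t0' = m & t' = rgt m & v' = [True]" using pre[OF t(2)] by blast
  have "t0 = t0' & v @ w = v' @ w'" using vtx_inj[OF y(1) 1(1) 2(1)] t(3) 1(2) 2(2) by metis
  thus ?thesis using 1(3) 2(3) by auto
 qed
 have "finite (spl m y)" using vtxD(1)[OF y(1)] by(simp add: spl_def)
 moreover have "good t & finite (wild t)" if "t : spl m y" for t
  using that vtxD(2,3)[OF y(1)] y(2) good_lft good_rgt finite_wild_lft finite_wild_rgt by(auto simp: spl_def)
 moreover have "finite (rest (spl m y))" "card (rest (spl m y)) = Suc (card (rest y))"
  using rest_spl[OF y] vtxD(4)[OF y(1)] rest_disj[OF y(2)] by simp_all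
 ultimately show "vtx (spl m y)" unfolding vtx_def using c vtxD(5)[OF y(1)] by(intro conjI ballI allI impI inj) simp_all
qed

lemma marks_spl: "vtx y ==> m : y ==> marks (spl m y) = marks y Un {m [False], m [True]}"
 unfolding marks_def by(simp only: rest_spl) (auto simp: spl_def lft_def rgt_def)

lemma marks_disj: "vtx y ==> m : y ==> w ~= [] ==> m w ~: marks y"
 using vtx_inj[of y m _ w "[]"] rest_disj[of m y] by(auto simp: marks_def)

lemma finite_marks: "vtx y ==> finite (marks y)" and marks_ne: "vtx y ==> marks y ~= {}"
 using vtxD(1,4) vtx_ne by(auto simp: marks_def)

lemma mrg_spl: "vtx y ==> s : y ==> mrg s (spl s y) = y"
 using fresh[of y s] by(auto simp: mrg_def spl_def)

lemma spl_mrg: "[|lft s : x; rgt s : x; s [] : rest x|] ==> spl s (mrg s x) = x"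
 using rest_disj[of s x] rest_disj by(auto simp: mrg_def spl_def)

lemma vtx_mrg:
 assumes x: "vtx x" "lft s : x" "rgt s : x" "lft s ~= rgt s" "s [] : rest x" "good s"
 shows "vtx (mrg s x)"
proof -
 note inj = vtx_inj[OF x(1)]
 have sx: "s ~: x" using rest_disj[of s x] x(5) by blast
 define ch where "ch a = (if a then rgt s else lft s)" for a
 have ch: "ch a : x" "s (a # v) = ch a v" for a v using x(2,3) by(auto simp: ch_def lft_def rgt_def)
 have chi: "a = a'" if "ch a = ch a'" for a a' using that x(4) by(auto simp: ch_def split: if_splits)
 have root: "s [] ~= t w" if "t : x" for t w using rest_disj[OF that] x(5) by metis
 have ss: "w = w'" if "s w = s w'" for w w'
 proof(cases w; cases w')
  fix a v a' v' assume w: "w = a # v" "w' = a' # v'"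
  hence "ch a = ch a' & v = v'" using that inj[OF ch(1) ch(1), of a v a' v'] ch(2) by simp
  thus ?thesis using w chi by blast
 next
  fix a v assume "w = a # v" "w' = []"
  thus ?thesis using that ch(2) root[OF ch(1)] by metis
 next
  fix a v assume "w = []" "w' = a # v"
  thus ?thesis using that ch(2) root[OF ch(1)] by metis
 qed simp
 have st: "s w ~= t w'" if "t : x" "t ~= lft s" "t ~= rgt s" for t w w'
 proof(cases w)
  case Nil
  thus ?thesis using root[OF that(1)] by simp
 next
  case (Cons a v)
  show ?thesis
  proof
   assume "s w = t w'"
   hence "ch a = t" using inj[OF ch(1) that(1), of a v w'] ch(2) Cons by simp
   thus False using that(2,3) by(auto simp: ch_def split: if_splits)
  qed
 qed
 have fin: "finite (mrg s x)" using vtxD(1)[OF x(1)] by(simp add: mrg_def)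
 have card: "Suc (card (mrg s x)) = card x"
 proof -
  have "card x = Suc (Suc (card (x - {lft s, rgt s})))"
   using card_Suc_Diff1[of x "lft s"] card_Suc_Diff1[of "x - {lft s}" "rgt s"] vtxD(1)[OF x(1)] x(2-4)
    Diff_insert2[of x "lft s" "{rgt s}"] by simp
  thus ?thesis using sx vtxD(1)[OF x(1)] by(simp add: mrg_def)
 qed
 have rest: "rest (mrg s x) = rest x - {s []}"
 proof -
  have "(UN t:x. range t) = range (lft s) Un range (rgt s) Un (UN t:x - {lft s, rgt s}. range t)" using x(2,3) by auto
  thus ?thesis unfolding rest_def mrg_def using range_tree[of s] by auto
 qed
 have "good t & finite (wild t)" if "t : mrg s x" for t
 proof(cases "t = s")
  case True
  have "finite ({[]} Un Cons False ` wild (lft s) Un Cons True ` wild (rgt s))" using vtxD(3)[OF x(1)] x(2,3) by blast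
  thus ?thesis using True x(6) finite_subset[OF wild_cases] by blast
 next
  case False
  thus ?thesis using that vtxD(2,3)[OF x(1)] by(auto simp: mrg_def)
 qed
 moreover have "t = t' & w = w'" if t: "t : mrg s x" "t' : mrg s x" "t w = t' w'" for t t' w w'
 proof(cases "t = s")
  case True
  thus ?thesis using t ss st[of t'] by(auto simp: mrg_def)
 next
  case False
  hence tx: "t : x" "t ~= lft s" "t ~= rgt s" using t(1) by(auto simp: mrg_def)
  show ?thesis
  proof(cases "t' = s")
   case True
   thus ?thesis using st[OF tx, of w' w] t(3) by simp
  next
   case F: False
   hence t'x: "t' : x" using t(2) by(auto simp: mrg_def)
   show ?thesis by(rule inj[OF tx(1) t'x t(3)])
  qed
 qed
 moreover have "finite (rest (mrg s x))" "Suc (card (rest (mrg s x))) = card (mrg s x)"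
  using rest vtxD(4)[OF x(1)] card_Suc_Diff1[OF vtxD(4)[OF x(1)] x(5)] vtxD(5)[OF x(1)] card by simp_all
 ultimately show ?thesis unfolding vtx_def using fin by blast
qed

lemma vtx_id: "vtx {id}"
using good_id by(auto simp: respects_children_def rest_def vtx_def wild_def)

lemma top_insert: "[|vtx y; A <= y; m : y; m ~: A|] ==> m : topv y A & topv y (insert m A) = spl m (topv y A)"
using fresh by(auto simp: spl_def topv_def)

lemma vtx_top:
 assumes y: "vtx y" and A: "A <= y"
 shows "vtx (topv y A) & card (topv y A) = card y + card A"
proof -
 have "finite A" using vtxD(1)[OF y] A finite_subset by blast
 thus ?thesis using A
 proof(induction A)
  case empty
  thus ?case using y by(simp add: topv_def)
 next
  case (insert m A)
  thus ?case using top_insert[OF y, of A m] vtx_spl[of "topv y A" m] by auto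
 qed
qed

lemma top_remove: "[|vtx y; A <= y; m : A|] ==> m : topv y (A - {m}) & topv y A = spl m (topv y (A - {m}))"
 using top_insert[of y "A - {m}" m] by(auto simp: insert_absorb)

lemma top_spl: "[|vtx y; A <= y; m : A|] ==> A - {m} <= spl m y & topv (spl m y) (A - {m}) = topv y A"
 using fresh[of y m] by(auto simp: topv_def spl_def)

lemma topv_del: "[|vtx y; A <= y; m : A|] ==> marks (topv y (A - {m})) = marks (topv y A) - {m [False], m [True]}"
proof -
 assume a: "vtx y" "A <= y" "m : A"
 have sub: "A - {m} <= y" using a(2) by blast
 note v = vtx_top[OF a(1) sub, THEN conjunct1] and t = top_remove[OF a]
 have "marks (topv y A) = marks (topv y (A - {m})) Un {m [False], m [True]}"
  using marks_spl[OF v] t by simp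
 moreover have "m [b] ~: marks (topv y (A - {m}))" for b using marks_disj[OF v] t by simp
 ultimately show ?thesis by blast
qed

end

text \<open>The cell \<open>(y, A, b)\<close> is a cube, whose directions are the trees of \<open>y\<close> in \<open>A\<close> that may be split, times
 the simplex on \<open>dom b\<close>; the labels \<open>b j\<close> are enumerations of the points that are roots or uncovered
 once all of \<open>A\<close> is split. The coordinate \<open>Inl (m, True)\<close> vanishes where \<open>m\<close> is not split,
 \<open>Inl (m, False)\<close> where it is split completely.\<close>

type_synonym cell = "tree set * tree set * (nat => bool list list option)"
type_synonym name = "tree * bool + nat"

text \<open>A single label is a simplex of dimension 0, whose name has to be absent for the sake of
  \<open>N_full\<close>.\<close>

fun names :: "cell => name set" where
 "names (y, A, b) = Inl ` (A \<times> UNIV) Un (if 2 <= card (dom b) then Inr ` dom b else {})"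

definition block :: "name => tree + unit" where
 "block = case_sum (%(m, e). Inl m) (%_. Inr ())"

definition strip :: "tree => bool list list => bool list list" where
 "strip m = filter (%p. p ~= m [False] & p ~= m [True])"

fun face :: "name => cell => cell" where
 "face (Inl (m, e)) (y, A, b) =
   (if e then (y, A - {m}, map_option (strip m) o b) else (spl m y, A - {m}, b))"
| "face (Inr j) (y, A, b) = (y, A, b(j := None))"

lemma block_simps [simp]: "block (Inl (m, e)) = Inl m" "block (Inr j) = Inr ()"
 by(simp_all add: block_def)

context good_trees
begin

definition labels :: "tree set => bool list list set" where
 "labels x = {xs. distinct xs & set xs = marks x}"

definition cells :: "cell set" where
 "cells = {(y, A, b). vtx y & A <= y & finite (dom b) & dom b ~= {} & ran b <= labels (topv y A)}"

lemma cellsD: "(y, A, b) : cells ==> vtx y" "(y, A, b) : cells ==> A <= y" "(y, A, b) : cells ==> finite (dom b)"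
 "(y, A, b) : cells ==> dom b ~= {}" "(y, A, b) : cells ==> b j = Some xs ==> xs : labels (topv y A)"
 "(y, A, b) : cells ==> finite A"
 using finite_subset[OF _ vtxD(1)] by(auto simp: cells_def ran_def)

lemma strip_labels: "[|vtx y; A <= y; m : A; xs : labels (topv y A)|] ==> strip m xs : labels (topv y (A - {m}))"
 using topv_del[of y A m] by(auto simp: labels_def strip_def)

lemma dom_map_option_comp: "dom (map_option f o b) = dom b"
 by(auto simp: dom_def)

lemma block_Inl: "block n = Inl m <-> n = Inl (m, False) | n = Inl (m, True)"
 by(cases n) (auto simp: block_def split: prod.splits)

lemma block_Inr: "block n = Inr u <-> (EX j. n = Inr j)"
 by(cases n) (auto simp: block_def split: prod.splits)

lemma prune_names:
 assumes "K = {} | 2 <= card K"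
 shows "prune block (Inl ` (A \<times> UNIV) Un Inr ` K) = Inl ` (A \<times> UNIV) Un Inr ` K"
  "prune block (Inl ` (A \<times> UNIV) Un Inr ` K - {Inl (m, e)}) = Inl ` ((A - {m}) \<times> UNIV) Un Inr ` K"
  "prune block (Inl ` (A \<times> UNIV) Un Inr ` K - {Inr j}) =
   Inl ` (A \<times> UNIV) Un (if 2 <= card (K - {j}) then Inr ` (K - {j}) else {})"
proof -
 have inl: "Inl (k, d) : prune block N <-> Inl (k, d) : N & Inl (k, ~ d) : N" for k d N
  unfolding prune_def by(cases d) (auto simp: block_Inl Bex_def)
 have inr: "Inr k : prune block N <-> Inr k : N & (EX k'. k' ~= k & Inr k' : N)" for k N
  unfolding prune_def by(auto simp: block_Inr)
 have two: "EX k'. k' ~= k & k' : K'" if K': "2 <= card K'" "k : K'" for k :: nat and K'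
 proof(rule ccontr)
  assume "~ ?thesis"
  hence "K' = {k}" using K'(2) by blast
  thus False using K'(1) by simp
 qed
 have one: "2 <= card K'" if K': "finite K'" "k : K'" "k' : K'" "k' ~= k" for k k' :: nat and K'
 proof -
  have "card {k, k'} <= card K'" using K' by(intro card_mono) auto
  thus ?thesis using K'(4) by simp
 qed
 have fK: "finite K" using assms card.infinite by fastforce
 have eqI: "X = Y" if "!!k d. Inl (k, d) : X <-> Inl (k, d) : Y" "!!k. Inr k : X <-> Inr k : Y" for X Y :: "name set"
 proof(rule Set.set_eqI)
  fix n show "n : X <-> n : Y" using that by(cases n; cases "projl n") simp_all
 qed
 show "prune block (Inl ` (A \<times> UNIV) Un Inr ` K) = Inl ` (A \<times> UNIV) Un Inr ` K"
  by(rule eqI) (use two assms in "auto simp: inl inr image_iff")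
 show "prune block (Inl ` (A \<times> UNIV) Un Inr ` K - {Inl (m, e)}) = Inl ` ((A - {m}) \<times> UNIV) Un Inr ` K"
  by(rule eqI) (use two assms in "auto simp: inl inr image_iff")
 show "prune block (Inl ` (A \<times> UNIV) Un Inr ` K - {Inr j}) =
   Inl ` (A \<times> UNIV) Un (if 2 <= card (K - {j}) then Inr ` (K - {j}) else {})"
 proof(rule eqI)
  fix k
  have "Inr k : prune block (Inl ` (A \<times> UNIV) Un Inr ` K - {Inr j}) <-> k : K - {j} & (EX k'. k' ~= k & k' : K - {j})"
   unfolding inr by auto
  also have "... <-> k : K - {j} & 2 <= card (K - {j})"
   using two[of "K - {j}" k] one[of "K - {j}" k] fK by blast
  finally show "Inr k : prune block (Inl ` (A \<times> UNIV) Un Inr ` K - {Inr j}) <->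
   Inr k : Inl ` (A \<times> UNIV) Un (if 2 <= card (K - {j}) then Inr ` (K - {j}) else {})" by auto
 qed (auto simp: inl)
qed

lemma names_K: "names (y, A, b) = Inl ` (A \<times> UNIV) Un Inr ` (if 2 <= card (dom b) then dom b else {})"
 by simp

lemma face_in: "[|c : cells; n : names c|] ==> face n c : cells"
proof -
 assume a: "c : cells" "n : names c"
 obtain y A b where c: "c = (y, A, b)" by(cases c) auto
 note C = cellsD[OF a(1)[unfolded c]]
 consider (u) m where "n = Inl (m, True)" "m : A" | (s) m where "n = Inl (m, False)" "m : A"
  | (d) j where "n = Inr j" "j : dom b" "2 <= card (dom b)"
  using a(2) by(auto simp: c split: if_splits)
 thus ?thesis
 proof cases
  case u
  have "ran (map_option (strip m) o b) <= labels (topv y (A - {m}))"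
   using strip_labels[OF C(1,2) u(2) C(5)] by(auto simp: ran_def)
  thus ?thesis using C(1-4) by(auto simp: c u cells_def dom_map_option_comp simp del: dom_eq_empty_conv)
 next
  case s
  have "ran b <= labels (topv (spl m y) (A - {m}))"
   using C(5) top_spl[OF C(1,2) s(2)] by(auto simp: ran_def)
  moreover have "m : y" using C(2) s(2) by blast
  ultimately show ?thesis using C(1-4) s(2) vtx_spl[OF C(1), of m] top_spl[OF C(1,2) s(2)]
   by(auto simp: c s cells_def)
 next
  case d
  have "ran (b(j := None)) <= labels (topv y A)" using C(5) by(auto simp: ran_def)
  moreover have "dom b - {j} ~= {}"
  proof
   assume "dom b - {j} = {}"
   hence "dom b <= {j}" by blast
   hence "card (dom b) <= 1" using card_mono[of "{j}" "dom b"] by simp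
   thus False using d(3) by simp
  qed
  ultimately show ?thesis using C(1-4) by(simp add: c d cells_def del: dom_eq_empty_conv)
 qed
qed

sublocale cx: named_complex cells names block face
proof
 fix c assume c: "c : cells"
 obtain y A b where e: "c = (y, A, b)" by(cases c) auto
 note C = cellsD[OF c[unfolded e]]
 let ?K = "if 2 <= card (dom b) then dom b else {}"
 have K: "?K = {} | 2 <= card ?K" by simp
 show "finite (names c)" using C(3,6) by(simp add: e)
 show "prune block (names c) = names c" unfolding e names_K by(rule prune_names(1)[OF K])
 fix n assume n: "n : names c"
 show "face n c : cells" by(rule face_in[OF c n])
 show "names (face n c) = prune block (names c - {n})"
 proof(cases n)
  case (Inl p)
  obtain m d where p: "p = (m, d)" by(cases p) auto
  show ?thesis unfolding e names_K Inl p prune_names(2)[OF K] by(cases d) (simp_all add: dom_map_option_comp)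
 next
  case (Inr j)
  hence "2 <= card (dom b)" using n e by(auto split: if_splits)
  thus ?thesis unfolding e names_K Inr prune_names(3)[OF K] by simp
 qed
 fix n' assume n': "n' : names (face n c)"
 show "face n' (face n c) = face n (face n' c)"
 proof(cases n)
  case (Inl p)
  obtain m d where p: "p = (m, d)" by(cases p) auto
  have m: "m : A" using n by(auto simp: e Inl p split: if_splits)
  show ?thesis
  proof(cases n')
   case i: (Inl p')
   obtain m' d' where p': "p' = (m', d')" by(cases p') auto
   have m': "m' : A" "m' ~= m" using n' by(auto simp: e Inl p i p' split: if_splits)
   have "spl m' (spl m y) = spl m (spl m' y)"
    using fresh[OF C(1), of m] fresh[OF C(1), of m'] m m' C(2) unfolding spl_def by blast
   moreover have "map_option (strip m') (map_option (strip m) q) = map_option (strip m) (map_option (strip m') q)" for q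
    by(simp add: strip_def option.map_comp comp_def conj_ac)
   moreover have "A - {m} - {m'} = A - {m'} - {m}" by blast
   ultimately show ?thesis by(cases d; cases d') (simp_all add: e Inl p i p' fun_eq_iff)
  next
   case (Inr j)
   thus ?thesis by(cases d) (auto simp: e Inl p fun_eq_iff)
  qed
 next
  case (Inr j)
  show ?thesis
  proof(cases n')
   case i: (Inl p')
   obtain m' d' where p': "p' = (m', d')" by(cases p') auto
   show ?thesis by(cases d') (auto simp: e Inr i p' fun_eq_iff)
  next
   case i: (Inr j')
   show ?thesis by(auto simp: e Inr i fun_eq_iff)
  qed
 qed
qed

end

section \<open>A matching with a single critical cell\<close>

context named_complex begin

text \<open>Acyclicity is reduced to a rank that is constant on pairs and drops on every facet of
  the larger cell except the partner, and on all facets of critical cells; within a pair the larger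
  cell is placed above the smaller one.\<close>

lemma matchingI:
 fixes crit :: "'c => bool" and tau :: "'c => 'c" and phi :: "'c => 'n" and rk :: "'c => 'r"
 assumes S: "wf S" "trans S"
  and tau: "!!c. [|c : C; ~ crit c|] ==> tau c : C & phi c : N (tau c) & ~ crit (tau c) & tau (tau c) = tau c &
    phi (tau c) = phi c & rk (tau c) = rk c"
  and sig: "!!c. [|c : C; ~ crit c; tau c = c|] ==> ~ crit (bd (phi c) c) & tau (bd (phi c) c) = c & phi (bd (phi c) c) = phi c"
  and cases: "!!c. [|c : C; ~ crit c; tau c ~= c|] ==> bd (phi c) (tau c) = c"
  and horn: "!!c vq. [|c : C; ~ crit c; tau c = c; vq : N c; vq ~= phi c|] ==> (rk (bd vq c), rk c) : S"
  and crit: "!!c vq. [|c : C; crit c; vq : N c|] ==> (rk (bd vq c), rk c) : S"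
 shows "matching C N blk bd (inv_image (S <*lex*> less_than) (%c. (rk c, if tau c = c then 1 else 0::nat))) crit tau phi"
proof(intro matching.intro named_complex_axioms matching_axioms.intro)
 show "wf (inv_image (S <*lex*> less_than) (%c. (rk c, if tau c = c then 1 else 0::nat)))"
  by(intro wf_inv_image wf_lex_prod S wf_less_than)
 show "trans (inv_image (S <*lex*> less_than) (%c. (rk c, if tau c = c then 1 else 0::nat)))"
  by(intro trans_inv_image trans_lex_prod S trans_less_than)
next
 fix c assume c: "c : C" "~ crit c"
 note t = tau[OF c]
 have s: "~ crit (bd (phi c) (tau c)) & tau (bd (phi c) (tau c)) = tau c & phi (bd (phi c) (tau c)) = phi c"
  using sig[of "tau c"] t by simp
 have sC: "bd (phi c) (tau c) : C" using bd_in t by blast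
 show "tau c : C" "phi c : N (tau c)" "~ crit (tau c) & tau (tau c) = tau c & phi (tau c) = phi c"
  "~ crit (bd (phi c) (tau c)) & tau (bd (phi c) (tau c)) = tau c & phi (bd (phi c) (tau c)) = phi c"
  using t s by blast+
 show "c = tau c | c = bd (phi c) (tau c)" using cases[OF c] by metis
 have "rk (bd (phi c) (tau c)) = rk c" using tau[OF sC] s t by simp
 moreover have "bd (phi c) (tau c) ~= tau c" using N_bd_subset[of "tau c" "phi c"] t by fastforce
 ultimately show "(bd (phi c) (tau c), tau c) : inv_image (S <*lex*> less_than) (%c. (rk c, if tau c = c then 1 else 0::nat))"
  using s t by simp
 fix vq assume "vq : N (tau c)" "vq ~= phi c"
 thus "(bd vq (tau c), c) : inv_image (S <*lex*> less_than) (%c. (rk c, if tau c = c then 1 else 0::nat))"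
  using horn[of "tau c" vq] t by simp
next
 fix c vq assume "c : C" "crit c" "vq : N c"
 thus "(bd vq c, c) : inv_image (S <*lex*> less_than) (%c. (rk c, if tau c = c then 1 else 0::nat))"
  using crit by simp
qed

end

lemma pure_eq: "wild t = {} ==> t w = t [] @ w"
proof(induction w rule: rev_induct)
 case (snoc a w)
 hence "respects_children t w" by(auto simp: wild_def)
 thus ?case using snoc by(cases a) (auto simp: respects_children_def)
qed simp

lemma pure_eqI: "[|wild t = {}; wild t' = {}; t [] = t' []|] ==> t = t'"
proof(rule ext)
 fix w assume a: "wild t = {}" "wild t' = {}" "t [] = t' []"
 show "t w = t' w" using pure_eq[OF a(1), of w] pure_eq[OF a(2), of w] a(3) by simp
qed

lemma wild_cone: "wild (%w. v @ w) = {}"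
 by(simp add: wild_def respects_children_def)

text \<open>The enumeration follows a fixed numbering of all words, so it commutes with filtering;
  the canonical label therefore restricts to the canonical label of a facet.\<close>

definition enumer :: "bool list set => bool list list" where
 "enumer X = map from_nat (sorted_list_of_set (to_nat ` X))"

lemma enumer: "finite X ==> distinct (enumer X) & set (enumer X) = X"
 by(auto simp: enumer_def distinct_map inj_on_def image_image)

lemma filter_enumer: "finite X ==> filter P (enumer X) = enumer {x : X. P x}"
proof -
 assume X: "finite X"
 let ?l = "sorted_list_of_set (to_nat ` X)"
 have "filter (P o from_nat) ?l = sorted_list_of_set (to_nat ` {x : X. P x})"
  by(rule sorted_distinct_set_unique) (use X in "auto intro: sorted_wrt_filter")
 thus ?thesis by(simp add: enumer_def filter_map)
qed

text \<open>Splitting a tree shortens each of its wild words by one letter and discards a wild root.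
  The weight makes both a loss, so splitting any tree with a wild vertex lowers the sum.\<close>

definition badness :: "tree set => nat" where
 "badness y = (SUM t:y. SUM w:wild t. Suc (length w))"

definition nonpure :: "tree set => tree set" where "nonpure y = {t : y. wild t ~= {}}"
definition pick :: "tree set => tree" where "pick y = (SOME t. t : nonpure y)"
definition caret :: "tree set => tree" where "caret x = (SOME s. wild s = {} & lft s : x & rgt s : x)"

lemma pick: "nonpure y ~= {} ==> pick y : y & wild (pick y) ~= {}"
proof -
 assume "nonpure y ~= {}"
 hence "EX t. t : nonpure y" by blast
 hence "pick y : nonpure y" unfolding pick_def by(rule someI_ex)
 thus ?thesis by(simp add: nonpure_def)
qed

lemma badness_children:
 assumes "finite (wild t)"
 shows "(SUM w:wild (lft t). Suc (length w)) + (SUM w:wild (rgt t). Suc (length w)) + card (wild t) <= (SUM w:wild t. Suc (length w))"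
proof -
 have f: "finite (wild (lft t))" "finite (wild (rgt t))"
  using finite_wild_lft finite_wild_rgt assms by auto
 let ?A = "Cons False ` wild (lft t)" and ?B = "Cons True ` wild (rgt t)"
 have "(SUM w:wild (lft t). Suc (length w)) + (SUM w:wild (rgt t). Suc (length w)) = sum length ?A + sum length ?B"
  by(simp add: sum.reindex)
 also have "... = sum length (?A Un ?B)" using f by(intro sum.union_disjoint[symmetric]) auto
 also have "... <= sum length (wild t)"
  by(rule sum_mono2[OF assms]) (auto simp: wild_lft wild_rgt)
 finally show ?thesis by(simp add: sum_Suc)
qed

context good_trees begin

lemma badness_spl:
 assumes y: "vtx y" "k : y"
 shows "badness (spl k y) + card (wild k) <= badness y"
proof -
 let ?B = "%t. SUM w:wild t. Suc (length w)"
 have "badness (spl k y) = ?B (lft k) + (?B (rgt k) + sum ?B (y - {k}))"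
  using fresh[OF y] vtxD(1)[OF y(1)] by(simp add: badness_def spl_def)
 moreover have "badness y = ?B k + sum ?B (y - {k})"
  unfolding badness_def by(rule sum.remove[OF vtxD(1)[OF y(1)] y(2)])
 ultimately show ?thesis using badness_children[OF vtxD(3)[OF y]] by simp
qed

lemma wild_pure_children: "wild k = {} ==> wild (lft k) = {} & wild (rgt k) = {}"
 by(simp add: wild_lft wild_rgt)

lemma nonpure_spl: "wild k = {} ==> nonpure (spl k y) = nonpure y"
 using wild_pure_children[of k] by(auto simp: nonpure_def spl_def)

lemma badness_spl_pure:
 assumes y: "vtx y" "k : y" "wild k = {}"
 shows "badness (spl k y) = badness y"
proof -
 let ?B = "%t. SUM w:wild t. Suc (length w)"
 have "badness (spl k y) = ?B (lft k) + (?B (rgt k) + sum ?B (y - {k}))"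
  using fresh[OF y(1,2)] vtxD(1)[OF y(1)] by(simp add: badness_def spl_def)
 moreover have "badness y = ?B k + sum ?B (y - {k})"
  unfolding badness_def by(rule sum.remove[OF vtxD(1)[OF y(1)] y(2)])
 ultimately show ?thesis using wild_pure_children[OF y(3)] y(3) by simp
qed

lemma good_cone: "good (%w. v @ w)"
proof(induction v rule: rev_induct)
 case Nil
 show ?case using good_id by(simp add: id_def)
next
 case (snoc a v)
 have "(%w. (v @ [a]) @ w) = (if a then rgt (%w. v @ w) else lft (%w. v @ w))"
  by(auto simp: lft_def rgt_def)
 thus ?case using good_lft[OF snoc] good_rgt[OF snoc] by simp
qed

lemma good_pure: "wild s = {} ==> good s"
 using good_cone[of "s []"] pure_eqI[OF _ wild_cone, of s "s []"] by simp

text \<open>A longest root \<open>u @ [a]\<close> has the sibling \<open>u @ [~ a]\<close>. As only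
  finitely many vertices are uncovered, some vertex below the sibling lies in a tree of the family.
  The root of that tree is not strictly above the sibling, for then it would cover
  \<open>t []\<close> too, nor strictly below, by maximality; so it is the sibling.\<close>

lemma caret:
 assumes x: "vtx x" "nonpure x = {}" "card x >= 2"
 shows "wild (caret x) = {} & lft (caret x) : x & rgt (caret x) : x"
proof -
 have pu: "wild t = {}" if "t : x" for t using x(2) that by(auto simp: nonpure_def)
 let ?L = "(%t. length (t [])) ` x"
 have L: "finite ?L" "?L ~= {}" using vtxD(1)[OF x(1)] vtx_ne[OF x(1)] by simp_all
 have "Max ?L : ?L" by(rule Max_in[OF L])
 then obtain t where t1: "t : x" "Max ?L = length (t [])" by(rule imageE) blast
 have "length (t' []) <= length (t [])" if "t' : x" for t'
  unfolding t1(2)[symmetric] by(rule Max_ge[OF L(1)]) (use that in simp)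
 note t = t1(1) this
 have "t [] ~= []"
 proof
  assume e: "t [] = []"
  have "t' = t" if "t' : x" for t'
   using vtx_inj[OF x(1) that t(1), of "[]" "t' []"] pure_eq[OF pu[OF t(1)], of "t' []"] e by simp
  hence "x = {t}" using t(1) by blast
  thus False using x(3) by simp
 qed
 then obtain u a where u: "t [] = u @ [a]" by(metis rev_exhaust)
 let ?z = "u @ [~ a]"
 have "infinite (range (%n. ?z @ replicate n True))"
  by(rule range_inj_infinite) (auto simp: inj_on_def)
 hence "~ range (%n. ?z @ replicate n True) <= rest x" using vtxD(4)[OF x(1)] finite_subset by blast
 then obtain n where "?z @ replicate n True ~: rest x" by blast
 hence "?z @ replicate n True : (UN t:x. range t)" unfolding rest_def Compl_iff by(rule notnotD)
 then obtain t' where "t' : x" "?z @ replicate n True : range t'" by(rule UN_E)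
 then obtain w where t': "t' : x" "t' w = ?z @ replicate n True" by(metis rangeE)
 have eq: "t' [] @ w = ?z @ replicate n True" using pure_eq[OF pu[OF t'(1)], of w] t'(2) by simp
 have z: "t' [] = ?z"
 proof -
  obtain r where "t' [] @ r = ?z | t' [] = ?z @ r" using eq unfolding append_eq_append_conv2 by blast
  thus ?thesis
  proof
   assume r: "t' [] @ r = ?z"
   show ?thesis
   proof(cases r rule: rev_cases)
    case (snoc r' d)
    hence "t' [] @ r' = u" using r by simp
    hence "t [] = t' (r' @ [a])" using u pure_eq[OF pu[OF t'(1)], of "r' @ [a]"] by(metis append.assoc)
    thus ?thesis using vtx_inj[OF x(1) t(1) t'(1), of "[]" "r' @ [a]"] by simp
   qed (use r in simp)
  next
   assume r: "t' [] = ?z @ r"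
   thus ?thesis using t(2)[OF t'(1)] u by simp
  qed
 qed
 let ?s = "%w. u @ w"
 have 1: "lft ?s = k" if "wild k = {}" "k [] = u @ [False]" for k
  by(rule ext) (subst pure_eq[OF that(1)], simp add: lft_def that(2))
 have 2: "rgt ?s = k" if "wild k = {}" "k [] = u @ [True]" for k
  by(rule ext) (subst pure_eq[OF that(1)], simp add: rgt_def that(2))
 have "lft ?s : x & rgt ?s : x"
  using 1[OF pu[OF t(1)]] 1[OF pu[OF t'(1)]] 2[OF pu[OF t(1)]] 2[OF pu[OF t'(1)]] t(1) t'(1) u z by(cases a; simp only: not_False_eq_True not_True_eq_False; blast)
 hence "EX s. wild s = {} & lft s : x & rgt s : x" using wild_cone by blast
 thus ?thesis unfolding caret_def by(rule someI_ex)
qed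

abbreviation om :: "tree set => tree set => bool list list" where "om y A == enumer (marks (topv y A))"
abbreviation ob :: "tree set => tree set => nat => bool list list option" where "ob y A == [0 |-> om y A]"
abbreviation oc :: "tree set => tree set => cell" where "oc y A == (y, A, ob y A)"

lemma om_labels: "vtx y ==> A <= y ==> om y A : labels (topv y A)"
 using vtx_top[of y A] finite_marks enumer by(auto simp: labels_def)

lemma strip_om: "[|vtx y; A <= y; m : A|] ==> strip m (om y A) = om y (A - {m})"
proof -
 assume a: "vtx y" "A <= y" "m : A"
 have "{p : marks (topv y A). p ~= m [False] & p ~= m [True]} = marks (topv y (A - {m}))"
  using topv_del[OF a] by auto
 moreover have "finite (marks (topv y A))" using finite_marks vtx_top[OF a(1,2)] by blast
 ultimately show ?thesis unfolding strip_def by(simp only: filter_enumer)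
qed

text \<open>The cone vertex is the canonical label, but a fixed stage may be occupied by another
  label; so the first stage that is vacant or already carries it is used.\<close>

definition stage :: "cell => nat" where
 "stage c = (case c of (y, A, b) => LEAST m. b m = None | b m = Some (om y A))"

definition c0 :: cell where "c0 = (oc {id} {})"

text \<open>Three flows in succession. The labels are coned off until the canonical one at stage 0
  is left; then a tree with wild vertices is split; once all trees are pure, a caret is merged,
  which leads down to the identity family.\<close>

definition tau2 :: "cell => cell" where
 "tau2 c = (case c of (y, A, b) =>
   if b ~= ob y A then (y, A, b(stage c |-> om y A))
   else if nonpure y ~= {} then (oc y (insert (pick y) A))
   else if caret (topv y A) : A then c
   else (mrg (caret (topv y A)) y, insert (caret (topv y A)) A, b))"

definition phi2 :: "cell => name" where
 "phi2 c = (case c of (y, A, b) =>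
   if b ~= ob y A then Inr (stage c)
   else if nonpure y ~= {} then Inl (pick y, True) else Inl (caret (topv y A), False))"

text \<open>The first entry is the phase. While the phase lasts, the second entry never increases on
  a facet other than the partner; the third counts the names apart from the paired one and breaks
  ties.\<close>

definition rk2 :: "cell => nat * nat * nat" where
 "rk2 c = (case c of (y, A, b) =>
   if b ~= ob y A then (2, stage c, card A + card (dom b - {stage c}))
   else if nonpure y ~= {} then (1, badness y, card (A - {pick y}))
   else (0, card (topv y A), card (A - {caret (topv y A)})))"

lemma stage:
 assumes "finite (dom b)"
 shows "b (stage (y, A, b)) = None | b (stage (y, A, b)) = Some (om y A)"
  and "j < stage (y, A, b) ==> b j ~= None & b j ~= Some (om y A)"
proof -
 obtain m where "m ~: dom b" using assms ex_new_if_finite infinite_UNIV_nat by blast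
 hence "b m = None | b m = Some (om y A)" by auto
 thus "b (stage (y, A, b)) = None | b (stage (y, A, b)) = Some (om y A)"
  unfolding stage_def prod.case by(rule LeastI)
 show "b j ~= None & b j ~= Some (om y A)" if "j < stage (y, A, b)"
  using not_less_Least[of j "%m. b m = None | b m = Some (om y A)"] that by(simp add: stage_def)
qed

lemma stage_le: "b m = None | b m = Some (om y A) ==> stage (y, A, b) <= m"
 using Least_le[of "%m. b m = None | b m = Some (om y A)" m] by(simp add: stage_def)

lemma stage_upd:
 assumes "finite (dom b)" "m = stage (y, A, b)" "v = None | v = Some (om y A)"
 shows "stage (y, A, b(m := v)) = m"
proof(rule antisym)
 show "stage (y, A, b(m := v)) <= m" by(rule stage_le) (use assms in simp)
 show "m <= stage (y, A, b(m := v))"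
 proof(rule leI, rule notI)
  assume k: "stage (y, A, b(m := v)) < m"
  have "finite (dom (b(m := v)))" using assms(1) by(simp add: dom_fun_upd)
  from stage(1)[OF this, of y A] stage(2)[OF assms(1) k[unfolded assms(2)]] k show False
   by(simp add: assms(2))
 qed
qed

text \<open>Pure trees are determined by their roots, so the halves of the caret \<open>s\<close>
  are not halves of any tree in \<open>A\<close>. A pure tree of \<open>y\<close> covering the root
  of \<open>s\<close> would cover the root of \<open>lft s\<close> in its interior, against
  disjointness.\<close>

lemma pure_split:
 assumes c: "(y, A, b) : cells" and p: "nonpure y = {}" "card (topv y A) >= 2" "caret (topv y A) ~: A"
 defines "s == caret (topv y A)"
 shows "wild s = {} & lft s : y - A & rgt s : y - A & lft s ~= rgt s & s [] : rest y"
proof -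
 note C = cellsD[OF c]
 have pu: "wild t = {}" if "t : y" for t using p(1) that by(auto simp: nonpure_def)
 have "nonpure (topv y A) = {}"
  using pu C(2) wild_pure_children by(auto simp: nonpure_def topv_def)
 hence s: "wild s = {}" "lft s : topv y A" "rgt s : topv y A"
  unfolding s_def using caret[OF _ _ p(2)] vtx_top[OF C(1,2)] by auto
 have l: "lft s ~= lft k" "lft s ~= rgt k" "rgt s ~= lft k" "rgt s ~= rgt k" if k: "k : A" for k
 proof -
  have pk: "wild k = {}" using pu k C(2) by blast
  have "s [] ~= k []" using pure_eqI[OF s(1) pk] k p(3) s_def by blast
  hence "s [e] ~= k [d]" for d e using pure_eq[OF s(1), of "[e]"] pure_eq[OF pk, of "[d]"] by simp
  thus "lft s ~= lft k" "lft s ~= rgt k" "rgt s ~= lft k" "rgt s ~= rgt k"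
   by(metis lft_def rgt_def)+
 qed
 hence y: "lft s : y - A" "rgt s : y - A" using s(2,3) unfolding topv_def by blast+
 have "lft s [] ~= rgt s []" using pure_eq[OF s(1), of "[False]"] pure_eq[OF s(1), of "[True]"] by(simp add: lft_def rgt_def)
 moreover have "s [] : rest y"
 proof(rule ccontr)
  assume "s [] ~: rest y"
  then obtain t w where t: "t : y" "t w = s []" by(auto simp: rest_def)
  have "t (w @ [False]) = lft s []"
   using pure_eq[OF pu[OF t(1)], of w] pure_eq[OF pu[OF t(1)], of "w @ [False]"] pure_eq[OF s(1), of "[False]"] t(2)
   by(simp add: lft_def)
  thus False using vtx_inj[OF C(1) t(1), of "lft s" "w @ [False]" "[]"] y(1) by simp
 qed
 ultimately show ?thesis using s(1) y by auto
qed

lemma pure_crit: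
 assumes c: "(y, A, b) : cells" and "b = ob y A" "nonpure y = {}"
 shows "(y, A, b) = c0 <-> ~ card (topv y A) >= 2"
proof
 note C = cellsD[OF c]
 assume "(y, A, b) = c0"
 thus "~ card (topv y A) >= 2" by(simp add: c0_def topv_def)
next
 note C = cellsD[OF c]
 assume "~ card (topv y A) >= 2"
 hence "card y + card A < 2" using vtx_top[OF C(1,2)] by simp
 hence "card y = 1" "card A = 0" using vtxD(5)[OF C(1)] by auto
 hence A: "A = {}" and "card y = 1" using C(6) by auto
 then obtain t where t: "y = {t}" using card_1_singletonE by blast
 have "rest y = {}" using vtxD(4,5)[OF C(1)] \<open>card y = 1\<close> by simp
 hence "[] : range t" using t unfolding rest_def by blast
 then obtain w where "t w = []" by(metis rangeE)
 moreover have w: "wild t = {}" using assms(3) t by(auto simp: nonpure_def)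
 ultimately have "t [] = []" using pure_eq[of t w] by simp
 hence "t = id" using pure_eq[OF w] by(metis append_Nil eq_id_iff)
 thus "(y, A, b) = c0" using A t assms(2) by(simp add: c0_def)
qed

lemma c0_in: "c0 : cells" and names_c0: "names c0 = {}"
 using vtx_id om_labels[of "{id}" "{}"] by(auto simp: c0_def cells_def)

lemma stage_strip:
 assumes c: "(y, A, b) : cells" "k : A"
 shows "stage (y, A - {k}, map_option (strip k) o b) <= stage (y, A, b)"
proof -
 note C = cellsD[OF c(1)]
 show ?thesis using stage(1)[OF C(3), of y A] strip_om[OF C(1,2) c(2)] by(intro stage_le) auto
qed

lemma fst_rk2: "b = ob y A ==> fst (rk2 (y, A, b)) < 2"
 by(simp add: rk2_def)

lemma matching2_ph1:
 assumes c: "(y, A, b) : cells" and p: "b ~= ob y A"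
 defines "m == stage (y, A, b)"
 shows "b(m |-> om y A) ~= ob y A" "b(m := None) ~= ob y A" "dom (b(m := None)) ~= {}"
  "2 <= card (dom (b(m |-> om y A)))"
proof -
 note C = cellsD[OF c]
 note s1 = stage(1)[OF C(3), of y A, folded m_def] and s2 = stage(2)[OF C(3), of _ y A, folded m_def]
 show ne: "dom (b(m := None)) ~= {}"
 proof
  assume e: "dom (b(m := None)) = {}"
  hence n: "b j = None" if "j ~= m" for j using that by(auto simp: fun_eq_iff split: if_splits)
  have m: "m = 0" using s2[of 0] n[of 0] by(cases "m = 0") auto
  have "b m ~= None"
  using n C(4) by fastforce
  hence "b j = ob y A j" for j using n s1 m by(cases "j = 0") auto
  thus False using p by blast
 qed
 show "b(m |-> om y A) ~= ob y A"
 proof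
  assume e: "b(m |-> om y A) = ob y A"
  have n: "b j = None" if "j ~= m" for j
  proof -
   have "m = 0" using fun_cong[OF e, of m] by(simp split: if_splits)
   thus ?thesis using fun_cong[OF e, of j] that by simp
  qed
  have "(b(m := None)) j = None" for j using n by(cases "j = m") auto
  hence "b(m := None) = Map.empty" by(rule ext)
  hence "dom (b(m := None)) = {}" by(simp only: dom_empty)
  thus False using ne by blast
 qed
 show "b(m := None) ~= ob y A"
 proof
  assume e: "b(m := None) = ob y A"
  have "m ~= 0" using fun_cong[OF e, of m] by(auto split: if_splits)
  moreover have "b 0 = Some (om y A)" using fun_cong[OF e, of 0] \<open>m ~= 0\<close> by simp
  ultimately show False using s2[of 0] by simp
 qed
 obtain j where j: "j : dom (b(m := None))" using ne by blast
 have "{j, m} <= dom (b(m |-> om y A))" "j ~= m" using j by(auto split: if_splits)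
 moreover have "finite (dom (b(m |-> om y A)))" using C(3) by simp
 ultimately show "2 <= card (dom (b(m |-> om y A)))" using card_mono[of "dom (b(m |-> om y A))" "{j, m}"] by simp
qed

abbreviation "S2 == less_than <*lex*> (less_than <*lex*> less_than)"

lemma tau2_ph1: "b ~= ob y A ==> tau2 (y, A, b) = (y, A, b(stage (y, A, b) |-> om y A))"
 and phi2_ph1: "b ~= ob y A ==> phi2 (y, A, b) = Inr (stage (y, A, b))"
 and rk2_ph1: "b ~= ob y A ==> rk2 (y, A, b) = (2, stage (y, A, b), card A + card (dom b - {stage (y, A, b)}))"
 and tau2_ph2: "nonpure y ~= {} ==> tau2 (oc y A) = (oc y (insert (pick y) A))"
 and phi2_ph2: "nonpure y ~= {} ==> phi2 (oc y A) = Inl (pick y, True)"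
 and rk2_ph2: "nonpure y ~= {} ==> rk2 (oc y A) = (1, badness y, card (A - {pick y}))"
 and tau2_ph3: "nonpure y = {} ==> tau2 (oc y A) = (if caret (topv y A) : A then (oc y A)
   else (mrg (caret (topv y A)) y, insert (caret (topv y A)) A, ob y A))"
 and phi2_ph3: "nonpure y = {} ==> phi2 (oc y A) = Inl (caret (topv y A), False)"
 and rk2_ph3: "nonpure y = {} ==> rk2 (oc y A) = (0, card (topv y A), card (A - {caret (topv y A)}))"
 by(simp_all add: tau2_def phi2_def rk2_def)

lemma names_single: "names (y, A, [0 |-> v]) = Inl ` (A \<times> UNIV)"
 by simp

lemma strip_single: "map_option f o [0 |-> v] = [0 |-> f v]" for v :: 'v
 by(rule ext) simp

lemma pure_cases:
 assumes c: "(oc y A) : cells" and p: "nonpure y = {}" and nc: "(oc y A) ~= c0"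
 defines "s == caret (topv y A)"
 obtains (tau) "s : A" | (sig) "s ~: A" "tau2 (oc y A) = (oc (mrg s y) (insert s A))"
  "vtx (mrg s y)" "insert s A <= mrg s y" "s ~: y" "spl s (mrg s y) = y" "topv (mrg s y) (insert s A) = topv y A"
  "nonpure (mrg s y) = {}"
proof(cases "s : A")
 case False
 note C = cellsD[OF c]
 have "2 <= card (topv y A)" using pure_crit[OF c refl p] nc by blast
 from pure_split[OF c p this] False
 have s: "wild s = {}" "lft s : y - A" "rgt s : y - A" "lft s ~= rgt s" "s [] : rest y" unfolding s_def by auto
 have sy: "s ~: y" using rest_disj[of s y] s(5) by blast
 have v: "vtx (mrg s y)" using vtx_mrg[OF C(1)] s good_pure by blast
 have sub: "insert s A <= mrg s y" using C(2) s unfolding mrg_def by blast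
 have sp: "spl s (mrg s y) = y" using spl_mrg s by blast
 have "A = insert s A - {s}" using False by blast
 hence tp: "topv (mrg s y) (insert s A) = topv y A" using top_spl[OF v sub, of s] sp by simp
 have "nonpure (mrg s y) = {}" using p s(1) by(auto simp: nonpure_def mrg_def)
 thus ?thesis using sig[OF False _ v sub sy sp tp] p False unfolding tau2_ph3[OF p] s_def[symmetric] by(simp add: tp)
qed (rule tau)

lemma matching2: "matching cells names block face
  (inv_image (S2 <*lex*> less_than) (%c. (rk2 c, if tau2 c = c then 1 else 0::nat))) (%c. c = c0) tau2 phi2"
proof(rule cx.matchingI)
 show "wf S2" "trans S2" by(intro wf_lex_prod wf_less_than trans_lex_prod trans_less_than)+
next
 fix c assume c: "c : cells" and nc: "c ~= c0"
 obtain y A b where e: "c = (y, A, b)" by(cases c) auto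
 note C = cellsD[OF c[unfolded e]]
 consider (1) "b ~= ob y A" | (2) "b = ob y A" "nonpure y ~= {}" | (3) "b = ob y A" "nonpure y = {}" by blast
 thus "tau2 c : cells & phi2 c : names (tau2 c) & tau2 c ~= c0 & tau2 (tau2 c) = tau2 c &
    phi2 (tau2 c) = phi2 c & rk2 (tau2 c) = rk2 c"
 proof cases
  case 1
  let ?m = "stage (y, A, b)" let ?b = "b(?m |-> om y A)"
  note ph = matching2_ph1[OF c[unfolded e] 1]
  have st: "stage (y, A, ?b) = ?m" by(rule stage_upd[OF C(3) refl]) simp
  have "ran ?b <= labels (topv y A)" using C(5) om_labels[OF C(1,2)] by(auto simp: ran_def)
  hence "(y, A, ?b) : cells" using C(1-3) by(auto simp: cells_def)
  moreover have "Inr ?m : names (y, A, ?b)" using ph(4) by simp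
  moreover have "(y, A, ?b) ~= c0" using ph(1) by(auto simp: c0_def)
  moreover have "dom ?b - {?m} = dom b - {?m}" by auto
  ultimately show ?thesis unfolding e tau2_ph1[OF 1] phi2_ph1[OF 1] rk2_ph1[OF 1]
   using tau2_ph1[OF ph(1)] phi2_ph1[OF ph(1)] rk2_ph1[OF ph(1)] unfolding st by simp
 next
  case 2
  let ?m = "pick y"
  have m: "?m : y" using pick[OF 2(2)] by blast
  have "(oc y (insert ?m A)) : cells"
   using C(1,2) m om_labels[OF C(1), of "insert ?m A"] by(auto simp: cells_def)
  moreover have "(oc y (insert ?m A)) ~= c0" by(simp add: c0_def)
  ultimately show ?thesis unfolding e 2(1) tau2_ph2[OF 2(2)] phi2_ph2[OF 2(2)] rk2_ph2[OF 2(2)]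
   by(simp add: insert_Diff_if)
 next
  case 3
  let ?s = "caret (topv y A)"
  from c[unfolded e 3(1)] 3(2) nc[unfolded e 3(1)] show ?thesis
  proof(cases rule: pure_cases)
   case tau
   hence t: "tau2 (oc y A) = (oc y A)" unfolding tau2_ph3[OF 3(2)] by simp
   show ?thesis using c nc tau unfolding e 3(1) t phi2_ph3[OF 3(2)] by simp
  next
   case sig
   have "(oc (mrg ?s y) (insert ?s A)) : cells"
    using sig(3,4) om_labels[OF sig(3,4)] by(auto simp: cells_def)
   moreover have "(oc (mrg ?s y) (insert ?s A)) ~= c0" by(simp add: c0_def)
   moreover have "insert ?s A - {?s} = A - {?s}" by blast
   ultimately show ?thesis
    unfolding e 3(1) sig(2) phi2_ph3[OF 3(2)] rk2_ph3[OF 3(2)]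
     tau2_ph3[OF sig(8)] phi2_ph3[OF sig(8)] rk2_ph3[OF sig(8)] unfolding sig(7) by simp
  qed
 qed
next
 fix c assume c: "c : cells" and nc: "c ~= c0" and t: "tau2 c = c"
 obtain y A b where e: "c = (y, A, b)" by(cases c) auto
 note C = cellsD[OF c[unfolded e]]
 consider (1) "b ~= ob y A" | (2) "b = ob y A" "nonpure y ~= {}" | (3) "b = ob y A" "nonpure y = {}" by blast
 thus "face (phi2 c) c ~= c0 & tau2 (face (phi2 c) c) = c & phi2 (face (phi2 c) c) = phi2 c"
 proof cases
  case 1
  let ?m = "stage (y, A, b)" let ?b = "b(?m := None)"
  note ph = matching2_ph1[OF c[unfolded e] 1]
  have st: "stage (y, A, ?b) = ?m" by(rule stage_upd[OF C(3) refl]) simp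
  have "b(?m |-> om y A) = b" using t unfolding e tau2_ph1[OF 1] by simp
  hence "?b(?m |-> om y A) = b" by simp
  moreover have "(y, A, ?b) ~= c0" using ph(2) by(auto simp: c0_def)
  ultimately show ?thesis unfolding e phi2_ph1[OF 1] face.simps tau2_ph1[OF ph(2)] phi2_ph1[OF ph(2)] st by simp
 next
  case 2
  let ?m = "pick y"
  have A: "?m : A" using t unfolding e 2(1) tau2_ph2[OF 2(2)] by auto
  have f: "face (phi2 c) c = (oc y (A - {?m}))"
   unfolding e 2(1) phi2_ph2[OF 2(2)] face.simps strip_single strip_om[OF C(1,2) A] by simp
  have "(oc y (A - {?m})) ~= c0"
   using 2(2) by(auto simp: c0_def nonpure_def wild_def respects_children_def)
  moreover have "insert ?m (A - {?m}) = A" using A by blast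
  ultimately show ?thesis unfolding f tau2_ph2[OF 2(2)] phi2_ph2[OF 2(2)] unfolding e 2(1) phi2_ph2[OF 2(2)] by simp
 next
  case 3
  let ?s = "caret (topv y A)"
  have A: "?s : A"
   using t unfolding e 3(1) tau2_ph3[OF 3(2)] by(auto split: if_splits)
  have sy: "?s : y" using A C(2) by blast
  note tp = top_spl[OF C(1,2) A]
  have pu: "wild ?s = {}" using 3(2) sy by(auto simp: nonpure_def)
  have np: "nonpure (spl ?s y) = {}" using nonpure_spl[OF pu] 3(2) by simp
  have f: "face (phi2 c) c = (oc (spl ?s y) (A - {?s}))"
   unfolding e 3(1) phi2_ph3[OF 3(2)] by(simp add: tp)
  have "2 <= card (topv y A)" using pure_crit[OF c[unfolded e] 3] nc[unfolded e] by blast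
  have "(oc (spl ?s y) (A - {?s})) ~= c0"
  proof
   assume "(oc (spl ?s y) (A - {?s})) = c0"
   hence "spl ?s y = {id}" "A - {?s} = {}" unfolding c0_def by blast+
   hence "topv y A = topv {id} {}" using tp by metis
   thus False using \<open>2 \<le> card (topv y A)\<close> by(simp add: topv_def)
  qed
  moreover have "insert ?s (A - {?s}) = A" using A by blast
  ultimately show ?thesis unfolding f tau2_ph3[OF np] phi2_ph3[OF np] unfolding e 3(1) phi2_ph3[OF 3(2)]
   using tp mrg_spl[OF C(1) sy] by simp
 qed
next
 fix c assume c: "c : cells" and nc: "c ~= c0" and t: "tau2 c ~= c"
 obtain y A b where e: "c = (y, A, b)" by(cases c) auto
 note C = cellsD[OF c[unfolded e]]
 consider (1) "b ~= ob y A" | (2) "b = ob y A" "nonpure y ~= {}" | (3) "b = ob y A" "nonpure y = {}" by blast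
 thus "face (phi2 c) (tau2 c) = c"
 proof cases
  case 1
  let ?m = "stage (y, A, b)"
  have "b ?m ~= Some (om y A)" using t unfolding e tau2_ph1[OF 1] by auto
  hence "b ?m = None" using stage(1)[OF C(3), of y A] by blast
  thus ?thesis unfolding e tau2_ph1[OF 1] phi2_ph1[OF 1] by auto
 next
  case 2
  let ?m = "pick y"
  have m: "?m : y" using pick[OF 2(2)] by blast
  have A: "?m ~: A"
  proof
   assume "?m : A"
   hence "insert ?m A = A" by blast
   thus False using t unfolding e 2(1) tau2_ph2[OF 2(2)] by simp
  qed
  have "insert ?m A <= y" using m C(2) by blast
  from strip_om[OF C(1) this, of ?m] A show ?thesis
   unfolding e 2(1) tau2_ph2[OF 2(2)] phi2_ph2[OF 2(2)] face.simps strip_single by simp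
 next
  case 3
  from c[unfolded e 3(1)] 3(2) nc[unfolded e 3(1)] show ?thesis
  proof(cases rule: pure_cases)
   case tau
   thus ?thesis using t unfolding e 3(1) tau2_ph3[OF 3(2)] by simp
  next
   case sig
   thus ?thesis unfolding e 3(1) sig(2) phi2_ph3[OF 3(2)] by simp
  qed
 qed
next
 fix c vq assume c: "c : cells" and nc: "c ~= c0" and t: "tau2 c = c" and vq: "vq : names c" "vq ~= phi2 c"
 obtain y A b where e: "c = (y, A, b)" by(cases c) auto
 note C = cellsD[OF c[unfolded e]]
 consider (1) "b ~= ob y A" | (2) "b = ob y A" "nonpure y ~= {}" | (3) "b = ob y A" "nonpure y = {}" by blast
 thus "(rk2 (face vq c), rk2 c) : S2"
 proof cases
  case 1
  let ?m = "stage (y, A, b)"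
  have low: "(rk2 (y', A', b'), rk2 c) : S2"
   if "b' ~= ob y' A' ==> stage (y', A', b') < ?m | stage (y', A', b') = ?m &
    card A' + card (dom b' - {?m}) < card A + card (dom b - {?m})" for y' A' b'
  proof(cases "b' = ob y' A'")
   case True
   have "fst (rk2 (y', A', b')) < 2" by(rule fst_rk2[OF True])
   thus ?thesis unfolding e rk2_ph1[OF 1] by(cases "rk2 (y', A', b')") simp
  next
   case False
   thus ?thesis using that[OF False] unfolding e rk2_ph1[OF 1] rk2_ph1[OF False] by auto
  qed
  have bm: "b ?m = Some (om y A)"
   using t unfolding e tau2_ph1[OF 1] by(metis fun_upd_same prod.inject)
  consider (j) j where "vq = Inr j" "j : dom b" "j ~= ?m" | (u) k where "vq = Inl (k, True)" "k : A"
   | (s) k where "vq = Inl (k, False)" "k : A"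
   using vq unfolding e phi2_ph1[OF 1] by(auto split: if_splits)
  thus ?thesis
  proof cases
   case j
   have "stage (y, A, b(j := None)) <= ?m" by(rule stage_le) (use bm j in simp)
   moreover have "card (dom (b(j := None)) - {?m}) < card (dom b - {?m})"
    by(rule psubset_card_mono) (use C(3) j in auto)
   ultimately show ?thesis unfolding j(1) unfolding e face.simps by(intro low[unfolded e]) auto
  next
   case u
   note st = stage_strip[OF c[unfolded e] u(2)]
   have "card (A - {k}) < card A" by(rule card_Diff1_less[OF C(6) u(2)])
   thus ?thesis unfolding u(1) unfolding e using st by(simp del: comp_apply) (intro low[unfolded e], auto simp: dom_map_option_comp)
  next
   case s
   have st: "stage (spl k y, A - {k}, b) = ?m" using top_spl[OF C(1,2) s(2)] by(simp add: stage_def)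
   have "card (A - {k}) < card A" by(rule card_Diff1_less[OF C(6) s(2)])
   thus ?thesis unfolding s(1) unfolding e using st by(simp del: comp_apply) (intro low[unfolded e], auto)
  qed
 next
  case 2
  let ?m = "pick y"
  have A: "?m : A" using t unfolding e 2(1) tau2_ph2[OF 2(2)] by auto
  have less: "card (A - {k} - {?m}) < card (A - {?m})" if "k : A" "k ~= ?m" for k
   by(rule psubset_card_mono) (use C(6) that in auto)
  consider (u) k where "vq = Inl (k, True)" "k : A" "k ~= ?m" | (s) k where "vq = Inl (k, False)" "k : A"
   using vq unfolding e 2(1) phi2_ph2[OF 2(2)] names_single by auto
  thus ?thesis
  proof cases
   case u
   have f: "face vq c = (oc y (A - {k}))"
    unfolding e 2(1) u(1) by(simp add: strip_single strip_om[OF C(1,2) u(2)])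
   show ?thesis unfolding f unfolding e 2(1) rk2_ph2[OF 2(2)] using less[OF u(2,3)] by simp
  next
   case s
   have ky: "k : y" using s(2) C(2) by blast
   have f: "face vq c = (oc (spl k y) (A - {k}))"
    unfolding e 2(1) s(1) by(simp add: top_spl[OF C(1,2) s(2)])
   show ?thesis
   proof(cases "nonpure (spl k y) = {}")
    case True
    show ?thesis unfolding f unfolding e 2(1) rk2_ph2[OF 2(2)] rk2_ph3[OF True] by simp
   next
    case np: False
    show ?thesis
    proof(cases "wild k = {}")
     case True
     have "k ~= ?m" using True pick[OF 2(2)] by auto
     moreover have "pick (spl k y) = ?m" using nonpure_spl[OF True] by(simp add: pick_def)
     ultimately show ?thesis unfolding f unfolding e 2(1) rk2_ph2[OF 2(2)] rk2_ph2[OF np]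
      using less[OF s(2)] badness_spl_pure[OF C(1) ky True] by simp
    next
     case False
     have "card (wild k) > 0" using False vtxD(3)[OF C(1) ky] by(simp add: card_gt_0_iff)
     hence "badness (spl k y) < badness y" using badness_spl[OF C(1) ky] by simp
     thus ?thesis unfolding f unfolding e 2(1) rk2_ph2[OF 2(2)] rk2_ph2[OF np] by simp
    qed
   qed
  qed
 next
  case 3
  let ?s = "caret (topv y A)"
  have A: "?s : A"
   using t unfolding e 3(1) tau2_ph3[OF 3(2)] by(auto split: if_splits)
  consider (u) k where "vq = Inl (k, True)" "k : A" | (s) k where "vq = Inl (k, False)" "k : A" "k ~= ?s"
   using vq unfolding e 3(1) phi2_ph3[OF 3(2)] names_single by auto
  thus ?thesis
  proof cases
   case u
   have f: "face vq c = (oc y (A - {k}))"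
    unfolding e 3(1) u(1) by(simp add: strip_single strip_om[OF C(1,2) u(2)])
   have "A - {k} <= y" using C(2) by blast
   hence "card (topv y (A - {k})) < card (topv y A)"
    using vtx_top[OF C(1)] C(2) card_Diff1_less[OF C(6) u(2)] by simp
   thus ?thesis unfolding f unfolding e 3(1) rk2_ph3[OF 3(2)] by simp
  next
   case s
   have ky: "k : y" using s(2) C(2) by blast
   have pu: "wild k = {}" using 3(2) ky by(auto simp: nonpure_def)
   have np: "nonpure (spl k y) = {}" using nonpure_spl[OF pu] 3(2) by simp
   note tp = top_spl[OF C(1,2) s(2)]
   have f: "face vq c = (oc (spl k y) (A - {k}))"
    unfolding e 3(1) s(1) by(simp add: tp)
   have "card (A - {k} - {?s}) < card (A - {?s})" by(rule psubset_card_mono) (use C(6) s in auto)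
   thus ?thesis unfolding f unfolding e 3(1) rk2_ph3[OF 3(2)] rk2_ph3[OF np] using tp by simp
  qed
 qed
next
 fix c vq assume "c = c0" "vq : names c"
 thus "(rk2 (face vq c), rk2 c) : S2" using names_c0 by simp
qed

end

section \<open>Group actions\<close>

abbreviation tact :: "tree => tree set => tree set" where "tact g y == (o) g ` y"

fun cact :: "tree => cell => cell" where
 "cact g (y, A, b) = (tact g y, tact g A, map_option (map g) o b)"

definition nmact :: "tree => name => name" where
 "nmact g = map_sum (map_prod ((o) g) id) id"

lemma nmact_simps [simp]: "nmact g (Inl (m, e)) = Inl (g o m, e)" "nmact g (Inr j) = Inr j"
 by(simp_all add: nmact_def)

lemma lft_comp: "lft (g o t) = g o lft t" and rgt_comp: "rgt (g o t) = g o rgt t"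
 by(auto simp: lft_def rgt_def)

lemma wild_comp: "wild (g o t) <= wild t Un t -` wild g"
 by(auto simp: wild_def respects_children_def)

text \<open>A list of merges that do not interfere with each other; the last bound says that they
  use all trees of the family except at most two.\<close>

definition valid_ground :: "(tree => bool) => tree set => tree list => bool" where
 "valid_ground good x ss <-> (ALL s:set ss. lft s : x & rgt s : x & lft s ~= rgt s & s [] : rest x & good s) &
   (ALL s:set ss. ALL s':set ss. s ~= s' --> s [] ~= s' [] & {lft s, rgt s} Int {lft s', rgt s'} = {}) &
   distinct ss & card x <= 2 * length ss + 2"

definition disjoint_pairs :: "(tree * tree) list => bool" where
 "disjoint_pairs ps <-> distinct (concat (map (%(a, c). [a, c]) ps))"

text \<open>\<open>ground_pairs\<close> speaks of pairs of trees and not of merges: any uncovered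
  point may serve as the root, since goodness of the merge must hold for every choice.\<close>

locale tree_group = good_trees +
 fixes H :: "tree set"
 assumes H_QV: "H <= QV_set" and H_id: "id : H" and H_comp: "[|g : H; h : H|] ==> g o h : H"
  and H_inv: "g : H ==> inv_into UNIV g : H"
  and good_comp: "[|g : H; good t; finite (wild t); inj t|] ==> good (g o t)"
  and ground_pairs: "vtx x ==> EX ps. disjoint_pairs ps & card x <= 2 * length ps + 2 &
   (ALL (a, c):set ps. a : x & c : x & (ALL s. lft s = a & rgt s = c --> good s))"
  and orbits: "EX K. finite K & {x. vtx x & card x = n} <= (UN g:H. tact g ` (K Int Collect vtx))"
begin

definition GH :: "tree monoid" where "GH = \<lparr>carrier = H, mult = (o), one = id\<rparr>"

lemma GH_simps [simp]: "car GH = H" "(\<otimes>\<^bsub>GH\<^esub>) = (o)" "\<one>\<^bsub>GH\<^esub> = id"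
 by(simp_all add: GH_def)

lemma H_bij: "g : H ==> bij g" and H_wild: "g : H ==> finite (wild g)"
 using H_QV by(auto simp: QV_set_def wild_def)

lemma H_inj: "g : H ==> g p = g p' <-> p = p'"
 using H_bij by(metis bij_is_inj inj_eq)

lemma H_injt: "g : H ==> g o t = g o t' <-> t = t'"
 using H_inj by(auto simp: fun_eq_iff)

lemma inj_tact: "g : H ==> inj ((o) g)"
 using H_injt by(auto simp: inj_def)

lemma group_GH: "group GH"
proof(rule groupI)
 fix g assume "g : car GH"
 hence "inv_into UNIV g : H" "inv_into UNIV g o g = id" using H_inv H_bij by(auto simp: bij_def)
 thus "EX h:car GH. h \<otimes>\<^bsub>GH\<^esub> g = \<one>\<^bsub>GH\<^esub>" by auto
qed (auto simp: H_id H_comp o_assoc)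

lemma rest_act: "g : H ==> rest (tact g y) = g ` rest y"
proof -
 assume g: "g : H"
 have "(UN t:tact g y. range t) = g ` (UN t:y. range t)" by(auto simp: image_iff)
 thus ?thesis unfolding rest_def by(simp only: bij_image_Compl_eq[OF H_bij[OF g]])
qed

lemma marks_act: "g : H ==> marks (tact g x) = g ` marks x"
 by(auto simp: marks_def rest_act image_Un image_image)

lemma vtx_act: "[|g : H; vtx y|] ==> vtx (tact g y)"
proof -
 assume g: "g : H" and y: "vtx y"
 have B: "good (g o t) & finite (wild (g o t))" if t: "t : y" for t
 proof
  have i: "inj t" using vtx_inj_same[OF y t] by(auto simp: inj_def)
  show "good (g o t)" using good_comp[OF g vtxD(2,3)[OF y t] i] .
  have "finite (t -` wild g)" using finite_vimageI[OF H_wild[OF g] i] .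
  thus "finite (wild (g o t))" using wild_comp[of g t] vtxD(3)[OF y t] finite_subset by blast
 qed
 have C: "t = t' & w = w'" if t: "t : tact g y" "t' : tact g y" "t w = t' w'" for t t' w w'
 proof -
  obtain u u' where u: "u : y" "t = g o u" "u' : y" "t' = g o u'" using t(1,2) by blast
  hence "u w = u' w'" using t(3) H_inj[OF g] by simp
  thus ?thesis using vtx_inj[OF y u(1,3)] u by blast
 qed
 have D: "card (tact g y) = card y" by(rule card_image[OF inj_on_subset[OF inj_tact[OF g] subset_UNIV]])
 have E: "card (rest (tact g y)) = card (rest y)"
  unfolding rest_act[OF g] by(rule card_image[OF inj_on_subset[OF bij_is_inj[OF H_bij[OF g]] subset_UNIV]])
 have "finite (rest (tact g y))" using rest_act[OF g] vtxD(4)[OF y] by simp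
 moreover have "ALL t:tact g y. good t & finite (wild t)" using B by blast
 moreover have "ALL t:tact g y. ALL t':tact g y. ALL w w'. t w = t' w' --> t = t' & w = w'"
  by(intro ballI allI impI C)
 moreover have "finite (tact g y)" using vtxD(1)[OF y] by simp
 moreover have "Suc (card (rest (tact g y))) = card (tact g y)" unfolding D E by(rule vtxD(5)[OF y])
 ultimately show ?thesis unfolding vtx_def by(intro conjI)
qed

lemma card_tact: "g : H ==> card (tact g y) = card y"
 by(rule card_image[OF inj_on_subset[OF inj_tact subset_UNIV]])

lemma image_diff_tact: "g : H ==> tact g (y - A) = tact g y - tact g A"
 by(rule image_set_diff[OF inj_tact])

lemma spl_act: "g : H ==> spl (g o m) (tact g y) = tact g (spl m y)"
 by(simp add: spl_def image_diff_tact lft_comp rgt_comp)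

lemma mrg_act: "g : H ==> mrg (g o m) (tact g y) = tact g (mrg m y)"
 by(simp add: mrg_def image_diff_tact lft_comp rgt_comp)

lemma topv_act: "g : H ==> topv (tact g y) (tact g A) = tact g (topv y A)"
 by(simp add: topv_def image_diff_tact image_Un image_image lft_comp rgt_comp)

lemma tact_id: "tact id y = y" and tact_comp: "tact (g o h) y = tact g (tact h y)"
 by(auto simp: image_image o_assoc)

lemma mem_tact: "g : H ==> g o t : tact g y <-> t : y"
 by(rule inj_image_mem_iff[OF inj_tact])

lemma labels_act: "g : H ==> xs : labels x ==> map g xs : labels (tact g x)"
 using H_inj by(auto simp: labels_def marks_act distinct_map inj_on_def)

lemma cact_in: "[|g : H; c : cells|] ==> cact g c : cells"
proof -
 assume g: "g : H" and c: "c : cells"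
 obtain y A b where e: "c = (y, A, b)" by(cases c) auto
 note C = cellsD[OF c[unfolded e]]
 have "ran (map_option (map g) o b) <= labels (topv (tact g y) (tact g A))"
  unfolding topv_act[OF g] using labels_act[OF g C(5)] by(auto simp: ran_def)
 thus ?thesis using C(1-4) vtx_act[OF g C(1)]
  by(auto simp: e cells_def dom_map_option_comp simp del: dom_eq_empty_conv)
qed

text \<open>An element fixing the complement of the ranges and all roots of a vertex pointwise fixes each
 of its trees, since it permutes them and they are told apart by their roots.\<close>

lemma fixes_labels:
 assumes g: "g : H" and x: "vtx x" "tact g x = x" and L: "xs : labels x" "map g xs = xs"
 shows "g = id"
proof
 have fx: "g p = p" if "p : marks x" for p
  using L that unfolding labels_def by(metis (mono_tags, lifting) map_eq_conv list.map_ident mem_Collect_eq map_idI)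
 have ft: "g o t = t" if t: "t : x" for t
 proof -
  have "g o t : x" using x(2) t by blast
  moreover have "(g o t) [] = t []" using fx[of "t []"] t by(simp add: marks_def)
  ultimately show ?thesis using vtx_inj[OF x(1) _ t, of "g o t" "[]" "[]"] by blast
 qed
 fix p show "g p = id p"
 proof(cases "p : rest x")
  case True
  thus ?thesis using fx by(simp add: marks_def)
 next
  case False
  then obtain t w where "t : x" "p = t w" by(auto simp: rest_def)
  thus ?thesis using fun_cong[OF ft, of t w] by simp
 qed
qed

lemma cact_id: "cact id c = c" and cact_comp: "cact (g o h) c = cact g (cact h c)"
proof -
 obtain y A b where e: "c = (y, A, b)" by(cases c) auto
 show "cact id c = c" by(simp add: e tact_id option.map_id0)
 have "map_option (map (g o h)) o b = map_option (map g) o (map_option (map h) o b)"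
 proof
  fix j show "(map_option (map (g o h)) o b) j = (map_option (map g) o (map_option (map h) o b)) j"
   by(cases "b j") simp_all
 qed
 thus "cact (g o h) c = cact g (cact h c)" by(simp only: e cact.simps tact_comp)
qed

lemma cact_free: "[|g : H; c : cells; cact g c = c|] ==> g = id"
proof -
 assume g: "g : H" and c: "c : cells" and fx: "cact g c = c"
 obtain y A b where e: "c = (y, A, b)" by(cases c) auto
 note C = cellsD[OF c[unfolded e]]
 have f: "tact g y = y" "tact g A = A" "map_option (map g) o b = b" using fx unfolding e by simp_all
 obtain j xs where j: "b j = Some xs" using C(4) by(auto simp: dom_def)
 have "map g xs = xs" using fun_cong[OF f(3), of j] j by simp
 thus ?thesis using fixes_labels[OF g _ _ C(5)[OF j]] vtx_top[OF C(1,2)] topv_act[OF g, of y A] f by simp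
qed

lemma names_act: "g : H ==> names (cact g c) = nmact g ` names c"
proof -
 assume g: "g : H"
 obtain y A b where e: "c = (y, A, b)" by(cases c) auto
 have "Inl ` (tact g A \<times> UNIV) = nmact g ` Inl ` (A \<times> UNIV)" by(force simp: image_iff)
 thus ?thesis by(auto simp: e dom_map_option_comp image_Un image_image)
qed

lemma strip_act: "g : H ==> strip (g o m) (map g xs) = map g (strip m xs)"
 using H_inj by(simp add: strip_def filter_map comp_def)

lemma face_act: "[|g : H; n : names c|] ==> face (nmact g n) (cact g c) = cact g (face n c)"
proof -
 assume g: "g : H"
 obtain y A b where e: "c = (y, A, b)" by(cases c) auto
 have d: "tact g A - {g o m} = tact g (A - {m})" for m using image_diff_tact[OF g, of A "{m}"] by simp
 have s: "map_option (strip (g o m)) (map_option (map g) q) = map_option (map g) (map_option (strip m) q)" for m q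
  using strip_act[OF g] by(cases q) simp_all
 show ?thesis
 proof(cases n)
  case (Inl p)
  obtain m b' where p: "p = (m, b')" by(cases p) auto
  show ?thesis by(cases b') (simp_all add: e Inl p d spl_act[OF g] fun_eq_iff s)
 next
  case (Inr j)
  show ?thesis by(simp add: e Inr fun_eq_iff)
 qed
qed

sublocale lab: free_action GH "{(x, xs). vtx x & xs : labels x}" "%g (x, xs). (tact g x, map g xs)"
proof(intro free_action.intro group_GH free_action_axioms.intro)
 fix g h and c :: "tree set * bool list list" assume c: "c : {(x, xs). vtx x & xs : labels x}"
 obtain x xs where e: "c = (x, xs)" "vtx x" "xs : labels x" using c by auto
 show "(case c of (x, xs) => (tact \<one>\<^bsub>GH\<^esub> x, map \<one>\<^bsub>GH\<^esub> xs)) = c" using e by(simp add: tact_id)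
 assume g: "g : car GH"
 show "(case c of (x, xs) => (tact g x, map g xs)) : {(x, xs). vtx x & xs : labels x}"
  using e g vtx_act labels_act by simp
 show "g = \<one>\<^bsub>GH\<^esub>" if "(case c of (x, xs) => (tact g x, map g xs)) = c"
  using fixes_labels[of g x xs] e g that by simp
 show "(case c of (x, xs) => (tact (g \<otimes>\<^bsub>GH\<^esub> h) x, map (g \<otimes>\<^bsub>GH\<^esub> h) xs)) =
  (case case c of (x, xs) => (tact h x, map h xs) of (x, xs) => (tact g x, map g xs))"
  using e by(simp add: image_image o_assoc)
qed

lemma valid_ground_act:
 assumes g: "g : H" and v: "valid_ground good x ss" "vtx x"
 shows "valid_ground good (tact g x) (map ((o) g) ss)"
proof -
 have gd: "good (g o s)" if "s : set ss" for s
 proof(rule good_comp[OF g])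
  have s: "lft s : x" "rgt s : x" "lft s ~= rgt s" "s [] : rest x" "good s" using v(1) that by(auto simp: valid_ground_def)
  have m: "vtx (mrg s x)" "s : mrg s x" using vtx_mrg[OF v(2) s] by(auto simp: mrg_def)
  show "good s" by fact
  show "finite (wild s)" by(rule vtxD(3)[OF m])
  show "inj s" using vtx_inj_same[OF m] by(auto simp: inj_def)
 qed
 have r: "g p : rest (tact g x) <-> p : rest x" for p using rest_act[OF g] H_inj[OF g] by auto
 show ?thesis using v gd unfolding valid_ground_def
  by(simp add: lft_comp rgt_comp mem_tact[OF g] H_injt[OF g] r H_inj[OF g] distinct_map inj_on_def card_tact[OF g])
qed

lemma valid_ground_ex: "vtx x ==> EX ss. valid_ground good x ss"
proof -
 assume x: "vtx x"
 obtain ps where ps: "disjoint_pairs ps" "card x <= 2 * length ps + 2"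
  "!!a c. (a, c) : set ps ==> a : x & c : x & (ALL s. lft s = a & rgt s = c --> good s)"
  using ground_pairs[OF x] by fast
 obtain rs where rs: "set rs = rest x" "distinct rs" using finite_distinct_list[OF vtxD(4)[OF x]] by blast
 define jn where "jn a c p w = (case w of [] => p | False # w' => a w' | True # w' => c w')" for a c :: tree and p w
 have jn: "lft (jn a c p) = a" "rgt (jn a c p) = c" "jn a c p [] = p" for a c p
  by(auto simp: jn_def lft_def rgt_def)
 \<comment> \<open>At least \<open>k\<close> pairs are on offer and \<open>card x - 1\<close>
   uncovered points to root them at; with this rounding at most two trees are left over. The tree
   \<open>jn a c p\<close> has the halves \<open>a\<close> and \<open>c\<close> and the root
   \<open>p\<close>.\<close>
 define k where "k = (card x - 1) div 2"
 let ?L = "concat (map (%(a, c). [a, c]) ps)"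
 have lenL: "length ?L = 2 * length ps" by(induction ps) auto
 have nthL: "i < length ps ==> ?L ! (2 * i) = fst (ps ! i) & ?L ! Suc (2 * i) = snd (ps ! i)" for i
 proof(induction ps arbitrary: i)
  case (Cons q ps)
  thus ?case by(cases i; cases q) auto
 qed simp
 have kr: "k <= length ps" "k <= length rs"
  using ps(2) rs vtxD(5)[OF x] distinct_card[OF rs(2)] by(auto simp: k_def)
 define s where "s i = jn (fst (ps ! i)) (snd (ps ! i)) (rs ! i)" for i
 have dL: "?L ! i = ?L ! j <-> i = j" if "i < 2 * length ps" "j < 2 * length ps" for i j
  using ps(1) that nth_eq_iff_index_eq[of ?L i j] unfolding disjoint_pairs_def lenL by blast
 have sep: "s i [] ~= s j [] & {lft (s i), rgt (s i)} Int {lft (s j), rgt (s j)} = {}" if "i < k" "j < k" "i ~= j" for i j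
 proof -
  have "rs ! i ~= rs ! j" using nth_eq_iff_index_eq[OF rs(2), of i j] that kr by simp
  moreover have "fst (ps ! i) ~= fst (ps ! j)" "snd (ps ! i) ~= snd (ps ! j)"
   using dL[of "2 * i" "2 * j"] dL[of "Suc (2 * i)" "Suc (2 * j)"] nthL[of i] nthL[of j] that kr by auto
  moreover have "fst (ps ! i) ~= snd (ps ! j)" "snd (ps ! i) ~= fst (ps ! j)"
   using dL[of "2 * i" "Suc (2 * j)"] dL[of "Suc (2 * i)" "2 * j"] nthL[of i] nthL[of j] that kr by auto
  ultimately show ?thesis by(simp add: s_def jn)
 qed
 have ok: "lft (s i) : x & rgt (s i) : x & lft (s i) ~= rgt (s i) & s i [] : rest x & good (s i)" if i: "i < k" for i
 proof -
  have il: "i < length ps" "i < length rs" using i kr by linarith+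
  have "(fst (ps ! i), snd (ps ! i)) : set ps" using nth_mem[OF il(1)] by simp
  note p = ps(3)[OF this]
  have "rs ! i : rest x" using nth_mem[OF il(2)] rs(1) by blast
  moreover have "fst (ps ! i) ~= snd (ps ! i)"
  proof -
   have "?L ! (2 * i) ~= ?L ! Suc (2 * i)" using dL[of "2 * i" "Suc (2 * i)"] il(1) by linarith
   thus ?thesis using nthL[OF il(1)] by metis
  qed
  ultimately show ?thesis unfolding s_def jn using p jn by blast
 qed
 have inj: "inj_on s {0..<k}"
 proof(rule inj_onI, rule ccontr)
  fix i j assume "i : {0..<k}" "j : {0..<k}" "s i = s j" "i ~= j"
  thus False using sep[of i j] by simp
 qed
 have "valid_ground good x (map s [0..<k])"
  unfolding valid_ground_def
 proof(intro conjI)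
  show "ALL s':set (map s [0..<k]). lft s' : x & rgt s' : x & lft s' ~= rgt s' & s' [] : rest x & good s'"
   using ok by simp
  show "ALL s1:set (map s [0..<k]). ALL s2:set (map s [0..<k]). s1 ~= s2 --> s1 [] ~= s2 [] & {lft s1, rgt s1} Int {lft s2, rgt s2} = {}"
  proof(intro ballI impI)
   fix s1 s2 assume "s1 : set (map s [0..<k])" "s2 : set (map s [0..<k])" and ne: "s1 ~= s2"
   then obtain i j where ij: "i < k" "s1 = s i" "j < k" "s2 = s j" by auto
   have "i ~= j" using ne ij by blast
   from sep[OF ij(1,3) this] show "s1 [] ~= s2 [] & {lft s1, rgt s1} Int {lft s2, rgt s2} = {}" unfolding ij .
  qed
  show "distinct (map s [0..<k])" using inj by(simp add: distinct_map)
  show "card x <= 2 * length (map s [0..<k]) + 2" by(simp add: k_def)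
 qed
 thus ?thesis by blast
qed

text \<open>The list is chosen on an orbit representative and carried along by \<open>mv\<close>.
  For families alone this would not be equivariant, since a stabiliser may permute the merges; on
  labelled families the action is free.\<close>

definition ground :: "tree set => bool list list => tree list" where
 "ground x xs = map ((o) (lab.mv (x, xs))) (SOME ss. valid_ground good (fst (lab.orb (x, xs))) ss)"

lemma ground_valid: "[|vtx x; xs : labels x|] ==> valid_ground good x (ground x xs)"
proof -
 assume a: "vtx x" "xs : labels x"
 obtain x0 xs0 where o: "lab.orb (x, xs) = (x0, xs0)" by(cases "lab.orb (x, xs)") auto
 have x0: "vtx x0" using lab.orb_in[of "(x, xs)"] a o by simp
 let ?g = "lab.mv (x, xs)"
 have m: "?g : H" "tact ?g x0 = x" using lab.mv[of "(x, xs)"] a o by auto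
 have "valid_ground good x0 (SOME ss. valid_ground good x0 ss)" by(rule someI_ex[OF valid_ground_ex[OF x0]])
 from valid_ground_act[OF m(1) this x0] show ?thesis unfolding m(2) by(simp add: ground_def o)
qed

lemma ground_act: "[|g : H; vtx x; xs : labels x|] ==> ground (tact g x) (map g xs) = map ((o) g) (ground x xs)"
using lab.mv_act lab.orb_act o_assoc by(fastforce simp: ground_def)

end

section \<open>The equivariant matching\<close>

text \<open>Whether the stage \<open>l\<close> may be added or removed is governed by the next stage \<open>k\<close> above it, whose
 label it shares; \<open>l\<close> is taken least, so that all stages below it are occupied, with distinct
 consecutive labels.\<close>

definition etl :: "(nat => 'v option) => nat => nat => bool" where
 "etl b l k <-> l < k & b k ~= None & (ALL j. l < j & j < k --> b j = None) & (b l = None | b l = b k) &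
   (ALL j<l. b j ~= None & (if Suc j < l then b j ~= b (Suc j) else b j ~= b k))"

definition et :: "(nat => 'v option) => bool" where "et b <-> (EX l k. etl b l k)"
definition el :: "(nat => 'v option) => nat" where "el b = (THE l. EX k. etl b l k)"
definition bt :: "(nat => 'v option) => nat => 'v option" where
 "bt b = (if et b then b(el b := b (THE k. etl b (el b) k)) else b)"

definition run_end :: "(nat => 'v option) => nat => bool" where
 "run_end b j <-> b j ~= None & (ALL k>j. b k ~= None & (ALL i. j < i & i < k --> b i = None) --> b k ~= b j)"

text \<open>The first entry is the number of maximal runs of equal labels at consecutive occupied
  stages, the second a weight of the occupied stages apart from the paired one. Both refer to the
  filled labelling \<open>bt b\<close> and so agree on the members of a pair.\<close>

definition rE :: "(nat => 'v option) => nat * nat" where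
 "rE b = (card {j. run_end (bt b) j}, SUM j:dom (bt b) - (if et b then {el b} else {}). Suc j)"

lemma etlD:
 assumes "etl b l k"
 shows "l < k" "b k ~= None" "[|l < j; j < k|] ==> b j = None" "b l = None | b l = b k"
  "j < l ==> b j ~= None" "Suc j < l ==> b j ~= b (Suc j)" "l = Suc j ==> b j ~= b k"
 using assms unfolding etl_def by(blast, blast, blast, blast, blast, (metis Suc_lessD), (metis lessI less_irrefl))

text \<open>By the last clause of \<open>etl\<close> a stage below a paired one has a label
  different from that of the stage following it, while a paired stage, if occupied, shares the label
  of the next occupied one. So no paired stage lies below another.\<close>

lemma etl_not_less:
 assumes "etl b l k" "etl b l' k'"
 shows "~ l < l'"
proof
 assume l: "l < l'"
 note D = etlD[OF assms(1)] and D' = etlD[OF assms(2)]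
 have bl: "b l = b k" using D(4) D'(5)[OF l] by auto
 show False
 proof(cases "Suc l < l'")
  case True
  have "k = Suc l"
  proof(rule ccontr)
   assume "k ~= Suc l"
   thus False using D(1) D(3)[of "Suc l"] D'(5)[OF True] by auto
  qed
  thus False using D'(6)[OF True] bl by simp
 next
  case False
  hence l': "l' = Suc l" using l by simp
  have "b l ~= b k'" by(rule D'(7)[OF l'])
  show False
  proof(cases "b l' = None")
   case True
   have "l' < k" using D(1,2) True l' by(metis Suc_lessI)
   have "~ k < k'" using D'(3)[of k] \<open>l' < k\<close> D(2) by auto
   moreover have "~ k' < k" using D(3)[of k'] D'(1,2) l by auto
   ultimately show False using bl \<open>b l ~= b k'\<close> by(metis linorder_neqE_nat)
  next
   case False
   hence "k = l'" using D(1) D(3)[of l'] l' by(metis Suc_lessI lessI)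
   thus False using D'(4) False bl \<open>b l ~= b k'\<close> by auto
  qed
 qed
qed

lemma etl_unique: "[|etl b l k; etl b l' k'|] ==> l = l' & k = k'"
proof -
 assume a: "etl b l k" "etl b l' k'"
 have l: "l = l'" using etl_not_less[OF a] etl_not_less[OF a(2,1)] by simp
 have "~ k < k'" "~ k' < k" using etlD(1-3)[OF a(1)] etlD(1-3)[OF a(2)] l by metis+
 thus ?thesis using l by simp
qed

lemma el_bt: "etl b l k ==> el b = l & bt b = b(l := b k) & et b"
proof -
 assume a: "etl b l k"
 have e: "et b" using a by(auto simp: et_def)
 have l: "el b = l" unfolding el_def by(rule the_equality) (use a etl_unique in blast)+
 have "(THE k. etl b l k) = k" by(rule the_equality) (use a etl_unique in blast)+
 thus ?thesis using e l by(simp add: bt_def)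
qed

lemma etl_upd: "[|etl b l k; v = None | v = b k|] ==> etl (b(l := v)) l k"
proof -
 assume e: "etl b l k" and v: "v = None | v = b k"
 note E = etlD[OF e]
 have o: "(b(l := v)) j = b j" if "j ~= l" for j using that by simp
 show ?thesis unfolding etl_def
 proof(intro conjI allI impI)
  show "l < k" by(rule E(1))
  show "(b(l := v)) k ~= None" using E(1,2) o[of k] by simp
  show "(b(l := v)) j = None" if "l < j & j < k" for j using E(3)[of j] o[of j] that by simp
  show "(b(l := v)) l = None | (b(l := v)) l = (b(l := v)) k" using v E(1) o[of k] by simp
  fix j assume j: "j < l"
  show "(b(l := v)) j ~= None" using E(5)[OF j] o[of j] j by simp
  show "if Suc j < l then (b(l := v)) j ~= (b(l := v)) (Suc j) else (b(l := v)) j ~= (b(l := v)) k"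
  using E(6) o j E(7) E(1) by auto
 qed
qed

lemma etl_inj: "inj f ==> etl (map_option f o b) l k <-> etl b l k"
proof -
 assume "inj f"
 hence "inj (map_option f)" by(rule option.inj_map)
 hence "map_option f u = map_option f v <-> u = v" for u v by(auto dest: injD)
 thus ?thesis unfolding etl_def by simp
qed

lemma finite_run_end: "finite (dom b) ==> finite {j. run_end b j}"
 by(rule finite_subset[of _ "dom b"]) (auto simp: run_end_def)

lemma run_end_del:
 assumes b: "b j0 ~= None" "run_end (b(j0 := None)) i" "~ run_end b i"
 shows "i < j0" "b i = b j0" "!!j. [|i < j; j < j0|] ==> b j = None" "run_end b j0" "b i ~= None" "i ~= j0"
proof -
 let ?b = "b(j0 := None)"
 show ij: "i ~= j0" and bi: "b i ~= None" using b(2) by(auto simp: run_end_def split: if_splits)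
 have nx: "b k ~= b i" if "i < k" "k ~= j0" "b k ~= None" "!!j. [|i < j; j < k|] ==> j = j0 | b j = None" for k
 using b(2) ij that by(fastforce simp: run_end_def)
 obtain k where k: "i < k" "b k ~= None" "!!j. [|i < j; j < k|] ==> b j = None" "b k = b i"
  using b(3) bi unfolding run_end_def by metis
 have kj: "k = j0"
 using nx k(1) k(2) k(3) k(4) by metis
 show "i < j0" "b i = b j0" "!!j. [|i < j; j < j0|] ==> b j = None" using k kj by auto
 show "run_end b j0"
  unfolding run_end_def
 proof(intro conjI allI impI)
  fix m assume m: "j0 < m" "b m ~= None & (ALL i. j0 < i & i < m --> b i = None)"
  have "b m ~= b i"
  proof(rule nx)
   fix j assume "i < j" "j < m"
   thus "j = j0 | b j = None" using k(3) kj m by(cases "j < j0"; cases "j0 < j") auto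
  qed (use k(1) kj m in auto)
  thus "b m ~= b j0" using k(4) kj by simp
 qed (rule b(1))
qed

text \<open>A new run end can appear only just before the deleted stage, in the same run, and then
  it replaces the deleted end. So the number of runs never grows, and it drops if the deleted stage
  was a run by itself.\<close>

lemma card_run_end_del:
 assumes b: "finite (dom b)" "b j0 ~= None"
 shows "card {j. run_end (b(j0 := None)) j} <= card {j. run_end b j}"
  and "[|run_end b j0; !!i. [|i < j0; b i ~= None; !!j. [|i < j; j < j0|] ==> b j = None|] ==> b i ~= b j0|] ==>
   card {j. run_end (b(j0 := None)) j} < card {j. run_end b j}"
proof -
 let ?X = "{j. run_end b j}" and ?Y = "{j. run_end (b(j0 := None)) j}"
 let ?Z = "?Y - ?X"
 note D = run_end_del[of b j0, OF b(2)]
 have fX: "finite ?X" by(rule finite_run_end[OF b(1)])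
 have j0: "j0 ~: ?Y" by(simp add: run_end_def)
 hence Y: "?Y <= (?X - {j0}) Un ?Z" by blast
 show "card ?Y <= card ?X"
 proof(cases "?Z = {}")
  case True
  thus ?thesis by(intro card_mono fX) blast
 next
  case False
  then obtain i where i: "i : ?Z" by blast
  have "i' = i" if i': "i' : ?Z" for i'
  proof -
   have "~ i < i'" using D(3)[of i i'] D(1,5)[of i'] i i' by blast
   moreover have "~ i' < i" using D(3)[of i' i] D(1,5)[of i] i i' by blast
   ultimately show ?thesis by simp
  qed
  hence "?Z = {i}" using i by blast
  hence "?Y <= insert i (?X - {j0})" using Y by blast
  hence "card ?Y <= card (insert i (?X - {j0}))" using fX by(intro card_mono) auto
  also have "... <= Suc (card (?X - {j0}))" by(simp add: card_insert_if fX)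
  also have "... = card ?X" using D(4)[of i] i fX by(intro card_Suc_Diff1) auto
  finally show ?thesis .
 qed
 assume e: "run_end b j0" and p: "!!i. [|i < j0; b i ~= None; !!j. [|i < j; j < j0|] ==> b j = None|] ==> b i ~= b j0"
 have "?Z = {}" using D p by blast
 thus "card ?Y < card ?X" using e j0 by(intro psubset_card_mono fX) blast
qed

lemma card_run_end_bt: "finite (dom b) ==> card {j. run_end (bt b) j} <= card {j. run_end b j}"
proof(cases "et b")
 case True
 assume f: "finite (dom b)"
 obtain l k where e: "etl b l k" using True by(auto simp: et_def)
 note E = etlD[OF e]
 let ?b = "b(l := b k)"
 have "run_end b j" if r: "run_end ?b j" for j
 proof -
  have jl: "j ~= l"
  using E(1-3) r E(1) by(auto simp: run_end_def)
  show ?thesis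
   unfolding run_end_def
  proof(intro conjI allI impI)
   show "b j ~= None" using r jl by(simp add: run_end_def)
   fix m assume m: "j < m" "b m ~= None & (ALL i. j < i & i < m --> b i = None)"
   show "b m ~= b j"
   proof(cases "j < l & l < m")
    case True
    hence mk: "m = k" using m E(1-3) by(metis linorder_neqE_nat less_trans)
    have "?b l ~= None & (ALL i. j < i & i < l --> ?b i = None)" using m True E(2) by auto
    hence "?b l ~= ?b j" using r True unfolding run_end_def by blast
    thus ?thesis using jl mk by simp
   next
    case False
    have "?b m ~= None & (ALL i. j < i & i < m --> ?b i = None)" using m False jl E(2) by auto
    hence "?b m ~= ?b j" using r m(1) unfolding run_end_def by blast
    thus ?thesis using jl m E(4) by(auto split: if_splits)
   qed
  qed
 qed
 thus ?thesis using el_bt[OF e] finite_run_end[OF f] by(auto intro!: card_mono)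
qed (simp add: bt_def)

lemma rE_bt: "etl b l k ==> rE (b(l := b k)) = rE b"
proof -
 assume e: "etl b l k"
 have "etl (b(l := b k)) l k" by(rule etl_upd[OF e]) simp
 from el_bt[OF this] el_bt[OF e] show ?thesis using etlD(1)[OF e] by(simp add: rE_def)
qed

abbreviation "lex2 == less_than <*lex*> less_than"

lemma dom_bt_subset: "dom (bt b) - (if et b then {el b} else {}) <= dom b"
 by(auto simp: bt_def split: if_splits)

text \<open>Below the paired stage \<open>l\<close> every run is a single stage, so a deletion there
  removes a run. Above it the number of runs does not grow and the sum falls: it loses the deleted
  stage \<open>j\<close> and gains at most the smaller \<open>l\<close>.\<close>

lemma rE_del_paired:
 assumes f: "finite (dom b)" and e: "etl b l k" "b l = b k" and j: "j ~= l" "b j ~= None"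
 shows "(rE (b(j := None)), rE b) : lex2"
proof -
 note E = etlD[OF e(1)]
 let ?b = "b(j := None)"
 have bt: "bt b = b" "et b" "el b = l" using el_bt[OF e(1)] e(2) by(auto simp: fun_upd_idem)
 have f': "finite (dom ?b)" using f by simp
 note le = card_run_end_bt[OF f'] card_run_end_del(1)[OF f j(2)]
 consider "j < l" | "l < j" using j(1) by linarith
 thus ?thesis
 proof cases
  case 1
  have nx: "b (Suc i) ~= None & b i ~= b (Suc i)" if "i < l" for i
   using E(2) E(5)[of "Suc i"] E(6)[of i] E(7)[of i] e(2) that by(cases "Suc i = l") auto
  have "card {j. run_end ?b j} < card {j. run_end b j}"
  proof(rule card_run_end_del(2)[OF f j(2)])
   show "run_end b j"
    unfolding run_end_def using j(2) nx[OF 1] by(metis Suc_lessI lessI)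
   fix i assume i: "i < j" "b i ~= None" "!!m. [|i < m; m < j|] ==> b m = None"
   have "j = Suc i" using i nx[of i] 1 by(metis Suc_lessI lessI less_trans)
   thus "b i ~= b j" using nx[of i] 1 by simp
  qed
  thus ?thesis using le bt by(simp add: rE_def)
 next
  case 2
  let ?S = "dom (bt ?b) - (if et ?b then {el ?b} else {})"
  have "sum Suc ?S <= sum Suc (dom b - {j})"
   using dom_bt_subset[of ?b] f by(intro sum_mono2) auto
  moreover have "sum Suc (dom b) = Suc j + sum Suc (dom b - {j})" using f j(2) by(intro sum.remove) auto
  moreover have "sum Suc (dom b) = Suc l + sum Suc (dom b - {l})" using f e(2) E(2) by(intro sum.remove) auto
  ultimately have "sum Suc ?S < sum Suc (dom b - {l})" using 2 by linarith
  thus ?thesis using le bt by(auto simp: rE_def)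
 qed
qed

text \<open>Consider the first failure below the last occupied stage. At a repetition the repeating
  stage could be paired; at a gap the vacant stage could, or the stage before it if that one carries
  the label found beyond the gap. Consequently the dimension of such a cell bounds its
  stages.\<close>

lemma not_et:
 assumes b: "finite (dom b)" "dom b ~= {}" "~ et b"
 shows "EX K. dom b = {..K} & (ALL j<K. b j ~= b (Suc j))"
proof -
 let ?K = "Max (dom b)"
 have K: "b ?K ~= None" "!!j. b j ~= None ==> j <= ?K" using Max_in[OF b(1,2)] Max_ge[OF b(1)] by auto
 have step: "b j ~= None & b j ~= b (Suc j)" if "j < ?K" for j
  using that
 proof(induction j rule: less_induct)
  case (less j)
  have IH: "b i ~= None & b i ~= b (Suc i)" if "i < j" for i using less that by simp
  define k where "k = (LEAST k. j < k & b k ~= None)"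
  have k: "j < k & b k ~= None" unfolding k_def by(rule LeastI[of _ ?K]) (use less.prems K(1) in simp)
  have kl: "b i = None" if "j < i" "i < k" for i using not_less_Least[of i "%k. j < k & b k ~= None"] that by(auto simp: k_def)
  show ?case
  proof(rule ccontr)
   assume neg: "~ ?thesis"
   have "et b"
   proof(cases "b j = None")
    case False
    hence bj: "b j = b (Suc j)" "b (Suc j) ~= None" using neg by auto
    have "etl b j (Suc j)" unfolding etl_def
    proof(intro conjI allI impI)
     show "j < Suc j" "b (Suc j) ~= None" "b j = None | b j = b (Suc j)" using bj by auto
     show "b m = None" if "j < m & m < Suc j" for m using that by linarith
     fix m assume m: "m < j"
     show "b m ~= None" using IH[of m] m by simp
     show "if Suc m < j then b m ~= b (Suc m) else b m ~= b (Suc j)"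
      using IH[of m] m bj(1) by(cases "Suc m = j") auto
    qed
    thus ?thesis by(auto simp: et_def)
   next
    case True
    show ?thesis
    proof(cases "j > 0 & b (j - 1) = b k")
     case True
     then obtain i where i: "j = Suc i" "b i = b k" by(cases j) auto
     have "etl b i k" unfolding etl_def
     proof(intro conjI allI impI)
      show "i < k" "b k ~= None" "b i = None | b i = b k" using i k by auto
      show "b m = None" if "i < m & m < k" for m using that kl[of m] i(1) \<open>b j = None\<close> by(cases "m = j") auto
      fix m assume m: "m < i"
      show "b m ~= None" using IH[of m] m i by simp
      show "if Suc m < i then b m ~= b (Suc m) else b m ~= b k"
       using IH[of m] m i by(cases "Suc m = i") auto
     qed
     thus ?thesis by(auto simp: et_def)
    next
     case False
     have "etl b j k" unfolding etl_def
     proof(intro conjI allI impI)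
      show "j < k" "b k ~= None" "b j = None | b j = b k" using k \<open>b j = None\<close> by auto
      show "b m = None" if "j < m & m < k" for m using that kl by blast
      fix m assume m: "m < j"
      show "b m ~= None" using IH[of m] m by simp
      show "if Suc m < j then b m ~= b (Suc m) else b m ~= b k"
       using IH[of m] m False by(cases "Suc m = j") auto
     qed
     thus ?thesis by(auto simp: et_def)
    qed
   qed
   thus False using b(3) by simp
  qed
 qed
 have "j : dom b <-> j : {..?K}" for j using K(1) K(2)[of j] step[of j] by(cases "j = ?K") auto
 thus ?thesis using step by(intro exI[of _ ?K]) blast
qed

lemma rE_del_reduced:
 assumes f: "finite (dom b)" and e: "~ et b" and j: "b j ~= None"
 shows "(rE (b(j := None)), rE b) : lex2"
proof -
 have "dom b ~= {}" using j by auto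
 then obtain K where K: "dom b = {..K}" "!!j. j < K ==> b j ~= b (Suc j)" using not_et[OF f _ e] by blast
 have nn: "b i ~= None <-> i <= K" for i using K(1) by(auto simp: dom_def set_eq_iff)
 have bt: "bt b = b" using e by(simp add: bt_def)
 have f': "finite (dom (b(j := None)))" using f by simp
 have "card {i. run_end (b(j := None)) i} < card {i. run_end b i}"
 proof(rule card_run_end_del(2)[OF f j])
  show "run_end b j" unfolding run_end_def
  proof(intro conjI allI impI j)
   fix k assume k: "j < k" "b k ~= None & (ALL i. j < i & i < k --> b i = None)"
   have "k = Suc j"
   proof(rule ccontr)
    assume "k ~= Suc j"
    thus False using k nn[of "Suc j"] nn[of k] by auto
   qed
   thus "b k ~= b j" using K(2)[of j] nn[of k] k by auto
  qed
  fix i assume i: "i < j" "b i ~= None" "!!m. [|i < m; m < j|] ==> b m = None"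
  have "j = Suc i"
  proof(rule ccontr)
   assume "j ~= Suc i"
   thus False using i(1) i(3)[of "Suc i"] nn[of "Suc i"] nn[of j] j by auto
  qed
  thus "b i ~= b j" using K(2)[of i] nn[of j] j by auto
 qed
 thus ?thesis using card_run_end_bt[OF f'] bt by(simp add: rE_def)
qed

section \<open>The matching on labelled cubes\<close>

context tree_group begin

text \<open>The merge \<open>s\<close> is available in the cube: it is one of its directions, or its
  halves are idle trees of \<open>y\<close> and it can be added as a new direction.\<close>

definition ok :: "tree set => tree set => tree => bool" where
 "ok y A s <-> s : A | lft s : y - A & rgt s : y - A & s [] : rest y"

text \<open>The merges depend on the top family and the label at stage 0 only, so splitting facets
  keep the list. By \<open>not_et\<close> there is a label at stage 0 whenever the list is
  consulted.\<close>

definition gr :: "cell => tree list" where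
 "gr c = (case c of (y, A, b) => ground (topv y A) (the (b 0)))"
definition ix :: "cell => nat" where
 "ix c = (case c of (y, A, b) => length (takeWhile (%s. ~ ok y A s) (gr c)))"

definition crit1 :: "cell => bool" where
 "crit1 c = (case c of (y, A, b) => ~ et b & ix c = length (gr c))"
definition tau1 :: "cell => cell" where
 "tau1 c = (case c of (y, A, b) => if et b then (y, A, bt b)
   else if gr c ! ix c : A then c else (mrg (gr c ! ix c) y, insert (gr c ! ix c) A, b))"
definition phi1 :: "cell => name" where
 "phi1 c = (case c of (y, A, b) => if et b then Inr (el b) else Inl (gr c ! ix c, False))"
definition rk1 :: "cell => nat * (nat * nat) * (nat * nat)" where
 "rk1 c = (case c of (y, A, b) => (card (topv y A), rE b,
   if et b then (0, card A) else (ix c, card (A - (if ix c < length (gr c) then {gr c ! ix c} else {})))))"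

abbreviation "S1 == less_than <*lex*> (lex2 <*lex*> lex2)"

lemma gr_valid:
 assumes "(y, A, b) : cells" "~ et b"
 shows "valid_ground good (topv y A) (gr (y, A, b))"
proof -
 note C = cellsD[OF assms(1)]
 obtain K where "dom b = {..K}" using not_et[OF C(3,4) assms(2)] by blast
 hence "0 : dom b" by simp
 then obtain xs where xs: "b 0 = Some xs" by auto
 show ?thesis using ground_valid[OF _ C(5)[OF xs]] vtx_top[OF C(1,2)] xs by(simp add: gr_def)
qed

text \<open>Members of the list have different roots and disjoint halves, so splitting one of them
  does not affect the availability of the others; the split one stays available through its halves,
  which are now idle.\<close>

lemma ok_spl:
 assumes y: "vtx y" "A <= y" and s: "s : A" "s : set ss" "s' : set ss" and v: "valid_ground good x ss"
 shows "ok (spl s y) (A - {s}) s' <-> ok y A s'"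
proof -
 have sy: "s : y" using y(2) s(1) by blast
 note fr = fresh[OF y(1) sy]
 have sub: "spl s y - (A - {s}) = {lft s, rgt s} Un (y - A)"
  using fr y(2) s(1) unfolding spl_def by blast
 have r: "rest (spl s y) = insert (s []) (rest y)" by(rule rest_spl[OF y(1) sy])
 show ?thesis
 proof(cases "s' = s")
  case True
  thus ?thesis unfolding ok_def sub r using s(1) by blast
 next
  case False
  have "s' [] ~= s []" "{lft s', rgt s'} Int {lft s, rgt s} = {}"
   using v s(2,3) False unfolding valid_ground_def by blast+
  thus ?thesis unfolding ok_def sub r using False by blast
 qed
qed

lemma gr_face:
 assumes c: "(y, A, b) : cells" "m : A"
 shows "gr (spl m y, A - {m}, b) = gr (y, A, b)"
 using top_spl[OF cellsD(1,2)[OF c(1)] c(2)] by(simp add: gr_def)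

lemma ix_face:
 assumes c: "(y, A, b) : cells" "~ et b" and m: "m : A" "m : set (gr (y, A, b))"
 shows "ix (spl m y, A - {m}, b) = ix (y, A, b)"
proof -
 have "takeWhile (%s. ~ ok (spl m y) (A - {m}) s) (gr (y, A, b)) = takeWhile (%s. ~ ok y A s) (gr (y, A, b))"
  by(rule takeWhile_cong[OF refl])
   (use ok_spl[OF cellsD(1,2)[OF c(1)] m(1,2) _ gr_valid[OF c]] in simp)
 thus ?thesis using gr_face[OF c(1) m(1)] by(simp add: ix_def)
qed

lemma ix_le: "ix (y, A, b) <= length (gr (y, A, b))"
 by(simp add: ix_def length_takeWhile_le)

lemma ix_ok: "ix (y, A, b) < length (gr (y, A, b)) ==> ok y A (gr (y, A, b) ! ix (y, A, b))"
 using nth_length_takeWhile[of "%s. ~ ok y A s" "gr (y, A, b)"] by(simp add: ix_def)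

lemma ix_le_ok: "i < length (gr (y, A, b)) ==> ok y A (gr (y, A, b) ! i) ==> ix (y, A, b) <= i"
 using nth_mem[of i] takeWhile_nth[of _ "%s. ~ ok y A s" "gr (y, A, b)"] set_takeWhileD
 unfolding ix_def by(metis (mono_tags, lifting) case_prod_conv not_le_imp_less nth_mem)

text \<open>The cell \<open>c\<close> is paired by merging the tree \<open>s\<close>: either \<open>s\<close> is already to be split, or its two
 halves are left alone.\<close>

lemma merge_cases:
 assumes c: "(y, A, b) : cells" "~ et b" "ix (y, A, b) < length (gr (y, A, b))"
 defines "s == gr (y, A, b) ! ix (y, A, b)"
 obtains (tau) "s : A" | (sig) "s ~: A" "(mrg s y, insert s A, b) : cells" "s : insert s A"
  "spl s (mrg s y) = y" "insert s A - {s} = A" "topv (mrg s y) (insert s A) = topv y A"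
proof(cases "s : A")
 case False
 note C = cellsD[OF c(1)]
 have s: "s : set (gr (y, A, b))" using c(3) by(simp add: s_def)
 have "lft s : y - A & rgt s : y - A & s [] : rest y" using ix_ok[OF c(3)] False by(simp add: ok_def s_def)
 moreover have "lft s ~= rgt s" "good s" using gr_valid[OF c(1,2)] s unfolding valid_ground_def by blast+
 ultimately have o: "lft s : y - A" "rgt s : y - A" "s [] : rest y" "lft s ~= rgt s" "good s" by blast+
 have v: "vtx (mrg s y)" using vtx_mrg[OF C(1)] o by blast
 have sub: "insert s A <= mrg s y" using C(2) o unfolding mrg_def by blast
 have sp: "spl s (mrg s y) = y" using spl_mrg o by blast
 have A: "insert s A - {s} = A" using False by blast
 have tp: "topv (mrg s y) (insert s A) = topv y A" using top_spl[OF v sub, of s] sp A by simp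
 have "(mrg s y, insert s A, b) : cells" using C(3-5) v sub tp by(auto simp: cells_def ran_def)
 thus ?thesis using sig[OF False] sp A tp by blast
qed (rule tau)

lemma tau1_et: "et b ==> tau1 (y, A, b) = (y, A, bt b)"
 and phi1_et: "et b ==> phi1 (y, A, b) = Inr (el b)"
 and crit1_et: "et b ==> ~ crit1 (y, A, b)"
 and rk1_et: "et b ==> rk1 (y, A, b) = (card (topv y A), rE b, (0, card A))"
 and tau1_net: "~ et b ==> tau1 (y, A, b) = (let s = gr (y, A, b) ! ix (y, A, b) in if s : A then (y, A, b) else (mrg s y, insert s A, b))"
 and phi1_net: "~ et b ==> phi1 (y, A, b) = Inl (gr (y, A, b) ! ix (y, A, b), False)"
 and crit1_net: "~ et b ==> crit1 (y, A, b) <-> ~ ix (y, A, b) < length (gr (y, A, b))"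
 and rk1_net: "~ et b ==> rk1 (y, A, b) = (card (topv y A), rE b, (ix (y, A, b),
   card (A - (if ix (y, A, b) < length (gr (y, A, b)) then {gr (y, A, b) ! ix (y, A, b)} else {}))))"
 using ix_le[of y A b] by(auto simp: tau1_def phi1_def crit1_def rk1_def Let_def)

lemma rk1_unsplit:
 assumes c: "(y, A, b) : cells" "m : A"
 shows "(rk1 (face (Inl (m, True)) (y, A, b)), rk1 (y, A, b)) : S1"
proof -
 note C = cellsD[OF c(1)]
 have sub: "A - {m} <= y" using C(2) by blast
 have "card (topv y (A - {m})) < card (topv y A)"
  using vtx_top[OF C(1,2)] vtx_top[OF C(1) sub] card_Diff1_less[OF C(6) c(2)] by simp
 thus ?thesis by(simp add: rk1_def)
qed

lemma rk1_split:
 assumes c: "(y, A, b) : cells" "m : A"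
  and s: "~ et b ==> ix (y, A, b) < length (gr (y, A, b)) ==> gr (y, A, b) ! ix (y, A, b) : A - {m}"
 shows "(rk1 (face (Inl (m, False)) (y, A, b)), rk1 (y, A, b)) : S1"
proof -
 note C = cellsD[OF c(1)]
 note tp = top_spl[OF C(1,2) c(2)]
 have lessA: "card (A - {m}) < card A" by(rule card_Diff1_less[OF C(6) c(2)])
 show ?thesis
 proof(cases "et b")
  case True
  thus ?thesis using tp lessA by(simp add: rk1_et)
 next
  case False
  let ?c = "(y, A, b)" and ?c' = "(spl m y, A - {m}, b)"
  have g: "gr ?c' = gr ?c" by(rule gr_face[OF c])
  have "(ix ?c', card (A - {m} - (if ix ?c' < length (gr ?c') then {gr ?c' ! ix ?c'} else {}))) = (ix ?c', card (A - {m})) |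
   ix ?c' < length (gr ?c')" by auto
  have "((ix ?c', card (A - {m} - (if ix ?c' < length (gr ?c') then {gr ?c' ! ix ?c'} else {}))),
    (ix ?c, card (A - (if ix ?c < length (gr ?c) then {gr ?c ! ix ?c} else {})))) : lex2"
  proof(cases "ix ?c < length (gr ?c)")
   case True
   let ?s = "gr ?c ! ix ?c"
   \<comment> \<open>The paired merge is still a direction of the split facet, so the first
     available merge there comes no later in the list.\<close>
   have sA: "?s : A - {m}" by(rule s[OF False True])
   hence "ok (spl m y) (A - {m}) (gr ?c' ! ix ?c)" by(simp add: ok_def g)
   hence le: "ix ?c' <= ix ?c" using True g by(intro ix_le_ok) simp_all
   have "card (A - {m} - {?s}) < card (A - {?s})" by(rule psubset_card_mono) (use C(6) c(2) sA in auto)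
   thus ?thesis using le True by(cases "ix ?c' = ix ?c") (auto simp: g)
  next
   case nl: False
   hence e: "ix ?c = length (gr ?c)" using ix_le[of y A b] by simp
   hence "ix ?c' <= ix ?c" using ix_le[of "spl m y" "A - {m}" b] g by simp
   thus ?thesis using e lessA by(cases "ix ?c' = ix ?c") (auto simp: g)
  qed
  thus ?thesis using tp False by(simp add: rk1_net)
 qed
qed

lemma rk1_del:
 assumes c: "(y, A, b) : cells" "b j ~= None" and "et b ==> bt b = b & j ~= el b"
 shows "(rk1 (face (Inr j) (y, A, b)), rk1 (y, A, b)) : S1"
proof -
 note C = cellsD[OF c(1)]
 have "(rE (b(j := None)), rE b) : lex2"
 proof(cases "et b")
  case True
  then obtain l k where e: "etl b l k" by(auto simp: et_def)
  have "b(l := b k) = b" "j ~= l" using assms(3)[OF True] el_bt[OF e] by auto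
  moreover from this have "b l = b k" by(metis fun_upd_same)
  ultimately show ?thesis using rE_del_paired[OF C(3) e] c(2) by blast
 qed (rule rE_del_reduced[OF C(3) _ c(2)])
 thus ?thesis by(auto simp: rk1_def)
qed

lemma matching1: "matching cells names block face
  (inv_image (S1 <*lex*> less_than) (%c. (rk1 c, if tau1 c = c then 1 else 0::nat))) crit1 tau1 phi1"
proof(rule cx.matchingI)
 show "wf S1" "trans S1" by(intro wf_lex_prod wf_less_than trans_lex_prod trans_less_than)+
next
 fix c assume c: "c : cells" and nc: "~ crit1 c"
 obtain y A b where e: "c = (y, A, b)" by(cases c) auto
 note C = cellsD[OF c[unfolded e]]
 show "tau1 c : cells & phi1 c : names (tau1 c) & ~ crit1 (tau1 c) & tau1 (tau1 c) = tau1 c &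
    phi1 (tau1 c) = phi1 c & rk1 (tau1 c) = rk1 c"
 proof(cases "et b")
  case True
  then obtain l k where lk: "etl b l k" by(auto simp: et_def)
  note E = etlD[OF lk] and eb = el_bt[OF lk]
  have lk': "etl (bt b) l k" using etl_upd[OF lk, of "b k"] eb by simp
  note eb' = el_bt[OF lk']
  have idem: "bt (bt b) = bt b" using eb eb' E(1) by simp
  have "ran (bt b) <= labels (topv y A)" using C(5) eb E(2) by(auto simp: ran_def split: if_splits)
  moreover have "dom (bt b) <= insert l (dom b)" "k : dom (bt b)" using eb E(2) by(auto split: if_splits)
  hence fin: "finite (dom (bt b))" "dom (bt b) ~= {}" using C(3) finite_subset[of "dom (bt b)" "insert l (dom b)"] by auto
  ultimately have "(y, A, bt b) : cells" using C(1,2) fin by(simp add: cells_def)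
  moreover have "Inr l : names (y, A, bt b)"
  proof -
   have "l : dom (bt b)" "k : dom (bt b)" using eb E(1,2) by auto
   hence "card {l, k} <= card (dom (bt b))" using fin by(intro card_mono) auto
   thus ?thesis using E(1) \<open>l \<in> dom (bt b)\<close> by simp
  qed
  moreover have "rE (bt b) = rE b" using rE_bt[OF lk] eb by simp
  ultimately show ?thesis unfolding e using True eb eb' idem
   by(simp add: tau1_et phi1_et crit1_et rk1_et del: names.simps)
 next
  case False
  have lt: "ix c < length (gr c)" using nc crit1_net[OF False] e by simp
  let ?s = "gr c ! ix c"
  from c[unfolded e] False lt[unfolded e] show ?thesis
  proof(cases rule: merge_cases)
   case tau
   hence t: "tau1 c = c" using False by(simp add: e tau1_net Let_def)
   show ?thesis unfolding t using c nc tau False by(simp add: e phi1_net)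
  next
   case sig
   let ?y = "mrg ?s y" and ?A = "insert ?s A"
   have t: "tau1 c = (?y, ?A, b)" using sig(1) False by(simp add: e tau1_net Let_def)
   have sg: "?s : set (gr c)" using lt by simp
   have tC: "(?y, ?A, b) : cells" using sig(2) by(simp add: e)
   have g: "gr (?y, ?A, b) = gr c" using gr_face[OF tC, of ?s] sig(4,5) by(simp add: e)
   have i: "ix (?y, ?A, b) = ix c" using ix_face[OF tC False, of ?s] sg g sig(4,5) by(simp add: e)
   have "topv ?y ?A = topv y A" "?A - {?s} = A - {?s}" using sig(6) by(auto simp: e)
   hence "rk1 (?y, ?A, b) = rk1 c" unfolding e rk1_net[OF False] using g i lt by(simp add: e)
   moreover have "~ crit1 (?y, ?A, b)" using crit1_net[OF False] g i lt by simp
   moreover have "tau1 (?y, ?A, b) = (?y, ?A, b)" "phi1 (?y, ?A, b) = phi1 c"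
    using tau1_net[OF False] phi1_net[OF False] g i by(simp_all add: e Let_def)
   ultimately show ?thesis unfolding t using tC False by(simp add: e phi1_net)
  qed
 qed
next
 fix c assume c: "c : cells" and nc: "~ crit1 c" and t: "tau1 c = c"
 obtain y A b where e: "c = (y, A, b)" by(cases c) auto
 note C = cellsD[OF c[unfolded e]]
 show "~ crit1 (face (phi1 c) c) & tau1 (face (phi1 c) c) = c & phi1 (face (phi1 c) c) = phi1 c"
 proof(cases "et b")
  case True
  then obtain l k where lk: "etl b l k" by(auto simp: et_def)
  note E = etlD[OF lk] and eb = el_bt[OF lk]
  have lk': "etl (b(l := None)) l k" by(rule etl_upd[OF lk]) simp
  note eb' = el_bt[OF lk']
  have "bt b = b" using t True by(simp add: e tau1_et)
  hence "bt (b(l := None)) = b" using eb eb' E(1) by(metis fun_upd_other fun_upd_upd less_irrefl)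
  thus ?thesis unfolding e using True eb eb' by(simp add: tau1_et phi1_et crit1_et)
 next
  case False
  have lt: "ix c < length (gr c)" using nc crit1_net[OF False] e by simp
  let ?s = "gr c ! ix c"
  have A: "?s : A"
  proof(rule ccontr)
   assume "?s ~: A"
   hence "insert ?s A = A" using t False by(simp add: e tau1_net Let_def)
   thus False using \<open>?s \<notin> A\<close> by blast
  qed
  have sg: "?s : set (gr c)" using lt by simp
  let ?y = "spl ?s y" and ?A = "A - {?s}"
  have g: "gr (?y, ?A, b) = gr c" using gr_face[OF c[unfolded e]] A by(simp add: e)
  have i: "ix (?y, ?A, b) = ix c" using ix_face[OF c[unfolded e] False] A sg by(simp add: e)
  have f: "face (phi1 c) c = (?y, ?A, b)" using False by(simp add: e phi1_net)
  have sy: "?s : y" using A C(2) by blast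
  have "tau1 (?y, ?A, b) = (mrg ?s ?y, insert ?s ?A, b)" using tau1_net[OF False] g i by(simp add: Let_def)
  moreover have "insert ?s ?A = A" using A by blast
  ultimately show ?thesis unfolding f using mrg_spl[OF C(1) sy] crit1_net[OF False] phi1_net[OF False] g i lt
   by(simp add: e)
 qed
next
 fix c assume c: "c : cells" and nc: "~ crit1 c" and t: "tau1 c ~= c"
 obtain y A b where e: "c = (y, A, b)" by(cases c) auto
 note C = cellsD[OF c[unfolded e]]
 show "face (phi1 c) (tau1 c) = c"
 proof(cases "et b")
  case True
  then obtain l k where lk: "etl b l k" by(auto simp: et_def)
  note E = etlD[OF lk] and eb = el_bt[OF lk]
  have "bt b ~= b" using t True by(simp add: e tau1_et)
  hence "b l = None" using E(4) eb by auto
  thus ?thesis using True eb by(auto simp: e tau1_et phi1_et)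
 next
  case False
  have lt: "ix c < length (gr c)" using nc crit1_net[OF False] e by simp
  from c[unfolded e] False lt[unfolded e] show ?thesis
  proof(cases rule: merge_cases)
   case tau
   thus ?thesis using t False by(simp add: e tau1_net Let_def)
  next
   case sig
   thus ?thesis using False by(simp add: e tau1_net phi1_net Let_def)
  qed
 qed
next
 fix c vq assume c: "c : cells" and nc: "~ crit1 c" and t: "tau1 c = c" and vq: "vq : names c" "vq ~= phi1 c"
 obtain y A b where e: "c = (y, A, b)" by(cases c) auto
 have sA: "gr c ! ix c : A" if "~ et b" "ix c < length (gr c)"
 proof(rule ccontr)
  assume n: "gr c ! ix c ~: A"
  hence "insert (gr c ! ix c) A = A" using t that(1) by(simp add: e tau1_net Let_def)
  thus False using n by blast
 qed
 consider (j) j where "vq = Inr j" "j : dom b" | (u) k where "vq = Inl (k, True)" "k : A"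
  | (s) k where "vq = Inl (k, False)" "k : A"
  using vq(1) unfolding e by(auto split: if_splits)
 thus "(rk1 (face vq c), rk1 c) : S1"
 proof cases
  case j
  have "bt b = b & j ~= el b" if "et b"
   using t vq(2) that j(1) by(simp add: e tau1_et phi1_et)
  thus ?thesis unfolding e j(1) using c j(2) by(intro rk1_del) (auto simp: e)
 next
  case u
  show ?thesis unfolding e u(1) using c u(2) by(intro rk1_unsplit) (auto simp: e)
 next
  case s
  have "gr c ! ix c : A - {k}" if "~ et b" "ix c < length (gr c)"
   using sA[OF that] vq(2) that(1) s(1) by(auto simp: e phi1_net)
  thus ?thesis unfolding e s(1) using c s(2) by(intro rk1_split) (auto simp: e)
 qed
next
 fix c vq assume c: "c : cells" and cr: "crit1 c" and vq: "vq : names c"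
 obtain y A b where e: "c = (y, A, b)" by(cases c) auto
 have ne: "~ et b" using cr crit1_et e by blast
 hence nl: "~ ix c < length (gr c)" using cr crit1_net e by blast
 consider (j) j where "vq = Inr j" "j : dom b" | (u) k where "vq = Inl (k, True)" "k : A"
  | (s) k where "vq = Inl (k, False)" "k : A"
  using vq unfolding e by(auto split: if_splits)
 thus "(rk1 (face vq c), rk1 c) : S1"
 proof cases
  case j
  thus ?thesis unfolding e j(1) using c j(2) ne by(intro rk1_del) (auto simp: e)
 next
  case u
  show ?thesis unfolding e u(1) using c u(2) by(intro rk1_unsplit) (auto simp: e)
 next
  case s
  thus ?thesis unfolding e s(1) using c s(2) nl by(intro rk1_split) (auto simp: e)
 qed
qed

end

lemma et_inj: "inj f ==> et (map_option f o b) <-> et b" and el_inj: "inj f ==> el (map_option f o b) = el b"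
 by(simp_all add: et_def el_def etl_inj)

lemma bt_inj: "inj f ==> bt (map_option f o b) = map_option f o bt b"
 by(rule ext) (simp add: bt_def et_inj el_inj etl_inj)

section \<open>Equivariance of the matching and finiteness of the critical orbits\<close>

context tree_group begin

lemma inj_map: "g : H ==> inj (map g)"
 using H_inj by(intro inj_mapI) (auto simp: inj_def)

lemma ok_act: "g : H ==> ok (tact g y) (tact g A) (g o s) <-> ok y A s"
using rest_act H_inj image_diff_tact lft_comp rgt_comp mem_tact comp_apply by(auto simp: ok_def)

lemma gr_act:
 assumes g: "g : H" and c: "(y, A, b) : cells" "~ et b"
 shows "gr (cact g (y, A, b)) = map ((o) g) (gr (y, A, b))"
proof -
 note C = cellsD[OF c(1)]
 obtain K where "dom b = {..K}" using not_et[OF C(3,4) c(2)] by blast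
 hence "0 : dom b" by simp
 then obtain xs where xs: "b 0 = Some xs" by auto
 show ?thesis using ground_act[OF g _ C(5)[OF xs]] vtx_top[OF C(1,2)] xs by(simp add: gr_def topv_act[OF g])
qed

lemma ix_act:
 assumes g: "g : H" and c: "(y, A, b) : cells" "~ et b"
 shows "ix (cact g (y, A, b)) = ix (y, A, b)"
 using gr_act[OF assms] by(simp add: ix_def takeWhile_map comp_def ok_act[OF g, unfolded comp_def])

lemma equivariant1:
 assumes g: "g : H" and c: "c : cells"
 shows "crit1 (cact g c) <-> crit1 c"
  and "~ crit1 c ==> tau1 (cact g c) = cact g (tau1 c) & phi1 (cact g c) = nmact g (phi1 c)"
proof -
 obtain y A b where e: "c = (y, A, b)" by(cases c) auto
 let ?b = "map_option (map g) o b"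
 have et: "et ?b <-> et b" "el ?b = el b" "bt ?b = map_option (map g) o bt b"
  using et_inj el_inj bt_inj inj_map[OF g] by blast+
 have r: "crit1 (cact g c) = crit1 c & (~ crit1 c --> tau1 (cact g c) = cact g (tau1 c) & phi1 (cact g c) = nmact g (phi1 c))"
 proof(cases "et b")
  case True
  thus ?thesis using et by(simp add: e tau1_et phi1_et crit1_et)
 next
  case False
  have gi: "gr (tact g y, tact g A, ?b) = map ((o) g) (gr c)" "ix (tact g y, tact g A, ?b) = ix c"
   using gr_act[OF g c[unfolded e] False] ix_act[OF g c[unfolded e] False] by(simp_all add: e)
  have cr: "crit1 (cact g c) = crit1 c" using False et(1) gi by(simp add: e crit1_net)
  moreover have "tau1 (cact g c) = cact g (tau1 c) & phi1 (cact g c) = nmact g (phi1 c)" if "~ crit1 c"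
  proof -
   have lt: "ix c < length (gr c)" using that False by(simp add: e crit1_net)
   have s: "gr (tact g y, tact g A, ?b) ! ix (tact g y, tact g A, ?b) = g o (gr c ! ix c)"
    using gi lt by simp
   have ne: "~ et ?b" using False et by simp
   show ?thesis unfolding e cact.simps tau1_net[OF ne] phi1_net[OF ne] Let_def s
    using False by(simp add: e tau1_net phi1_net Let_def mem_tact[OF g] mrg_act[OF g])
  qed
  ultimately show ?thesis by blast
 qed
 thus "crit1 (cact g c) <-> crit1 c" by blast
 show "~ crit1 c ==> tau1 (cact g c) = cact g (tau1 c) & phi1 (cact g c) = nmact g (phi1 c)" using r by blast
qed

abbreviation "R1 == inv_image (S1 <*lex*> less_than) (%c. (rk1 c, if tau1 c = c then 1 else 0::nat))"

lemma block_nmact: "g : H ==> block (nmact g n) = block (nmact g m) <-> block n = block m"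
proof -
 assume g: "g : H"
 show ?thesis
 proof(cases n)
  case n: (Inl p)
  obtain t d where p: "p = (t, d)" by(cases p) auto
  show ?thesis
  proof(cases m)
   case (Inl p')
   obtain t' d' where p': "p' = (t', d')" by(cases p') auto
   show ?thesis by(simp add: n p Inl p' H_injt[OF g])
  qed (simp add: n p)
 next
  case n: (Inr j)
  show ?thesis
  proof(cases m)
   case (Inl p')
   obtain t' d' where p': "p' = (t', d')" by(cases p') auto
   show ?thesis by(simp add: n Inl p')
  qed (simp add: n)
 qed
qed

sublocale ma: morse_action GH cells names block face R1 crit1 tau1 phi1 cact nmact
proof(intro morse_action.intro free_action.intro group_GH free_action_axioms.intro matching1 morse_action_axioms.intro)
 show "cact \<one>\<^bsub>GH\<^esub> c = c" for c by(simp add: cact_id)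
 show "nmact \<one>\<^bsub>GH\<^esub> n = n" for n by(cases n) (auto simp: nmact_def)
 fix g assume "g : car GH"
 hence g: "g : H" by simp
 show "cact g c : cells" if "c : cells" for c by(rule cact_in[OF g that])
 show "g = \<one>\<^bsub>GH\<^esub>" if "c : cells" "cact g c = c" for c using cact_free[OF g that] by simp
 show "cact (g \<otimes>\<^bsub>GH\<^esub> h) c = cact g (cact h c)" for h c by(simp add: cact_comp)
 show "nmact (g \<otimes>\<^bsub>GH\<^esub> h) n = nmact g (nmact h n)" for h n by(cases n) (auto simp: nmact_def o_assoc)
 show "names (cact g c) = nmact g ` names c" for c by(rule names_act[OF g])
 show "block (nmact g n) = block (nmact g m) <-> block n = block m" for n m by(rule block_nmact[OF g])
 show "face (nmact g vp) (cact g c) = cact g (face vp c)" if "vp : names c" for c vp by(rule face_act[OF g that])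
 show "crit1 (cact g c) <-> crit1 c" if "c : cells" for c by(rule equivariant1(1)[OF g that])
 show "tau1 (cact g c) = cact g (tau1 c)" "phi1 (cact g c) = nmact g (phi1 c)" if "c : cells" "~ crit1 c" for c
  using equivariant1(2)[OF g that] by blast+
qed

text \<open>Each direction of the cube has two names in one block and adds 1; the labels span a
  simplex of dimension one less than their number, which is also right when a single label has no
  name.\<close>

lemma sdim_names:
 assumes "(y, A, b) : cells"
 shows "Suc (sdim block (names (y, A, b))) = card A + card (dom b)"
proof -
 note C = cellsD[OF assms]
 have b1: "1 <= card (dom b)" using C(3,4) by(simp add: Suc_le_eq card_gt_0_iff)
 have cA: "card (Inl ` (A \<times> UNIV) :: name set) = 2 * card A" by(simp add: card_image card_cartesian_product)
 have fA: "finite (Inl ` (A \<times> UNIV) :: name set)" using C(6) by simp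
 have bA: "block ` Inl ` (A \<times> UNIV) = Inl ` A" by(auto simp: image_iff)
 show ?thesis
 proof(cases "2 <= card (dom b)")
  case True
  have "card (names (y, A, b)) = 2 * card A + card (dom b)"
   unfolding names_K using True
   by(subst card_Un_disjoint) (use cA fA C(3) in "auto simp: card_image")
  moreover have "block ` names (y, A, b) = insert (Inr ()) (Inl ` A)"
  proof -
   have "block ` Inr ` dom b = {Inr ()}" using C(4) by(simp add: image_image image_constant_conv del: dom_eq_empty_conv)
   thus ?thesis using True bA unfolding names_K image_Un by simp
  qed
  moreover have "card (insert (Inr ()) (Inl ` A)) = Suc (card A)" using C(6) by(simp add: card_image image_iff)
  ultimately show ?thesis using True by(simp add: sdim_def)
 next
  case False
  hence "card (dom b) = 1" using b1 by simp
  thus ?thesis using False cA bA by(simp add: sdim_def card_image)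
 qed
qed

text \<open>Every merge of a critical cell is obstructed by one of the three marks \<open>lft m\<close>, \<open>rgt m\<close> and
 \<open>m []\<close> of some tree \<open>m\<close> to be split, and distinct merges by distinct marks.\<close>

lemma crit1_bound:
 assumes c: "(y, A, b) : cells" "crit1 (y, A, b)"
 shows "card (topv y A) <= 6 * card A + 2" "~ et b"
proof -
 note C = cellsD[OF c(1)]
 show ne: "~ et b" using c(2) crit1_et by blast
 let ?ss = "gr (y, A, b)"
 note v = gr_valid[OF c(1) ne]
 have nl: "ix (y, A, b) = length ?ss" using c(2) ne by(simp add: crit1_def)
 have nok: "~ ok y A s" if s: "s : set ?ss" for s
 proof -
  have "takeWhile (%s. ~ ok y A s) ?ss = ?ss"
   using nl takeWhile_eq_take[of "%s. ~ ok y A s" ?ss] by(simp add: ix_def)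
  thus ?thesis using s by(metis set_takeWhileD)
 qed
 define U :: "(tree + bool list) set" where "U = Inl ` (lft ` A Un rgt ` A) Un Inr ` (%m. m []) ` A"
 define f :: "tree => tree + bool list" where
  "f s = (if lft s : lft ` A Un rgt ` A then Inl (lft s) else if rgt s : lft ` A Un rgt ` A then Inl (rgt s) else Inr (s []))" for s
 have rest: "rest (topv y A) <= rest y Un (%m. m []) ` A"
 proof
  fix p assume p: "p : rest (topv y A)"
  show "p : rest y Un (%m. m []) ` A"
  proof(cases "p : rest y")
   case False
   then obtain t w where t: "t : y" "p = t w" by(auto simp: rest_def)
   have n: "p ~: range u" if "u : topv y A" for u using p that by(auto simp: rest_def)
   have tA: "t : A" using n[of t] t by(auto simp: topv_def)
   have "p ~: range (lft t)" "p ~: range (rgt t)" using n tA by(auto simp: topv_def)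
   hence "p = t []" using range_tree[of t] t(2) by blast
   thus ?thesis using tA by blast
  qed simp
 qed
 have "f s : U" if s: "s : set ?ss" for s
 proof -
  have "lft s : topv y A" "rgt s : topv y A" "s [] : rest (topv y A)" using v s unfolding valid_ground_def by blast+
  thus ?thesis using nok[OF s] rest unfolding f_def U_def ok_def topv_def by auto
 qed
 moreover have "inj_on f (set ?ss)"
 proof(rule inj_onI, rule ccontr)
  fix s s' assume s: "s : set ?ss" "s' : set ?ss" "f s = f s'" "s ~= s'"
  hence "s [] ~= s' []" "{lft s, rgt s} Int {lft s', rgt s'} = {}" using v unfolding valid_ground_def by blast+
  thus False using s(3) by(auto simp: f_def split: if_splits)
 qed
 moreover have fU: "finite U" using C(6) by(simp add: U_def)
 ultimately have "card (set ?ss) <= card U" by(intro card_inj_on_le[of f]) blast+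
 also have "card U <= card (lft ` A Un rgt ` A) + card ((%m. m []) ` A)"
  unfolding U_def by(rule order_trans[OF card_Un_le]) (simp add: card_image)
 also have "... <= (card A + card A) + card A"
  using C(6) by(intro add_mono order_trans[OF card_Un_le] card_image_le) simp_all
 finally have "card (set ?ss) <= 3 * card A" by simp
 moreover have "card (set ?ss) = length ?ss" "card (topv y A) <= 2 * length ?ss + 2"
  using v by(simp_all add: valid_ground_def distinct_card)
 ultimately show "card (topv y A) <= 6 * card A + 2" by simp
qed

text \<open>A tree is determined by its halves and its root, so the directions of a cube with top
  family \<open>x\<close> are drawn from a finite set, and together with \<open>x\<close> they
  determine the bottom family.\<close>

lemma finite_cells_over:
 assumes x: "vtx x"
 shows "finite {(y, A, b). (y, A, b) : cells & topv y A = x & dom b <= {..n}}"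
proof -
 let ?T = "{s. lft s : x & rgt s : x & s [] : rest x}"
 have "inj_on (%s. (lft s, rgt s, s [])) ?T"
 proof(rule inj_onI, rule ext)
  fix s s' :: tree and w assume e: "(lft s, rgt s, s []) = (lft s', rgt s', s' [])"
  show "s w = s' w"
  proof(cases w)
   case Nil
   thus ?thesis using e by simp
  next
   case (Cons a v)
   have "lft s v = lft s' v" "rgt s v = rgt s' v" using e by simp_all
   thus ?thesis using Cons by(cases a) (simp_all add: lft_def rgt_def)
  qed
 qed
 moreover have "(%s. (lft s, rgt s, s [])) ` ?T <= x \<times> x \<times> rest x" by auto
 moreover have "finite (x \<times> x \<times> rest x)" using vtxD(1,4)[OF x] by simp
 ultimately have fT: "finite ?T" by(meson finite_subset inj_on_finite)
 have "labels x <= {xs. set xs <= marks x & distinct xs}" by(auto simp: labels_def)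
 hence fL: "finite (labels x)" using finite_subset_distinct[OF finite_marks[OF x]] finite_subset by blast
 let ?B = "UN D:Pow {..n}. {b. dom b = D & ran b <= labels x}"
 have fB: "finite ?B" using fL by(intro finite_UN_I finite_set_of_finite_maps) (auto intro: finite_subset)
 have "{(y, A, b). (y, A, b) : cells & topv y A = x & dom b <= {..n}}
   <= (%(A, b). ((x - lft ` A - rgt ` A) Un A, A, b)) ` (Pow ?T \<times> ?B)"
 proof
  fix q assume "q : {(y, A, b). (y, A, b) : cells & topv y A = x & dom b <= {..n}}"
  then obtain y A b where q: "q = (y, A, b)" and c: "(y, A, b) : cells" and b: "dom b <= {..n}" and xe: "x = topv y A" by blast
  note C = cellsD[OF c]
  have s: "s : ?T" if "s : A" for s
  proof -
   have sub: "A - {s} <= y" using C(2) by blast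
   have "vtx (topv y (A - {s}))" using vtx_top[OF C(1) sub] by blast
   from rest_spl[OF this] top_remove[OF C(1,2) that] have "s [] : rest (topv y A)" by simp
   thus ?thesis using that xe by(auto simp: topv_def)
  qed
  have "y Int (lft ` A Un rgt ` A) = {}" using fresh[OF C(1)] C(2) by blast
  hence "y = (x - lft ` A - rgt ` A) Un A" using C(2) unfolding xe topv_def by blast
  moreover have "b : ?B" using b C(5) xe by(auto simp: ran_def)
  moreover have "A : Pow ?T" using s by blast
  ultimately show "q : (%(A, b). ((x - lft ` A - rgt ` A) Un A, A, b)) ` (Pow ?T \<times> ?B)"
   unfolding q by(intro image_eqI[of _ _ "(A, b)"]) (simp, blast)
 qed
 thus ?thesis using fT fB by(meson finite_Pow_iff finite_SigmaI finite_imageI finite_subset)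
qed

text \<open>The dimension bounds the number of directions and of labels, hence the size of the top
  family by \<open>crit1_bound\<close> and the stages by \<open>not_et\<close>. Up to the group the
  top family is one of finitely many.\<close>

lemma crit_orbits:
 "EX K. finite K & {c : cells. crit1 c & sdim block (names c) = n} <= (UN g:H. cact g ` {c : K Int cells. crit1 c})"
proof -
 define X where "X m = (SOME K. finite K & {x. vtx x & card x = m} <= (UN g:H. tact g ` (K Int Collect vtx)))" for m
 have X: "finite (X m)" "{x. vtx x & card x = m} <= (UN g:H. tact g ` (X m Int Collect vtx))" for m
  using someI_ex[OF orbits[of m]] unfolding X_def by blast+
 let ?X = "(UN m<=6 * n + 2. X m) Int Collect vtx"
 let ?K = "UN x:?X. {(y, A, b). (y, A, b) : cells & topv y A = x & dom b <= {..n}}"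
 have "finite ?X" using X(1) by simp
 hence "finite ?K" by(rule finite_UN_I) (rule finite_cells_over, simp)
 moreover have "{c : cells. crit1 c & sdim block (names c) = n} <= (UN g:H. cact g ` {c : ?K Int cells. crit1 c})"
 proof
  fix c assume "c : {c : cells. crit1 c & sdim block (names c) = n}"
  hence c: "c : cells" "crit1 c" "sdim block (names c) = n" by auto
  obtain y A b where e: "c = (y, A, b)" by(cases c) auto
  note C = cellsD[OF c(1)[unfolded e]]
  have dim: "Suc n = card A + card (dom b)" using sdim_names[OF c(1)[unfolded e]] c(3) e by simp
  have b1: "1 <= card (dom b)" using C(3,4) by(simp add: Suc_le_eq card_gt_0_iff)
  note cb = crit1_bound[OF c(1,2)[unfolded e]]
  have m: "card (topv y A) <= 6 * n + 2" using cb(1) dim b1 by linarith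
  have "topv y A : (UN g:H. tact g ` (X (card (topv y A)) Int Collect vtx))"
   using X(2)[of "card (topv y A)"] vtx_top[OF C(1,2)] by blast
  then obtain g x where g: "g : H" "topv y A = tact g x" "x : X (card (topv y A))" "vtx x" by blast
  have xX: "x : ?X" using g(3,4) m by blast
  let ?h = "inv_into UNIV g"
  have h: "?h : H" "?h o g = id" "g o ?h = id" using H_inv[OF g(1)] H_bij[OF g(1)] by(auto simp: bij_def surj_iff)
  let ?c = "cact ?h c"
  have cC: "?c : cells" by(rule cact_in[OF h(1) c(1)])
  have "topv (tact ?h y) (tact ?h A) = tact ?h (tact g x)" using topv_act[OF h(1)] g(2) by simp
  also have "... = x" using tact_comp[of ?h g x] h(2) by(simp add: tact_id)
  finally have tx: "topv (tact ?h y) (tact ?h A) = x" .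
  obtain k where k: "dom b = {..k}" using not_et[OF C(3,4) cb(2)] by blast
  have "Suc k <= Suc n" using dim k by simp
  hence "dom b <= {..n}" using k by auto
  hence "?c : {(y, A, b). (y, A, b) : cells & topv y A = x & dom b <= {..n}}"
   using cC tx by(simp add: e dom_map_option_comp)
  hence cK: "?c : ?K" by(rule UN_I[OF xX])
  have "crit1 ?c" using equivariant1(1)[OF h(1) c(1)] c(2) by simp
  hence "?c : {c : ?K Int cells. crit1 c}" using cC cK by(intro CollectI conjI IntI)
  moreover have "c = cact g ?c" using cact_comp[of g ?h c] h(3) by(simp add: cact_id)
  ultimately show "c : (UN g:H. cact g ` {c : ?K Int cells. crit1 c})" by(intro UN_I[OF g(1)] image_eqI[of _ _ ?c])
 qed
 ultimately show ?thesis by blast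
qed

theorem type_F_infinity_GH: "type_F_infinity GH"
 by(rule ma.morse_type_F_infinity[OF matching2 c0_in names_c0]) (use crit_orbits in simp_all)

end

section \<open>Maps induced on ends\<close>

definition tame :: "tree => nat => bool" where
 "tame t N <-> (ALL v. N <= length v --> respects_children t v)"

lemma tame_mono: "tame t N ==> N <= M ==> tame t M"
 by(simp add: tame_def)

lemma tame_ex: "finite (wild t) ==> EX N. tame t N"
proof -
 assume "finite (wild t)"
 then obtain N where "ALL n:length ` wild t. n < N" using finite_nat_set_iff_bounded[of "length ` wild t"] by auto
 hence "respects_children t v" if "N <= length v" for v using that by(auto simp: wild_def)
 thus ?thesis by(auto simp: tame_def)
qed

lemma tame_append: "tame t (length v) ==> t (v @ u) = t v @ u"
proof(induction u rule: rev_induct)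
 case (snoc a u)
 hence "respects_children t (v @ u)" by(simp add: tame_def)
 thus ?case using snoc by(cases a) (simp_all add: respects_children_def)
qed simp

lemma map_conc: "map (v @@ x) [0..<length v + k] = v @ map x [0..<k]"
 by(rule nth_equalityI) (auto simp: conc_def nth_append)

lemma conc_inj: "[|length u = length v; u @@ x = v @@ y|] ==> u = v & x = y"
using fun_cong nth_equalityI by auto

lemma end_map_conc:
 assumes "tame t (length v)"
 shows "em t (v @@ x) = t v @@ x"
 unfolding end_map_def
proof(rule the_equality)
 have *: "t (map (v @@ x) [0..<length v + k]) = map (t v @@ x) [0..<length (t v) + k]" for k
  unfolding map_conc by(rule tame_append[OF assms])
 show "maps_end t (v @@ x) (t v @@ x)" unfolding maps_end_def
  using * by(metis le_Suc_ex)
 fix u assume "maps_end t (v @@ x) u"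
 then obtain N where N: "!!n. N <= n ==> EX m. t (map (v @@ x) [0..<n]) = map u [0..<m]" by(auto simp: maps_end_def)
 show "u = t v @@ x"
 proof
  fix i
  obtain m where m: "t (map (v @@ x) [0..<length v + (Suc i + N)]) = map u [0..<m]"
   using N[of "length v + (Suc i + N)"] by auto
  have e: "map u [0..<m] = map (t v @@ x) [0..<length (t v) + (Suc i + N)]" by(rule trans[OF m[symmetric] *])
  hence l: "m = length (t v) + (Suc i + N)" by(metis diff_zero length_map length_upt)
  show "u i = (t v @@ x) i" using arg_cong[OF e, of "%xs. xs ! i"] l by(simp del: upt_Suc)
 qed
qed

lemma end_split: "EX v x. w = v @@ x & length v = n"
 by(metis word_split)

lemma end_map_id: "em id = id"
proof
 fix w show "em id w = id w"
  using end_map_conc[of id "[]" w] by(simp add: tame_def respects_children_def)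
qed

lemma tame_child: "tame t N ==> tame (lft t) N & tame (rgt t) N"
proof -
 assume "tame t N"
 moreover have "respects_children (lft t) v <-> respects_children t (False # v)"
  "respects_children (rgt t) v <-> respects_children t (True # v)" for v
  by(simp_all add: respects_children_def lft_def rgt_def)
 ultimately show ?thesis by(simp add: tame_def)
qed

lemma end_map_child:
 assumes "finite (wild t)"
 shows "em (lft t) w = em t ([False] @@ w)" "em (rgt t) w = em t ([True] @@ w)"
proof -
 obtain N where N: "tame t N" using tame_ex[OF assms] by blast
 obtain v x where w: "w = v @@ x" "length v = N" using end_split by blast
 have "tame t (length ([b] @ v))" for b using tame_mono[OF N] w by simp
 note e = end_map_conc[OF this, of _ x]
 show "em (lft t) w = em t ([False] @@ w)"
  using end_map_conc[of "lft t" v x] tame_child[OF N] w e[of False] by(simp add: lft_def)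
 show "em (rgt t) w = em t ([True] @@ w)"
  using end_map_conc[of "rgt t" v x] tame_child[OF N] w e[of True] by(simp add: rgt_def)
qed

lemma end_map_comp:
 assumes "finite (wild g)" "finite (wild t)" "inj t"
 shows "em (g o t) w = em g (em t w)"
proof -
 have "finite (wild t Un t -` wild g)" using assms finite_vimageI[of "wild g" t] by blast
 hence "finite (wild (g o t))" by(rule finite_subset[OF wild_comp])
 then obtain L M N where LMN: "tame (g o t) L" "tame g M" "tame t N"
  using tame_ex[of "g o t"] tame_ex[OF assms(1)] tame_ex[OF assms(2)] by blast
 obtain v x where w: "w = v @@ x" "length v = N + (L + M)" using end_split by blast
 define u u' where "u = take N v" and "u' = drop N v"
 have uv: "v = u @ u'" "length u = N" "length u' = L + M" using w(2) by(simp_all add: u_def u'_def)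
 have "tame t (length u)" using LMN(3) uv by simp
 hence "length (t v) >= M" using tame_append[of t u u'] uv by simp
 hence g: "tame g (length (t v))" using tame_mono[OF LMN(2)] by blast
 have "tame (g o t) (length v)" "tame t (length v)" using tame_mono[OF LMN(1)] tame_mono[OF LMN(3)] w(2) by simp_all
 thus ?thesis using end_map_conc[of "g o t" v x] end_map_conc[of t v x] end_map_conc[OF g, of x] w(1) by simp
qed

context good_trees begin

lemma vtx_injt: "vtx y ==> t : y ==> inj t"
 using vtx_inj_same by(auto simp: inj_def)

text \<open>Both ends are cut so deep that the images of the two prefixes have equal length; then
  equality of the ends gives equality of vertices, where injectivity of the family applies.\<close>

lemma end_map_inj:
 assumes y: "vtx y" "t : y" "t' : y" and e: "em t w = em t' w'"
 shows "t = t' & w = w'"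
proof -
 obtain N N' where N: "tame t N" "tame t' N'" using tame_ex vtxD(3)[OF y(1)] y by blast
 obtain v x v' x' where w: "w = v @@ x" "length v = N" "w' = v' @@ x'" "length v' = N'" using end_split by metis
 obtain u z where x: "x = u @@ z" "length u = length (t' v')" using end_split by blast
 obtain u' z' where x': "x' = u' @@ z'" "length u' = length (t v)" using end_split by blast
 have a: "t (v @ u) = t v @ u" "t' (v' @ u') = t' v' @ u'" using tame_append N w by auto
 have "em t w = t (v @ u) @@ z" "em t' w' = t' (v' @ u') @@ z'"
  using end_map_conc[of t v x] end_map_conc[of t' v' x'] N w a x x' by simp_all
 hence "t (v @ u) = t' (v' @ u') & z = z'" using e a x(2) x'(2) by(intro conc_inj) simp_all
 thus ?thesis using vtx_inj[OF y, of "v @ u" "v' @ u'"] w x x' by simp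
qed

text \<open>Only finitely many vertices on the ray towards \<open>u\<close> are uncovered or images
  of short words. Any other one is the image of a word beyond the wild vertices of its tree, and the
  rest of the ray follows.\<close>

lemma end_map_surj:
 assumes y: "vtx y"
 shows "EX t:y. EX w. em t w = u"
proof -
 have "EX N. ALL t:y. tame t N"
 proof -
  have "EX N. tame t N" if "t : y" for t using tame_ex vtxD(3)[OF y that] by blast
  then obtain f where f: "!!t. t : y ==> tame t (f t)" by metis
  have "tame t (Max (f ` y))" if "t : y" for t
   using tame_mono[OF f[OF that]] vtxD(1)[OF y] that by simp
  thus ?thesis by blast
 qed
 then obtain N where N: "!!t. t : y ==> tame t N" by blast
 have fN: "finite {v :: bool list. length v < N}"
 proof -
  have "{v :: bool list. length v < N} <= {v. set v <= UNIV & length v <= N}" by auto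
  thus ?thesis using finite_lists_length_le[of "UNIV :: bool set" N] finite_subset by auto
 qed
 let ?F = "rest y Un (UN t:y. t ` {v. length v < N})"
 have "finite ?F" using fN vtxD(1,4)[OF y] by simp
 moreover have "infinite (range (%m. prefix m u))"
  by(rule range_inj_infinite) (auto simp: inj_def dest: arg_cong[of _ _ length])
 ultimately obtain m where m: "prefix m u ~: ?F" by(meson finite_subset image_subsetI)
 then obtain t v where t: "t : y" "prefix m u = t v" by(auto simp: rest_def)
 hence "~ length v < N" using m by blast
 hence "tame t (length v)" using tame_mono[OF N[OF t(1)]] by simp
 from end_map_conc[OF this, of "suffix m u"] t(2) have "em t (v @@ suffix m u) = u" by(metis prefix_suffix)
 thus ?thesis using t(1) by blast
qed

end

section \<open>Elements of QV and their action on ends\<close>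

interpretation plain: good_trees "%_. True"
 by unfold_locales auto

lemma QV_vtx: "h : QV_set ==> plain.vtx {h}"
proof -
 assume h: "h : QV_set"
 hence b: "inj h" "surj h" "finite (wild h)" by(auto simp: QV_set_def bij_def wild_def)
 hence "rest {h} = {}" by(simp add: rest_def)
 thus ?thesis using b by(auto simp: plain.vtx_def dest: injD)
qed

lemma QV_wild: "h : QV_set ==> finite (wild h)" and QV_inj: "h : QV_set ==> inj h"
 by(auto simp: QV_set_def wild_def bij_def)

lemma bij_end_map: "h : QV_set ==> bij (em h)"
proof(rule bijI)
 assume "h : QV_set"
 note v = QV_vtx[OF this]
 show "inj (em h)" using plain.end_map_inj[OF v, of h h] by(auto simp: inj_def)
 show "surj (em h)" using plain.end_map_surj[OF v] by(metis singletonD surj_def)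
qed

text \<open>For \<open>N\<close> beyond all wild vertices, the words of length \<open>N\<close> and
  their images under \<open>h\<close> are the prefixes of the two partitions; the second is one
  because \<open>em h\<close> is bijective.\<close>

lemma end_map_V: "h : QV_set ==> em h : V_set"
proof -
 assume h: "h : QV_set"
 obtain N where N: "tame h N" using tame_ex[OF QV_wild[OF h]] by blast
 let ?P = "(%v. (v, h v)) ` {v. length v = N}"
 have e: "em h (v @@ x) = h v @@ x" if "length v = N" for v x
  using end_map_conc[of h v x] N that by simp
 have "finite {v :: bool list. set v <= UNIV & length v = N}" by(rule finite_lists_length_eq) simp
 hence "finite ?P" by simp
 moreover have "EX! p. p : ?P & x : range (%y. fst p @@ y)" for x
 proof -
  obtain v z where v: "x = v @@ z" "length v = N" using end_split by blast
  show ?thesis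
  proof(rule ex1I[of _ "(v, h v)"])
   show "(v, h v) : ?P & x : range (%y. fst (v, h v) @@ y)" using v by auto
   fix p assume "p : ?P & x : range (%y. fst p @@ y)"
   then obtain v' z' where "p = (v', h v')" "length v' = N" "x = v' @@ z'" by auto
   thus "p = (v, h v)" using conc_inj[of v' v z' z] v by simp
  qed
 qed
 moreover have "EX! p. p : ?P & x : range (%y. snd p @@ y)" for x
 proof -
  obtain w where w: "em h w = x" using bij_end_map[OF h] by(metis bij_def surj_def)
  obtain v z where v: "w = v @@ z" "length v = N" using end_split by blast
  show ?thesis
  proof(rule ex1I[of _ "(v, h v)"])
   show "(v, h v) : ?P & x : range (%y. snd (v, h v) @@ y)" using v w e by auto
   fix p assume "p : ?P & x : range (%y. snd p @@ y)"
   then obtain v' z' where p: "p = (v', h v')" "length v' = N" "x = h v' @@ z'" by auto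
   hence "em h (v' @@ z') = em h w" using e w by simp
   hence "v' @@ z' = v @@ z" using bij_end_map[OF h] v(1) by(simp add: bij_def inj_eq)
   moreover have "length v' = length v" using p(2) v(2) by simp
   ultimately have "v' = v" using conc_inj[of v' v z' z] by blast
   thus "p = (v, h v)" using p(1) by simp
  qed
 qed
 moreover have "ALL (a, b):?P. ALL y. em h (a @@ y) = b @@ y" by(simp add: e)
 ultimately show ?thesis unfolding V_set_def by(intro CollectI exI[of _ ?P] conjI allI)
qed

lemma QV_id: "id : QV_set"
 by(simp add: QV_set_def respects_children_def)

lemma QV_comp: "[|g : QV_set; h : QV_set|] ==> g o h : QV_set"
proof -
 assume g: "g : QV_set" and h: "h : QV_set"
 have "finite (wild h Un h -` wild g)" using QV_wild[OF g] QV_wild[OF h] finite_vimageI[OF _ QV_inj[OF h]] by blast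
 hence "finite (wild (g o h))" by(rule finite_subset[OF wild_comp])
 thus ?thesis using g h by(auto simp: QV_set_def wild_def bij_comp)
qed

lemma QV_inv: "h : QV_set ==> inv_into UNIV h : QV_set"
proof -
 assume h: "h : QV_set"
 hence b: "bij h" "finite (wild h)" by(auto simp: QV_set_def wild_def)
 let ?i = "inv_into UNIV h"
 have hi: "h (?i v) = v" "?i (h v) = v" for v using b(1) by(simp_all add: bij_def surj_f_inv_f)
 have "v : h ` wild h" if "v : wild ?i" for v
 proof(rule ccontr)
  assume "v ~: h ` wild h"
  hence "?i v ~: wild h" using hi(1)[of v] by(metis imageI)
  hence r: "h (?i v @ [False]) = v @ [False]" "h (?i v @ [True]) = v @ [True]"
   by(simp_all add: wild_def respects_children_def hi)
  have "respects_children ?i v" unfolding respects_children_def using hi(2)[of "?i v @ [False]"] hi(2)[of "?i v @ [True]"] r by simp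
  thus False using that by(simp add: wild_def)
 qed
 hence "finite (wild ?i)" using b(2) by(meson finite_imageI finite_subset subsetI)
 thus ?thesis using bij_imp_bij_inv[OF b(1)] by(simp add: QV_set_def wild_def)
qed

lemma end_map_comp_QV: "[|g : QV_set; h : QV_set|] ==> em (g o h) = em g o em h"
 using end_map_comp[OF QV_wild QV_wild QV_inj] by(simp add: fun_eq_iff)

lemma end_map_inv_QV: "h : QV_set ==> em h (em (inv_into UNIV h) w) = w"
proof -
 assume h: "h : QV_set"
 have "h o inv_into UNIV h = id" using h by(simp add: QV_set_def bij_def surj_iff)
 thus ?thesis using end_map_comp_QV[OF h QV_inv[OF h]] end_map_id by(metis comp_apply id_apply)
qed

text \<open>Families of equal size have equally many uncovered points. Matching the trees in the
  listed order and the uncovered points by any bijection gives a bijection of all vertices, wild at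
  most at uncovered points and at images of wild words.\<close>

lemma QV_transport:
 assumes g: "good_trees good" and x: "good_trees.vtx good x" "good_trees.vtx good x'"
  and ts: "distinct ts" "set ts = x" "distinct ts'" "set ts' = x'" "length ts = length ts'"
 shows "EX h:QV_set. (ALL i<length ts. h o ts ! i = ts' ! i) & tact h x = x'"
proof -
 interpret good_trees good by(rule g)
 have c: "card x = card x'" using ts distinct_card by metis
 have "card (rest x) = card (rest x')" using vtxD(5)[OF x(1)] vtxD(5)[OF x(2)] c by simp
 then obtain r where r: "bij_betw r (rest x) (rest x')"
  using finite_same_card_bij vtxD(4)[OF x(1)] vtxD(4)[OF x(2)] by blast
 define loc where "loc p = (THE iw. fst iw < length ts & p = (ts ! fst iw) (snd iw))" for p
 define h where "h p = (if p : rest x then r p else (ts' ! fst (loc p)) (snd (loc p)))" for p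
 have loc: "loc ((ts ! i) w) = (i, w)" if i: "i < length ts" for i w
  unfolding loc_def
 proof(rule the_equality)
  fix iw assume a: "fst iw < length ts & (ts ! i) w = (ts ! fst iw) (snd iw)"
  hence "ts ! i : x" "ts ! fst iw : x" using ts(2) i by auto
  from vtx_inj[OF x(1) this] a have "ts ! i = ts ! fst iw" "w = snd iw" by blast+
  hence "i = fst iw" using ts(1) i a by(simp add: nth_eq_iff_index_eq)
  thus "iw = (i, w)" using \<open>w = snd iw\<close> by(simp add: prod_eq_iff)
 qed (use i in simp)
 have hts: "h ((ts ! i) w) = (ts' ! i) w" if i: "i < length ts" for i w
 proof -
  have "ts ! i : x" using i ts(2) by auto
  hence "(ts ! i) w ~: rest x" by(rule rest_disj)
  thus ?thesis using loc[OF i] by(simp add: h_def)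
 qed
 have hr: "h p = r p" if "p : rest x" for p using that by(simp add: h_def)
 have cov: "p : rest x | (EX i<length ts. EX w. p = (ts ! i) w)" for p
 proof(cases "p : rest x")
  case False
  then obtain t w where "t : x" "p = t w" by(auto simp: rest_def)
  thus ?thesis using ts(2) by(metis in_set_conv_nth)
 qed simp
 have cov': "p : rest x' | (EX i<length ts. EX w. p = (ts' ! i) w)" for p
 proof(cases "p : rest x'")
  case False
  then obtain t w where "t : x'" "p = t w" by(auto simp: rest_def)
  thus ?thesis using ts(4,5) by(metis in_set_conv_nth)
 qed simp
 have tx': "ts' ! i : x'" if "i < length ts" for i using that ts(4,5) by auto
 have rx': "r p : rest x'" if "p : rest x" for p using bij_betwE[OF r] that by blast
 have "inj h"
 proof(rule injI)
  fix p q assume e: "h p = h q"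
  from cov[of p] cov[of q] show "p = q"
  proof(elim disjE exE conjE)
   assume "p : rest x" "q : rest x"
   thus ?thesis using e hr r by(metis bij_betw_def inj_onD)
  next
   fix i w assume "p : rest x" "i < length ts" "q = (ts ! i) w"
   thus ?thesis using e hr hts rx' rest_disj[OF tx'] by metis
  next
   fix i w assume "q : rest x" "i < length ts" "p = (ts ! i) w"
   thus ?thesis using e hr hts rx' rest_disj[OF tx'] by metis
  next
   fix i w j w' assume ij: "i < length ts" "p = (ts ! i) w" "j < length ts" "q = (ts ! j) w'"
   hence "(ts' ! i) w = (ts' ! j) w'" using e hts by simp
   from vtx_inj[OF x(2) tx'[OF ij(1)] tx'[OF ij(3)] this] have "i = j" "w = w'"
    using ij ts(3,5) by(auto simp: nth_eq_iff_index_eq)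
   thus ?thesis using ij by simp
  qed
 qed
 moreover have "surj h"
 proof -
  have "EX p. q = h p" for q
  proof -
   from cov'[of q] show ?thesis
   proof(elim disjE exE conjE)
    assume "q : rest x'"
    then obtain p where "p : rest x" "q = r p" using r by(metis bij_betw_def imageE)
    thus ?thesis using hr by metis
   next
    fix i w assume "i < length ts" "q = (ts' ! i) w"
    thus ?thesis using hts by metis
   qed
  qed
  thus ?thesis by(simp add: surj_def)
 qed
 moreover have "finite (wild h)"
 proof -
  let ?F = "rest x Un (UN i<length ts. (ts ! i) ` (wild (ts ! i) Un wild (ts' ! i)))"
  have "p : ?F" if p: "p : wild h" for p
  proof(rule ccontr)
   assume n: "p ~: ?F"
   then obtain i w where i: "i < length ts" "p = (ts ! i) w" using cov[of p] by blast
   hence "respects_children (ts ! i) w" "respects_children (ts' ! i) w" using n by(auto simp: wild_def)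
   hence "(ts ! i) w @ [b] = (ts ! i) (w @ [b])" "(ts' ! i) (w @ [b]) = (ts' ! i) w @ [b]" for b
    by(cases b; simp add: respects_children_def)+
   hence "respects_children h p" unfolding respects_children_def i(2) by(simp add: hts[OF i(1)])
   thus False using p by(simp add: wild_def)
  qed
  moreover have "finite ?F"
  proof -
   have "finite (wild (ts ! i))" "finite (wild (ts' ! i))" if "i < length ts" for i
    using vtxD(3)[OF x(1)] vtxD(3)[OF x(2)] tx' that ts(2) by auto
   thus ?thesis using vtxD(4)[OF x(1)] by auto
  qed
  ultimately show ?thesis by(meson finite_subset subsetI)
 qed
 ultimately have hQ: "h : QV_set" by(simp add: QV_set_def bij_def wild_def)
 have he: "h o ts ! i = ts' ! i" if "i < length ts" for i using hts[OF that] by(simp add: fun_eq_iff)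
 have "tact h x = x'"
 proof -
  have "x = (%i. ts ! i) ` {..<length ts}" "x' = (%i. ts' ! i) ` {..<length ts}"
   using ts(2,4,5) by(auto simp: set_conv_nth)
  thus ?thesis using he by(auto simp: image_image intro!: image_cong)
 qed
 thus ?thesis using hQ he by blast
qed

section \<open>Orders on ends\<close>

lemma less_fun_total: "less_fun u w | u = w | less_fun w (u :: bool word)"
proof(cases "u = w")
 case False
 define k where "k = (LEAST k. u k ~= w k)"
 have "u k ~= w k" unfolding k_def by(rule LeastI_ex) (use False in auto)
 moreover have "u i = w i" if "i < k" for i using not_less_Least[of i "%k. u k ~= w k"] that by(simp add: k_def)
 ultimately show ?thesis unfolding less_fun_def by(metis neqE)
qed simp

lemma less_fun_cons: "less_fun ([a] @@ u) ([b] @@ w) <-> (~ a & b) | (a = b & less_fun u w)"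
proof -
 have ab: "less_fun ([a] @@ u) ([b] @@ w) <-> less_fun u w" if e: "a = b"
 proof
  assume "less_fun ([a] @@ u) ([b] @@ w)"
  then obtain k where k: "([a] @@ u) k < ([b] @@ w) k" "!!i. i < k ==> ([a] @@ u) i = ([b] @@ w) i" by(auto simp: less_fun_def)
  then obtain m where m: "k = Suc m" using e by(cases k) auto
  have "u m < w m" using k(1) m by simp
  moreover have "u i = w i" if "i < m" for i using k(2)[of "Suc i"] that m by simp
  ultimately show "less_fun u w" by(auto simp: less_fun_def)
 next
  assume "less_fun u w"
  then obtain k where k: "u k < w k" "!!i. i < k ==> u i = w i" by(auto simp: less_fun_def)
  have "([a] @@ u) i = ([b] @@ w) i" if "i < Suc k" for i using that k(2) e by(cases i) auto
  thus "less_fun ([a] @@ u) ([b] @@ w)" unfolding less_fun_def using k(1) by(intro exI[of _ "Suc k"]) simp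
 qed
 have lt: "less_fun ([False] @@ x) ([True] @@ y)" for x y
  unfolding less_fun_def by(intro exI[of _ 0]) simp
 show ?thesis
 proof(cases "a = b")
  case False
  thus ?thesis using lt less_fun_asym[OF lt] by(cases a; cases b) auto
 qed (use ab in auto)
qed

lemma less_fun_build: "less_fun (a ## u) (b ## w) <-> (~ a & b) | (a = b & less_fun u w)"
 using less_fun_cons[of a u b w] by simp

lemma word_cons: "EX b w. v = [b] @@ (w :: bool word)"
 using end_split[of v 1] by(metis One_nat_def length_0_conv length_Suc_conv)

abbreviation zero :: "bool word" where "zero == %_. False"

text \<open>Convexity makes the trees of a family occupy disjoint intervals of ends, which are
  linearly ordered and whose neighbours can be merged within the predicate.\<close>

definition goodo :: "(bool word => bool word => bool) => tree => bool" where
 "goodo lt t <-> finite (wild t) & (ALL u w. less_fun u w --> lt (em t u) (em t w)) &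
   (ALL u w v. lt (em t u) v & lt v (em t w) --> v : range (em t))"

text \<open>With an order present only neighbouring trees can be merged, so the pairs are formed
  from consecutive entries of the sorted list, omitting at most one entry.\<close>

fun pairup :: "'a list => ('a * 'a) list" where
 "pairup (a # c # xs) = (a, c) # pairup xs"
| "pairup _ = []"

lemma pairup_concat: "EX zs. xs = concat (map (%(a, c). [a, c]) (pairup xs)) @ zs & length zs <= 1"
 by(induction xs rule: pairup.induct) auto

lemma pairup_length: "length xs <= 2 * length (pairup xs) + 1"
 by(induction xs rule: pairup.induct) auto

lemma pairup_consecutive: "(a, c) : set (pairup xs) ==> EX i. Suc i < length xs & xs ! i = a & xs ! Suc i = c"
proof(induction xs rule: pairup.induct)
 case (1 x z xs)
 show ?case
 proof(cases "(a, c) = (x, z)")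
  case True
  thus ?thesis by(intro exI[of _ 0]) simp
 next
  case False
  then obtain i where "Suc i < length xs & xs ! i = a & xs ! Suc i = c" using 1 by auto
  thus ?thesis by(intro exI[of _ "Suc (Suc i)"]) simp
 qed
qed auto

lemma disjoint_pairup: "distinct xs ==> disjoint_pairs (pairup xs)"
 using pairup_concat[of xs] unfolding disjoint_pairs_def by(metis distinct_append)

lemma pairup_ground:
 assumes "distinct ts" "set ts = x"
  and "!!i s. [|Suc i < length ts; lft s = ts ! i; rgt s = ts ! Suc i|] ==> good s"
 shows "EX ps. disjoint_pairs ps & card x <= 2 * length ps + 2 &
   (ALL (a, c):set ps. a : x & c : x & (ALL s. lft s = a & rgt s = c --> good s))"
proof(intro exI[of _ "pairup ts"] conjI ballI)
 show "disjoint_pairs (pairup ts)" by(rule disjoint_pairup[OF assms(1)])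
 show "card x <= 2 * length (pairup ts) + 2" using pairup_length[of ts] distinct_card[OF assms(1)] assms(2) by simp
 fix p assume p: "p : set (pairup ts)"
 obtain a c where ac: "p = (a, c)" by(cases p) auto
 from pairup_consecutive[OF p[unfolded ac]]
 obtain i where i: "Suc i < length ts" "ts ! i = a" "ts ! Suc i = c" by(elim exE conjE)
 have "a : x" "c : x" using i assms(2) nth_mem[of i ts] nth_mem[of "Suc i" ts] by auto
 thus "case p of (a, c) => a : x & c : x & (ALL s. lft s = a & rgt s = c --> good s)"
  using assms(3)[OF i(1)] i ac by simp
qed

locale end_order =
 fixes lt :: "bool word => bool word => bool"
 assumes irrefl: "~ lt u u" and trans: "[|lt u v; lt v w|] ==> lt u w" and total: "lt u w | u = w | lt w u"
begin

lemma asym: "lt u w ==> ~ lt w u"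
 using irrefl trans by blast

lemma goodo_mono: "goodo lt t ==> less_fun u w ==> lt (em t u) (em t w)"
 and goodo_wild: "goodo lt t ==> finite (wild t)"
 by(simp_all add: goodo_def)

lemma goodo_convex:
 assumes "goodo lt t" "lt (em t u) v" "lt v (em t w)"
 shows "v : range (em t)"
proof -
 have "ALL u w v. lt (em t u) v & lt v (em t w) --> v : range (em t)"
  using assms(1) unfolding goodo_def by(elim conjE)
 from this[rule_format, OF conjI[OF assms(2,3)]] show ?thesis .
qed

lemma goodo_less_iff: "goodo lt t ==> lt (em t u) (em t w) <-> less_fun u w"
 using goodo_mono[of t u w] goodo_mono[of t w u] less_fun_total[of u w] asym irrefl by metis

lemma goodo_child:
 assumes t: "goodo lt t"
 shows "goodo lt (lft t)" "goodo lt (rgt t)"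
proof -
 note e = end_map_child[OF goodo_wild[OF t]]
 have c: "EX w'. v = em t ([b] @@ w')"
  if b: "lt (em t ([b] @@ u)) v" "lt v (em t ([b] @@ w))" for b u w v
 proof -
  obtain z where z: "v = em t z" using goodo_convex[OF t b] by blast
  obtain d z' where d: "z = [d] @@ z'" using word_cons by blast
  have "less_fun ([b] @@ u) ([d] @@ z')" "less_fun ([d] @@ z') ([b] @@ w)"
   using b goodo_less_iff[OF t] z d by simp_all
  hence "d = b" unfolding less_fun_cons by auto
  thus ?thesis using z d by blast
 qed
 show "goodo lt (lft t)" unfolding goodo_def
 proof(intro conjI allI impI)
  show "finite (wild (lft t))" by(rule finite_wild_lft[OF goodo_wild[OF t]])
  show "lt (em (lft t) u) (em (lft t) w)" if "less_fun u w" for u w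
   unfolding e by(rule goodo_mono[OF t]) (use that in "simp add: less_fun_build")
  show "v : range (em (lft t))" if l: "lt (em (lft t) u) v & lt v (em (lft t) w)" for u w v
  proof -
   obtain w' where "v = em (lft t) w'" using c[of False u v w] l unfolding e by blast
   thus ?thesis by blast
  qed
 qed
 show "goodo lt (rgt t)" unfolding goodo_def
 proof(intro conjI allI impI)
  show "finite (wild (rgt t))" by(rule finite_wild_rgt[OF goodo_wild[OF t]])
  show "lt (em (rgt t) u) (em (rgt t) w)" if "less_fun u w" for u w
   unfolding e by(rule goodo_mono[OF t]) (use that in "simp add: less_fun_build")
  show "v : range (em (rgt t))" if l: "lt (em (rgt t) u) v & lt v (em (rgt t) w)" for u w v
  proof -
   obtain w' where "v = em (rgt t) w'" using c[of True u v w] l unfolding e by blast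
   thus ?thesis by blast
  qed
 qed
qed

text \<open>Disjoint convex sets of ends cannot interlace, so a single comparison between the two
  trees decides all of them.\<close>

lemma goodo_separated:
 assumes y: "plain.vtx y" "t : y" "t' : y" "t ~= t'" and g: "goodo lt t" "goodo lt t'"
  and l: "lt (em t a) (em t' b)"
 shows "lt (em t u) (em t' w)"
proof(rule ccontr)
 assume n: "~ lt (em t u) (em t' w)"
 have ne: "em t p ~= em t' q" for p q using plain.end_map_inj[OF y(1-3)] y(4) by blast
 have l': "lt (em t' w) (em t u)" using n total ne by blast
 have "~ lt (em t a) (em t' w)"
 proof
  assume "lt (em t a) (em t' w)"
  from goodo_convex[OF g(1) this l'] obtain p where "em t' w = em t p" by(rule rangeE)
  thus False using ne[of p w] by simp
 qed
 hence "lt (em t' w) (em t a)" using total[of "em t a" "em t' w"] ne[of a w] by simp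
 from goodo_convex[OF g(2) this l] obtain p where "em t a = em t' p" by(rule rangeE)
 thus False using ne[of a p] by simp
qed

lemma sorted_vertex:
 assumes y: "plain.vtx y" and g: "!!t. t : y ==> goodo lt t"
 shows "EX ts. distinct ts & set ts = y &
  (ALL i j u w. i < j & j < length ts --> lt (em (ts ! i) u) (em (ts ! j) w))"
proof -
 define bf where "bf t t' <-> lt (em t zero) (em t' zero)" for t t'
 define rank where "rank t = card {t' : y. bf t' t}" for t
 have fy: "finite y" by(rule plain.vtxD(1)[OF y])
 obtain xs where xs: "set xs = y" "distinct xs" using finite_distinct_list[OF fy] by blast
 let ?ts = "sort_key rank xs"
 have rk: "rank t < rank t'" if "t : y" "bf t t'" for t t'
  unfolding rank_def
 proof(rule psubset_card_mono)
  show "finite {t'' : y. bf t'' t'}" using fy by simp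
  have "t : {t'' : y. bf t'' t'} - {t'' : y. bf t'' t}" using that irrefl by(simp add: bf_def)
  moreover have "{t'' : y. bf t'' t} <= {t'' : y. bf t'' t'}" using that(2) trans unfolding bf_def by blast
  ultimately show "{t'' : y. bf t'' t} \<subset> {t'' : y. bf t'' t'}" by blast
 qed
 have d: "distinct ?ts" "set ?ts = y" using xs by simp_all
 have "lt (em (?ts ! i) u) (em (?ts ! j) w)" if ij: "i < j" "j < length ?ts" for i j u w
 proof -
  have m: "?ts ! i : y" "?ts ! j : y" using nth_mem[of i ?ts] nth_mem[of j ?ts] ij unfolding d(2) by simp_all
  have ne: "?ts ! i ~= ?ts ! j" using d(1) ij by(simp add: nth_eq_iff_index_eq)
  have "rank (?ts ! i) <= rank (?ts ! j)"
   using sorted_nth_mono[of "map rank ?ts" i j] sorted_sort_key[of rank xs] ij by simp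
  hence "~ bf (?ts ! j) (?ts ! i)" using rk[OF m(2), of "?ts ! i"] by linarith
  moreover have "em (?ts ! i) zero ~= em (?ts ! j) zero" using plain.end_map_inj[OF y m] ne by blast
  ultimately have "lt (em (?ts ! i) zero) (em (?ts ! j) zero)" using total unfolding bf_def by blast
  thus ?thesis by(rule goodo_separated[OF y m ne g[OF m(1)] g[OF m(2)]])
 qed
 thus ?thesis using d by blast
qed

text \<open>For convexity of the merge, an end between two of its ends belongs to some tree of the
  family, because the family covers all ends; in the sorted list that tree comes neither before nor
  after the two neighbours.\<close>

lemma goodo_merge:
 assumes y: "plain.vtx y" and ts: "set ts = y"
  and o: "!!i j u w. [|i < j; j < length ts|] ==> lt (em (ts ! i) u) (em (ts ! j) w)"
  and g: "!!t. t : y ==> goodo lt t" and i: "Suc i < length ts" and s: "lft s = ts ! i" "rgt s = ts ! Suc i"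
 shows "goodo lt s"
proof -
 have gi: "goodo lt (ts ! i)" "goodo lt (ts ! Suc i)" using g ts i nth_mem[of i ts] nth_mem[of "Suc i" ts] by auto
 have "finite ({[]} Un Cons False ` wild (lft s) Un Cons True ` wild (rgt s))"
  using goodo_wild[OF gi(1)] goodo_wild[OF gi(2)] s by simp
 hence w: "finite (wild s)" using finite_subset[OF wild_cases] by blast
 note e = end_map_child[OF w, unfolded s]
 have es: "EX w'. em s w = em (ts ! k) w' & (k = i | k = Suc i) & k < length ts" if "w = [b] @@ w'" "k = (if b then Suc i else i)" for w b w' k
  by(intro exI[of _ w'] conjI) (use that e[of w'] i in \<open>cases b; simp\<close>)+
 show ?thesis unfolding goodo_def
 proof(intro conjI allI impI)
  show "finite (wild s)" by(rule w)
  fix u w :: "bool word" assume l: "less_fun u w"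
  obtain a u' b w' where ab: "u = [a] @@ u'" "w = [b] @@ w'" using word_cons by metis
  have "~ a & b | a = b & less_fun u' w'" using l unfolding ab less_fun_cons .
  thus "lt (em s u) (em s w)"
   using o[of i "Suc i" u' w'] i goodo_mono[OF gi(1), of u' w'] goodo_mono[OF gi(2), of u' w'] e[of u'] e[of w'] ab
   by(cases a; cases b) simp_all
 next
  fix u w v assume l: "lt (em s u) v & lt v (em s w)"
  obtain t z where t: "t : y" "em t z = v" using plain.end_map_surj[OF y] by blast
  then obtain k where k: "k < length ts" "ts ! k = t" using ts by(metis in_set_conv_nth)
  obtain a u' b w' where ab: "u = [a] @@ u'" "w = [b] @@ w'" using word_cons by metis
  obtain p u'' where p: "em s u = em (ts ! p) u''" "p = i | p = Suc i" "p < length ts" using es[OF ab(1) refl] by blast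
  obtain r w'' where r: "em s w = em (ts ! r) w''" "r = i | r = Suc i" "r < length ts" using es[OF ab(2) refl] by blast
  have "~ k < i" using o[of k p z u''] p l t k asym by auto
  moreover have "~ Suc i < k" using o[of r k w'' z] r l t k asym by auto
  ultimately have "k = i | k = Suc i" by linarith
  thus "v : range (em s)" using e[of z] t k by(metis rangeI)
 qed
qed

lemma goodo_ground:
 assumes y: "plain.vtx y" and g: "!!t. t : y ==> goodo lt t" and good: "!!s. goodo lt s ==> good s"
 shows "EX ps. disjoint_pairs ps & card y <= 2 * length ps + 2 &
   (ALL (a, c):set ps. a : y & c : y & (ALL s. lft s = a & rgt s = c --> good s))"
using sorted_vertex y g pairup_ground good goodo_merge by fastforce

end

lemma goodo_transport:
 assumes o: "end_order lt" "end_order lt'" and y: "plain.vtx y" "plain.vtx y'" "card y = card y'"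
  and g: "!!t. t : y ==> goodo lt t" "!!t. t : y' ==> goodo lt' t"
 shows "EX h:QV_set. tact h y = y' & (ALL p q. lt p q --> lt' (em h p) (em h q))"
proof -
 interpret l: end_order lt by(rule o(1))
 interpret l': end_order lt' by(rule o(2))
 obtain ts where ts: "distinct ts" "set ts = y"
  "!!i j u w. [|i < j; j < length ts|] ==> lt (em (ts ! i) u) (em (ts ! j) w)"
  using l.sorted_vertex[OF y(1) g(1)] by blast
 obtain ts' where ts': "distinct ts'" "set ts' = y'"
  "!!i j u w. [|i < j; j < length ts'|] ==> lt' (em (ts' ! i) u) (em (ts' ! j) w)"
  using l'.sorted_vertex[OF y(2) g(2)] by blast
 have len: "length ts = length ts'" using ts(1,2) ts'(1,2) y(3) distinct_card by metis
 obtain h where h: "h : QV_set" "!!i. i < length ts ==> h o ts ! i = ts' ! i" "tact h y = y'"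
  using QV_transport[OF plain.good_trees_axioms y(1,2) ts(1,2) ts'(1,2) len] by blast
 have e: "em h (em (ts ! i) w) = em (ts' ! i) w" if "i < length ts" for i w
 proof -
  have m: "ts ! i : y" using that ts(2) by auto
  show ?thesis using end_map_comp[OF QV_wild[OF h(1)] plain.vtxD(3)[OF y(1) m] plain.vtx_injt[OF y(1) m], of w] h(2)[OF that] by simp
 qed
 have "lt' (em h p) (em h q)" if pq: "lt p q" for p q
 proof -
  obtain t u where t: "t : y" "em t u = p" using plain.end_map_surj[OF y(1)] by blast
  obtain t' w where t': "t' : y" "em t' w = q" using plain.end_map_surj[OF y(1)] by blast
  obtain i where i: "i < length ts" "ts ! i = t" using t(1) ts(2) by(metis in_set_conv_nth)
  obtain j where j: "j < length ts" "ts ! j = t'" using t'(1) ts(2) by(metis in_set_conv_nth)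
  have ep: "em h p = em (ts' ! i) u" "em h q = em (ts' ! j) w"
   using e[OF i(1), of u] e[OF j(1), of w] i j t t' by simp_all
  consider "i < j" | "j < i" | "i = j" by linarith
  thus ?thesis
  proof cases
   case 1
   thus ?thesis unfolding ep using ts'(3) j(1) len by simp
  next
   case 2
   hence "lt q p" using ts(3)[OF 2 i(1), of w u] i j t t' by simp
   thus ?thesis using l.asym pq by blast
  next
   case 3
   hence "less_fun u w" using l.goodo_less_iff[OF g(1)[OF t(1)], of u w] pq t t' i j by simp
   moreover have "ts' ! i : y'" using i(1) len ts'(2) by auto
   ultimately show ?thesis unfolding ep using l'.goodo_mono[OF g(2)] 3 by simp
  qed
 qed
 thus ?thesis using h(1,3) by blast
qed

interpretation lex: end_order less_fun
 using less_fun_irrefl less_fun_trans less_fun_total by unfold_locales blast+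

text \<open>The linear order obtained by cutting the cyclic order open in front of \<open>a\<close>.\<close>

definition cut_less :: "bool word => bool word => bool word => bool" where
 "cut_less a v w <-> ~ less_fun v a & less_fun w a | (less_fun v a <-> less_fun w a) & less_fun v w"

lemma end_order_cut_less: "end_order (cut_less a)"
proof
 show "~ cut_less a u u" for u by(simp add: cut_less_def lex.irrefl)
 show "cut_less a u w" if "cut_less a u v" "cut_less a v w" for u v w using that lex.trans unfolding cut_less_def by blast
 show "cut_less a u w | u = w | cut_less a w u" for u w using lex.total[of u w] unfolding cut_less_def by blast
qed

lemma cut_least: "v ~= a ==> cut_less a a v"
 using lex.total[of v a] lex.irrefl by(auto simp: cut_less_def)

text \<open>Cutting at \<open>a\<close> moves the ends below \<open>a\<close> behind all others, a
  rotation, which does not affect the cyclic order.\<close>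

lemma cyclic_less_cut:
 "cyclic_less x y z <-> cut_less a x y & cut_less a y z | cut_less a y z & cut_less a z x | cut_less a z x & cut_less a x y"
proof -
 have hl: "less_fun v w" "~ less_fun w v" if "less_fun v a" "~ less_fun w a" for v w
 proof -
  show "less_fun v w" using that lex.trans lex.total by blast
  thus "~ less_fun w v" by(rule lex.asym)
 qed
 note h = hl(1)[of x y] hl(1)[of y x] hl(1)[of x z] hl(1)[of z x] hl(1)[of y z] hl(1)[of z y]
  lex.asym[of x y] lex.asym[of x z] lex.asym[of y z]
 show ?thesis unfolding cyclic_less_def cut_less_def
  by(cases "less_fun x a"; cases "less_fun y a"; cases "less_fun z a") (use h in "simp; blast")+
qed

lemma cyclic_less_total: "x ~= y ==> y ~= z ==> x ~= z ==> cyclic_less x y z | cyclic_less x z y"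
 using lex.total[of x y] lex.total[of y z] lex.total[of x z] unfolding cyclic_less_def by blast

lemma cyclic_less_asym: "cyclic_less x y z ==> ~ cyclic_less x z y"
 unfolding cyclic_less_def using lex.asym by blast

lemma cyclic_less_distinct: "cyclic_less x y z ==> x ~= y & y ~= z & x ~= z"
 unfolding cyclic_less_def using lex.asym lex.irrefl by blast

context good_trees begin

lemma vtx_plain: "vtx y ==> plain.vtx y"
proof -
 assume y: "vtx y"
 have "ALL t:y. ALL t':y. ALL w w'. t w = t' w' --> t = t' & w = w'"
  using y unfolding vtx_def by(elim conjE)
 moreover have "ALL t:y. True & finite (wild t)" using vtxD(3)[OF y] by blast
 ultimately show ?thesis unfolding plain.vtx_def
  by(intro conjI vtxD(1)[OF y] vtxD(4)[OF y] vtxD(5)[OF y])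
qed

lemma orbitsI:
 assumes "!!x x'. [|vtx x; vtx x'; card x = n; card x' = n|] ==> EX h:H. tact h x = x'"
 shows "EX K. finite K & {x. vtx x & card x = n} <= (UN g:H. tact g ` (K Int Collect vtx))"
proof(cases "EX x. vtx x & card x = n")
 case True
 then obtain x0 where x0: "vtx x0" "card x0 = n" by blast
 have "x : (UN g:H. tact g ` ({x0} Int Collect vtx))" if x: "vtx x" "card x = n" for x
 proof -
  obtain h where "h : H" "tact h x0 = x" using assms[OF x0(1) x(1) x0(2) x(2)] by blast
  thus ?thesis using x0 by blast
 qed
 thus ?thesis by(intro exI[of _ "{x0}"]) blast
qed (intro exI[of _ "{}"], simp)

end

section \<open>The three groups as instances\<close>

lemma tree_group_QV: "tree_group (%_. True) QV_set"
proof(intro tree_group.intro plain.good_trees_axioms tree_group_axioms.intro QV_id QV_comp QV_inv)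
 fix x assume x: "plain.vtx x"
 obtain ts where ts: "distinct ts" "set ts = x" using finite_distinct_list[OF plain.vtxD(1)[OF x]] by blast
 show "EX ps. disjoint_pairs ps & card x <= 2 * length ps + 2 &
   (ALL (a, c):set ps. a : x & c : x & (ALL s. lft s = a & rgt s = c --> True))"
  by(rule pairup_ground[OF ts]) simp
next
 fix n
 show "EX K. finite K & {x. plain.vtx x & card x = n} <= (UN g:QV_set. tact g ` (K Int Collect plain.vtx))"
 proof(rule plain.orbitsI)
  fix x x' assume x: "plain.vtx x" "plain.vtx x'" "card x = n" "card x' = n"
  obtain ts where ts: "distinct ts" "set ts = x" using finite_distinct_list[OF plain.vtxD(1)[OF x(1)]] by blast
  obtain ts' where ts': "distinct ts'" "set ts' = x'" using finite_distinct_list[OF plain.vtxD(1)[OF x(2)]] by blast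
  have "length ts = length ts'" using ts ts' x(3,4) distinct_card by metis
  thus "EX h:QV_set. tact h x = x'"
   using QV_transport[OF plain.good_trees_axioms x(1,2) ts ts'] by blast
 qed
qed simp_all

definition QF_set :: "tree set" where "QF_set = {h : QV_set. em h : F_set}"
definition QT_set :: "tree set" where "QT_set = {h : QV_set. em h : T_set}"

lemma QF_set_iff: "h : QF_set <-> h : QV_set & (ALL x y. less_fun x y --> less_fun (em h x) (em h y))"
 using end_map_V by(auto simp: QF_set_def F_set_def)

lemma QT_set_iff: "h : QT_set <-> h : QV_set &
  (ALL x y z. cyclic_less x y z --> cyclic_less (em h x) (em h y) (em h z))"
 using end_map_V by(auto simp: QT_set_def T_set_def)

lemma QF_less_iff: "h : QF_set ==> less_fun (em h x) (em h y) <-> less_fun x y"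
 using lex.total[of x y] lex.asym lex.irrefl unfolding QF_set_iff by metis

lemma QT_cyclic_iff: "h : QT_set ==> cyclic_less (em h x) (em h y) (em h z) <-> cyclic_less x y z"
using cyclic_less_distinct cyclic_less_asym QT_set_iff cyclic_less_total by metis

definition goodl :: "tree => bool" where "goodl = goodo less_fun"

lemma goodl_id: "goodl id"
 using end_map_id by(auto simp: goodl_def goodo_def wild_def respects_children_def)

lemma QF_goodo_comp:
 assumes g: "g : QF_set" and t: "goodo less_fun t" "finite (wild t)" "inj t"
 shows "goodo less_fun (g o t)"
proof -
 have gQ: "g : QV_set" using g by(simp add: QF_set_iff)
 have e: "em (g o t) = em g o em t"
  using end_map_comp[OF QV_wild[OF gQ] t(2,3)] by(simp add: fun_eq_iff)
 have "finite (wild t Un t -` wild g)" using QV_wild[OF gQ] t finite_vimageI[of "wild g" t] by blast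
 hence w: "finite (wild (g o t))" by(rule finite_subset[OF wild_comp])
 have "v : range (em g o em t)"
  if l: "less_fun (em g (em t u)) v" "less_fun v (em g (em t w))" for u w v
 proof -
  obtain v' where v: "v = em g v'" using bij_end_map[OF gQ] by(metis bij_def surj_def)
  have "v' : range (em t)" using l lex.goodo_convex[OF t(1)] QF_less_iff[OF g] unfolding v by blast
  thus ?thesis using v by auto
 qed
 moreover have "less_fun (em g (em t u)) (em g (em t w))" if "less_fun u w" for u w
  using QF_less_iff[OF g] lex.goodo_mono[OF t(1) that] by blast
 ultimately show ?thesis unfolding goodo_def e o_apply using w by(auto simp: comp_def)
qed

lemma tree_group_QF: "tree_group goodl QF_set"
proof -
 interpret g: good_trees goodl
  by(unfold_locales; (unfold goodl_def)?) (erule lex.goodo_child, erule lex.goodo_child, rule goodl_id[unfolded goodl_def])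
 show "tree_group goodl QF_set"
 proof(intro tree_group.intro g.good_trees_axioms tree_group_axioms.intro)
  show "QF_set <= QV_set" "id : QF_set" using QV_id end_map_id by(auto simp: QF_set_iff)
  show "g o h : QF_set" if "g : QF_set" "h : QF_set" for g h
   using that QV_comp end_map_comp_QV by(auto simp: QF_set_iff)
  show "inv_into UNIV g : QF_set" if g: "g : QF_set" for g
  using g QF_set_iff QV_inv end_map_inv_QV QF_less_iff by metis
  show "goodl (g o t)" if "g : QF_set" "goodl t" "finite (wild t)" "inj t" for g t
   using QF_goodo_comp that by(simp add: goodl_def)
 next
  fix x assume x: "g.vtx x"
  show "EX ps. disjoint_pairs ps & card x <= 2 * length ps + 2 &
   (ALL (a, c):set ps. a : x & c : x & (ALL s. lft s = a & rgt s = c --> goodl s))"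
   by(rule lex.goodo_ground[OF g.vtx_plain[OF x]]) (use g.vtxD(2)[OF x] in "simp_all add: goodl_def")
 next
  fix n
  show "EX K. finite K & {x. g.vtx x & card x = n} <= (UN g:QF_set. tact g ` (K Int Collect g.vtx))"
  proof(rule g.orbitsI)
   fix x x' assume x: "g.vtx x" "g.vtx x'" "card x = n" "card x' = n"
   have "EX h:QV_set. tact h x = x' & (ALL p q. less_fun p q --> less_fun (em h p) (em h q))"
   proof(rule goodo_transport[where lt = less_fun and lt' = less_fun])
    show "end_order less_fun" "end_order less_fun" by(rule lex.end_order_axioms)+
    show "plain.vtx x" "plain.vtx x'" by(rule g.vtx_plain[OF x(1)], rule g.vtx_plain[OF x(2)])
    show "card x = card x'" using x by simp
    show "goodo less_fun t" if "t : x" for t using g.vtxD(2)[OF x(1) that] by(simp add: goodl_def)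
    show "goodo less_fun t" if "t : x'" for t using g.vtxD(2)[OF x(2) that] by(simp add: goodl_def)
   qed
   then obtain h where h: "h : QV_set" "tact h x = x'" "ALL p q. less_fun p q --> less_fun (em h p) (em h q)" by blast
   hence "h : QF_set" unfolding QF_set_iff by blast
   thus "EX h:QF_set. tact h x = x'" using h(2) by blast
  qed
 qed
qed

text \<open>The ends of \<open>t\<close> fill an interval of the cyclic order, in increasing order.\<close>

definition goodc :: "tree => bool" where
 "goodc t <-> finite (wild t) & (ALL u w v :: bool word. less_fun u w -->
   cyclic_less (em t u) v (em t w) <-> (EX z. less_fun u z & less_fun z w & v = em t z))"

lemma goodcD: "goodc t ==> less_fun u w ==>
  cyclic_less (em t u) v (em t w) <-> (EX z. less_fun u z & less_fun z w & v = em t z)"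
 by(simp add: goodc_def)

lemma goodo_goodc: "goodo (cut_less a) t ==> goodc t"
proof -
 assume g: "goodo (cut_less a) t"
 interpret c: end_order "cut_less a" by(rule end_order_cut_less)
 show ?thesis unfolding goodc_def
 proof(intro conjI c.goodo_wild[OF g] allI impI)
  fix u w v :: "bool word" assume l: "less_fun u w"
  have m: "cut_less a (em t u) (em t w)" by(rule c.goodo_mono[OF g l])
  have "cyclic_less (em t u) v (em t w) <-> cut_less a (em t u) v & cut_less a v (em t w)"
   unfolding cyclic_less_cut[of _ _ _ a] using c.asym[OF m] by blast
  also have "... <-> (EX z. less_fun u z & less_fun z w & v = em t z)"
  proof
   assume b: "cut_less a (em t u) v & cut_less a v (em t w)"
   then obtain z where "v = em t z" using c.goodo_convex[OF g] by blast
   thus "EX z. less_fun u z & less_fun z w & v = em t z" using b c.goodo_less_iff[OF g] by blast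
  next
   assume "EX z. less_fun u z & less_fun z w & v = em t z"
   thus "cut_less a (em t u) v & cut_less a v (em t w)" using c.goodo_mono[OF g] by blast
  qed
  finally show "cyclic_less (em t u) v (em t w) <-> (EX z. less_fun u z & less_fun z w & v = em t z)" .
 qed
qed

text \<open>A cut outside of \<open>t\<close> or exactly in front of its first end leaves its arc of
  ends whole, so the arc becomes an interval of the linear order.\<close>

lemma goodc_goodo:
 assumes g: "goodc t" and i: "inj (em t)" and a: "a ~: range (em t) | a = em t zero"
 shows "goodo (cut_less a) t"
proof -
 interpret c: end_order "cut_less a" by(rule end_order_cut_less)
 have nl: "~ cut_less a v a" for v using cut_least[of v a] c.asym c.irrefl by metis
 have m: "cut_less a (em t u) (em t w)" if l: "less_fun u w" for u w
 proof(rule ccontr)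
  assume n: "~ cut_less a (em t u) (em t w)"
  have ne: "em t u ~= em t w" using l i lex.irrefl by(metis inj_eq)
  hence wu: "cut_less a (em t w) (em t u)" using n c.total by blast
  hence "em t u ~= a" using nl by blast
  show False
  proof(cases "em t w = a")
   case True
   hence "w = zero" using a i by(auto simp: inj_eq)
   thus False using l by(auto simp: less_fun_def)
  next
   case False
   hence "cut_less a a (em t w)" by(rule cut_least)
   hence "cyclic_less (em t u) a (em t w)" unfolding cyclic_less_cut[of _ _ _ a] using wu by blast
   then obtain z where z: "less_fun u z" "a = em t z" using goodcD[OF g l] by blast
   hence "z = zero" using a i by(auto simp: inj_eq)
   thus False using z(1) by(auto simp: less_fun_def)
  qed
 qed
 show ?thesis unfolding goodo_def
 proof(intro conjI allI impI m)
  show "finite (wild t)" using g by(simp add: goodc_def)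
  fix u w v assume b: "cut_less a (em t u) v & cut_less a v (em t w)"
  hence uw: "cut_less a (em t u) (em t w)" using c.trans by blast
  have "less_fun u w"
  proof(rule ccontr)
   assume "~ less_fun u w"
   hence "u = w | less_fun w u" using lex.total by blast
   thus False using uw m[of w u] c.asym c.irrefl by metis
  qed
  moreover have "cyclic_less (em t u) v (em t w)" unfolding cyclic_less_cut[of _ _ _ a] using b by blast
  ultimately show "v : range (em t)" using goodcD[OF g] by blast
 qed
qed

text \<open>A cut at the first end of one member runs through no member of the family; this reduces
  the cyclic case to the linear one.\<close>

lemma goodc_vertex:
 assumes y: "plain.vtx y" "!!t. t : y ==> goodc t" and t0: "t0 : y" and t: "t : y"
 shows "goodo (cut_less (em t0 zero)) t"
proof(rule goodc_goodo[OF y(2)[OF t]])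
 show "inj (em t)" using plain.end_map_inj[OF y(1) t t] by(auto simp: inj_def)
 show "em t0 zero ~: range (em t) | em t0 zero = em t zero"
  using plain.end_map_inj[OF y(1) t0 t] by blast
qed

lemma goodc_child:
 assumes t: "goodc t"
 shows "goodc (lft t)" "goodc (rgt t)"
proof -
 have w: "finite (wild t)" using t by(simp add: goodc_def)
 note e = end_map_child[OF w]
 have c: "cyclic_less (em t ([b] @@ u)) v (em t ([b] @@ w)) <->
   (EX z. less_fun u z & less_fun z w & v = em t ([b] @@ z))" if l: "less_fun u w" for b u w v
 proof -
  have l': "less_fun ([b] @@ u) ([b] @@ w)" unfolding less_fun_cons using l by simp
  show ?thesis unfolding goodcD[OF t l']
  proof
   assume "EX z. less_fun ([b] @@ u) z & less_fun z ([b] @@ w) & v = em t z"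
   then obtain z where z: "less_fun ([b] @@ u) z" "less_fun z ([b] @@ w)" "v = em t z" by blast
   obtain d z' where d: "z = [d] @@ z'" using word_cons by blast
   have "d = b" "less_fun u z'" "less_fun z' w" using z(1,2) unfolding d less_fun_cons by auto
   thus "EX z. less_fun u z & less_fun z w & v = em t ([b] @@ z)" using z(3) d by blast
  next
   assume "EX z. less_fun u z & less_fun z w & v = em t ([b] @@ z)"
   then obtain z where z: "less_fun u z" "less_fun z w" "v = em t ([b] @@ z)" by blast
   hence "less_fun ([b] @@ u) ([b] @@ z)" "less_fun ([b] @@ z) ([b] @@ w)" unfolding less_fun_cons by simp_all
   thus "EX z. less_fun ([b] @@ u) z & less_fun z ([b] @@ w) & v = em t z" using z(3) by blast
  qed
 qed
 show "goodc (lft t)" unfolding goodc_def e by(intro conjI allI impI c finite_wild_lft[OF w])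
 show "goodc (rgt t)" unfolding goodc_def e by(intro conjI allI impI c finite_wild_rgt[OF w])
qed

lemma goodc_id: "goodc id"
proof -
 have "goodo (cut_less zero) id"
  unfolding goodo_def using end_map_id by(auto simp: wild_def respects_children_def cut_less_def less_fun_def)
 thus ?thesis by(rule goodo_goodc)
qed

lemma tree_group_QT: "tree_group goodc QT_set"
proof -
 interpret g: good_trees goodc
  by unfold_locales (erule goodc_child, erule goodc_child, rule goodc_id)
 show "tree_group goodc QT_set"
 proof(intro tree_group.intro g.good_trees_axioms tree_group_axioms.intro)
  show "QT_set <= QV_set" "id : QT_set" using QV_id end_map_id by(auto simp: QT_set_iff)
  show "g o h : QT_set" if "g : QT_set" "h : QT_set" for g h
   using that QV_comp end_map_comp_QV by(auto simp: QT_set_iff)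
  show "inv_into UNIV g : QT_set" if g: "g : QT_set" for g
  using g QT_set_iff QV_inv end_map_inv_QV QT_cyclic_iff by fastforce
  show "goodc (g o t)" if g: "g : QT_set" and t: "goodc t" "finite (wild t)" "inj t" for g t
  proof -
   have gQ: "g : QV_set" using g by(simp add: QT_set_iff)
   have e: "em (g o t) w = em g (em t w)" for w by(rule end_map_comp[OF QV_wild[OF gQ] t(2,3)])
   have "finite (wild t Un t -` wild g)" using QV_wild[OF gQ] t finite_vimageI[of "wild g" t] by blast
   hence w: "finite (wild (g o t))" by(rule finite_subset[OF wild_comp])
   show ?thesis unfolding goodc_def e
   proof(intro conjI w allI impI)
    fix u w v :: "bool word" assume l: "less_fun u w"
    obtain v' where v: "v = em g v'" using bij_end_map[OF gQ] by(metis bij_def surj_def)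
    have "em g v' = em g p <-> v' = p" for p using bij_end_map[OF gQ] by(simp add: bij_def inj_eq)
    thus "cyclic_less (em g (em t u)) v (em g (em t w)) <->
      (EX z. less_fun u z & less_fun z w & v = em g (em t z))"
     unfolding v QT_cyclic_iff[OF g] goodcD[OF t(1) l] by simp
   qed
  qed
 next
  fix x assume x: "g.vtx x"
  obtain t0 where t0: "t0 : x" using g.vtx_ne[OF x] by blast
  show "EX ps. disjoint_pairs ps & card x <= 2 * length ps + 2 &
   (ALL (a, c):set ps. a : x & c : x & (ALL s. lft s = a & rgt s = c --> goodc s))"
   by(rule end_order.goodo_ground[OF end_order_cut_less g.vtx_plain[OF x]
      goodc_vertex[OF g.vtx_plain[OF x] g.vtxD(2)[OF x] t0] goodo_goodc])
 next
  fix n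
  show "EX K. finite K & {x. g.vtx x & card x = n} <= (UN g:QT_set. tact g ` (K Int Collect g.vtx))"
  proof(rule g.orbitsI)
   fix x x' assume x: "g.vtx x" "g.vtx x'" "card x = n" "card x' = n"
   obtain t0 where t0: "t0 : x" using g.vtx_ne[OF x(1)] by blast
   obtain t0' where t0': "t0' : x'" using g.vtx_ne[OF x(2)] by blast
   let ?a = "em t0 zero" and ?a' = "em t0' zero"
   have "card x = card x'" using x by simp
   from goodo_transport[OF end_order_cut_less end_order_cut_less g.vtx_plain[OF x(1)] g.vtx_plain[OF x(2)] this
     goodc_vertex[OF g.vtx_plain[OF x(1)] g.vtxD(2)[OF x(1)] t0]
     goodc_vertex[OF g.vtx_plain[OF x(2)] g.vtxD(2)[OF x(2)] t0']]
   obtain h where h: "h : QV_set" "tact h x = x'" "!!p q. cut_less ?a p q ==> cut_less ?a' (em h p) (em h q)" by blast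
   have "cyclic_less (em h p) (em h q) (em h r)" if "cyclic_less p q r" for p q r
    using that[unfolded cyclic_less_cut[of p q r ?a]] h(3) unfolding cyclic_less_cut[of "em h p" _ _ ?a'] by blast
   hence "h : QT_set" using h(1) unfolding QT_set_iff by blast
   thus "EX h:QT_set. tact h x = x'" using h(2) by blast
  qed
 qed
qed

theorem theorem4p14:
 shows "type_F_infinity QF \<and> type_F_infinity QT \<and> type_F_infinity QV"
proof(intro conjI)
 have "QF = tree_group.GH QF_set"
  unfolding tree_group.GH_def[OF tree_group_QF] by(simp add: QF_def QF_set_def QV_def)
 thus "type_F_infinity QF" using tree_group.type_F_infinity_GH[OF tree_group_QF] by(simp only:)
 have "QT = tree_group.GH QT_set"
  unfolding tree_group.GH_def[OF tree_group_QT] by(simp add: QT_def QT_set_def QV_def)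
 thus "type_F_infinity QT" using tree_group.type_F_infinity_GH[OF tree_group_QT] by(simp only:)
 have "QV = tree_group.GH QV_set"
  unfolding tree_group.GH_def[OF tree_group_QV] by(simp add: QV_def)
 thus "type_F_infinity QV" using tree_group.type_F_infinity_GH[OF tree_group_QV] by(simp only:)
qed

end
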